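(* Let $s\in\mathbb{R}$, $\varphi\in\Upsilon$, and $1<p<\infty$. Then the space $B^{s,\varphi}_{p}(\Gamma)$ is complete and separable and does not depend, up to equivalence of norms, on the choice of open sets $\Gamma_{j}\subset\Gamma$, diffeomorphisms $\pi_{j,0}:V_{j,0}\leftrightarrow \Gamma_{j}$ of class $C^{\infty}$, and functions $\chi_{j,0}\in C^{\infty}(\Gamma)$, with $j\in\{1,\ldots,\varkappa\}$, that satisfy $\Gamma=\Gamma_{1}\cup\cdots\cup\Gamma_{\varkappa}$, $\mathrm{supp}\,\chi_{j,0}\subset \Gamma_j$ and $\chi_{1,0}+\cdots+\chi_{\varkappa,0}\equiv1$. The set $C^{\infty}(\Gamma)$ is dense in $B^{s,\varphi}_{p}(\Gamma)$.
   Context: All spaces are complex. $\Gamma$ is the boundary, of class $C^\infty$, of a bounded open domain $\Omega\subset\mathbb{R}^n$, $n\geq2$; put $d:=n-1$. $\mathcal{D}'(\Gamma)$ is the space of all distributions on the compact $C^\infty$-manifold $\Gamma$. $\Upsilon$ is the set of all $C^\infty$ functions $\varphi:[1,\infty)\to(0,\infty)$ such that (i) $\varphi(\lambda t)/\varphi(t)\to1$ as $t\to\infty$ for every $\lambda>0$; (ii) for each integer $k\geq1$ there is $c_k>0$ with $t^{k}|\varphi^{(k)}(t)|\leq c_{k}\varphi(t)$ for all $t\geq1$. Choose $\beta_0\in C^{\infty}(\mathbb{R}^{d})$ with $\beta_0(y)=1$ for $|y|\leq1$ and $\beta_0(y)=0$ for $|y|\geq2$, and put $\beta_k(y):=\beta_{0}(2^{-k}y)-\beta_{0}(2^{1-k}y)$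 for integers $k\geq1$. For $s\in\mathbb{R}$, $\varphi\in\Upsilon$, $p\in(1,\infty)$, the space $B^{s,\varphi}_{p}(\mathbb{R}^{d})$ consists of all $w\in\mathcal{S}'(\mathbb{R}^{d})$ such that $w_{k}:=\mathcal{F}^{-1}[\beta_{k}\mathcal{F}w]\in L_{p}(\mathbb{R}^{d})$ for all integers $k\geq0$ and $$\|w,B^{s,\varphi}_{p}(\mathbb{R}^{d})\|^{p}:=\sum_{k=0}^{\infty}\bigl(2^{sk}\varphi(2^{k})\|w_{k},L_{p}(\mathbb{R}^{d})\|\bigr)^{p}<\infty,$$ where $\mathcal{F}$ is the Fourier transform (up to equivalence of norms this does not depend on $\beta_0$). Given a finite open covering $\Gamma=\Gamma_1\cup\dots\cup\Gamma_\varkappa$, $C^\infty$-diffeomorphisms $\pi_{j,0}:V_{j,0}\leftrightarrow\Gamma_j$ with $V_{j,0}$ open in $\mathbb{R}^{d}$, and functions $\chi_{j,0}\in C^\infty(\Gamma)$ with $\mathrm{supp}\,\chi_{j,0}\subset\Gamma_j$ and $\sum_j\chi_{j,0}\equiv1$, the space $B^{s,\varphi}_{p}(\Gamma)$ consists of all $v\in\mathcal{D}'(\Gamma)$ such that $\mathcal{O}((\chi_{j,0}v)\circ\pi_{j,0})\in B^{s,\varphi}_{p}(\mathbb{R}^{d})$ for every $j$, where $\mathcal{O}$ is extension by zero onto $\mathbb{R}^d$; its norm is $\|v,B^{s,\varphi}_{p}(\Gamma)\|:=\sum_{j=1}^{\varkappa}\|\mathcal{O}((\chi_{j,0}v)\circ\pi_{j,0}),B^{s,\varphi}_{p}(\mathbb{R}^{d})\|$.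 *)

theory Defs
  imports "HOL-Analysis.Analysis" "HOL-Library.Function_Algebras"
begin

section \<open>Smooth functions and diffeomorphisms\<close>

text \<open>\<open>Ck_on k U f\<close> is meant for open \<open>U\<close>: \<open>f\<close> is of class \<open>C\<^sup>k\<close> on \<open>U\<close>.\<close>

primrec Ck_on ::
  "nat \<Rightarrow> ('a::euclidean_space) set \<Rightarrow> ('a \<Rightarrow> 'b::real_normed_vector) \<Rightarrow> bool" where
  "Ck_on 0 U f \<longleftrightarrow> continuous_on U f"
| "Ck_on (Suc k) U f \<longleftrightarrow>
     (\<forall>x\<in>U. f differentiable (at x)) \<and>
     (\<forall>v. Ck_on k U (\<lambda>x. frechet_derivative f (at x) v))"

text \<open>
  Smoothness on an arbitrary subset \<open>S\<close> of a Euclidean space: near each of its points, \<open>f\<close> is the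
  restriction to \<open>S\<close> of a \<open>C\<^sup>\<infinity>\<close> function. For open \<open>S\<close> this is ordinary \<open>C\<^sup>\<infinity>\<close> smoothness; for an
  embedded submanifold such as the boundary of a smooth domain it is smoothness on the manifold.
\<close>

definition smooth_on ::
  "('a::euclidean_space) set \<Rightarrow> ('a \<Rightarrow> 'b::real_normed_vector) \<Rightarrow> bool" where
  "smooth_on S f \<longleftrightarrow>
     (\<forall>x\<in>S. \<exists>U F. open U \<and> x \<in> U \<and> (\<forall>k. Ck_on k U F) \<and> (\<forall>y\<in>U \<inter> S. F y = f y))"

definition smooth_diffeo ::
  "('a::euclidean_space) set \<Rightarrow> ('b::euclidean_space) set \<Rightarrow> ('a \<Rightarrow> 'b) \<Rightarrow> bool" where
  "smooth_diffeo S T f \<longleftrightarrow>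
     bij_betw f S T \<and> smooth_on S f \<and> smooth_on T (inv_into S f)"

definition smooth_boundary :: "(real ^ 'n) set \<Rightarrow> bool" where
  "smooth_boundary \<Omega> \<longleftrightarrow>
     (\<forall>x\<in>frontier \<Omega>. \<exists>U (W :: (real ^ 'n) set) (\<Phi> :: real ^ 'n \<Rightarrow> real ^ 'n) i.
        open U \<and> x \<in> U \<and> open W \<and> smooth_diffeo U W \<Phi> \<and>
        \<Phi> ` (U \<inter> \<Omega>) = {y \<in> W. y $ i > 0} \<and>
        \<Phi> ` (U \<inter> frontier \<Omega>) = {y \<in> W. y $ i = 0})"

text \<open>Iterated partial derivatives, when the list consists of elements of \<^term>\<open>Basis\<close>.\<close>

primrec iter_deriv ::
  "('a::euclidean_space) list \<Rightarrow> ('a \<Rightarrow> 'b::real_normed_vector) \<Rightarrow> 'a \<Rightarrow> 'b" where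
  "iter_deriv [] f = f"
| "iter_deriv (v # vs) f = (\<lambda>x. frechet_derivative (iter_deriv vs f) (at x) v)"

definition basis_lists :: "nat \<Rightarrow> ('a::euclidean_space) list set" where
  "basis_lists N = {vs. set vs \<subseteq> Basis \<and> length vs \<le> N}"


section \<open>The class \<open>\<Upsilon>\<close>\<close>

text \<open>
  \<open>D k\<close> is the \<open>k\<close>-th derivative of \<open>\<phi>\<close> on \<open>[1,\<infinity>)\<close>, one-sided at the endpoint \<open>1\<close>; its
  values there are uniquely determined by \<open>\<phi>\<close>. Values of \<open>\<phi>\<close> on \<open>(-\<infinity>,1)\<close> are irrelevant.
\<close>

definition Upsilon :: "(real \<Rightarrow> real) set" where
  "Upsilon = {\<phi>.
     (\<forall>t\<ge>1. \<phi> t > 0) \<and>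
     (\<forall>l>0. ((\<lambda>t. \<phi> (l * t) / \<phi> t) \<longlongrightarrow> 1) at_top) \<and>
     (\<exists>D :: nat \<Rightarrow> real \<Rightarrow> real.
        (\<forall>t\<ge>1. D 0 t = \<phi> t) \<and>
        (\<forall>k. \<forall>t\<ge>1. (D k has_real_derivative D (Suc k) t) (at t within {1..})) \<and>
        (\<forall>k\<ge>1. \<exists>c>0. \<forall>t\<ge>1. t ^ k * \<bar>D k t\<bar> \<le> c * \<phi> t))}"


section \<open>Tempered distributions and the Fourier transform\<close>

definition schwartz :: "('a::euclidean_space \<Rightarrow> complex) set" where
  "schwartz = {f. smooth_on UNIV f \<and>
     (\<forall>vs N. set vs \<subseteq> Basis \<longrightarrow>
        bdd_above (range (\<lambda>x. (1 + norm x) ^ N * norm (iter_deriv vs f x))))}"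

definition schwartz_norm :: "nat \<Rightarrow> ('a::euclidean_space \<Rightarrow> complex) \<Rightarrow> real" where
  "schwartz_norm N f =
     (\<Sum>vs\<in>basis_lists N. SUP x. (1 + norm x) ^ N * norm (iter_deriv vs f x))"

definition linear_functional_on ::
  "('a \<Rightarrow> complex) set \<Rightarrow> (('a \<Rightarrow> complex) \<Rightarrow> complex) \<Rightarrow> bool" where
  "linear_functional_on D u \<longleftrightarrow>
     (\<forall>f\<in>D. \<forall>g\<in>D. u (\<lambda>x. f x + g x) = u f + u g) \<and>
     (\<forall>c. \<forall>f\<in>D. u (\<lambda>x. c * f x) = c * u f)"

text \<open>
  Distributions are linear functionals on the respective test functions. They are total functions
  here; they are set to \<open>0\<close> off the test functions, so that equality of distributions is
  equality in HOL.
\<close>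

definition tempered :: "(('a::euclidean_space \<Rightarrow> complex) \<Rightarrow> complex) set" where
  "tempered = {w. linear_functional_on schwartz w \<and>
     (\<exists>C N. \<forall>f\<in>schwartz. norm (w f) \<le> C * schwartz_norm N f) \<and>
     (\<forall>f. f \<notin> schwartz \<longrightarrow> w f = 0)}"

definition fourier_fun :: "(real ^ 'd \<Rightarrow> complex) \<Rightarrow> real ^ 'd \<Rightarrow> complex" where
  "fourier_fun f \<xi> = complex_of_real ((2 * pi) powr (- real CARD('d) / 2)) *
     (LINT x|lborel. cis (- (x \<bullet> \<xi>)) * f x)"

definition inv_fourier_fun :: "(real ^ 'd \<Rightarrow> complex) \<Rightarrow> real ^ 'd \<Rightarrow> complex" where
  "inv_fourier_fun f x = complex_of_real ((2 * pi) powr (- real CARD('d) / 2)) *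
     (LINT \<xi>|lborel. cis (x \<bullet> \<xi>) * f \<xi>)"

definition fourier ::
  "((real ^ 'd \<Rightarrow> complex) \<Rightarrow> complex) \<Rightarrow> (real ^ 'd \<Rightarrow> complex) \<Rightarrow> complex" where
  "fourier w f = (if f \<in> schwartz then w (fourier_fun f) else 0)"

definition inv_fourier ::
  "((real ^ 'd \<Rightarrow> complex) \<Rightarrow> complex) \<Rightarrow> (real ^ 'd \<Rightarrow> complex) \<Rightarrow> complex" where
  "inv_fourier w f = (if f \<in> schwartz then w (inv_fourier_fun f) else 0)"

text \<open>Product of a tempered distribution and a compactly supported smooth function \<open>b\<close>.\<close>

definition mult_tempered ::
  "('a::euclidean_space \<Rightarrow> complex) \<Rightarrow> (('a \<Rightarrow> complex) \<Rightarrow> complex) \<Rightarrow> ('a \<Rightarrow> complex) \<Rightarrow> complex" where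
  "mult_tempered b w f = (if f \<in> schwartz then w (\<lambda>x. b x * f x) else 0)"


section \<open>The spaces \<open>B\<^sub>p\<close> on \<open>\<real>\<^sup>d\<close>\<close>

definition Lp_fun :: "real \<Rightarrow> ('a::euclidean_space \<Rightarrow> complex) set" where
  "Lp_fun p = {g. g \<in> borel_measurable lborel \<and> integrable lborel (\<lambda>x. norm (g x) powr p)}"

definition represents ::
  "('a::euclidean_space \<Rightarrow> complex) \<Rightarrow> (('a \<Rightarrow> complex) \<Rightarrow> complex) \<Rightarrow> bool" where
  "represents g w \<longleftrightarrow> (\<forall>f\<in>schwartz. w f = (LINT x|lborel. g x * f x))"

definition in_Lp :: "real \<Rightarrow> (('a::euclidean_space \<Rightarrow> complex) \<Rightarrow> complex) \<Rightarrow> bool" where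
  "in_Lp p w \<longleftrightarrow> (\<exists>g\<in>Lp_fun p. represents g w)"

text \<open>The representing function is unique almost everywhere, hence the number below is unique.\<close>

definition Lp_norm :: "real \<Rightarrow> (('a::euclidean_space \<Rightarrow> complex) \<Rightarrow> complex) \<Rightarrow> real" where
  "Lp_norm p w =
     (THE r. \<exists>g\<in>Lp_fun p. represents g w \<and> r = (LINT x|lborel. norm (g x) powr p) powr (1 / p))"

definition is_cutoff :: "('a::euclidean_space \<Rightarrow> complex) \<Rightarrow> bool" where
  "is_cutoff b \<longleftrightarrow> smooth_on UNIV b \<and>
     (\<forall>y. norm y \<le> 1 \<longrightarrow> b y = 1) \<and> (\<forall>y. norm y \<ge> 2 \<longrightarrow> b y = 0)"

definition dyadic :: "('a::euclidean_space \<Rightarrow> complex) \<Rightarrow> nat \<Rightarrow> 'a \<Rightarrow> complex" where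
  "dyadic b k y = (if k = 0 then b y
     else b (2 powr (- real k) *\<^sub>R y) - b (2 powr (1 - real k) *\<^sub>R y))"

definition piece ::
  "(real ^ 'd \<Rightarrow> complex) \<Rightarrow> nat \<Rightarrow> ((real ^ 'd \<Rightarrow> complex) \<Rightarrow> complex) \<Rightarrow>
     (real ^ 'd \<Rightarrow> complex) \<Rightarrow> complex" where
  "piece b k w = inv_fourier (mult_tempered (dyadic b k) (fourier w))"

definition besov_term ::
  "(real ^ 'd \<Rightarrow> complex) \<Rightarrow> real \<Rightarrow> (real \<Rightarrow> real) \<Rightarrow> real \<Rightarrow>
     ((real ^ 'd \<Rightarrow> complex) \<Rightarrow> complex) \<Rightarrow> nat \<Rightarrow> real" where
  "besov_term b s \<phi> p w k =
     (2 powr (s * real k) * \<phi> (2 ^ k) * Lp_norm p (piece b k w)) powr p"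

definition besov_Rd ::
  "(real ^ 'd \<Rightarrow> complex) \<Rightarrow> real \<Rightarrow> (real \<Rightarrow> real) \<Rightarrow> real \<Rightarrow>
     ((real ^ 'd \<Rightarrow> complex) \<Rightarrow> complex) set" where
  "besov_Rd b s \<phi> p =
     {w \<in> tempered. (\<forall>k. in_Lp p (piece b k w)) \<and> summable (besov_term b s \<phi> p w)}"

definition besov_Rd_norm ::
  "(real ^ 'd \<Rightarrow> complex) \<Rightarrow> real \<Rightarrow> (real \<Rightarrow> real) \<Rightarrow> real \<Rightarrow>
     ((real ^ 'd \<Rightarrow> complex) \<Rightarrow> complex) \<Rightarrow> real" where
  "besov_Rd_norm b s \<phi> p w = (\<Sum>k. besov_term b s \<phi> p w k) powr (1 / p)"


section \<open>Distributions on the manifold \<open>\<Gamma>\<close>\<close>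

definition test_fun :: "('a::euclidean_space) set \<Rightarrow> ('a \<Rightarrow> complex) set" where
  "test_fun V = {f. smooth_on UNIV f \<and> compact (closure {x. f x \<noteq> 0}) \<and>
     closure {x. f x \<noteq> 0} \<subseteq> V}"

definition distributions :: "('a::euclidean_space) set \<Rightarrow> (('a \<Rightarrow> complex) \<Rightarrow> complex) set" where
  "distributions V = {u. linear_functional_on (test_fun V) u \<and>
     (\<forall>K. compact K \<and> K \<subseteq> V \<longrightarrow>
        (\<exists>C N. \<forall>f\<in>test_fun K.
           norm (u f) \<le> C * (\<Sum>vs\<in>basis_lists N. SUP x. norm (iter_deriv vs f x)))) \<and>
     (\<forall>f. f \<notin> test_fun V \<longrightarrow> u f = 0)}"

text \<open>
  A local parametrization \<open>\<pi> : V \<leftrightarrow> \<pi>(V)\<close> of \<open>\<Gamma>\<close>, with \<open>V\<close> open in \<open>\<real>\<^sup>d\<close> and \<open>\<pi>(V)\<close> open in \<open>\<Gamma>\<close>.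
\<close>

definition param :: "(real ^ 'n) set \<Rightarrow> (real ^ 'd) set \<Rightarrow> (real ^ 'd \<Rightarrow> real ^ 'n) \<Rightarrow> bool" where
  "param \<Gamma> V \<pi> \<longleftrightarrow>
     open V \<and> openin (top_of_set \<Gamma>) (\<pi> ` V) \<and> smooth_diffeo V (\<pi> ` V) \<pi>"

text \<open>
  Distributions on a manifold in the sense of Hoermander (The Analysis of Linear Partial
  Differential Operators I, Section 6.3): a distribution \<open>v\<close> on \<open>\<Gamma>\<close> is a family of distributions
  \<open>v V \<pi>\<close> (the pullback \<open>v \<circ> \<pi>\<close>) on \<open>V\<close>, one for each local parametrization \<open>\<pi> : V \<leftrightarrow> \<pi>(V)\<close>,
  transforming like functions: on overlaps \<open>v \<circ> \<pi>2\<close> is the pullback of \<open>v \<circ> \<pi>1\<close> by the transition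
  map \<open>\<pi>1\<^sup>-\<^sup>1 \<circ> \<pi>2\<close>. In terms of test functions supported in the overlap, with the inverse transition
  map \<open>\<psi> = \<pi>2\<^sup>-\<^sup>1 \<circ> \<pi>1\<close>,
  this reads \<open>(v \<circ> \<pi>2)(f) = (v \<circ> \<pi>1)((f \<circ> \<psi>) \<bar>det D\<psi>\<bar>)\<close>.
  By convention \<open>v V \<pi> = 0\<close> if \<open>\<pi>\<close> is not a local parametrization on \<open>V\<close>.
\<close>

type_synonym ('n, 'd) mdistr =
  "(real ^ 'd) set \<Rightarrow> (real ^ 'd \<Rightarrow> real ^ 'n) \<Rightarrow> (real ^ 'd \<Rightarrow> complex) \<Rightarrow> complex"

definition transition ::
  "(real ^ 'd) set \<Rightarrow> (real ^ 'd \<Rightarrow> real ^ 'n) \<Rightarrow> (real ^ 'd \<Rightarrow> real ^ 'n) \<Rightarrow> real ^ 'd \<Rightarrow> real ^ 'd" where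
  "transition V2 \<pi>2 \<pi>1 x = inv_into V2 \<pi>2 (\<pi>1 x)"

definition mdistributions :: "(real ^ 'n) set \<Rightarrow> ('n::finite, 'd::finite) mdistr set" where
  "mdistributions \<Gamma> = {v.
     (\<forall>V \<pi>. param \<Gamma> V \<pi> \<longrightarrow> v V \<pi> \<in> distributions V) \<and>
     (\<forall>V \<pi>. \<not> param \<Gamma> V \<pi> \<longrightarrow> v V \<pi> = (\<lambda>_. 0)) \<and>
     (\<forall>V1 \<pi>1 V2 \<pi>2. param \<Gamma> V1 \<pi>1 \<and> param \<Gamma> V2 \<pi>2 \<longrightarrow>
        (\<forall>f\<in>test_fun {y \<in> V2. \<pi>2 y \<in> \<pi>1 ` V1}.
           v V2 \<pi>2 f = v V1 \<pi>1 (\<lambda>x.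
             if x \<in> V1 \<and> \<pi>1 x \<in> \<pi>2 ` V2
             then f (transition V2 \<pi>2 \<pi>1 x) *
               complex_of_real \<bar>det (matrix (frechet_derivative (transition V2 \<pi>2 \<pi>1) (at x)))\<bar>
             else 0)))}"

text \<open>The distribution on \<open>\<Gamma>\<close> given by a smooth function \<open>f\<close>; its component in \<open>\<pi>\<close> is \<open>f \<circ> \<pi>\<close>.\<close>

definition mdistr_of_fun :: "(real ^ 'n) set \<Rightarrow> (real ^ 'n \<Rightarrow> complex) \<Rightarrow> ('n::finite, 'd::finite) mdistr" where
  "mdistr_of_fun \<Gamma> f V \<pi> g =
     (if param \<Gamma> V \<pi> \<and> g \<in> test_fun V then LINT y:V|lborel. f (\<pi> y) * g y else 0)"

text \<open>\<open>C\<^sup>\<infinity>(\<Gamma>)\<close> as a set of distributions on \<open>\<Gamma>\<close>.\<close>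

definition C_infinity :: "(real ^ 'n) set \<Rightarrow> ('n::finite, 'd::finite) mdistr set" where
  "C_infinity \<Gamma> = mdistr_of_fun \<Gamma> ` {f. smooth_on \<Gamma> f}"

text \<open>
  \<open>\<O>((h v) \<circ> \<pi>)\<close> as a tempered distribution. The component of \<open>h v\<close> in \<open>\<pi>\<close> is
  \<open>(h \<circ> \<pi>) (v \<circ> \<pi>)\<close>. If the support of \<open>h\<close> is a compact subset of \<open>\<pi>(V)\<close>, then
  \<open>(h \<circ> \<pi>) f\<close>, extended by zero outside \<open>V\<close>, is a test function on \<open>V\<close> for each Schwartz
  function \<open>f\<close>, and evaluating \<open>v \<circ> \<pi>\<close> on it gives the extension by zero.
\<close>

definition local_part ::
  "(real ^ 'd) set \<Rightarrow> (real ^ 'd \<Rightarrow> real ^ 'n) \<Rightarrow> (real ^ 'n \<Rightarrow> complex) \<Rightarrow> ('n::finite, 'd::finite) mdistr \<Rightarrow>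
     (real ^ 'd \<Rightarrow> complex) \<Rightarrow> complex" where
  "local_part V \<pi> h v f =
     (if f \<in> schwartz then v V \<pi> (\<lambda>y. if y \<in> V then h (\<pi> y) * f y else 0) else 0)"


section \<open>The spaces \<open>B\<^sub>p\<close> on \<open>\<Gamma>\<close>\<close>

text \<open>
  The local data: the number \<open>\<kappa>\<close> of sets in the covering and, for \<open>j \<in> {1..\<kappa>}\<close>, the sets
  \<open>V\<^sub>j\<close>, the parametrizations \<open>\<pi>\<^sub>j\<close> and the functions \<open>\<chi>\<^sub>j\<close>. The sets of the covering are
  \<open>\<Gamma>\<^sub>j = \<pi>\<^sub>j(V\<^sub>j)\<close>.
\<close>

record ('n::finite, 'd::finite) local_data =
  num :: nat
  dom :: "nat \<Rightarrow> (real ^ 'd) set"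
  par :: "nat \<Rightarrow> real ^ 'd \<Rightarrow> real ^ 'n"
  cut :: "nat \<Rightarrow> real ^ 'n \<Rightarrow> complex"

definition is_local_data :: "(real ^ 'n) set \<Rightarrow> ('n::finite, 'd::finite) local_data \<Rightarrow> bool" where
  "is_local_data \<Gamma> A \<longleftrightarrow>
     (\<forall>j\<in>{1..num A}. param \<Gamma> (dom A j) (par A j) \<and> smooth_on \<Gamma> (cut A j) \<and>
        closure {x \<in> \<Gamma>. cut A j x \<noteq> 0} \<subseteq> par A j ` dom A j) \<and>
     \<Gamma> = (\<Union>j\<in>{1..num A}. par A j ` dom A j) \<and>
     (\<forall>x\<in>\<Gamma>. (\<Sum>j\<in>{1..num A}. cut A j x) = 1)"

definition besov ::
  "(real ^ 'd \<Rightarrow> complex) \<Rightarrow> (real ^ 'n) set \<Rightarrow> ('n::finite, 'd::finite) local_data \<Rightarrow>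
     real \<Rightarrow> (real \<Rightarrow> real) \<Rightarrow> real \<Rightarrow> ('n::finite, 'd::finite) mdistr set" where
  "besov b \<Gamma> A s \<phi> p = {v \<in> mdistributions \<Gamma>.
     \<forall>j\<in>{1..num A}. local_part (dom A j) (par A j) (cut A j) v \<in> besov_Rd b s \<phi> p}"

definition besov_norm ::
  "(real ^ 'd \<Rightarrow> complex) \<Rightarrow> ('n::finite, 'd::finite) local_data \<Rightarrow>
     real \<Rightarrow> (real \<Rightarrow> real) \<Rightarrow> real \<Rightarrow> ('n::finite, 'd::finite) mdistr \<Rightarrow> real" where
  "besov_norm b A s \<phi> p v =
     (\<Sum>j\<in>{1..num A}. besov_Rd_norm b s \<phi> p (local_part (dom A j) (par A j) (cut A j) v))"


section \<open>Normed spaces given by a carrier and a norm\<close>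

definition mscale :: "complex \<Rightarrow> ('n::finite, 'd::finite) mdistr \<Rightarrow> ('n::finite, 'd::finite) mdistr" where
  "mscale c v = (\<lambda>V \<pi> f. c * v V \<pi> f)"

definition is_normed_space :: "('n::finite, 'd::finite) mdistr set \<Rightarrow> (('n::finite, 'd::finite) mdistr \<Rightarrow> real) \<Rightarrow> bool" where
  "is_normed_space B N \<longleftrightarrow> module.subspace mscale B \<and>
     (\<forall>v\<in>B. N v \<ge> 0 \<and> (N v = 0 \<longleftrightarrow> v = 0)) \<and>
     (\<forall>c. \<forall>v\<in>B. N (mscale c v) = norm c * N v) \<and>
     (\<forall>u\<in>B. \<forall>v\<in>B. N (u + v) \<le> N u + N v)"

definition norm_dist ::
  "(('n::finite, 'd::finite) mdistr \<Rightarrow> real) \<Rightarrow> ('n::finite, 'd::finite) mdistr \<Rightarrow> ('n::finite, 'd::finite) mdistr \<Rightarrow> real" where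
  "norm_dist N u v = N (u - v)"

definition equivalent_norms ::
  "('n::finite, 'd::finite) mdistr set \<Rightarrow> (('n::finite, 'd::finite) mdistr \<Rightarrow> real) \<Rightarrow> (('n::finite, 'd::finite) mdistr \<Rightarrow> real) \<Rightarrow> bool" where
  "equivalent_norms B N N' \<longleftrightarrow>
     (\<exists>c>0. \<exists>C>0. \<forall>v\<in>B. c * N v \<le> N' v \<and> N' v \<le> C * N v)"

end

theory Submission
  imports Defs "HOL-Probability.Probability"
begin

text \<open>
  Let \<open>P f = a (f \<circ> \<psi>)\<close> with \<open>\<psi>\<close> a diffeomorphism and \<open>a\<close> a test function, and let \<open>\<Delta>\<^sub>j\<close> be the
  Littlewood--Paley blocks. Repeated factorisation of \<open>\<Delta>\<^sub>k\<close> through the gradient shows that the norm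
  of \<open>\<Delta>\<^sub>k P \<Delta>\<^sub>j\<close> on \<open>L\<^sub>q\<close> decays like any power of \<open>2\<close> in \<open>|j - k|\<close>, while the weights
  \<open>2\<^sup>s\<^sup>k \<phi>(2\<^sup>k)\<close> vary at most exponentially; by Schur's test the transpose of \<open>P\<close> is bounded on
  \<open>B\<^sub>p(\<real>\<^sup>d)\<close>.

  In any chart a distribution on \<open>\<Gamma>\<close> is a finite sum of its local parts transported by such operators,
  whence the independence of the local data. The same formula glues limits of local parts, which together
  with the lower semicontinuity of the norm gives completeness; and it lifts the low-pass regularisations
  of the local parts to smooth functions on \<open>\<Gamma>\<close>, which gives density. Separability follows because
  the norm is dominated by finitely many derivatives of a smooth function in the charts, and such
  derivatives form a separable set in the uniform metric.
\<close>

section \<open>Smooth functions\<close>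

text \<open>The obstacle is that \<open>Lp_norm\<close> speaks of a representing function, which is
  awkward to carry through operators. Everything is therefore turned into inequalities on test
  functions: a tempered \<open>w\<close> lies in the space iff |w(\<Delta>_k f)| <= A_k ||f||_q for
  all Schwartz f, with (weight_k A_k) in l_p and q conjugate to p. To return from the inequality to
  L_p a density is needed: w composed with a compactly supported multiplier is integration against y
  -> w(kernel(. - y)), and the converse of Hoelder's inequality puts this function into L_p. This is
  why operators are estimated on L_q and why the result concerns the transpose of P.

  The gradient factorisation gains only if the output frequency exceeds the input frequency; the
  other half is the same estimate for the transposed operator, which has the same form with the
  inverse diffeomorphism and a Jacobian. The decay rate L + 2 comes from the weights, which change
  by at most 2^L per step: L powers absorb them, two remain for the sums in Schur's test.

  In the gluing formula the operators do not depend on the distribution, so it also makes sense for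
  families (w_j) not known to be local parts of anything.\<close>

lemmas integral_cong_refl = Bochner_Integration.integral_cong[OF refl]

abbreviation Dv :: "'a::real_normed_vector => ('a => 'b::real_normed_vector) => 'a => 'b" where
  "Dv v f == (%x. frechet_derivative f (at x) v)"

lemma has_derivative_cong_open:
  assumes "open U" "x \<in> U" "!!y. y \<in> U ==> f y = g y"
  shows "(f has_derivative D) (at x) \<longleftrightarrow> (g has_derivative D) (at x)"
  using assms by (metis has_derivative_transform_within_open)

text \<open>Both sides are the same Hilbert choice applied to equal predicates, so the equality also
  covers points where neither function is differentiable.\<close>

lemma frechet_derivative_cong_open:
  assumes "open U" "x \<in> U" "!!y. y \<in> U ==> f y = g y"
  shows "frechet_derivative f (at x) = frechet_derivative g (at x)"
  unfolding frechet_derivative_def using has_derivative_cong_open[OF assms] by simp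

lemma differentiable_cong_open:
  assumes "open U" "x \<in> U" "!!y. y \<in> U ==> f y = g y"
  shows "f differentiable (at x) \<longleftrightarrow> g differentiable (at x)"
  unfolding differentiable_def using has_derivative_cong_open[OF assms] by simp

lemma Dv_eq: "(f has_derivative D) (at x) ==> Dv v f x = D v"
  using frechet_derivative_at by metis

lemma has_derivative_frechet:
  "f differentiable (at x) ==> (f has_derivative frechet_derivative f (at x)) (at x)"
  by (simp add: frechet_derivative_works)

lemma Ck_on_cong:
  assumes "open U" "!!x. x \<in> U ==> f x = g x"
  shows "Ck_on k U f \<longleftrightarrow> Ck_on k U g"
  using assms(2)
proof (induction k arbitrary: f g)
  case 0
  then show ?case by (simp cong: continuous_on_cong)
next
  case (Suc k)
  have "Ck_on k U (Dv v f) \<longleftrightarrow> Ck_on k U (Dv v g)" for v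
    using frechet_derivative_cong_open[OF assms(1) _ Suc.prems] by (intro Suc.IH) simp
  then show ?case
    using differentiable_cong_open[OF assms(1) _ Suc.prems] by simp
qed

lemma Ck_on_subset: "Ck_on k U f ==> V \<subseteq> U ==> Ck_on k V f"
  by (induction k arbitrary: f) (auto intro: continuous_on_subset)

lemma Ck_on_Suc_D: "Ck_on (Suc k) U f ==> Ck_on k U f"
  by (induction k arbitrary: f)
     (auto intro!: continuous_at_imp_continuous_on differentiable_imp_continuous_within)

lemma Ck_on_local:
  assumes "!!x. x \<in> S ==> \<exists>U. open U \<and> x \<in> U \<and> Ck_on k U f"
  shows "Ck_on k S f"
  using assms
proof (induction k arbitrary: f)
  case 0
  show ?case unfolding Ck_on.simps
  proof (rule continuous_at_imp_continuous_on, rule ballI)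
    fix x assume "x \<in> S"
    with 0 obtain U where "open U" "x \<in> U" "continuous_on U f" by auto
    then show "isCont f x" using continuous_on_eq_continuous_at by blast
  qed
next
  case (Suc k)
  have "f differentiable (at x)" if "x \<in> S" for x
    using Suc.prems[OF that] by auto
  moreover have "Ck_on k S (Dv v f)" for v
  proof (rule Suc.IH)
    fix x assume "x \<in> S"
    then show "\<exists>U. open U \<and> x \<in> U \<and> Ck_on k U (Dv v f)"
      using Suc.prems[of x] by (metis Ck_on.simps(2))
  qed
  ultimately show ?case by simp
qed

lemma Ck_on_const [simp]: "Ck_on k U (%x. c)"
  by (induction k arbitrary: c) auto

lemma Ck_on_bounded_linear:
  assumes "bounded_linear f" shows "Ck_on k U f"
proof (cases k)
  case 0
  then show ?thesis using assms by (simp add: linear_continuous_on)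
next
  case (Suc j)
  have d: "(f has_derivative f) (at x)" for x
    using assms by (simp add: bounded_linear_imp_has_derivative)
  then have "frechet_derivative f (at x) = f" for x
    using frechet_derivative_at by metis
  then show ?thesis using Suc d by (auto simp: differentiable_def)
qed

lemma Ck_on_add:
  assumes "Ck_on k U f" "Ck_on k U g" "open U"
  shows "Ck_on k U (%x. f x + g x)"
  using assms(1,2)
proof (induction k arbitrary: f g)
  case 0
  then show ?case by (auto intro: continuous_intros)
next
  case (Suc k)
  have d: "((%x. f x + g x) has_derivative (%v. Dv v f x + Dv v g x)) (at x)" if "x \<in> U" for x
    using Suc.prems that by (auto intro!: has_derivative_add has_derivative_frechet)
  have "Ck_on k U (Dv v (%x. f x + g x))" for v
    using Suc.prems by (subst Ck_on_cong[OF \<open>open U\<close>, where g="%x. Dv v f x + Dv v g x"])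
      (auto intro!: Suc.IH simp: Dv_eq[OF d])
  then show ?case using d by (auto simp: differentiable_def)
qed

text \<open>One Leibniz induction serves multiplication, scaling and inner products alike; the
  undifferentiated factor is lowered to class k by \<open>Ck_on_Suc_D\<close>.\<close>

lemma Ck_on_bilinear:
  assumes "bounded_bilinear pr" "open U" "Ck_on k U f" "Ck_on k U g"
  shows "Ck_on k U (%x. pr (f x) (g x))"
  using assms(3,4)
proof (induction k arbitrary: f g)
  case 0
  then show ?case using assms(1) by (auto intro: bounded_bilinear.continuous_on)
next
  case (Suc k)
  have d: "((%x. pr (f x) (g x)) has_derivative (%v. pr (f x) (Dv v g x) + pr (Dv v f x) (g x))) (at x)"
    if "x \<in> U" for x
    using Suc.prems that by (auto intro!: bounded_bilinear.FDERIV[OF assms(1)] has_derivative_frechet)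
  have "Ck_on k U (Dv v (%x. pr (f x) (g x)))" for v
  proof (subst Ck_on_cong[OF \<open>open U\<close>, where g="%x. pr (f x) (Dv v g x) + pr (Dv v f x) (g x)"])
    show "Ck_on k U (%x. pr (f x) (Dv v g x) + pr (Dv v f x) (g x))"
      using Suc.prems Ck_on_Suc_D[OF Suc.prems(1)] Ck_on_Suc_D[OF Suc.prems(2)]
      by (intro Ck_on_add[OF _ _ \<open>open U\<close>] Suc.IH) auto
  qed (simp add: Dv_eq[OF d])
  then show ?case using d by (auto simp: differentiable_def)
qed

lemma Ck_on_sum:
  assumes "open U" "!!i. i \<in> I ==> Ck_on k U (f i)"
  shows "Ck_on k U (%x. \<Sum>i\<in>I. f i x)"
  using assms(2) by (induction I rule: infinite_finite_induct) (auto intro: Ck_on_add assms(1))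

lemma Ck_on_linear_compose:
  assumes "bounded_linear h" "open U" "Ck_on k U f"
  shows "Ck_on k U (%x. h (f x))"
  using assms(3)
proof (induction k arbitrary: f)
  case 0
  then show ?case using assms(1) by (auto intro: bounded_linear.continuous_on)
next
  case (Suc k)
  have d: "((%x. h (f x)) has_derivative (%v. h (Dv v f x))) (at x)" if "x \<in> U" for x
    using Suc.prems that by (auto intro!: bounded_linear.has_derivative[OF assms(1)] has_derivative_frechet)
  have "Ck_on k U (Dv v (%x. h (f x)))" for v
    using Suc.prems
    by (subst Ck_on_cong[OF \<open>open U\<close>, where g="%x. h (Dv v f x)"])
      (auto intro!: Suc.IH simp: Dv_eq[OF d])
  then show ?case using d by (auto simp: differentiable_def)
qed

lemma linear_eq_sum_Basis:
  fixes x :: "'a::euclidean_space"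
  assumes "linear h" shows "h x = (\<Sum>b\<in>Basis. (x \<bullet> b) *\<^sub>R h b)"
  by (subst euclidean_representation[symmetric, of x])
     (simp only: linear_sum[OF assms] linear_scale[OF assms])

text \<open>In the chain rule the outer derivative is taken in the direction
  \<open>Dv v g x\<close>, which moves with \<open>x\<close>, whereas \<open>Ck_on\<close> only
  controls derivatives in fixed directions. Expanding in the basis leaves fixed directions with
  smooth coefficients.\<close>

lemma Dv_compose:
  fixes g :: "'a::euclidean_space => 'b::euclidean_space"
  assumes "g differentiable (at x)" "f differentiable (at (g x))"
  shows "((%x. f (g x)) has_derivative
      (%v. \<Sum>b\<in>Basis. (Dv v g x \<bullet> b) *\<^sub>R Dv b f (g x))) (at x)"
proof -
  have 1: "((%x. f (g x)) has_derivative (%v. frechet_derivative f (at (g x)) (Dv v g x))) (at x)"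
    by (rule has_derivative_compose[OF has_derivative_frechet[OF assms(1)] has_derivative_frechet[OF assms(2)]])
  have "linear (frechet_derivative f (at (g x)))"
    using assms(2) linear_frechet_derivative by blast
  then have "(%v. frechet_derivative f (at (g x)) (Dv v g x)) =
      (%v. \<Sum>b\<in>Basis. (Dv v g x \<bullet> b) *\<^sub>R Dv b f (g x))"
    by (intro ext linear_eq_sum_Basis)
  with 1 show ?thesis by (simp only:)
qed

lemma Ck_on_compose:
  fixes g :: "'a::euclidean_space => 'b::euclidean_space"
  assumes U: "open U" and W: "open W" and g: "Ck_on k U g" and f: "Ck_on k W f" and gU: "g ` U \<subseteq> W"
  shows "Ck_on k U (%x. f (g x))"
  using g f
proof (induction k arbitrary: f)
  case 0
  then show ?case using gU by (auto intro: continuous_on_compose2)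
next
  case (Suc k)
  have d: "((%x. f (g x)) has_derivative
      (%v. \<Sum>b\<in>Basis. (Dv v g x \<bullet> b) *\<^sub>R Dv b f (g x))) (at x)" if "x \<in> U" for x
    using Suc.prems that gU by (intro Dv_compose) auto
  have "Ck_on k U (%x. \<Sum>b\<in>Basis. (Dv v g x \<bullet> b) *\<^sub>R Dv b f (g x))" for v
  proof (intro Ck_on_sum U)
    fix b :: 'b
    have "Ck_on k U (%x. Dv b f (g x))"
      using Suc.prems by (intro Suc.IH Ck_on_Suc_D[OF Suc.prems(1)]) auto
    moreover have "Ck_on k U (%x. Dv v g x \<bullet> b)"
      using Suc.prems by (intro Ck_on_linear_compose[OF bounded_linear_inner_left U]) auto
    ultimately show "Ck_on k U (%x. (Dv v g x \<bullet> b) *\<^sub>R Dv b f (g x))"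
      by (intro Ck_on_bilinear[OF bounded_bilinear_scaleR U])
  qed
  then have "Ck_on k U (Dv v (%x. f (g x)))" for v
    by (subst Ck_on_cong[OF U, where g="%x. \<Sum>b\<in>Basis. (Dv v g x \<bullet> b) *\<^sub>R Dv b f (g x)"])
       (simp_all only: Dv_eq[OF d])
  then show ?case using d by (auto simp: differentiable_def)
qed

text \<open>The notion for open sets, in which all the analysis is done; \<open>smooth_on\<close>,
  with its local extensions, is kept for functions on the manifold.\<close>

definition Cinf :: "('a::euclidean_space) set => ('a => 'b::real_normed_vector) => bool" where
  "Cinf U f \<longleftrightarrow> (\<forall>k. Ck_on k U f)"

lemma smooth_on_open: "open S ==> smooth_on S f \<longleftrightarrow> Cinf S f"
proof
  assume S: "open S" and f: "smooth_on S f"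
  show "Cinf S f" unfolding Cinf_def
  proof (intro allI Ck_on_local)
    fix k x assume "x \<in> S"
    with f obtain U F where U: "open U" "x \<in> U" "!!k. Ck_on k U F" "!!y. y \<in> U \<inter> S ==> F y = f y"
      unfolding smooth_on_def by meson
    have "Ck_on k (U \<inter> S) F" using U(3) Ck_on_subset by blast
    then have "Ck_on k (U \<inter> S) f" using Ck_on_cong[of "U \<inter> S" F f] U S by blast
    then show "\<exists>U. open U \<and> x \<in> U \<and> Ck_on k U f" using U S \<open>x \<in> S\<close> by blast
  qed
next
  assume S: "open S" and f: "Cinf S f"
  then show "smooth_on S f" unfolding smooth_on_def Cinf_def by blast
qed

lemma smooth_on_iff: "smooth_on S f \<longleftrightarrow>
    (\<forall>x\<in>S. \<exists>U F. open U \<and> x \<in> U \<and> Cinf U F \<and> (\<forall>y\<in>U \<inter> S. F y = f y))"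
  by (simp add: smooth_on_def Cinf_def)

lemma Cinf_differentiable: "Cinf U f ==> x \<in> U ==> f differentiable (at x)"
  unfolding Cinf_def using Ck_on.simps(2) by metis

lemma Cinf_Dv: "Cinf U f ==> Cinf U (Dv v f)"
  unfolding Cinf_def using Ck_on.simps(2) by metis

lemma Cinf_has_derivative: "Cinf U f ==> x \<in> U ==> (f has_derivative (%v. Dv v f x)) (at x)"
  using Cinf_differentiable has_derivative_frechet by fastforce

lemma Cinf_imp_continuous: "Cinf U f ==> continuous_on U f"
  unfolding Cinf_def using Ck_on.simps(1) by metis

lemma Cinf_cong: "open U ==> (!!x. x \<in> U ==> f x = g x) ==> Cinf U f \<longleftrightarrow> Cinf U g"
  unfolding Cinf_def using Ck_on_cong by blast

lemma Cinf_subset: "Cinf U f ==> V \<subseteq> U ==> Cinf V f"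
  unfolding Cinf_def using Ck_on_subset by blast

text \<open>The gluing device behind every extension by zero: near a point either the defining
  formula is smooth, or a neighbourhood avoids the compact support.\<close>

lemma Cinf_local:
  "(!!x. x \<in> S ==> \<exists>U. open U \<and> x \<in> U \<and> Cinf U f) ==> Cinf S f"
  unfolding Cinf_def by (intro allI Ck_on_local) blast

lemma Cinf_const [simp]: "Cinf U (%x. c)" by (simp add: Cinf_def)

lemma Cinf_bounded_linear: "bounded_linear f ==> Cinf U f"
  by (simp add: Cinf_def Ck_on_bounded_linear)

lemma Cinf_id [simp]: "Cinf U (%x. x)" by (simp add: Cinf_bounded_linear bounded_linear_ident)

lemma Cinf_add: "open U ==> Cinf U f ==> Cinf U g ==> Cinf U (%x. f x + g x)"
  by (simp add: Cinf_def Ck_on_add)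

lemma Cinf_bilinear:
  "bounded_bilinear pr ==> open U ==> Cinf U f ==> Cinf U g ==> Cinf U (%x. pr (f x) (g x))"
  by (simp add: Cinf_def Ck_on_bilinear)

lemmas Cinf_mult = Cinf_bilinear[OF bounded_bilinear_mult]
lemmas Cinf_scaleR = Cinf_bilinear[OF bounded_bilinear_scaleR]
lemmas Cinf_inner = Cinf_bilinear[OF bounded_bilinear_inner]

lemma Cinf_linear_compose:
  "bounded_linear h ==> open U ==> Cinf U f ==> Cinf U (%x. h (f x))"
  by (simp add: Cinf_def Ck_on_linear_compose)

lemma Cinf_minus: "open U ==> Cinf U f ==> Cinf U (%x. - f x)"
  by (rule Cinf_linear_compose[OF bounded_linear_minus[OF bounded_linear_ident]])

lemma Cinf_diff: "open U ==> Cinf U f ==> Cinf U g ==> Cinf U (%x. f x - g x)"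
  using Cinf_add[of U f "%x. - g x"] Cinf_minus by fastforce

lemma Cinf_sum: "open U ==> (!!i. i \<in> I ==> Cinf U (f i)) ==> Cinf U (%x. \<Sum>i\<in>I. f i x)"
  by (simp add: Cinf_def Ck_on_sum)

lemma Cinf_prod:
  fixes f :: "'i => 'a::euclidean_space => 'b::real_normed_field"
  shows "open U ==> (!!i. i \<in> I ==> Cinf U (f i)) ==> Cinf U (%x. \<Prod>i\<in>I. f i x)"
  by (induction I rule: infinite_finite_induct) (auto intro: Cinf_mult)

lemma Cinf_compose:
  fixes g :: "'a::euclidean_space => 'b::euclidean_space"
  shows "open U ==> open W ==> Cinf U g ==> Cinf W f ==> g ` U \<subseteq> W ==> Cinf U (%x. f (g x))"
  unfolding Cinf_def using Ck_on_compose by blast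

text \<open>The derivative is a constant times the square of the function itself, so the induction
  closes through the product rule.\<close>

lemma Ck_on_inverse: "Ck_on k (- {0}) (inverse :: real => real)"
proof (induction k)
  case 0
  then show ?case by (auto intro!: continuous_intros)
next
  case (Suc k)
  have d: "(inverse has_derivative (%v. - (inverse x * v * inverse x))) (at x)" if "x \<in> - {0}" for x :: real
    using that has_derivative_inverse' by blast
  have "Ck_on k (- {0}) (Dv v (inverse :: real => real))" for v
  proof (subst Ck_on_cong[where g="%x. (- v) * (inverse x * inverse x)"])
    show "Ck_on k (- {0}) (%x::real. - v * (inverse x * inverse x))"
      by (intro Ck_on_bilinear[OF bounded_bilinear_mult] Suc) auto
  qed (auto simp: Dv_eq[OF d])
  then show ?case using d by (auto simp: differentiable_def)
qed

lemma Cinf_inverse: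
  fixes f :: "'a::euclidean_space => real"
  assumes "open U" "Cinf U f" "!!x. x \<in> U ==> f x ~= 0"
  shows "Cinf U (%x. inverse (f x))"
  by (rule Cinf_compose[OF assms(1) _ assms(2), of "- {0}"])
     (use assms(3) Ck_on_inverse in \<open>auto simp: Cinf_def\<close>)

text \<open>A continuous function without zeros has locally constant sign. Needed for the absolute
  value in the Jacobian.\<close>

lemma Cinf_abs:
  fixes f :: "'a::euclidean_space => real"
  assumes "open U" "Cinf U f" "!!x. x \<in> U ==> f x ~= 0"
  shows "Cinf U (%x. \<bar>f x\<bar>)"
proof (rule Cinf_local)
  fix x assume x: "x \<in> U"
  have c: "continuous_on U f" using assms(2) by (rule Cinf_imp_continuous)
  let ?P = "U \<inter> f -` {0<..}" and ?N = "U \<inter> f -` {..<0}"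
  have P: "open ?P" and N: "open ?N"
    by (intro continuous_open_preimage[OF c assms(1)]; simp)+
  show "\<exists>V. open V \<and> x \<in> V \<and> Cinf V (%x. \<bar>f x\<bar>)"
  proof (cases "f x > 0")
    case True
    have "Cinf ?P f" using assms(2) Cinf_subset by blast
    then have "Cinf ?P (%x. \<bar>f x\<bar>)" using Cinf_cong[OF P, of f "%x. \<bar>f x\<bar>"] by auto
    then show ?thesis using P True x by (intro exI[of _ ?P]) auto
  next
    case False
    have "Cinf ?N (%x. - f x)" using assms Cinf_subset[of U "%x. - f x"] Cinf_minus by blast
    then have "Cinf ?N (%x. \<bar>f x\<bar>)" using Cinf_cong[OF N, of "%x. - f x" "%x. \<bar>f x\<bar>"] by auto
    then show ?thesis using N False x assms(3)[of x] by (intro exI[of _ ?N]) auto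
  qed
qed

lemma Cinf_of_real: "open U ==> Cinf U f ==> Cinf U (%x. complex_of_real (f x))"
  by (rule Cinf_linear_compose[OF bounded_linear_of_real])

section \<open>Calculus of directional and iterated derivatives\<close>

lemma Dv_add:
  assumes "f differentiable (at x)" "g differentiable (at x)"
  shows "Dv v (%x. f x + g x) x = Dv v f x + Dv v g x"
  using assms by (intro Dv_eq has_derivative_add has_derivative_frechet)

lemma Dv_sum:
  assumes "!!i. i \<in> I ==> f i differentiable (at x)"
  shows "Dv v (%x. \<Sum>i\<in>I. f i x) x = (\<Sum>i\<in>I. Dv v (f i) x)"
  using assms by (intro Dv_eq has_derivative_sum has_derivative_frechet)

lemma Dv_mult:
  fixes f g :: "_ => 'a::real_normed_algebra"
  assumes "f differentiable (at x)" "g differentiable (at x)"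
  shows "Dv v (%x. f x * g x) x = f x * Dv v g x + Dv v f x * g x"
  using assms by (intro Dv_eq has_derivative_mult has_derivative_frechet)

lemma Dv_linear_compose:
  assumes "bounded_linear h" "f differentiable (at x)"
  shows "Dv v (%x. h (f x)) x = h (Dv v f x)"
  by (rule Dv_eq[OF bounded_linear.has_derivative[OF assms(1) has_derivative_frechet[OF assms(2)]]])

lemma Dv_bounded_linear: "bounded_linear f ==> Dv v f x = f v"
  by (intro Dv_eq bounded_linear_imp_has_derivative)

lemma Dv_const [simp]: "Dv v (%x. c) x = 0"
  by (intro Dv_eq) auto

lemma Dv_mult_left:
  fixes f :: "_ => 'a::real_normed_algebra"
  assumes "f differentiable (at x)"
  shows "Dv v (%x. c * f x) x = c * Dv v f x"
  by (rule Dv_linear_compose[OF bounded_linear_mult_right assms])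

lemma Dv_linear: "f differentiable (at x) ==> linear (%v. Dv v f x)"
  using linear_frechet_derivative by fastforce

lemma iter_deriv_append: "iter_deriv (vs @ ws) f = iter_deriv vs (iter_deriv ws f)"
  by (induction vs) auto

text \<open>The last entry of the list is the derivative taken first. Inductions from the right
  therefore replace the function by \<open>Dv v f\<close> and keep the shape of the statement, which
  is how they are used for products and pullbacks.\<close>

lemma iter_deriv_snoc: "iter_deriv (vs @ [v]) f = iter_deriv vs (Dv v f)"
  by (simp add: iter_deriv_append)

lemma Cinf_iter_deriv: "Cinf U f ==> Cinf U (iter_deriv vs f)"
  by (induction vs) (auto intro: Cinf_Dv)

lemma iter_deriv_add:
  assumes "Cinf UNIV f" "Cinf UNIV g"
  shows "iter_deriv vs (%x. f x + g x) = (%x. iter_deriv vs f x + iter_deriv vs g x)"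
proof (induction vs)
  case (Cons v vs)
  show ?case unfolding iter_deriv.simps Cons.IH
    by (intro ext Dv_add Cinf_differentiable[OF Cinf_iter_deriv UNIV_I] assms)
qed simp

lemma iter_deriv_sum:
  assumes "!!i. i \<in> I ==> Cinf UNIV (f i)"
  shows "iter_deriv vs (%x. \<Sum>i\<in>I. f i x) = (%x. \<Sum>i\<in>I. iter_deriv vs (f i) x)"
proof (induction vs)
  case (Cons v vs)
  show ?case unfolding iter_deriv.simps Cons.IH
    by (intro ext Dv_sum Cinf_differentiable[OF Cinf_iter_deriv UNIV_I] assms)
qed simp

lemma iter_deriv_linear_compose:
  assumes "bounded_linear h" "Cinf UNIV f"
  shows "iter_deriv vs (%x. h (f x)) = (%x. h (iter_deriv vs f x))"
proof (induction vs)
  case (Cons v vs)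
  show ?case unfolding iter_deriv.simps Cons.IH
    by (intro ext Dv_linear_compose[OF assms(1)] Cinf_differentiable[OF Cinf_iter_deriv[OF assms(2)] UNIV_I])
qed simp

lemma iter_deriv_cmult:
  fixes f :: "_ => 'a::real_normed_algebra"
  assumes "Cinf UNIV f"
  shows "iter_deriv vs (%x. c * f x) = (%x. c * iter_deriv vs f x)"
  by (rule iter_deriv_linear_compose[OF bounded_linear_mult_right assms])

section \<open>Test functions and Schwartz functions\<close>

lemma test_funI:
  assumes "Cinf UNIV f" "compact K" "K \<subseteq> V" "!!x. x \<notin> K ==> f x = 0"
  shows "f \<in> test_fun V"
proof -
  have "closure {x. f x ~= 0} \<subseteq> K"
    using assms by (intro closure_minimal) (auto intro: compact_imp_closed)
  moreover from this have "compact (closure {x. f x ~= 0})"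
    using compact_Int_closed[OF \<open>compact K\<close> closed_closure, of "{x. f x ~= 0}"] by (simp add: Int_absorb1)
  ultimately show ?thesis using assms by (auto simp: test_fun_def smooth_on_open)
qed

lemma test_funE:
  assumes "f \<in> test_fun V"
  obtains K where "compact K" "K \<subseteq> V" "!!x. x \<notin> K ==> f x = 0" "Cinf UNIV f"
proof (rule that[of "closure {x. f x ~= 0}"])
  show "x \<notin> closure {x. f x ~= 0} ==> f x = 0" for x
    using closure_subset[of "{x. f x ~= 0}"] by auto
qed (use assms in \<open>auto simp: test_fun_def smooth_on_open\<close>)

lemma test_fun_Cinf: "f \<in> test_fun V ==> Cinf UNIV f"
  by (auto simp: test_fun_def smooth_on_open)

lemma test_fun_mono: "f \<in> test_fun V ==> V \<subseteq> W ==> f \<in> test_fun W"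
  by (auto simp: test_fun_def)

lemma test_fun_support: "f \<in> test_fun V ==> x \<notin> V ==> f x = 0"
  by (erule test_funE) auto

lemma test_fun_zero [simp]: "(%x. 0) \<in> test_fun V"
  by (rule test_funI[of _ "{}"]) auto

lemma test_fun_Dv: assumes "f \<in> test_fun V" shows "Dv v f \<in> test_fun V"
proof -
  from assms obtain K where K: "compact K" "K \<subseteq> V" "!!x. x \<notin> K ==> f x = 0" "Cinf UNIV f"
    by (rule test_funE) blast
  have "Dv v f x = 0" if "x \<notin> K" for x
    using frechet_derivative_cong_open[of "- K" x f "%x. 0"] K that
    by (auto simp: compact_imp_closed open_Compl)
  then show ?thesis using K by (intro test_funI[of _ K]) (auto intro: Cinf_Dv)
qed

lemma test_fun_iter_deriv: "f \<in> test_fun V ==> iter_deriv vs f \<in> test_fun V"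
  by (induction vs) (auto intro: test_fun_Dv)

lemma test_fun_add:
  assumes "f \<in> test_fun V" "g \<in> test_fun V" shows "(%x. f x + g x) \<in> test_fun V"
proof -
  from assms(1) obtain K where K: "compact K" "K \<subseteq> V" "!!x. x \<notin> K ==> f x = 0" "Cinf UNIV f"
    by (rule test_funE) blast
  from assms(2) obtain L where L: "compact L" "L \<subseteq> V" "!!x. x \<notin> L ==> g x = 0" "Cinf UNIV g"
    by (rule test_funE) blast
  show ?thesis using K L by (intro test_funI[of _ "K \<union> L"]) (auto intro: Cinf_add)
qed

lemma test_fun_sum: "(!!i. i \<in> I ==> f i \<in> test_fun V) ==> (%x. \<Sum>i\<in>I. f i x) \<in> test_fun V"
  by (induction I rule: infinite_finite_induct) (auto intro: test_fun_add)

text \<open>\<open>g\<close> is smooth only on \<open>V\<close>, but the support of \<open>a\<close>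
  is a compact subset of \<open>V\<close>, so the complement of that support and \<open>V\<close>
  cover the space and the product is smooth on each.\<close>

lemma test_fun_mult:
  assumes "a \<in> test_fun V" "open V" "Cinf V g"
  shows "(%x. a x * g x) \<in> test_fun V"
proof -
  from assms(1) obtain K where K: "compact K" "K \<subseteq> V" "!!x. x \<notin> K ==> a x = 0" "Cinf UNIV a"
    by (rule test_funE) blast
  have "Cinf UNIV (%x. a x * g x)"
  proof (rule Cinf_local)
    fix x
    show "\<exists>U. open U \<and> x \<in> U \<and> Cinf U (%x. a x * g x)"
    proof (cases "x \<in> V")
      case True
      then show ?thesis using assms K Cinf_mult[of V a g] Cinf_subset[of UNIV a V] by blast
    next
      case False
      have "open (- K)" using K by (auto simp: compact_imp_closed)
      then have "Cinf (- K) (%x. a x * g x)" using Cinf_cong[of "- K" "%x. a x * g x" "%x. 0"] K by auto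
      then show ?thesis using False K \<open>open (- K)\<close> by blast
    qed
  qed
  then show ?thesis using K by (intro test_funI[of _ K]) auto
qed

lemma test_fun_cmult: "f \<in> test_fun V ==> (%x. c * f x) \<in> test_fun V"
  by (elim test_funE) (rule test_funI, auto intro: Cinf_mult)

lemma test_fun_bounded: assumes "f \<in> test_fun V" obtains C where "C >= 0" "!!x. norm (f x) <= C"
proof -
  from assms obtain K where K: "compact K" "K \<subseteq> V" "!!x. x \<notin> K ==> f x = 0" "Cinf UNIV f"
    by (rule test_funE) blast
  have "continuous_on K f" using Cinf_imp_continuous K(4) continuous_on_subset by blast
  then have "bounded (f ` K)" using K(1) compact_continuous_image compact_imp_bounded by blast
  then obtain C where "C > 0" "!!x. x \<in> K ==> norm (f x) <= C" unfolding bounded_pos by blast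
  then show ?thesis using K(3) by (intro that[of C]) (metis less_imp_le norm_zero)+
qed

section \<open>Seminorm estimates on the Schwartz space\<close>

abbreviation jb :: "'a::real_normed_vector => real" where "jb x == 1 + norm x"

lemma schwartz_iff: "f \<in> schwartz \<longleftrightarrow> Cinf UNIV f \<and>
    (\<forall>vs N. set vs \<subseteq> Basis --> (\<exists>B. \<forall>x. jb x ^ N * norm (iter_deriv vs f x) <= B))"
  unfolding schwartz_def bdd_above_def by (auto simp: smooth_on_open)

lemma schwartz_Cinf: "f \<in> schwartz ==> Cinf UNIV f" by (simp add: schwartz_iff)

lemma finite_basis_lists [simp]: "finite (basis_lists N :: 'a::euclidean_space list set)"
  unfolding basis_lists_def using finite_lists_length_le[of "Basis :: 'a set" N] by simp

lemma Nil_basis_lists [simp]: "[] \<in> basis_lists N" by (simp add: basis_lists_def)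

lemma schwartz_norm_ge:
  assumes f: "f \<in> schwartz" and vs: "set vs \<subseteq> Basis" "length vs <= M" and N: "N <= M"
  shows "jb x ^ N * norm (iter_deriv vs f x) <= schwartz_norm M f"
proof -
  have bdd: "bdd_above (range (%x. jb x ^ M * norm (iter_deriv ws f x)))" if "ws \<in> basis_lists M" for ws
    using that f by (auto simp: schwartz_def basis_lists_def)
  have "jb x ^ N * norm (iter_deriv vs f x) <= jb x ^ M * norm (iter_deriv vs f x)"
    using N by (intro mult_right_mono power_increasing) auto
  also have "... <= (SUP x. jb x ^ M * norm (iter_deriv vs f x))"
    using vs by (intro cSUP_upper bdd) (auto simp: basis_lists_def)
  also have "... <= schwartz_norm M f"
    unfolding schwartz_norm_def
  proof (rule member_le_sum)
    fix ws :: "'a list" assume "ws \<in> basis_lists M - {vs}"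
    then show "0 <= (SUP x. jb x ^ M * norm (iter_deriv ws f x))"
      using cSUP_upper[OF UNIV_I[of 0] bdd[of ws]] by (auto intro: order_trans[rotated])
  next
    show "vs \<in> basis_lists M" using vs by (simp add: basis_lists_def)
  qed simp
  finally show ?thesis .
qed

lemma schwartz_norm_ge0: "f \<in> schwartz ==> norm (f x) <= schwartz_norm M f"
  using schwartz_norm_ge[of f "[]" M 0 x] by simp

lemma schwartz_norm_nonneg: "f \<in> schwartz ==> 0 <= schwartz_norm M f"
  using schwartz_norm_ge0[of f 0 M] norm_ge_zero order_trans by blast

lemma schwartz_norm_le:
  fixes f :: "'a::euclidean_space => complex"
  assumes "!!vs x. vs \<in> basis_lists N ==> jb x ^ N * norm (iter_deriv vs f x) <= B"
  shows "schwartz_norm N f <= real (card (basis_lists N :: 'a list set)) * B"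
proof -
  have "schwartz_norm N f <= (\<Sum>vs\<in>(basis_lists N :: 'a list set). B)"
    unfolding schwartz_norm_def by (intro sum_mono cSUP_least assms) auto
  then show ?thesis by simp
qed

text \<open>The factor is the number of summands: each supremum in the smaller norm is bounded by
  the whole of the larger one.\<close>

lemma schwartz_norm_mono:
  fixes f :: "'a::euclidean_space => complex"
  assumes "f \<in> schwartz" "N <= M"
  shows "schwartz_norm N f <= schwartz_norm M f * real (card (basis_lists N :: 'a list set))"
proof -
  have "jb x ^ N * norm (iter_deriv vs f x) <= schwartz_norm M f" if "vs \<in> basis_lists N" for vs x
    using that assms by (intro schwartz_norm_ge) (auto simp: basis_lists_def)
  from schwartz_norm_le[OF this] show ?thesis by (simp add: mult.commute)
qed

text \<open>Domination by a continuous seminorm of the Schwartz space. Constant and order are hidden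
  behind quantifiers so that estimates can be added and composed without bookkeeping of
  orders.\<close>

definition sb :: "(('a::euclidean_space => complex) => real) => bool" where
  "sb \<Phi> \<longleftrightarrow> (\<exists>C\<ge>0. \<exists>M. \<forall>f\<in>schwartz. \<Phi> f <= C * schwartz_norm M f)"

definition scont :: "(('a::euclidean_space => complex) => ('b::euclidean_space => complex)) => bool" where
  "scont A \<longleftrightarrow> (\<forall>f\<in>schwartz. A f \<in> schwartz) \<and> (\<forall>N. sb (%f. schwartz_norm N (A f)))"

lemma sbI:
  fixes \<Phi> :: "('a::euclidean_space => complex) => real"
  shows "(!!f. f \<in> schwartz ==> \<Phi> f <= C * schwartz_norm M f) ==> sb \<Phi>"
  unfolding sb_def
proof (intro exI[of _ "\<bar>C\<bar>"] conjI exI[of _ M] ballI)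
  fix f :: "'a => complex" assume *: "!!f. f \<in> schwartz ==> \<Phi> f <= C * schwartz_norm M f" "f \<in> schwartz"
  have "C * schwartz_norm M f <= \<bar>C\<bar> * schwartz_norm M f"
    using * by (intro mult_right_mono schwartz_norm_nonneg) auto
  with * show "\<Phi> f <= \<bar>C\<bar> * schwartz_norm M f" by force
qed simp

lemma sb_norm [simp]: "sb (schwartz_norm N)" by (rule sbI[of _ 1 N]) simp

lemma sb_const_mult: "sb \<Phi> ==> (!!f. f \<in> schwartz ==> \<Psi> f <= c * \<Phi> f) ==> c >= 0 ==> sb \<Psi>"
  unfolding sb_def
proof (elim exE conjE)
  fix C M assume *: "C >= 0" "\<forall>f\<in>schwartz. \<Phi> f <= C * schwartz_norm M f"
    "!!f. f \<in> schwartz ==> \<Psi> f <= c * \<Phi> f" "c >= 0"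
  have "\<Psi> f <= (c * C) * schwartz_norm M f" if "f \<in> schwartz" for f
  proof -
    have "\<Psi> f <= c * \<Phi> f" using * that by blast
    also have "... <= c * (C * schwartz_norm M f)" using * that by (intro mult_left_mono) auto
    finally show ?thesis by (simp add: mult.assoc)
  qed
  then show "\<exists>C\<ge>0. \<exists>M. \<forall>f\<in>schwartz. \<Psi> f <= C * schwartz_norm M f"
    using * by (metis mult_nonneg_nonneg)
qed

lemma sb_le: "sb \<Phi> ==> (!!f. f \<in> schwartz ==> \<Psi> f <= \<Phi> f) ==> sb \<Psi>"
  by (rule sb_const_mult[of _ _ 1]) auto

lemma sb_add: assumes "sb \<Phi>" "sb \<Psi>" shows "sb (%f. \<Phi> f + \<Psi> f)"
proof -
  obtain C M where 1: "C >= 0" "!!f. f \<in> schwartz ==> \<Phi> f <= C * schwartz_norm M f"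
    using assms(1) unfolding sb_def by blast
  obtain D N where 2: "D >= 0" "!!f. f \<in> schwartz ==> \<Psi> f <= D * schwartz_norm N f"
    using assms(2) unfolding sb_def by blast
  let ?K = "max M N" and ?c = "%n. real (card (basis_lists n :: 'a list set))"
  show ?thesis
  proof (rule sbI[of _ "C * ?c M + D * ?c N" ?K])
    fix f :: "'a => complex" assume f: "f \<in> schwartz"
    have "C * schwartz_norm M f <= C * (schwartz_norm ?K f * ?c M)"
      using 1 f by (intro mult_left_mono schwartz_norm_mono) auto
    moreover have "D * schwartz_norm N f <= D * (schwartz_norm ?K f * ?c N)"
      using 2 f by (intro mult_left_mono schwartz_norm_mono) auto
    ultimately show "\<Phi> f + \<Psi> f <= (C * ?c M + D * ?c N) * schwartz_norm ?K f"
      using 1(2)[OF f] 2(2)[OF f] by (simp add: algebra_simps)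
  qed
qed

lemma sb_zero [simp]: "sb (%f. 0)" by (rule sbI[of _ 0 0]) simp

lemma sb_sum: "(!!i. i \<in> I ==> sb (\<Phi> i)) ==> sb (%f. \<Sum>i\<in>I. \<Phi> i f)"
  by (induction I rule: infinite_finite_induct) (auto intro: sb_add)

lemma sb_cmult: "sb \<Phi> ==> c >= 0 ==> sb (%f. c * \<Phi> f)"
  by (rule sb_const_mult[of \<Phi> _ c]) auto

lemma sb_compose: assumes "sb \<Phi>" "scont A" shows "sb (%f. \<Phi> (A f))"
proof -
  obtain C M where 1: "C >= 0" "!!f. f \<in> schwartz ==> \<Phi> f <= C * schwartz_norm M f"
    using assms(1) unfolding sb_def by blast
  have "sb (%f. schwartz_norm M (A f))" using assms(2) by (simp add: scont_def)
  then show ?thesis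
    by (rule sb_const_mult[OF _ _ 1(1)]) (use assms(2) 1 in \<open>auto simp: scont_def\<close>)
qed

text \<open>Each weighted derivative may be bounded by its own functional; a Schwartz norm involves
  only finitely many derivatives, so the sum of these functionals dominates it.\<close>

lemma scontI:
  fixes A :: "('a::euclidean_space => complex) => ('b::euclidean_space => complex)"
  assumes C: "!!f. f \<in> schwartz ==> Cinf UNIV (A f)"
    and b: "!!N vs. set vs \<subseteq> Basis ==> \<exists>\<Phi>. sb \<Phi> \<and>
      (\<forall>f\<in>schwartz. \<forall>x. jb x ^ N * norm (iter_deriv vs (A f) x) <= \<Phi> f)"
  shows "scont A"
  unfolding scont_def
proof (intro conjI ballI allI)
  fix f :: "'a => complex" assume "f \<in> schwartz"
  then show "A f \<in> schwartz" unfolding schwartz_iff[of "A f"] using C b by meson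
next
  fix N
  have "\<forall>vs\<in>basis_lists N. \<exists>\<Phi>. sb \<Phi> \<and>
      (\<forall>f\<in>schwartz. \<forall>x. jb x ^ N * norm (iter_deriv vs (A f) x) <= \<Phi> f)"
    using b by (auto simp: basis_lists_def)
  then obtain \<Phi> where \<Phi>: "!!vs. vs \<in> basis_lists N ==> sb (\<Phi> vs) \<and>
      (\<forall>f\<in>schwartz. \<forall>x. jb x ^ N * norm (iter_deriv vs (A f) x) <= \<Phi> vs f)"
    by (auto dest!: bchoice)
  have "sb (%f. \<Sum>vs\<in>basis_lists N. \<Phi> vs f)" using \<Phi> by (intro sb_sum) auto
  then show "sb (%f. schwartz_norm N (A f))"
    by (rule sb_le) (use \<Phi> in \<open>auto simp: schwartz_norm_def intro!: sum_mono cSUP_least\<close>)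
qed

lemma scont_schwartz: "scont A ==> f \<in> schwartz ==> A f \<in> schwartz"
  by (simp add: scont_def)

lemma scont_compose: "scont A ==> scont B ==> scont (%f. A (B f))"
  unfolding scont_def[of "%f. A (B f)"]
  using sb_compose[of "%f. schwartz_norm _ (A f)" B] by (auto simp: scont_def)

lemma scont_Dv: assumes "v \<in> Basis" shows "scont (Dv v)"
proof (rule scontI)
  fix N vs assume vs: "set vs \<subseteq> (Basis :: 'a set)"
  let ?M = "N + Suc (length vs)"
  have "jb x ^ N * norm (iter_deriv vs (Dv v f) x) <= schwartz_norm ?M f"
    if "f \<in> schwartz" for f and x :: 'a
    using schwartz_norm_ge[OF that, of "vs @ [v]" ?M N x] vs assms by (auto simp: iter_deriv_snoc)
  then show "\<exists>\<Phi>. sb \<Phi> \<and> (\<forall>f\<in>schwartz. \<forall>x. jb x ^ N * norm (iter_deriv vs (Dv v f) x) <= \<Phi> f)"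
    using sb_norm by blast
qed (auto intro: Cinf_Dv schwartz_Cinf)

lemma scont_id: "scont (%f. f)" by (auto simp: scont_def intro: sb_norm)

lemma scont_iter_deriv: "set vs \<subseteq> Basis ==> scont (iter_deriv vs)"
proof (induction vs)
  case Nil
  show ?case using scont_id by (simp add: scont_def)
next
  case (Cons v vs)
  then show ?case using scont_compose[OF scont_Dv[of v] Cons.IH] by (simp add: scont_def)
qed

text \<open>The multiplier space O_M: smooth functions all of whose derivatives grow at most
  polynomially, the order depending on the derivative.\<close>

definition pgrow :: "('a::euclidean_space => complex) => bool" where
  "pgrow a \<longleftrightarrow> Cinf UNIV a \<and>
     (\<forall>vs. set vs \<subseteq> Basis --> (\<exists>C M. \<forall>x. norm (iter_deriv vs a x) <= C * jb x ^ M))"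

lemma pgrow_Dv: "pgrow a ==> v \<in> Basis ==> pgrow (Dv v a)"
  unfolding pgrow_def
  by (auto intro: Cinf_Dv)
    (metis iter_deriv_snoc set_append Un_subset_iff empty_subsetI insert_subset list.set)

text \<open>A nonempty list gives zero and the empty list gives \<open>c\<close>; the inequality
  treats both at once.\<close>

lemma norm_iter_deriv_const: "norm (iter_deriv vs (%x. c) x) <= norm c"
proof (induction vs arbitrary: x c rule: rev_induct)
  case (snoc v vs)
  then show ?case using snoc[of 0 x] norm_ge_zero[of c] by (simp add: iter_deriv_snoc) 
qed simp

lemma pgrow_const [simp]: "pgrow (%x. c)"
  unfolding pgrow_def
  by (intro conjI allI impI Cinf_const exI[of _ "norm c"] exI[of _ "0::nat"])
     (simp add: norm_iter_deriv_const)

lemma pgrow_bounded_linear: assumes "bounded_linear L" shows "pgrow L"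
  unfolding pgrow_def
proof (intro conjI allI impI)
  fix vs :: "'a list"
  show "\<exists>C M. \<forall>x. norm (iter_deriv vs L x) <= C * jb x ^ M"
  proof (cases vs rule: rev_cases)
    case Nil
    obtain K where K: "!!x. norm (L x) <= norm x * K" "K > 0" using bounded_linear.pos_bounded[OF assms] by blast
    have "norm (L x) <= K * jb x ^ 1" for x
      using K(1)[of x] K(2) by (simp add: algebra_simps)
    then show ?thesis using Nil by (intro exI[of _ K] exI[of _ "1::nat"]) simp
  next
    case (snoc ws v)
    have "iter_deriv vs L = iter_deriv ws (%x. L v)"
      using snoc by (simp add: iter_deriv_snoc Dv_bounded_linear[OF assms])
    then show ?thesis using norm_iter_deriv_const[of ws "L v"]
      by (intro exI[of _ "norm (L v)"] exI[of _ 0]) simp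
  qed
qed (rule Cinf_bounded_linear[OF assms])

lemma pgrow_test_fun: assumes "a \<in> test_fun V" shows "pgrow a"
  unfolding pgrow_def
proof (intro conjI allI impI)
  fix vs :: "'a list"
  obtain C where "!!x. norm (iter_deriv vs a x) <= C"
    using test_fun_bounded[OF test_fun_iter_deriv[OF assms]] by metis
  then show "\<exists>C M. \<forall>x. norm (iter_deriv vs a x) <= C * jb x ^ M"
    by (intro exI[of _ C] exI[of _ 0]) simp
qed (rule test_fun_Cinf[OF assms])

text \<open>The first derivative falls either on \<open>f\<close>, which stays in the Schwartz
  space, or on \<open>a\<close>, which stays in \<open>pgrow\<close>. With \<open>a\<close>
  generalised the induction needs no Leibniz formula.\<close>

lemma scont_mult: assumes "pgrow a" shows "scont (%f x. a x * f x)"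
proof (rule scontI)
  show "Cinf UNIV (%x. a x * f x)" if "f \<in> schwartz" for f
    using assms schwartz_Cinf[OF that] by (intro Cinf_mult) (auto simp: pgrow_def)
  fix N vs assume "set vs \<subseteq> (Basis :: 'a set)"
  then show "\<exists>\<Phi>. sb \<Phi> \<and> (\<forall>f\<in>schwartz. \<forall>x. jb x ^ N *
      norm (iter_deriv vs (%x. a x * f x) x) <= \<Phi> f)"
    using assms
  proof (induction vs arbitrary: a rule: rev_induct)
    case Nil
    then obtain C M where CM: "!!x. norm (a x) <= C * jb x ^ M"
      unfolding pgrow_def using iter_deriv.simps(1) by (metis Nil.prems(1))
    have "C >= 0" using order_trans[OF norm_ge_zero CM[of 0]] by simp
    have "jb x ^ N * norm (a x * f x) <= C * schwartz_norm (N + M) f" if "f \<in> schwartz" for f x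
    proof -
      have "jb x ^ N * norm (a x * f x) <= jb x ^ N * (C * jb x ^ M * norm (f x))"
        using CM by (auto simp: norm_mult intro!: mult_left_mono mult_right_mono)
      also have "... = C * (jb x ^ (N + M) * norm (f x))" by (simp add: power_add)
      also have "... <= C * schwartz_norm (N + M) f"
        using schwartz_norm_ge[OF that, of "[]" "N + M" "N + M" x] \<open>C >= 0\<close> by (intro mult_left_mono) auto
      finally show ?thesis .
    qed
    then show ?case using \<open>C >= 0\<close> by (intro exI[of _ "%f. C * schwartz_norm (N + M) f"]) (auto intro: sb_cmult)
  next
    case (snoc v vs)
    then have v: "v \<in> Basis" and vs: "set vs \<subseteq> Basis" by auto
    obtain \<Phi> where \<Phi>: "sb \<Phi>" "!!f x. f \<in> schwartz ==> jb x ^ N *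
        norm (iter_deriv vs (%x. Dv v a x * f x) x) <= \<Phi> f"
      using snoc.IH[OF vs pgrow_Dv[OF snoc.prems(2) v]] by blast
    obtain \<Psi> where \<Psi>: "sb \<Psi>" "!!f x. f \<in> schwartz ==> jb x ^ N *
        norm (iter_deriv vs (%x. a x * f x) x) <= \<Psi> f"
      using snoc.IH[OF vs snoc.prems(2)] by blast
    let ?\<Phi> = "%f. \<Psi> (Dv v f) + \<Phi> f"
    have "sb ?\<Phi>" using \<Phi> \<Psi> v by (intro sb_add sb_compose[OF _ scont_Dv]) auto
    moreover have "jb x ^ N * norm (iter_deriv (vs @ [v]) (%x. a x * f x) x) <= ?\<Phi> f"
      if f: "f \<in> schwartz" for f x
    proof -
      have a: "Cinf UNIV a" using snoc.prems by (simp add: pgrow_def)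
      have fs: "Cinf UNIV f" using f by (rule schwartz_Cinf)
      have "Dv v (%x. a x * f x) = (%x. a x * Dv v f x + Dv v a x * f x)"
        using Dv_mult[of a _ f v] Cinf_differentiable[OF a] Cinf_differentiable[OF fs] by auto
      then have "iter_deriv (vs @ [v]) (%x. a x * f x) x =
          iter_deriv vs (%x. a x * Dv v f x) x + iter_deriv vs (%x. Dv v a x * f x) x"
        using a fs by (simp add: iter_deriv_snoc iter_deriv_add Cinf_mult Cinf_Dv)
      then have "jb x ^ N * norm (iter_deriv (vs @ [v]) (%x. a x * f x) x)
         <= jb x ^ N * (norm (iter_deriv vs (%x. a x * Dv v f x) x) + norm (iter_deriv vs (%x. Dv v a x * f x) x))"
        by (auto intro!: mult_left_mono norm_triangle_ineq)
      also have "... <= ?\<Phi> f"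
        using \<Psi>(2)[OF scont_schwartz[OF scont_Dv[OF v] f], of x] \<Phi>(2)[OF f, of x]
        by (simp add: distrib_left)
      finally show ?thesis .
    qed
    ultimately show ?case by blast
  qed
qed

lemmas schwartz_mult = scont_schwartz[OF scont_mult]
lemmas schwartz_Dv = scont_schwartz[OF scont_Dv]

lemma schwartz_add: "f \<in> schwartz ==> g \<in> schwartz ==> (%x. f x + g x) \<in> schwartz"
proof -
  assume f: "f \<in> schwartz" and g: "g \<in> schwartz"
  have "Cinf UNIV (%x. f x + g x)" using schwartz_Cinf[OF f] schwartz_Cinf[OF g] by (intro Cinf_add) auto
  moreover have "\<exists>B. \<forall>x. jb x ^ N * norm (iter_deriv vs (%x. f x + g x) x) <= B"
    if "set vs \<subseteq> Basis" for vs N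
  proof -
    let ?M = "N + length vs"
    have "jb x ^ N * norm (iter_deriv vs (%x. f x + g x) x) <= schwartz_norm ?M f + schwartz_norm ?M g" for x
    proof -
      have "jb x ^ N * norm (iter_deriv vs (%x. f x + g x) x)
        <= jb x ^ N * (norm (iter_deriv vs f x) + norm (iter_deriv vs g x))"
        using f g by (subst iter_deriv_add) (auto intro!: mult_left_mono schwartz_Cinf norm_triangle_ineq)
      then show ?thesis
        using schwartz_norm_ge[OF f, of vs ?M N x] schwartz_norm_ge[OF g, of vs ?M N x] that
        by (simp add: distrib_left)
    qed
    then show ?thesis by blast
  qed
  ultimately show ?thesis by (auto simp: schwartz_iff)
qed

lemma schwartz_cmult: "f \<in> schwartz ==> (%x. c * f x) \<in> schwartz"
  by (rule schwartz_mult[OF pgrow_const])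

lemma schwartz_diff: "f \<in> schwartz ==> g \<in> schwartz ==> (%x. f x - g x) \<in> schwartz"
  using schwartz_add[of f "%x. (- 1) * g x"] schwartz_cmult[of g "- 1"] by simp

lemma test_fun_weight_bounded:
  assumes "compact K"
  obtains C where "C >= 1" "!!x N. x \<in> K ==> jb x ^ N <= C ^ N"
proof -
  obtain B where B: "B > 0" "!!x. x \<in> K ==> norm x <= B"
    using compact_imp_bounded[OF assms] unfolding bounded_pos by blast
  show ?thesis by (rule that[of "1 + B"]) (use B in \<open>auto intro!: power_mono\<close>)
qed

lemma test_fun_schwartz: assumes "f \<in> test_fun V" shows "f \<in> schwartz"
  unfolding schwartz_iff
proof (intro conjI allI impI)
  fix vs N
  have "iter_deriv vs f \<in> test_fun V" using assms by (rule test_fun_iter_deriv)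
  then obtain K where K: "compact K" "!!x. x \<notin> K ==> iter_deriv vs f x = 0" by (rule test_funE) blast
  obtain C where C: "C >= 1" "!!x N. x \<in> K ==> jb x ^ N <= C ^ N"
    using test_fun_weight_bounded[OF K(1)] by metis
  obtain D where D: "D >= 0" "!!x. norm (iter_deriv vs f x) <= D"
    using test_fun_bounded[OF test_fun_iter_deriv[OF assms]] by metis
  have "jb x ^ N * norm (iter_deriv vs f x) <= C ^ N * D" for x
    using K(2)[of x] C(2)[of x N] D C(1) by (cases "x \<in> K") (auto intro!: mult_mono)
  then show "\<exists>B. \<forall>x. jb x ^ N * norm (iter_deriv vs f x) <= B" by blast
qed (rule test_fun_Cinf[OF assms])

text \<open>On a fixed compact set the polynomial weight is bounded. This links the unweighted
  seminorms in the definition of \<open>distributions\<close> with Schwartz norms.\<close>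

lemma schwartz_norm_test_fun:
  fixes K :: "'a::euclidean_space set"
  assumes K: "compact K"
  obtains C where "C >= 0" "!!f. f \<in> test_fun K ==>
    schwartz_norm N f <= C * (\<Sum>vs\<in>basis_lists N. SUP x. norm (iter_deriv vs f x))"
proof -
  obtain C where C: "C >= 1" "!!x N. x \<in> K ==> jb x ^ N <= C ^ N"
    using test_fun_weight_bounded[OF K(1)] by metis
  show ?thesis
  proof (rule that[of "C ^ N"])
    fix f :: "'a => complex" assume f: "f \<in> test_fun K"
    show "schwartz_norm N f <= C ^ N * (\<Sum>vs\<in>basis_lists N. SUP x. norm (iter_deriv vs f x))"
      unfolding schwartz_norm_def sum_distrib_left
    proof (intro sum_mono cSUP_least)
      fix vs :: "'a list" and x
      obtain D where D: "!!x. norm (iter_deriv vs f x) <= D"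
        using test_fun_bounded[OF test_fun_iter_deriv[OF f]] by metis
      have "norm (iter_deriv vs f x) <= (SUP x. norm (iter_deriv vs f x))"
        by (rule cSUP_upper) (use D in \<open>auto simp: bdd_above_def\<close>)
      moreover have "iter_deriv vs f x = 0" if "x \<notin> K"
        using test_fun_support[OF test_fun_iter_deriv[OF f] that] .
      ultimately show "jb x ^ N * norm (iter_deriv vs f x) <= C ^ N * (SUP x. norm (iter_deriv vs f x))"
        using C(2)[of x N] C(1) by (cases "x \<in> K") (auto intro!: mult_mono)
    qed auto
  qed (use C in auto)
qed

section \<open>Pullbacks multiplied by a test function\<close>

lemma test_fun_pullback:
  fixes \<psi> :: "'a::euclidean_space => 'b::euclidean_space"
  assumes "a \<in> test_fun V" "open V" "Cinf V \<psi>" "Cinf UNIV f"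
  shows "(%x. a x * f (\<psi> x)) \<in> test_fun V"
  using assms by (intro test_fun_mult) (auto intro: Cinf_compose[of V UNIV \<psi> f])

lemma Dv_pullback:
  fixes \<psi> :: "'a::euclidean_space => 'b::euclidean_space"
  assumes a: "a \<in> test_fun V" "open V" "Cinf V \<psi>" "Cinf UNIV f"
  shows "Dv e (%x. a x * f (\<psi> x)) =
    (%x. Dv e a x * f (\<psi> x) + (\<Sum>b\<in>Basis. (a x * complex_of_real (Dv e \<psi> x \<bullet> b)) * Dv b f (\<psi> x)))"
proof
  fix x
  show "Dv e (%x. a x * f (\<psi> x)) x =
    Dv e a x * f (\<psi> x) + (\<Sum>b\<in>Basis. (a x * complex_of_real (Dv e \<psi> x \<bullet> b)) * Dv b f (\<psi> x))"
  proof (cases "x \<in> V")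
    case True
    have d: "((%x. f (\<psi> x)) has_derivative (%v. \<Sum>b\<in>Basis. (Dv v \<psi> x \<bullet> b) *\<^sub>R Dv b f (\<psi> x))) (at x)"
      using Cinf_differentiable[OF a(3) True] Cinf_differentiable[OF a(4)] by (intro Dv_compose) auto
    have "a differentiable (at x)" using test_fun_Cinf[OF a(1)] Cinf_differentiable by blast
    then have "Dv e (%x. a x * f (\<psi> x)) x = a x * Dv e (%x. f (\<psi> x)) x + Dv e a x * f (\<psi> x)"
      using d by (intro Dv_mult) (auto simp: differentiable_def)
    also have "Dv e (%x. f (\<psi> x)) x = (\<Sum>b\<in>Basis. (Dv e \<psi> x \<bullet> b) *\<^sub>R Dv b f (\<psi> x))"
      using d by (rule Dv_eq)
    finally show ?thesis by (simp add: sum_distrib_left scaleR_conv_of_real mult.assoc)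
  next
    case False
    then show ?thesis
      using test_fun_support[OF a(1)] test_fun_support[OF test_fun_Dv[OF a(1)]]
        test_fun_support[OF test_fun_Dv[OF test_fun_pullback[OF a]]] by simp
  qed
qed

text \<open>Derivatives are taken from the inside, so that each step produces operators of the same form
  \<open>f \<mapsto> a (f \<circ> \<psi>)\<close> and no Leibniz formula is needed.\<close>

lemma pullback_deriv_bound:
  fixes \<psi> :: "'a::euclidean_space => 'b::euclidean_space"
    and \<nu> :: "('a => complex) => real" and W :: "('b => complex) => real"
  assumes V: "open V" "Cinf V \<psi>"
    and X: "!!f. f \<in> X ==> Cinf UNIV f" "!!f b. f \<in> X ==> b \<in> Basis ==> Dv b f \<in> X"
    and \<nu>: "\<nu> (%x. 0) = 0"
      "!!f g. f \<in> test_fun V ==> g \<in> test_fun V ==> \<nu> (%x. f x + g x) <= \<nu> f + \<nu> g"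
    and base: "!!a. a \<in> test_fun V ==> \<exists>C\<ge>0. \<forall>f\<in>X. \<nu> (%x. a x * f (\<psi> x)) <= C * W f"
    and W: "!!f. f \<in> X ==> 0 <= W f"
    and a: "a \<in> test_fun V" "set vs \<subseteq> Basis"
  shows "\<exists>C\<ge>0. \<forall>f\<in>X. \<nu> (iter_deriv vs (%x. a x * f (\<psi> x))) <=
    C * (\<Sum>ws\<in>basis_lists (length vs). W (iter_deriv ws f))"
  using a
proof (induction vs arbitrary: a rule: rev_induct)
  case Nil
  have "basis_lists 0 = {[]::'b list}" by (auto simp: basis_lists_def)
  then show ?case using base[OF Nil(1)] by simp
next
  case (snoc e vs)
  let ?n = "length vs" and ?S = "%n f. \<Sum>ws\<in>basis_lists n. W (iter_deriv ws f)"
  have Xi: "iter_deriv ws f \<in> X" if "f \<in> X" "set ws \<subseteq> Basis" for ws f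
    using that(2) by (induction ws) (use that(1) X in auto)
  have vs: "set vs \<subseteq> Basis" "e \<in> Basis" using snoc.prems by auto
  obtain C0 where C0: "C0 >= 0" "!!f. f \<in> X ==> \<nu> (iter_deriv vs (%x. Dv e a x * f (\<psi> x))) <= C0 * ?S ?n f"
    using snoc.IH[OF test_fun_Dv[OF snoc.prems(1)] vs(1)] by blast
  \<comment> \<open>Coefficients produced by the chain rule. Like \<open>Dv e a\<close> they are
    test functions on \<open>V\<close>, so the induction hypothesis applies to every term of the
    differentiated pullback.\<close>
  define ab where "ab b x = a x * complex_of_real (Dv e \<psi> x \<bullet> b)" for b x
  have ab: "ab b \<in> test_fun V" for b
    unfolding ab_def using snoc.prems V
    by (intro test_fun_mult Cinf_of_real Cinf_linear_compose[OF bounded_linear_inner_left] Cinf_Dv) auto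
  have "\<forall>b. \<exists>C\<ge>0. \<forall>f\<in>X. \<nu> (iter_deriv vs (%x. ab b x * f (\<psi> x))) <= C * ?S ?n f"
    using snoc.IH[OF ab vs(1)] by blast
  then obtain C where C: "!!b. C b >= 0" "!!b f. f \<in> X ==> \<nu> (iter_deriv vs (%x. ab b x * f (\<psi> x))) <= C b * ?S ?n f"
    by metis
  have \<nu>sum: "\<nu> (%x. \<Sum>i\<in>I. g i x) <= (\<Sum>i\<in>I. \<nu> (g i))" if "finite I" "!!i. i \<in> I ==> g i \<in> test_fun V"
    for I and g :: "'b => 'a => complex"
    using that
  proof (induction I rule: finite_induct)
    case (insert i I)
    have "\<nu> (%x. \<Sum>j\<in>insert i I. g j x) = \<nu> (%x. g i x + (\<Sum>j\<in>I. g j x))"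
      using insert by simp
    also have "... <= \<nu> (g i) + \<nu> (%x. \<Sum>j\<in>I. g j x)"
      using insert by (intro \<nu>(2) test_fun_sum) auto
    finally show ?case using insert by fastforce
  qed (simp add: \<nu>)
  show ?case
  proof (rule exI[of _ "C0 + (\<Sum>b\<in>Basis. C b)"], intro conjI ballI)
    fix f assume f: "f \<in> X"
    have Cf: "Cinf UNIV f" "!!b. Cinf UNIV (Dv b f)" using X f Cinf_Dv by blast+
    let ?T = "?S (Suc ?n) f"
    have 1: "?S ?n f <= ?T"
      by (intro sum_mono2 finite_basis_lists) (auto simp: basis_lists_def intro!: W Xi f)
    have 2: "?S ?n (Dv b f) <= ?T" if "b \<in> Basis" for b
    proof -
      have "?S ?n (Dv b f) = (\<Sum>ws\<in>(%ws. ws @ [b]) ` basis_lists ?n. W (iter_deriv ws f))"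
        by (subst sum.reindex) (auto simp: inj_on_def iter_deriv_snoc)
      also have "... <= ?T"
        using that by (intro sum_mono2 finite_basis_lists) (auto simp: basis_lists_def intro!: W Xi f)
      finally show ?thesis .
    qed
    have t: "(%x. Dv e a x * f (\<psi> x)) \<in> test_fun V" "!!b. (%x. ab b x * Dv b f (\<psi> x)) \<in> test_fun V"
      using test_fun_pullback[OF test_fun_Dv[OF snoc.prems(1)] V Cf(1)] test_fun_pullback[OF ab V Cf(2)] by auto
    have "iter_deriv (vs @ [e]) (%x. a x * f (\<psi> x)) =
        iter_deriv vs (%x. Dv e a x * f (\<psi> x) + (\<Sum>b\<in>Basis. ab b x * Dv b f (\<psi> x)))"
      unfolding iter_deriv_snoc Dv_pullback[OF snoc.prems(1) V Cf(1)] ab_def ..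
    also have "... = (%x. iter_deriv vs (%x. Dv e a x * f (\<psi> x)) x +
        (\<Sum>b\<in>Basis. iter_deriv vs (%x. ab b x * Dv b f (\<psi> x)) x))"
    proof -
      have ts: "Cinf UNIV (%x. \<Sum>b\<in>Basis. ab b x * Dv b f (\<psi> x))"
        by (rule test_fun_Cinf[OF test_fun_sum]) (rule t(2))
      have "iter_deriv vs (%x. \<Sum>b\<in>Basis. ab b x * Dv b f (\<psi> x)) =
          (%x. \<Sum>b\<in>Basis. iter_deriv vs (%x. ab b x * Dv b f (\<psi> x)) x)"
        by (rule iter_deriv_sum) (rule test_fun_Cinf[OF t(2)])
      then show ?thesis by (simp only: iter_deriv_add[OF test_fun_Cinf[OF t(1)] ts])
    qed
    finally have "\<nu> (iter_deriv (vs @ [e]) (%x. a x * f (\<psi> x))) <=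
       \<nu> (iter_deriv vs (%x. Dv e a x * f (\<psi> x))) + \<nu> (%x. \<Sum>b\<in>Basis. iter_deriv vs (%x. ab b x * Dv b f (\<psi> x)) x)"
      using \<nu>(2) t by (simp add: test_fun_iter_deriv test_fun_sum)
    also have "... <= C0 * ?S ?n f + (\<Sum>b\<in>Basis. C b * ?S ?n (Dv b f))"
      using C0(2)[OF f] C(2)[OF X(2)[OF f]] t
      by (intro add_mono order_trans[OF \<nu>sum] sum_mono) (auto intro: test_fun_iter_deriv)
    also have "... <= C0 * ?T + (\<Sum>b\<in>Basis. C b * ?T)"
      using C0 C 1 2 by (intro add_mono mult_left_mono sum_mono) auto
    finally show "\<nu> (iter_deriv (vs @ [e]) (%x. a x * f (\<psi> x))) <=
        (C0 + (\<Sum>b\<in>Basis. C b)) * ?S (length (vs @ [e])) f"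
      by (simp add: distrib_right sum_distrib_right)
  qed (use C0 C in \<open>auto intro!: add_nonneg_nonneg sum_nonneg\<close>)
qed

text \<open>The weight costs only a constant because \<open>a\<close> has compact support, and
  \<open>f\<close> enters through unweighted suprema of its derivatives, so nothing depends on
  \<open>\<psi>\<close> outside \<open>V\<close>.\<close>

lemma scont_pullback:
  fixes \<psi> :: "'a::euclidean_space => 'b::euclidean_space"
  assumes "open V" "Cinf V \<psi>" "a \<in> test_fun V"
  shows "scont (%f x. a x * f (\<psi> x))"
proof (rule scontI)
  show "Cinf UNIV (%x. a x * f (\<psi> x))" if "f \<in> schwartz" for f
    using test_fun_pullback[OF assms(3,1,2) schwartz_Cinf[OF that]] test_fun_Cinf by blast
  fix N vs assume vs: "set vs \<subseteq> (Basis :: 'a set)"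
  let ?\<nu> = "%h::'a => complex. SUP x. jb x ^ N * norm (h x)"
  have bdd: "bdd_above (range (%x. jb x ^ N * norm (h x)))" if "h \<in> test_fun V" for h
    using schwartz_iff[of h] test_fun_schwartz[OF that] unfolding bdd_above_def
    by (metis (no_types, lifting) empty_subsetI imageE iter_deriv.simps(1) list.set(1))
  have "\<exists>C\<ge>0. \<forall>f\<in>schwartz. ?\<nu> (iter_deriv vs (%x. a x * f (\<psi> x))) <=
    C * (\<Sum>ws\<in>basis_lists (length vs). schwartz_norm 0 (iter_deriv ws f))"
  proof (rule pullback_deriv_bound[where \<nu>="?\<nu>" and V=V and X=schwartz])
    show "?\<nu> (%x. f x + g x) <= ?\<nu> f + ?\<nu> g" if "f \<in> test_fun V" "g \<in> test_fun V" for f g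
    proof (rule cSUP_least)
      fix x
      have "jb x ^ N * norm (f x + g x) <= jb x ^ N * norm (f x) + jb x ^ N * norm (g x)"
        by (simp add: distrib_left[symmetric] mult_left_mono norm_triangle_ineq)
      also have "... <= ?\<nu> f + ?\<nu> g"
        using that by (intro add_mono cSUP_upper bdd) auto
      finally show "jb x ^ N * norm (f x + g x) <= ?\<nu> f + ?\<nu> g" .
    qed simp
    fix a :: "'a => complex" assume a: "a \<in> test_fun V"
    then obtain K where K: "compact K" "!!x. x \<notin> K ==> a x = 0" by (rule test_funE) blast
    obtain C where C: "C >= 1" "!!x N. x \<in> K ==> jb x ^ N <= C ^ N"
      using test_fun_weight_bounded[OF K(1)] by metis
    obtain D where D: "D >= 0" "!!x. norm (a x) <= D" using test_fun_bounded[OF a] by metis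
    have "?\<nu> (%x. a x * f (\<psi> x)) <= (C ^ N * D) * schwartz_norm 0 f" if f: "f \<in> schwartz" for f
    proof (rule cSUP_least)
      fix x
      show "jb x ^ N * norm (a x * f (\<psi> x)) <= (C ^ N * D) * schwartz_norm 0 f"
        using K(2)[of x] C(2)[of x N] D C(1) schwartz_norm_nonneg[OF f] schwartz_norm_ge0[OF f, of "\<psi> x" 0]
        by (cases "x \<in> K") (auto intro!: mult_mono simp: norm_mult mult.assoc)
    qed simp
    then show "\<exists>C\<ge>0. \<forall>f\<in>schwartz. ?\<nu> (%x. a x * f (\<psi> x)) <= C * schwartz_norm 0 f"
      using C D by (intro exI[of _ "C ^ N * D"]) auto
  qed (use assms vs in \<open>auto intro: schwartz_Cinf schwartz_Dv schwartz_norm_nonneg\<close>)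
  then obtain C where C: "C >= 0" "!!f. f \<in> schwartz ==> ?\<nu> (iter_deriv vs (%x. a x * f (\<psi> x))) <=
    C * (\<Sum>ws\<in>basis_lists (length vs). schwartz_norm 0 (iter_deriv ws f))" by blast
  let ?\<Phi> = "%f. C * (\<Sum>ws\<in>basis_lists (length vs). schwartz_norm 0 (iter_deriv ws f :: 'b => complex))"
  have "sb ?\<Phi>"
    using C by (intro sb_cmult sb_sum sb_compose[OF sb_norm scont_iter_deriv]) (auto simp: basis_lists_def)
  moreover have "jb x ^ N * norm (iter_deriv vs (%x. a x * f (\<psi> x)) x) <= ?\<Phi> f" if "f \<in> schwartz" for f x
    by (rule order_trans[OF cSUP_upper[OF UNIV_I bdd] C(2)[OF that]])
       (intro test_fun_iter_deriv test_fun_pullback assms schwartz_Cinf that)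
  ultimately show "\<exists>\<Phi>. sb \<Phi> \<and> (\<forall>f\<in>schwartz. \<forall>x. jb x ^ N *
      norm (iter_deriv vs (%x. a x * f (\<psi> x)) x) <= \<Phi> f)" by blast
qed

text \<open>Dilations, reflections and translations are all obtained from this one formula.\<close>

lemma iter_deriv_affine:
  fixes f :: "'a::euclidean_space => 'b::real_normed_vector"
  assumes "Cinf UNIV f"
  shows "iter_deriv vs (%x. f (c *\<^sub>R x + y)) = (%x. c ^ length vs *\<^sub>R iter_deriv vs f (c *\<^sub>R x + y))"
proof (induction vs)
  case (Cons v vs)
  let ?g = "iter_deriv vs f"
  have "((%x. c ^ length vs *\<^sub>R ?g (c *\<^sub>R x + y)) has_derivative
      (%v. c ^ length vs *\<^sub>R Dv (c *\<^sub>R v) ?g (c *\<^sub>R x + y))) (at x)" for x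
    by (intro has_derivative_scaleR_right has_derivative_compose[of "%x. c *\<^sub>R x + y" _ x UNIV ?g]
        Cinf_has_derivative[OF Cinf_iter_deriv[OF assms]]) (auto intro!: derivative_eq_intros)
  then have "Dv v (%x. c ^ length vs *\<^sub>R ?g (c *\<^sub>R x + y)) x = c ^ length vs *\<^sub>R Dv (c *\<^sub>R v) ?g (c *\<^sub>R x + y)" for x
    by (rule Dv_eq)
  then show ?case unfolding iter_deriv.simps Cons.IH
    using linear_scale[OF Dv_linear[OF Cinf_differentiable[OF Cinf_iter_deriv[OF assms] UNIV_I]]]
    by (simp add: mult.commute)
qed simp

lemma Cinf_affine:
  fixes f :: "'a::euclidean_space => 'b::real_normed_vector"
  shows "Cinf UNIV f ==> Cinf UNIV (%x. f (c *\<^sub>R x + y))"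
  by (rule Cinf_compose[of UNIV UNIV]) (auto intro!: Cinf_add Cinf_scaleR)

lemma test_fun_dilation:
  assumes "f \<in> test_fun UNIV" "c ~= 0" shows "(%x. f (c *\<^sub>R x)) \<in> test_fun UNIV"
proof -
  from assms obtain K where K: "compact K" "!!x. x \<notin> K ==> f x = 0" "Cinf UNIV f"
    by (elim test_funE) blast
  show ?thesis
  proof (rule test_funI[of _ "(%x. inverse c *\<^sub>R x) ` K"])
    show "compact ((*\<^sub>R) (inverse c) ` K)" using K(1) by (rule compact_scaling)
    show "f (c *\<^sub>R x) = 0" if "x \<notin> (*\<^sub>R) (inverse c) ` K" for x
      using K(2)[of "c *\<^sub>R x"] that assms(2) by force
  qed (use Cinf_affine[OF K(3), of c 0] in auto)
qed

section \<open>Integrals of rapidly decreasing functions\<close>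

text \<open>Keeps the exponent \<open>DIM('a) + 2\<close> from being rewritten into successors, so
  that the integrable weight stays recognisable.\<close>

declare add_2_eq_Suc' [simp del]

lemma one_plus_norm_pos [simp]: "0 < 1 + norm x" "1 + norm x ~= 0" "0 <= 1 + norm x"
  by (auto simp: add_pos_nonneg) (metis norm_ge_zero add_pos_nonneg less_irrefl zero_less_one)

text \<open>With n the integer part of |x|, the weight is at most (1 + n)^-(D + 2) on a ball of
  radius n + 1, whose volume is a constant times (n + 1)^D. The remaining series is that of the
  inverse squares, which explains the 2 in the exponent.\<close>

lemma integrable_weight:
  "integrable lborel (%x::'a::euclidean_space. 1 / jb x ^ (DIM('a) + 2))"
proof (rule integrableI_bounded)
  let ?D = "DIM('a)" and ?V = "unit_ball_vol (real DIM('a))"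
  let ?t = "%n::nat. ennreal (1 / (1 + real n) ^ (?D + 2))"
  have V: "?V >= 0" by simp
  have "(\<integral>\<^sup>+x. ennreal (norm (1 / jb (x::'a) ^ (?D + 2))) \<partial>lborel)
     <= (\<integral>\<^sup>+x. (\<Sum>n. ?t n * indicator (cball (0::'a) (real n + 1)) x) \<partial>lborel)"
  proof (rule nn_integral_mono)
    fix x :: 'a
    define n where "n = nat \<lfloor>norm x\<rfloor>"
    have n: "real n <= norm x" "norm x <= real n + 1" 
    proof -
      have "real n = of_int \<lfloor>norm x\<rfloor>" by (simp add: n_def)
      then show "real n <= norm x" "norm x <= real n + 1" by linarith+
    qed
    have "ennreal (norm (1 / jb x ^ (?D + 2))) <= ?t n * indicator (cball (0::'a) (real n + 1)) x"
    proof -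
      have "1 / jb x ^ (?D + 2) <= 1 / (1 + real n) ^ (?D + 2)"
        using n by (intro divide_left_mono power_mono mult_pos_pos zero_less_power) auto
      then show ?thesis using n by (auto intro!: ennreal_leI simp del: power_Suc)
    qed
    also have "... <= (\<Sum>n. ?t n * indicator (cball (0::'a) (real n + 1)) x)"
    proof -
      define g where "g n = ?t n * indicator (cball (0::'a) (real n + 1)) x" for n
      have "g n <= suminf g" using sum_le_suminf[of g "{n}"] by simp
      then show ?thesis unfolding g_def .
    qed
    finally show "ennreal (norm (1 / jb x ^ (?D + 2))) <=
        (\<Sum>n. ?t n * indicator (cball (0::'a) (real n + 1)) x)" .
  qed
  also have "... = (\<Sum>n. ?t n * emeasure lborel (cball (0::'a) (real n + 1)))"
    by (subst nn_integral_suminf)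
       (auto simp: nn_integral_cmult_indicator simp del: power_Suc
         intro!: borel_measurable_times_ennreal borel_measurable_indicator suminf_cong)
  also have "... = (\<Sum>n. ennreal (?V * inverse (real (Suc n) ^ 2)))"
  proof (rule suminf_cong)
    fix n :: nat
    have "?t n * emeasure lborel (cball (0::'a) (real n + 1)) =
        ennreal (1 / (1 + real n) ^ (?D + 2) * (?V * (real n + 1) ^ ?D))"
      by (subst emeasure_cball) (auto simp: ennreal_mult'[symmetric])
    also have "1 / (1 + real n) ^ (?D + 2) * (?V * (real n + 1) ^ ?D) = ?V * inverse (real (Suc n) ^ 2)"
      by (simp add: power_add add.commute[of 1] inverse_eq_divide)
    finally show "?t n * emeasure lborel (cball (0::'a) (real n + 1)) = ennreal (?V * inverse (real (Suc n) ^ 2))" .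
  qed
  also have "... = ennreal (\<Sum>n. ?V * inverse (real (Suc n) ^ 2))"
  proof (rule suminf_ennreal_eq[OF _ summable_sums])
    have "summable (%n. inverse (real n ^ 2))"
      using inverse_power_summable[of 2, where 'a=real] by simp
    then have "summable (%n. inverse (real (Suc n) ^ 2))"
      using summable_Suc_iff[of "%n. inverse (real n ^ 2)"] by simp
    then show "summable (%n. ?V * inverse (real (Suc n) ^ 2))" by (rule summable_mult)
  qed (use V in auto)
  finally show "(\<integral>\<^sup>+x. ennreal (norm (1 / jb (x::'a) ^ (?D + 2))) \<partial>lborel) < \<infinity>"
    by (simp add: order_le_less_trans)
qed simp

definition wint :: "'a::euclidean_space itself => real" where
  "wint _ = (LBINT x. 1 / jb (x::'a) ^ (DIM('a) + 2))"

lemma wint_nonneg: "0 <= wint TYPE('a::euclidean_space)"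
  unfolding wint_def by (intro integral_nonneg_AE) simp

lemma integrable_rapid:
  fixes f :: "'a::euclidean_space => 'b::{banach, second_countable_topology}"
  assumes [measurable]: "f \<in> borel_measurable lborel"
    and le: "!!x. jb x ^ (DIM('a) + 2) * norm (f x) <= C"
  shows "integrable lborel f" "(LBINT x. norm (f x)) <= C * wint TYPE('a)"
proof -
  have le': "norm (f x) <= C * (1 / jb x ^ (DIM('a) + 2))" for x
  proof -
    have "0 < jb x ^ (DIM('a) + 2)" by (rule zero_less_power) simp
    with le[of x] show ?thesis
      by (simp only: times_divide_eq_right mult_1_right pos_le_divide_eq mult.commute)
  qed
  have i: "integrable lborel (%x::'a. C * (1 / jb x ^ (DIM('a) + 2)))"
    using integrable_weight by (rule integrable_mult_right)
  show f: "integrable lborel f"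
  proof (rule Bochner_Integration.integrable_bound[OF i])
    show "AE x in lborel. norm (f x) <= norm (C * (1 / jb x ^ (DIM('a) + 2)))"
      using le' by (intro AE_I2) (metis abs_ge_self order_trans real_norm_def)
  qed measurable
  have "(LBINT x. norm (f x)) <= (LBINT x. C * (1 / jb (x::'a) ^ (DIM('a) + 2)))"
    by (rule integral_mono[OF integrable_norm[OF f] i le'])
  then show "(LBINT x. norm (f x)) <= C * wint TYPE('a)"
    by (simp only: wint_def integral_mult_right_zero)
qed

lemma schwartz_measurable [measurable_dest]: "f \<in> schwartz ==> f \<in> borel_measurable borel"
  by (intro borel_measurable_continuous_onI Cinf_imp_continuous schwartz_Cinf)

lemma schwartz_continuous: "f \<in> schwartz ==> continuous_on UNIV f"
  by (intro Cinf_imp_continuous schwartz_Cinf)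

lemma schwartz_weight:
  fixes f :: "'a::euclidean_space => complex"
  assumes "f \<in> schwartz" "n <= N"
  shows "jb x ^ n * norm (f x) <= schwartz_norm N f"
  using schwartz_norm_ge[OF assms(1), of "[]" N n x] assms by simp

lemma schwartz_integrable: "f \<in> schwartz ==> integrable lborel f"
  by (rule integrable_rapid(1)[OF _ schwartz_weight[OF _ order_refl]]) auto

lemma schwartz_L1:
  fixes f :: "'a::euclidean_space => complex"
  assumes "f \<in> schwartz"
  shows "(LBINT x. norm (f x)) <= schwartz_norm (DIM('a) + 2) f * wint TYPE('a)"
  using assms by (intro integrable_rapid(2)[OF _ schwartz_weight[OF _ order_refl]]) auto

lemma one_plus_norm_add: "1 + norm (x + y) <= jb x * jb y"
proof -
  have "norm (x + y) <= norm x + norm y" by (rule norm_triangle_ineq)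
  moreover have "0 <= norm x * norm y" by simp
  moreover have "jb x * jb y = 1 + norm x + norm y + norm x * norm y"
    by (simp add: algebra_simps)
  ultimately show ?thesis by linarith
qed

lemma one_plus_norm_shift: "1 + norm x <= jb (x - y) * jb y"
  using one_plus_norm_add[of "x - y" y] by simp

text \<open>Dominated convergence for the Frechet difference quotient: by the mean value inequality
  both the increment and the linear term are bounded by \<open>h t\<close> times the
  displacement.\<close>

lemma has_derivative_integral:
  fixes F :: "'a::euclidean_space => 'm => 'b::{banach, second_countable_topology}"
  assumes e: "e > 0"
    and int: "!!x. x \<in> ball x0 e ==> integrable M (F x)"
    and D: "!!x t. x \<in> ball x0 e ==> t \<in> space M ==> ((%x. F x t) has_derivative F' x t) (at x)"
    and bd: "!!x t v. x \<in> ball x0 e ==> t \<in> space M ==> norm (F' x t v) <= h t * norm v"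
    and h: "integrable M h"
    and meas: "!!v. F' x0 \<in> space M \<rightarrow> UNIV ==> (%t. F' x0 t v) \<in> borel_measurable M"
  shows "((%x. \<integral>t. F x t \<partial>M) has_derivative (%v. \<integral>t. F' x0 t v \<partial>M)) (at x0)"
proof -
  have x0: "x0 \<in> ball x0 e" using e by simp
  have [measurable]: "(%t. F' x0 t v) \<in> borel_measurable M" for v using meas by auto
  have [measurable]: "F x \<in> borel_measurable M" if "x \<in> ball x0 e" for x
    using int[OF that] by auto
  have intF': "integrable M (%t. F' x0 t v)" for v
  proof (rule Bochner_Integration.integrable_bound)
    show "integrable M (%t. h t * norm v)" using h by simp
    show "AE t in M. norm (F' x0 t v) <= norm (h t * norm v)"
      by (intro AE_I2 order_trans[OF bd[OF x0]]) auto
  qed measurable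
  have lin: "linear (F' x0 t)" if "t \<in> space M" for t
    using D[OF x0 that] by (rule has_derivative_linear)
  have hb: "norm (F x t - F x0 t) <= h t * norm (x - x0)" if "x \<in> ball x0 e" "t \<in> space M" for x t
  proof (rule differentiable_bound[where f'="%x. F' x t"])
    fix y assume y: "y \<in> ball x0 e"
    show "((%x. F x t) has_derivative F' y t) (at y within ball x0 e)"
      using D[OF y that(2)] by (rule has_derivative_at_withinI)
    have "norm (F' y t v) <= h t * norm v" for v using bd[OF y that(2)] .
    then show "onorm (F' y t) <= h t"
      by (intro onorm_le)
  qed (use that x0 in auto)
  \<comment> \<open>Set to 0 outside the ball, so that the majorant \<open>2 * h t\<close> is valid
    for every \<open>x\<close> and not only eventually.\<close>
  define q where "q x t = (if x \<in> ball x0 e then (F x t - F x0 t - F' x0 t (x - x0)) /\<^sub>R norm (x - x0) else 0)" for x t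
  have q: "norm (q x t) <= 2 * h t" if "t \<in> space M" for x t
  proof (cases "x \<in> ball x0 e \<and> x ~= x0")
    case True
    have "norm (F x t - F x0 t - F' x0 t (x - x0)) <= h t * norm (x - x0) + h t * norm (x - x0)"
      using hb[of x t] bd[OF x0 that, of "x - x0"] True that
      by (auto intro!: order_trans[OF norm_triangle_ineq4[of "F x t - F x0 t"]] add_mono)
    moreover have "norm (q x t) = norm (F x t - F x0 t - F' x0 t (x - x0)) / norm (x - x0)"
      using True by (simp add: q_def divide_inverse mult.commute)
    ultimately show ?thesis using True by (simp add: divide_le_eq)
  next
    case False
    \<comment> \<open>Nonnegativity of \<open>h\<close> is read off the bound on \<open>F'\<close>
      at a basis vector, which has norm 1.\<close>
    have "0 <= h t" using order_trans[OF norm_ge_zero bd[OF x0 that, of "SOME b. b \<in> Basis"]]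
      by (simp add: some_in_eq)
    then show ?thesis using False by (auto simp: q_def)
  qed
  have qm[measurable]: "q x \<in> borel_measurable M" for x
    unfolding q_def by (cases "x \<in> ball x0 e") (use x0 in \<open>simp_all\<close>)
  have qt: "((%x. q x t) \<longlongrightarrow> 0) (at x0)" if t: "t \<in> space M" for t
  proof -
    have "((%x. (F x t - F x0 t - F' x0 t (x - x0)) /\<^sub>R norm (x - x0)) \<longlongrightarrow> 0) (at x0)"
      using D[OF x0 t] by (simp add: has_derivative_at_within)
    then show ?thesis
      by (rule Lim_transform_eventually) (use e in \<open>auto simp: eventually_at q_def dist_commute intro!: exI[of _ e]\<close>)
  qed
  have "((%x. \<integral>t. q x t \<partial>M) \<longlongrightarrow> 0) (at x0)"
    \<comment> \<open>Dominated convergence is a statement about sequences, so the limit at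
      \<open>x0\<close> is tested along sequences.\<close>
    unfolding tendsto_at_iff_sequentially comp_def
  proof (intro allI impI)
    fix X assume X: "\<forall>i. X i \<in> UNIV - {x0}" "X \<longlonglongrightarrow> x0"
    have "(%i. \<integral>t. q (X i) t \<partial>M) \<longlonglongrightarrow> (\<integral>t. 0 \<partial>M)"
    proof (rule integral_dominated_convergence[where w="%t. 2 * h t"])
      show "AE t in M. (%i. q (X i) t) \<longlonglongrightarrow> 0"
        using qt X by (intro AE_I2) (auto simp: tendsto_at_iff_sequentially comp_def)
    qed (use h q in auto)
    then show "(%i. \<integral>t. q (X i) t \<partial>M) \<longlonglongrightarrow> 0" by simp
  qed
  moreover have "\<forall>\<^sub>F x in at x0. (\<integral>t. q x t \<partial>M) =
      ((\<integral>t. F x t \<partial>M) - (\<integral>t. F x0 t \<partial>M) - (\<integral>t. F' x0 t (x - x0) \<partial>M)) /\<^sub>R norm (x - x0)"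
  proof -
    have "(\<integral>t. q x t \<partial>M) =
      ((\<integral>t. F x t \<partial>M) - (\<integral>t. F x0 t \<partial>M) - (\<integral>t. F' x0 t (x - x0) \<partial>M)) /\<^sub>R norm (x - x0)"
      if "x \<in> ball x0 e" for x
      using that int[OF that] int[OF x0] intF'[of "x - x0"]
      by (simp only: q_def if_True integral_scaleR_right Bochner_Integration.integral_diff
          Bochner_Integration.integrable_diff)
    then show ?thesis unfolding eventually_at using e
      by (intro exI[of _ e]) (simp add: dist_commute)
  qed
  ultimately have lim: "((%x. ((\<integral>t. F x t \<partial>M) - (\<integral>t. F x0 t \<partial>M) - (\<integral>t. F' x0 t (x - x0) \<partial>M)) /\<^sub>R norm (x - x0)) \<longlongrightarrow> 0) (at x0)"
    by (rule Lim_transform_eventually)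
  have "bounded_linear (%v. \<integral>t. F' x0 t v \<partial>M)"
  proof (rule bounded_linear_intro)
    show "(\<integral>t. F' x0 t (v + w) \<partial>M) = (\<integral>t. F' x0 t v \<partial>M) + (\<integral>t. F' x0 t w \<partial>M)" for v w
      by (subst Bochner_Integration.integral_add[symmetric, OF intF' intF'])
         (intro integral_cong_refl linear_add lin)
    show "(\<integral>t. F' x0 t (r *\<^sub>R v) \<partial>M) = r *\<^sub>R (\<integral>t. F' x0 t v \<partial>M)" for r v
      by (subst integral_scaleR_right[symmetric])
         (intro integral_cong_refl linear_scale lin)
    show "norm (\<integral>t. F' x0 t v \<partial>M) <= norm v * (\<integral>t. h t \<partial>M)" for v
    proof -
      have "norm (\<integral>t. F' x0 t v \<partial>M) <= (\<integral>t. norm (F' x0 t v) \<partial>M)" by (rule integral_norm_bound)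
      also have "... <= (\<integral>t. h t * norm v \<partial>M)"
        using intF' h bd[OF x0] by (intro integral_mono) auto
      finally show ?thesis using h by (simp add: mult.commute)
    qed
  qed
  with lim show ?thesis by (simp add: has_derivative_at_within)
qed

section \<open>Invariance of the Lebesgue integral under shifts and dilations\<close>

lemma lborel_integral_shift:
  fixes f :: "'a::euclidean_space => 'b::{banach, second_countable_topology}"
  assumes "f \<in> borel_measurable borel"
  shows "(LBINT x. f (x + c)) = (LBINT x. f x)"
proof -
  have "(LBINT x. f x) = (LINT x|distr lborel borel ((+) c). f x)" by (simp only: lborel_distr_plus)
  also have "... = (LBINT x. f (c + x))" using assms by (intro integral_distr) auto
  finally show ?thesis by (simp add: add.commute)
qed

lemma lborel_integrable_shift:
  fixes f :: "'a::euclidean_space => 'b::{banach, second_countable_topology}"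
  assumes "integrable lborel f"
  shows "integrable lborel (%x. f (x + c))"
proof -
  have "integrable (distr lborel borel ((+) c)) f" using assms by (simp only: lborel_distr_plus)
  then show ?thesis using assms by (subst (asm) integrable_distr_eq) (auto simp: add.commute)
qed

lemma lborel_integral_scale:
  fixes f :: "'a::euclidean_space => 'b::{banach, second_countable_topology}"
  assumes [measurable]: "f \<in> borel_measurable borel" and c: "c ~= 0"
  shows "(LBINT x. f x) = \<bar>c\<bar> ^ DIM('a) *\<^sub>R (LBINT x. f (c *\<^sub>R x))"
proof -
  have "(LBINT x. f x) = (LINT x|density (distr lborel borel (%x. 0 + c *\<^sub>R x)) (%_. ennreal (\<bar>c\<bar> ^ DIM('a))). f x)"
    using lborel_affine[OF c, of "0::'a"] by simp
  also have "... = (LINT x|distr lborel borel (%x. 0 + c *\<^sub>R x). \<bar>c\<bar> ^ DIM('a) *\<^sub>R f x)"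
    by (rule integral_density) auto
  also have "... = (LBINT x. \<bar>c\<bar> ^ DIM('a) *\<^sub>R f (0 + c *\<^sub>R x))"
    by (rule integral_distr) auto
  finally show ?thesis by simp
qed

lemma lborel_integrable_scale:
  fixes f :: "'a::euclidean_space => 'b::{banach, second_countable_topology}"
  assumes f: "integrable lborel f" and c: "c ~= 0"
  shows "integrable lborel (%x. f (c *\<^sub>R x))"
proof -
  have [measurable]: "f \<in> borel_measurable borel" using f by auto
  have "integrable (density (distr lborel borel (%x. 0 + c *\<^sub>R x)) (%_. ennreal (\<bar>c\<bar> ^ DIM('a)))) f"
    using f lborel_affine[OF c, of "0::'a"] by simp
  then have "integrable (distr lborel borel (%x. 0 + c *\<^sub>R x)) (%x. \<bar>c\<bar> ^ DIM('a) *\<^sub>R f x)"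
    by (subst (asm) integrable_density) auto
  then have "integrable lborel (%x. \<bar>c\<bar> ^ DIM('a) *\<^sub>R f (c *\<^sub>R x))"
    by (subst (asm) integrable_distr_eq) auto
  then have "integrable lborel (%x. inverse (\<bar>c\<bar> ^ DIM('a)) *\<^sub>R (\<bar>c\<bar> ^ DIM('a) *\<^sub>R f (c *\<^sub>R x)))"
    by (rule integrable_scaleR_right)
  then show ?thesis using c by simp
qed

lemma lborel_integral_reflect:
  fixes f :: "'a::euclidean_space => 'b::{banach, second_countable_topology}"
  assumes "f \<in> borel_measurable borel"
  shows "(LBINT x. f (- x)) = (LBINT x. f x)"
  using lborel_integral_scale[OF assms, of "-1"] by simp

text \<open>The integral of the translate x -> f (x + \<tau> v) does not depend on \<tau>;
  differentiating it under the integral sign at \<tau> = 0 gives the integral of the derivative.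
  This replaces integration by parts in one coordinate.\<close>

lemma integral_Dv_schwartz:
  fixes f :: "'a::euclidean_space => complex"
  assumes f: "f \<in> schwartz" and v: "v \<in> Basis"
  shows "(LBINT x. Dv v f x) = 0"
proof -
  let ?k = "DIM('a) + 2"
  have df: "Dv v f \<in> schwartz" using schwartz_Dv[OF v f] .
  \<comment> \<open>For |\<tau>| < 1 the shift has length less than 1, so \<open>jb\<close> changes
    by a factor of at most 2; this is the origin of \<open>2 ^ ?k\<close>.\<close>
  define h where "h x = schwartz_norm ?k (Dv v f) * 2 ^ ?k * (1 / jb x ^ ?k)" for x :: 'a
  have h: "integrable lborel h" unfolding h_def by (rule integrable_mult_right[OF integrable_weight])
  have "((%\<tau>::real. LBINT x. f (x + \<tau> *\<^sub>R v)) has_derivative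
      (%w. LBINT x. w *\<^sub>R Dv v f (x + 0 *\<^sub>R v))) (at 0)"
  proof (rule has_derivative_integral[where e=1 and h=h and F'="%\<tau> x w. w *\<^sub>R Dv v f (x + \<tau> *\<^sub>R v)"])
    show "((%\<tau>. f (x + \<tau> *\<^sub>R v)) has_derivative (%w. w *\<^sub>R Dv v f (x + \<tau> *\<^sub>R v))) (at \<tau>)" for x \<tau>
    proof -
      have "((%\<tau>. f (x + \<tau> *\<^sub>R v)) has_derivative (%w. Dv (w *\<^sub>R v) f (x + \<tau> *\<^sub>R v))) (at \<tau>)"
        by (rule has_derivative_compose[of "%\<tau>. x + \<tau> *\<^sub>R v" _ \<tau> UNIV f])
          (auto intro!: derivative_eq_intros Cinf_has_derivative[OF schwartz_Cinf[OF f]])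
      then show ?thesis
        using linear_scale[OF Dv_linear[OF Cinf_differentiable[OF schwartz_Cinf[OF f] UNIV_I]]] by simp
    qed
    show "norm (w *\<^sub>R Dv v f (x + \<tau> *\<^sub>R v)) <= h x * norm w" if "\<tau> \<in> ball 0 1" for \<tau> x w
    proof -
      have "1 + norm x <= jb (x + \<tau> *\<^sub>R v) * jb (\<tau> *\<^sub>R v)"
        using one_plus_norm_add[of "x + \<tau> *\<^sub>R v" "- \<tau> *\<^sub>R v"] by simp
      also have "... <= jb (x + \<tau> *\<^sub>R v) * 2"
        using that v by (intro mult_left_mono) auto
      finally have "jb x ^ ?k <= (jb (x + \<tau> *\<^sub>R v) * 2) ^ ?k"
        by (intro power_mono) auto
      then have "jb x ^ ?k * norm (Dv v f (x + \<tau> *\<^sub>R v)) <=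
         (jb (x + \<tau> *\<^sub>R v) ^ ?k * 2 ^ ?k) * norm (Dv v f (x + \<tau> *\<^sub>R v))"
        by (intro mult_right_mono) (auto simp only: power_mult_distrib norm_ge_zero)
      also have "... = (jb (x + \<tau> *\<^sub>R v) ^ ?k * norm (Dv v f (x + \<tau> *\<^sub>R v))) * 2 ^ ?k"
        by (simp only: ac_simps)
      also have "... <= schwartz_norm ?k (Dv v f) * 2 ^ ?k"
        by (intro mult_right_mono schwartz_weight[OF df order_refl]) simp
      finally have "norm (Dv v f (x + \<tau> *\<^sub>R v)) <= h x"
        unfolding h_def times_divide_eq_right mult_1_right
        by (subst pos_le_divide_eq) (auto simp only: mult.commute zero_less_power one_plus_norm_pos)
      then show ?thesis by (simp add: mult.commute mult_left_mono)
    qed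
    show "integrable lborel (%x. f (x + \<tau> *\<^sub>R v))" for \<tau>
      by (rule lborel_integrable_shift[OF schwartz_integrable[OF f]])
    show "(%t. w *\<^sub>R Dv v f (t + 0 *\<^sub>R v)) \<in> borel_measurable lborel" for w
      using schwartz_measurable[OF df] by simp
  qed (use h in auto)
  moreover have "(LBINT x. f (x + \<tau> *\<^sub>R v)) = (LBINT x. f x)" for \<tau> :: real
    using schwartz_measurable[OF f] by (rule lborel_integral_shift)
  ultimately have "((%\<tau>::real. LBINT x. f x) has_derivative (%w. w *\<^sub>R (LBINT x. Dv v f x))) (at 0)"
    by simp
  from has_derivative_unique[OF this has_derivative_const]
  show ?thesis by (metis scaleR_one)
qed

section \<open>The Fourier transform of Schwartz functions\<close>

lemma fubini_bound:
  fixes k :: "'a::euclidean_space => 'b::euclidean_space => complex"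
  assumes meas[measurable]: "case_prod k \<in> borel_measurable (borel \<Otimes>\<^sub>M borel)"
    and le: "!!x y. norm (k x y) <= A x * B y"
    and A: "integrable lborel A" and B: "integrable lborel B"
  shows "(LBINT x. LBINT y. k x y) = (LBINT y. LBINT x. k x y)"
    "integrable lborel (%x. LBINT y. k x y)"
proof -
  have [measurable]: "A \<in> borel_measurable borel" "B \<in> borel_measurable borel" using A B by auto
  have m[measurable]: "case_prod k \<in> borel_measurable (lborel \<Otimes>\<^sub>M lborel)"
    using meas by (simp add: measurable_lborel2 cong: measurable_cong_sets)
  have AB: "integrable (lborel \<Otimes>\<^sub>M lborel) (%(x, y). A x * B y)"
  proof (rule lborel_pair.Fubini_integrable)
    show "integrable lborel (%x. LBINT y. norm (case (x, y) of (x, y) => A x * B y))"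
      using A by (simp add: abs_mult)
    show "AE x in lborel. integrable lborel (%y. case (x, y) of (x, y) => A x * B y)" using B by simp
  qed measurable
  have i: "integrable (lborel \<Otimes>\<^sub>M lborel) (case_prod k)"
    by (rule Bochner_Integration.integrable_bound[OF AB m])
       (auto intro!: AE_I2 order_trans[OF le])
  show "(LBINT x. LBINT y. k x y) = (LBINT y. LBINT x. k x y)"
    using lborel_pair.Fubini_integral[OF i] by simp
  show "integrable lborel (%x. LBINT y. k x y)"
    using lborel_pair.integrable_fst'[OF i] by simp
qed

abbreviation fc :: "'d::finite itself => complex" where
  "fc _ == complex_of_real ((2 * pi) powr (- real CARD('d) / 2))"

text \<open>Both transforms in the unitary normalisation: \<sigma> = -1 is
  \<open>fourier_fun\<close> and \<sigma> = 1 is \<open>inv_fourier_fun\<close>. The sign is a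
  parameter so that each property is proved once.\<close>

definition FT :: "real => (real ^ 'd => complex) => real ^ 'd => complex" where
  "FT \<sigma> f \<xi> = fc TYPE('d) * (LBINT x. cis (\<sigma> * (x \<bullet> \<xi>)) * f x)"

lemma fourier_fun_eq: "fourier_fun f = FT (- 1) f"
  by (simp add: fun_eq_iff fourier_fun_def FT_def)

lemma inv_fourier_fun_eq: "inv_fourier_fun f = FT 1 f"
  by (simp add: fun_eq_iff inv_fourier_fun_def FT_def inner_commute)

lemma FT_uminus: "FT (- \<sigma>) f \<xi> = FT \<sigma> f (- \<xi>)"
  by (simp add: FT_def)

lemma cis_measurable [measurable]: "cis \<in> borel_measurable borel"
  by (intro borel_measurable_continuous_onI continuous_intros)

lemma schwartz_coord: "f \<in> schwartz ==> (%x. c * complex_of_real (x \<bullet> v) * f x) \<in> schwartz"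
proof (rule schwartz_mult)
  have "bounded_linear (%x. c * complex_of_real (x \<bullet> v))"
    by (intro bounded_linear_const_mult bounded_linear_compose[OF bounded_linear_of_real] bounded_linear_inner_left)
  then show "pgrow (%x. c * complex_of_real (x \<bullet> v))" by (rule pgrow_bounded_linear)
qed

lemma pgrow_coord: "pgrow (%x. c * complex_of_real (x \<bullet> v))"
  by (intro pgrow_bounded_linear bounded_linear_const_mult bounded_linear_compose[OF bounded_linear_of_real] bounded_linear_inner_left)

lemma cis_schwartz_integrable: "f \<in> schwartz ==> integrable lborel (%x. cis (\<sigma> * (x \<bullet> \<xi>)) * f x)"
  by (rule Bochner_Integration.integrable_bound[OF schwartz_integrable[of f]])
     (auto simp: norm_mult)

lemma FT_has_derivative:
  fixes f :: "real ^ 'd => complex"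
  assumes f: "f \<in> schwartz"
  shows "(FT \<sigma> f has_derivative (%v. FT \<sigma> (%x. (\<i> * \<sigma>) * complex_of_real (x \<bullet> v) * f x) \<xi>)) (at \<xi>)"
proof -
  have "((%\<xi>. LBINT x. cis (\<sigma> * (x \<bullet> \<xi>)) * f x) has_derivative
     (%v. LBINT x. cis (\<sigma> * (x \<bullet> \<xi>)) * ((\<i> * \<sigma>) * complex_of_real (x \<bullet> v) * f x))) (at \<xi>)"
  proof (rule has_derivative_integral[where e=1 and h="%x. \<bar>\<sigma>\<bar> * (norm x * norm (f x))" and
        F'="%\<xi> x v. cis (\<sigma> * (x \<bullet> \<xi>)) * ((\<i> * \<sigma>) * complex_of_real (x \<bullet> v) * f x)"])
    show "((%\<xi>. cis (\<sigma> * (x \<bullet> \<xi>)) * f x) has_derivative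
        (%v. cis (\<sigma> * (x \<bullet> \<xi>)) * ((\<i> * \<sigma>) * complex_of_real (x \<bullet> v) * f x))) (at \<xi>)" for x \<xi>
      by (auto intro!: derivative_eq_intros simp: scaleR_conv_of_real algebra_simps)
    show "integrable lborel (%x. \<bar>\<sigma>\<bar> * (norm x * norm (f x)))"
    proof (intro integrable_mult_right integrable_rapid)
      show "jb x ^ (DIM(real^'d) + 2) * norm (norm x * norm (f x)) <= schwartz_norm (DIM(real^'d) + 3) f" for x
      proof -
        have "jb x ^ (DIM(real^'d) + 2) * (norm x * norm (f x)) <=
            jb x ^ (DIM(real^'d) + 2) * (jb x * norm (f x))"
          by (intro mult_left_mono mult_right_mono) auto
        also have "... = jb x ^ (DIM(real^'d) + 3) * norm (f x)"
          by (simp add: eval_nat_numeral)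
        also have "... <= schwartz_norm (DIM(real^'d) + 3) f" by (rule schwartz_weight[OF f order_refl])
        finally show ?thesis by simp
      qed
    qed (use schwartz_measurable[OF f] in simp)
    show "norm (cis (\<sigma> * (x \<bullet> \<xi>)) * ((\<i> * \<sigma>) * complex_of_real (x \<bullet> v) * f x)) <= \<bar>\<sigma>\<bar> * (norm x * norm (f x)) * norm v" for x \<xi> v
      using mult_right_mono[OF Cauchy_Schwarz_ineq2[of x v], of "\<bar>\<sigma>\<bar> * norm (f x)"]
      by (simp add: norm_mult mult_ac)
  qed (use f schwartz_measurable[OF f] in \<open>auto intro: cis_schwartz_integrable\<close>)
  from has_derivative_mult_right[OF this, of "fc TYPE('d)"] show ?thesis
    by (simp add: FT_def[abs_def])
qed

lemma Dv_FT:
  assumes "f \<in> schwartz"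
  shows "Dv v (FT \<sigma> f) = FT \<sigma> (%x. (\<i> * \<sigma>) * complex_of_real (x \<bullet> v) * f x)"
  using Dv_eq[OF FT_has_derivative[OF assms]] by auto

lemma Cinf_FT: "f \<in> schwartz ==> Cinf UNIV (FT \<sigma> f)"
  unfolding Cinf_def
proof
  fix k assume "f \<in> schwartz" then show "Ck_on k UNIV (FT \<sigma> f)"
  proof (induction k arbitrary: f)
    case 0
    then show ?case
      by (auto intro!: continuous_at_imp_continuous_on has_derivative_continuous[OF FT_has_derivative])
  next
    case (Suc k)
    show ?case using FT_has_derivative[OF Suc.prems]
      by (auto simp: Dv_FT[OF Suc.prems] differentiable_def intro!: Suc.IH schwartz_coord Suc.prems)
  qed
qed

text \<open>Integration by parts against the character. The product of character and
  \<open>f\<close> is a Schwartz function because the derivatives of the character are multiples of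
  itself, so it belongs to \<open>pgrow\<close>; the derivative of the product then has integral
  0.\<close>

lemma FT_Dv:
  fixes f :: "real ^ 'd => complex"
  assumes f: "f \<in> schwartz" and v: "v \<in> Basis"
  shows "FT \<sigma> (Dv v f) \<xi> = - (\<i> * \<sigma>) * complex_of_real (\<xi> \<bullet> v) * FT \<sigma> f \<xi>"
proof -
  let ?e = "%x. cis (\<sigma> * (x \<bullet> \<xi>))"
  have de: "(?e has_derivative (%v. (\<i> * \<sigma>) * complex_of_real (v \<bullet> \<xi>) * ?e x)) (at x)" for x
    by (auto intro!: derivative_eq_intros simp: scaleR_conv_of_real algebra_simps)
  have De: "Dv w (%x. c * ?e x) = (%x. (c * ((\<i> * \<sigma>) * complex_of_real (w \<bullet> \<xi>))) * ?e x)" for w c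
    using Dv_eq[OF has_derivative_mult_right[OF de]] by (auto simp: mult_ac)
  have itd: "\<exists>c'. iter_deriv vs ?e = (%x. c' * ?e x)" for vs
  proof (induction vs)
    case Nil show ?case by (rule exI[of _ 1]) simp
  next
    case (Cons w vs) then show ?case using De by auto
  qed
  have "Ck_on k UNIV (%x. c * ?e x)" for k c
  proof (induction k arbitrary: c)
    case 0 show ?case by (auto intro!: continuous_intros)
  next
    case (Suc k)
    have "(%x. c * ?e x) differentiable (at x)" for x
      using has_derivative_mult_right[OF de] differentiable_def by blast
    then show ?case using Suc by (simp add: De)
  qed
  from this[of _ 1] have Ce: "Cinf UNIV ?e" by (simp add: Cinf_def)
  have "pgrow ?e" unfolding pgrow_def
  proof (intro conjI allI impI Ce)
    fix vs :: "(real ^ 'd) list"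
    obtain c where "iter_deriv vs ?e = (%x. c * ?e x)" using itd by blast
    then show "\<exists>C M. \<forall>x. norm (iter_deriv vs ?e x) <= C * jb x ^ M"
      by (intro exI[of _ "norm c"] exI[of _ "0::nat"]) (simp add: norm_mult)
  qed
  then have S: "(%x. ?e x * f x) \<in> schwartz" using f by (rule schwartz_mult)
  have "Dv v (%x. ?e x * f x) = (%x. ?e x * Dv v f x + ((\<i> * \<sigma>) * complex_of_real (v \<bullet> \<xi>)) * (?e x * f x))"
    using Dv_mult[OF Cinf_differentiable[OF Ce] Cinf_differentiable[OF schwartz_Cinf[OF f]], where v=v]
      Dv_eq[OF de, where v=v] by (auto simp: mult_ac)
  then have "(LBINT x. ?e x * Dv v f x + ((\<i> * \<sigma>) * complex_of_real (v \<bullet> \<xi>)) * (?e x * f x)) = 0"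
    using integral_Dv_schwartz[OF S v] by simp
  then have "(LBINT x. ?e x * Dv v f x) + ((\<i> * \<sigma>) * complex_of_real (v \<bullet> \<xi>)) * (LBINT x. ?e x * f x) = 0"
    by (subst (asm) Bochner_Integration.integral_add)
       (auto intro!: cis_schwartz_integrable schwartz_Dv f v)
  then have "(LBINT x. ?e x * Dv v f x) = - ((\<i> * \<sigma>) * complex_of_real (v \<bullet> \<xi>)) * (LBINT x. ?e x * f x)"
    by (simp add: eq_neg_iff_add_eq_0)
  then show ?thesis by (simp add: FT_def inner_commute)
qed

lemma norm_FT_le:
  fixes f :: "real ^ 'd => complex"
  assumes "f \<in> schwartz"
  shows "norm (FT \<sigma> f \<xi>) <= norm (fc TYPE('d)) * (schwartz_norm (DIM(real^'d) + 2) f * wint TYPE(real^'d))"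
proof -
  have "norm (LBINT x. cis (\<sigma> * (x \<bullet> \<xi>)) * f x) <= (LBINT x. norm (cis (\<sigma> * (x \<bullet> \<xi>)) * f x))"
    by (rule integral_norm_bound)
  also have "... = (LBINT x. norm (f x))" by (simp add: norm_mult)
  also have "... <= schwartz_norm (DIM(real^'d) + 2) f * wint TYPE(real^'d)" by (rule schwartz_L1[OF assms])
  finally show ?thesis unfolding FT_def norm_mult by (intro mult_left_mono) auto
qed

text \<open>One power of the weight is at most 1 plus the sum of the |\<xi>_b|, and multiplication
  by \<xi>_b on the transform side is, up to a factor of modulus 1, differentiation of
  \<open>f\<close> along b.\<close>

lemma FT_weight_bound:
  assumes "\<bar>\<sigma>\<bar> = 1"
  shows "\<exists>\<Phi>. sb \<Phi> \<and> (\<forall>f\<in>schwartz. \<forall>\<xi>. jb \<xi> ^ N * norm (FT \<sigma> f \<xi>) <= \<Phi> (f :: real ^ 'a => complex))"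
proof (induction N)
  case 0
  show ?case
  proof (intro exI conjI ballI allI)
    fix f :: "real ^ 'a => complex" and \<xi> assume "f \<in> schwartz"
    from norm_FT_le[OF this] show "jb \<xi> ^ 0 * norm (FT \<sigma> f \<xi>) <=
        norm (fc TYPE('a)) * wint TYPE(real^'a) * schwartz_norm (DIM(real^'a) + 2) f" by (simp add: mult_ac)
  qed (intro sb_cmult sb_norm, simp add: wint_nonneg)
next
  case (Suc N)
  then obtain \<Phi> where \<Phi>: "sb \<Phi>" "!!f \<xi>. f \<in> schwartz ==> jb \<xi> ^ N * norm (FT \<sigma> f \<xi> :: complex) <= \<Phi> (f :: real ^ 'a => complex)"
    by blast
  let ?\<Psi> = "%f. \<Phi> f + (\<Sum>b\<in>Basis. \<Phi> (Dv b f))"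
  have "sb ?\<Psi>" using \<Phi> by (intro sb_add sb_sum sb_compose[OF _ scont_Dv]) auto
  moreover have "jb \<xi> ^ Suc N * norm (FT \<sigma> f \<xi>) <= ?\<Psi> f" if f: "f \<in> schwartz" for f \<xi>
  proof -
    have "norm \<xi> <= (\<Sum>b\<in>Basis. \<bar>\<xi> \<bullet> b\<bar>)" by (rule norm_le_l1)
    then have "jb \<xi> * norm (FT \<sigma> f \<xi>) <= (1 + (\<Sum>b\<in>Basis. \<bar>\<xi> \<bullet> b\<bar>)) * norm (FT \<sigma> f \<xi>)"
      by (intro mult_right_mono) auto
    also have "... = norm (FT \<sigma> f \<xi>) + (\<Sum>b\<in>Basis. norm (FT \<sigma> (Dv b f) \<xi>))"
      using assms f by (simp add: distrib_right sum_distrib_right FT_Dv norm_mult)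
    finally have "jb \<xi> ^ N * (jb \<xi> * norm (FT \<sigma> f \<xi>)) <=
       jb \<xi> ^ N * (norm (FT \<sigma> f \<xi>) + (\<Sum>b\<in>Basis. norm (FT \<sigma> (Dv b f) \<xi>)))"
      by (intro mult_left_mono) auto
    also have "... = jb \<xi> ^ N * norm (FT \<sigma> f \<xi>) + (\<Sum>b\<in>Basis. jb \<xi> ^ N * norm (FT \<sigma> (Dv b f) \<xi>))"
      by (simp add: distrib_left sum_distrib_left)
    also have "... <= ?\<Psi> f"
      by (intro add_mono sum_mono \<Phi> f schwartz_Dv)
    finally show ?thesis by (simp add: mult_ac)
  qed
  ultimately show ?case by blast
qed

lemma iter_deriv_FT:
  assumes "set vs \<subseteq> Basis"
  shows "\<exists>A. scont A \<and> (\<forall>f\<in>schwartz. iter_deriv vs (FT \<sigma> f) = FT \<sigma> (A f))"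
  using assms
proof (induction vs)
  case Nil
  then show ?case using scont_id by (intro exI[of _ "%f. f"]) simp
next
  case (Cons v vs)
  then obtain A where A: "scont A" "!!f. f \<in> schwartz ==> iter_deriv vs (FT \<sigma> f) = FT \<sigma> (A f)" by auto
  let ?B = "%f x. (\<i> * \<sigma>) * complex_of_real (x \<bullet> v) * A f x"
  have "scont ?B" using scont_compose[OF scont_mult[OF pgrow_coord] A(1)] .
  moreover have "iter_deriv (v # vs) (FT \<sigma> f) = FT \<sigma> (?B f)" if "f \<in> schwartz" for f
    using A that by (simp add: Dv_FT scont_schwartz)
  ultimately show ?case by blast
qed

lemma scont_FT:
  assumes "\<bar>\<sigma>\<bar> = 1" shows "scont (FT \<sigma>)"
proof (rule scontI)
  fix N vs assume "set vs \<subseteq> (Basis :: (real ^ 'a) set)"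
  then obtain A where A: "scont A" "!!f. f \<in> schwartz ==> iter_deriv vs (FT \<sigma> f) = FT \<sigma> (A f :: real ^ 'a => complex)"
    using iter_deriv_FT by blast
  obtain \<Phi> where \<Phi>: "sb \<Phi>" "!!f \<xi>. f \<in> schwartz ==> jb \<xi> ^ N * norm (FT \<sigma> f \<xi> :: complex) <= \<Phi> (f :: real ^ 'a => complex)"
    using FT_weight_bound[OF assms] by blast
  show "\<exists>\<Phi>. sb \<Phi> \<and> (\<forall>f\<in>schwartz. \<forall>x. jb x ^ N * norm (iter_deriv vs (FT \<sigma> f :: real ^ 'a => complex) x) <= \<Phi> f)"
    using sb_compose[OF \<Phi>(1) A(1)] A \<Phi>(2) scont_schwartz[OF A(1)]
    by (intro exI[of _ "%f. \<Phi> (A f)"]) auto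
qed (rule Cinf_FT)

lemma FT_schwartz: "\<bar>\<sigma>\<bar> = 1 ==> f \<in> schwartz ==> FT \<sigma> f \<in> schwartz"
  using scont_FT scont_schwartz by blast

lemma FT_symmetric:
  assumes f: "f \<in> schwartz" and g: "g \<in> schwartz"
  shows "(LBINT x. FT \<sigma> f x * g x) = (LBINT x. f x * FT \<sigma> g x)"
proof -
  have [measurable]: "f \<in> borel_measurable borel" "g \<in> borel_measurable borel"
    using f g schwartz_measurable by blast+
  have "(LBINT x. FT \<sigma> f x * g x) = fc TYPE('a) * (LBINT x. LBINT y. cis (\<sigma> * (y \<bullet> x)) * f y * g x)"
    unfolding FT_def integral_mult_left_zero by (simp add: mult.assoc)
  also have "(LBINT x. LBINT y. cis (\<sigma> * (y \<bullet> x)) * f y * g x) =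
      (LBINT y. LBINT x. cis (\<sigma> * (y \<bullet> x)) * f y * g x)"
    by (rule fubini_bound(1)[where A="%x. norm (g x)" and B="%y. norm (f y)"])
       (use f g in \<open>auto simp: norm_mult intro!: schwartz_integrable\<close>)
  also have "... = (LBINT y. f y * (LBINT x. cis (\<sigma> * (x \<bullet> y)) * g x))"
    by (intro integral_cong_refl) (simp add: mult_ac inner_commute)
  also have "fc TYPE('a) * ... = (LBINT x. f x * FT \<sigma> g x)"
    by (simp only: FT_def mult.left_commute[of _ "fc TYPE('a)"] integral_mult_right_zero)
  finally show ?thesis .
qed

subsection \<open>Fourier inversion\<close>

lemma lborel_integral_prod_coords:
  fixes h :: "'a::euclidean_space => real => complex"
  assumes "!!b. b \<in> Basis ==> integrable lborel (h b)"
  shows "(LBINT x. (\<Prod>b\<in>Basis. h b (x \<bullet> b))) = (\<Prod>b\<in>Basis. (LBINT t. h b t))"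
proof -
  interpret product_sigma_finite "%_::'a. lborel :: real measure"
    by (intro product_sigma_finite.intro lborel.sigma_finite_measure_axioms)
  have [measurable]: "!!b. b \<in> Basis ==> h b \<in> borel_measurable borel" using assms by auto
  have "(LBINT x. (\<Prod>b\<in>Basis. h b (x \<bullet> b))) =
      (LINT x|distr (\<Pi>\<^sub>M b\<in>Basis. lborel) borel (%f. \<Sum>b\<in>Basis. f b *\<^sub>R b). (\<Prod>b\<in>Basis. h b ((x::'a) \<bullet> b)))"
    by (subst lborel_eq) (rule refl)
  also have "... = (LINT f|(\<Pi>\<^sub>M b\<in>Basis. lborel). (\<Prod>b\<in>Basis. h b ((\<Sum>b\<in>Basis. f b *\<^sub>R b) \<bullet> (b::'a))))"
    by (intro integral_distr) measurable
  also have "... = (LINT f|(\<Pi>\<^sub>M b\<in>Basis. lborel). (\<Prod>b\<in>(Basis::'a set). h b (f b)))"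
    by (intro integral_cong_refl prod.cong)
       (simp_all add: inner_sum_left inner_Basis if_distrib sum.delta cong: if_cong)
  also have "... = (\<Prod>b\<in>Basis. (LBINT t. h b t))"
    using assms by (intro product_integral_prod) auto
  finally show ?thesis .
qed

text \<open>Up to the normalising factor this is the characteristic function of the standard normal
  distribution.\<close>

lemma gauss_FT_real:
  "integrable lborel (%x. cis (t * x) * complex_of_real (exp (- x\<^sup>2 / 2)))"
  "(LBINT x. cis (t * x) * complex_of_real (exp (- x\<^sup>2 / 2))) = complex_of_real (sqrt (2 * pi) * exp (- t\<^sup>2 / 2))"
proof -
  have d: "std_normal_density x = inverse (sqrt (2 * pi)) * exp (- x\<^sup>2 / 2)" for x
    by (simp add: std_normal_density_def inverse_eq_divide)
  have i: "integrable lborel (%x::real. exp (- x\<^sup>2 / 2))"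
    using integrable_mult_right[OF integrable_normal_density[of 1 0], of "sqrt (2 * pi)"] by (simp add: d)
  show "integrable lborel (%x. cis (t * x) * complex_of_real (exp (- x\<^sup>2 / 2)))"
    by (rule Bochner_Integration.integrable_bound[OF i]) (auto simp: norm_mult)
  have "complex_of_real (exp (- t\<^sup>2 / 2)) = char std_normal_distribution t"
    by (simp add: char_std_normal_distribution)
  also have "... = (LBINT x. std_normal_density x *\<^sub>R iexp (t * x))"
    unfolding char_def by (subst integral_density) (auto)
  also have "... = (LBINT x. inverse (sqrt (2 * pi)) * (cis (t * x) * complex_of_real (exp (- x\<^sup>2 / 2))))"
    by (intro integral_cong_refl) (simp only: d cis_conv_exp scaleR_conv_of_real of_real_mult mult_ac)
  also have "... = inverse (sqrt (2 * pi)) * (LBINT x. cis (t * x) * complex_of_real (exp (- x\<^sup>2 / 2)))" by simp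
  finally show "(LBINT x. cis (t * x) * complex_of_real (exp (- x\<^sup>2 / 2))) = complex_of_real (sqrt (2 * pi) * exp (- t\<^sup>2 / 2))"
    by (simp add: field_simps)
qed

definition gauss :: "real ^ 'd => complex" where "gauss x = complex_of_real (exp (- (norm x)\<^sup>2 / 2))"

lemma gauss_FT:
  fixes z :: "real ^ 'd"
  shows "(LBINT x. cis (x \<bullet> z) * gauss x) = complex_of_real (sqrt (2 * pi) ^ CARD('d)) * gauss z"
proof -
  have e: "exp (- (norm x)\<^sup>2 / 2) = (\<Prod>b\<in>Basis. exp (- (x \<bullet> b)\<^sup>2 / 2))" for x :: "real ^ 'd"
    unfolding power2_norm_eq_inner euclidean_inner[of x x]
    by (simp add: exp_sum[symmetric] sum_negf sum_divide_distrib power2_eq_square)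
  have c: "cis (x \<bullet> z) = (\<Prod>b\<in>Basis. cis ((z \<bullet> b) * (x \<bullet> b)))" for x :: "real ^ 'd"
    by (simp add: cis_conv_exp exp_sum[symmetric] euclidean_inner[of x z] sum_distrib_left[symmetric] mult_ac)
  have ge: "gauss x = (\<Prod>b\<in>Basis. complex_of_real (exp (- (x \<bullet> b)\<^sup>2 / 2)))" for x :: "real ^ 'd"
    by (simp only: gauss_def e of_real_prod)
  have "(LBINT x. cis (x \<bullet> z) * gauss x) =
     (LBINT x. (\<Prod>b\<in>Basis. cis ((z \<bullet> b) * (x \<bullet> b)) * complex_of_real (exp (- (x \<bullet> b)\<^sup>2 / 2))))"
    by (simp only: ge c prod.distrib)
  also have "... = (\<Prod>b\<in>Basis. (LBINT t. cis ((z \<bullet> b) * t) * complex_of_real (exp (- t\<^sup>2 / 2))))"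
    by (rule lborel_integral_prod_coords) (rule gauss_FT_real)
  also have "... = (\<Prod>b\<in>(Basis :: (real ^ 'd) set). complex_of_real (sqrt (2 * pi) * exp (- (z \<bullet> b)\<^sup>2 / 2)))"
    by (simp only: gauss_FT_real(2))
  also have "... = complex_of_real (sqrt (2 * pi) ^ CARD('d)) * gauss z"
    by (simp only: ge[of z] of_real_mult prod.distrib prod_constant of_real_power) simp
  finally show ?thesis .
qed

text \<open>A function that is not integrable has Bochner integral 0 by convention, but the product
  formula at frequency 0 gives a nonzero value.\<close>

lemma gauss_integrable: "integrable lborel (gauss :: real ^ 'd => complex)"
proof (rule ccontr)
  assume "\<not> ?thesis"
  then have "(LBINT x. gauss (x :: real ^ 'd)) = 0" by (rule not_integrable_integral_eq)
  then show False using gauss_FT[of "0 :: real ^ 'd"] by (simp add: gauss_def)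
qed

lemma fc_sqrt: "fc TYPE('d::finite) * complex_of_real (sqrt (2 * pi) ^ CARD('d)) = 1"
proof -
  have "sqrt (2 * pi) ^ CARD('d) = (2 * pi) powr (real CARD('d) / 2)"
    by (simp add: powr_half_sqrt[symmetric] powr_powr powr_realpow[symmetric])
  then have "(2 * pi) powr (- real CARD('d) / 2) * sqrt (2 * pi) ^ CARD('d) = 1"
    by (simp add: powr_add[symmetric])
  then show ?thesis by (metis of_real_1 of_real_mult)
qed

lemma gauss_measurable [measurable]: "gauss \<in> borel_measurable borel"
  unfolding gauss_def[abs_def] by measurable

lemma norm_gauss_le: "norm (gauss x) <= 1" by (simp add: gauss_def)

text \<open>Gaussian summation. The double integral is not absolutely convergent, so a factor
  \<open>gauss (\<epsilon> \<xi>)\<close> is inserted; the regularised integral is evaluated as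
  \<epsilon> tends to 0 on the frequency side and, after Fubini, as an average of \<open>f\<close>
  around \<open>x\<close>.\<close>

lemma FT_inversion:
  fixes f :: "real ^ 'd => complex"
  assumes f: "f \<in> schwartz" and \<sigma>: "\<bar>\<sigma>\<bar> = 1"
  shows "FT (- \<sigma>) (FT \<sigma> f) x = f x"
proof -
  let ?c = "fc TYPE('d)" and ?\<epsilon> = "%n. inverse (real (Suc n))"
  have [measurable]: "f \<in> borel_measurable borel" using schwartz_measurable[OF f] .
  have gS: "FT \<sigma> f \<in> schwartz" using FT_schwartz[OF \<sigma> f] .
  have [measurable]: "FT \<sigma> f \<in> borel_measurable borel" using schwartz_measurable[OF gS] .
  \<comment> \<open>The regularised inversion integral. Since the Gaussian factor is bounded by 1,
    \<open>norm (FT \<sigma> f \<xi>)\<close> dominates it for all n.\<close>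
  define I where "I n = ?c * (LBINT \<xi>. gauss (?\<epsilon> n *\<^sub>R \<xi>) * (cis (- \<sigma> * (\<xi> \<bullet> x)) * FT \<sigma> f \<xi>))" for n
  have \<epsilon>0: "?\<epsilon> \<longlonglongrightarrow> 0" by (rule LIMSEQ_inverse_real_of_nat)
  have g1: "(%n. gauss (?\<epsilon> n *\<^sub>R \<xi>)) \<longlonglongrightarrow> 1" for \<xi> :: "real ^ 'd"
  proof -
    have "(%n. gauss (?\<epsilon> n *\<^sub>R \<xi>)) \<longlonglongrightarrow> complex_of_real (exp (- (0 * norm \<xi>)\<^sup>2 / 2))"
      unfolding gauss_def norm_scaleR abs_inverse abs_of_nat
      by (intro tendsto_intros \<epsilon>0) simp
    then show ?thesis by simp
  qed
  have "I \<longlonglongrightarrow> ?c * (LBINT \<xi>. cis (- \<sigma> * (\<xi> \<bullet> x)) * FT \<sigma> f \<xi>)"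
    unfolding I_def
  proof (intro tendsto_mult_left integral_dominated_convergence[where w="%\<xi>. norm (FT \<sigma> f \<xi>)"])
    show "AE \<xi> in lborel. (%n. gauss (?\<epsilon> n *\<^sub>R \<xi>) * (cis (- \<sigma> * (\<xi> \<bullet> x)) * FT \<sigma> f \<xi>)) \<longlonglongrightarrow>
        cis (- \<sigma> * (\<xi> \<bullet> x)) * FT \<sigma> f \<xi>"
      using tendsto_mult_right[OF g1] by (intro AE_I2) fastforce
    show "AE \<xi> in lborel. norm (gauss (?\<epsilon> n *\<^sub>R \<xi>) * (cis (- \<sigma> * (\<xi> \<bullet> x)) * FT \<sigma> f \<xi>)) <= norm (FT \<sigma> f \<xi>)" for n
      unfolding norm_mult by (intro AE_I2) (auto intro!: mult_left_le_one_le norm_gauss_le)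
  qed (use schwartz_integrable[OF gS] in auto)
  then have lim1: "I \<longlonglongrightarrow> FT (- \<sigma>) (FT \<sigma> f) x" by (simp add: FT_def)
  \<comment> \<open>Fubini brings in the transform of a dilated Gaussian, which is again a dilated
    Gaussian; the scaling factors cancel. One normalising constant \<open>fc\<close> is used up here
    by \<open>fc_sqrt\<close>, the other by the limit.\<close>
  have I: "I n = ?c * (LBINT w. f (?\<epsilon> n *\<^sub>R w + x) * gauss w)" for n
  proof -
    define e where "e = ?\<epsilon> n"
    have e: "e > 0" by (simp add: e_def)
    have gi: "integrable lborel (%\<xi>. gauss (e *\<^sub>R \<xi> :: real ^ 'd))"
      using gauss_integrable e by (intro lborel_integrable_scale) auto
    have "I n = ?c * (?c * (LBINT \<xi>. LBINT y. gauss (e *\<^sub>R \<xi>) * (cis (\<sigma> * ((y - x) \<bullet> \<xi>)) * f y)))"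
    proof -
      have "cis (\<sigma> * ((y - x) \<bullet> \<xi>)) = cis (- \<sigma> * (\<xi> \<bullet> x)) * cis (\<sigma> * (y \<bullet> \<xi>))" for y \<xi>
        by (simp add: cis_mult inner_diff_left inner_commute[of x] algebra_simps)
      then have "(LBINT y. gauss (e *\<^sub>R \<xi>) * (cis (\<sigma> * ((y - x) \<bullet> \<xi>)) * f y)) =
          gauss (e *\<^sub>R \<xi>) * (cis (- \<sigma> * (\<xi> \<bullet> x)) * (LBINT y. cis (\<sigma> * (y \<bullet> \<xi>)) * f y))" for \<xi>
        by (simp only: mult.assoc integral_mult_right_zero)
      then have "gauss (e *\<^sub>R \<xi>) * (cis (- \<sigma> * (\<xi> \<bullet> x)) * FT \<sigma> f \<xi>) =
          ?c * (LBINT y. gauss (e *\<^sub>R \<xi>) * (cis (\<sigma> * ((y - x) \<bullet> \<xi>)) * f y))" for \<xi>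
        by (simp only: FT_def mult_ac)
      then show ?thesis
        unfolding I_def e_def[symmetric] by (simp only: integral_mult_right_zero)
    qed
    also have "(LBINT \<xi>. LBINT y. gauss (e *\<^sub>R \<xi>) * (cis (\<sigma> * ((y - x) \<bullet> \<xi>)) * f y)) =
       (LBINT y. LBINT \<xi>. gauss (e *\<^sub>R \<xi>) * (cis (\<sigma> * ((y - x) \<bullet> \<xi>)) * f y))"
      by (rule fubini_bound(1)[where A="%\<xi>. norm (gauss (e *\<^sub>R \<xi>))" and B="%y. norm (f y)"])
        (use gi schwartz_integrable[OF f] in \<open>auto simp: norm_mult\<close>)
    also have "... = (LBINT y. f y * (LBINT \<xi>. cis (\<xi> \<bullet> (\<sigma> *\<^sub>R (y - x))) * gauss (e *\<^sub>R \<xi>)))"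
      by (intro integral_cong_refl) (simp add: mult_ac inner_commute)
    also have "... = (LBINT y. f y * (complex_of_real (sqrt (2 * pi) ^ CARD('d)) * gauss ((y - x) /\<^sub>R e)) / e ^ CARD('d))"
    proof (intro integral_cong_refl)
      fix y
      let ?z = "\<sigma> *\<^sub>R (y - x)"
      have A: "(LBINT \<xi>. cis (\<xi> \<bullet> (?z /\<^sub>R e)) * gauss \<xi>) =
          \<bar>e\<bar> ^ DIM(real ^ 'd) *\<^sub>R (LBINT \<xi>. cis ((e *\<^sub>R \<xi>) \<bullet> (?z /\<^sub>R e)) * gauss (e *\<^sub>R \<xi>))"
        using e by (intro lborel_integral_scale) auto
      have "(LBINT \<xi>. cis (\<xi> \<bullet> ?z) * gauss (e *\<^sub>R \<xi>)) =
          complex_of_real (sqrt (2 * pi) ^ CARD('d)) * gauss (?z /\<^sub>R e) / e ^ CARD('d)"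
      proof -
        have divc: "J = a / complex_of_real r" if "a = r *\<^sub>R J" "r ~= 0" for J a :: complex and r
          using that by (simp add: scaleR_conv_of_real)
        have "(e *\<^sub>R \<xi>) \<bullet> (?z /\<^sub>R e) = \<xi> \<bullet> ?z" for \<xi> using e by simp
        then have "complex_of_real (sqrt (2 * pi) ^ CARD('d)) * gauss (?z /\<^sub>R e) =
            (e ^ CARD('d)) *\<^sub>R (LBINT \<xi>. cis (\<xi> \<bullet> ?z) * gauss (e *\<^sub>R \<xi>))"
          using A e by (simp only: gauss_FT abs_of_pos DIM_cart DIM_real mult_1_right)
        from divc[OF this] e show ?thesis by simp
      qed
      moreover have "gauss (?z /\<^sub>R e) = gauss ((y - x) /\<^sub>R e)" using \<sigma> by (simp add: gauss_def abs_mult)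
      ultimately show "f y * (LBINT \<xi>. cis (\<xi> \<bullet> ?z) * gauss (e *\<^sub>R \<xi>)) =
        f y * (complex_of_real (sqrt (2 * pi) ^ CARD('d)) * gauss ((y - x) /\<^sub>R e)) / e ^ CARD('d)" by simp
    qed
    also have "... = complex_of_real (sqrt (2 * pi) ^ CARD('d)) * ((LBINT y. f y * gauss ((y - x) /\<^sub>R e)) / e ^ CARD('d))"
      by (simp only: integral_mult_right_zero[symmetric] integral_divide_zero[symmetric]
          times_divide_eq_right mult.left_commute[of _ "complex_of_real (sqrt (2 * pi) ^ CARD('d))"])
    also have "(LBINT y. f y * gauss ((y - x) /\<^sub>R e)) = (LBINT y. f (y + x) * gauss (y /\<^sub>R e))"
      using lborel_integral_shift[of "%y. f y * gauss ((y - x) /\<^sub>R e)" x] by simp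
    also have "... = \<bar>e\<bar> ^ DIM(real ^ 'd) *\<^sub>R (LBINT w. f (e *\<^sub>R w + x) * gauss ((e *\<^sub>R w) /\<^sub>R e))"
      using e by (intro lborel_integral_scale) auto
    finally have "I n = ?c * (?c * (complex_of_real (sqrt (2 * pi) ^ CARD('d)) *
       (\<bar>e\<bar> ^ DIM(real ^ 'd) *\<^sub>R (LBINT w. f (e *\<^sub>R w + x) * gauss ((e *\<^sub>R w) /\<^sub>R e)) / e ^ CARD('d))))" .
    also have "... = (?c * complex_of_real (sqrt (2 * pi) ^ CARD('d))) * (?c * (LBINT w. f (e *\<^sub>R w + x) * gauss w))"
      using e by (simp add: scaleR_conv_of_real[where 'a=complex])
    finally show ?thesis by (simp only: fc_sqrt mult_1_left e_def)
  qed
  have "(%n. LBINT w. f (?\<epsilon> n *\<^sub>R w + x) * gauss w) \<longlonglongrightarrow> (LBINT w. f x * gauss (w :: real ^ 'd))"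
  proof (rule integral_dominated_convergence[where w="%w::real^'d. schwartz_norm 0 f * norm (gauss w)"])
    have "(%n. f (?\<epsilon> n *\<^sub>R w + x)) \<longlonglongrightarrow> f (0 *\<^sub>R w + x)" for w
      by (rule continuous_on_tendsto_compose[OF schwartz_continuous[OF f]]) (intro tendsto_intros \<epsilon>0, auto)
    then show "AE w in lborel. (%n. f (?\<epsilon> n *\<^sub>R w + x) * gauss w) \<longlonglongrightarrow> f x * gauss w"
      by (intro AE_I2 tendsto_mult_right) simp
    show "AE w in lborel. norm (f (?\<epsilon> n *\<^sub>R w + x) * gauss w) <= schwartz_norm 0 f * norm (gauss w)" for n
      using schwartz_norm_ge0[OF f] by (intro AE_I2) (auto simp: norm_mult intro!: mult_right_mono)
  qed (use gauss_integrable in auto)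
  then have "I \<longlonglongrightarrow> ?c * (LBINT w. f x * gauss (w :: real ^ 'd))"
    unfolding I[abs_def] by (rule tendsto_mult_left)
  also have "?c * (LBINT w. f x * gauss (w :: real ^ 'd)) = f x"
    using gauss_FT[of "0::real^'d"] fc_sqrt[where 'd='d] by (simp add: gauss_def)
  finally show ?thesis using lim1 LIMSEQ_unique by blast
qed

subsection \<open>Fourier multipliers\<close>

text \<open>A Fourier multiplier acting on test functions. The order of the two transforms is the
  reverse of the one in \<open>piece\<close>, because operators on distributions are defined by
  duality.\<close>

definition Mul :: "(real ^ 'd => complex) => (real ^ 'd => complex) => real ^ 'd => complex" where
  "Mul m f = FT (- 1) (%\<xi>. m \<xi> * FT 1 f \<xi>)"

text \<open>The convolution kernel of \<open>Mul m\<close>; the second factor \<open>fc\<close> is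
  due to the unitary normalisation, in which a product of symbols corresponds to \<open>fc\<close>
  times a convolution.\<close>

definition ker :: "(real ^ 'd => complex) => real ^ 'd => complex" where
  "ker m z = fc TYPE('d) * FT (- 1) m z"

lemma scont_Mul: "pgrow m ==> scont (Mul m)"
  unfolding Mul_def[abs_def] by (intro scont_compose[OF scont_FT scont_compose[OF scont_mult scont_FT]]) auto

lemma Mul_schwartz: "pgrow m ==> f \<in> schwartz ==> Mul m f \<in> schwartz"
  using scont_Mul scont_schwartz by blast

lemma Mul_Mul:
  assumes "pgrow m'" "f \<in> schwartz"
  shows "Mul m (Mul m' f) = Mul (%\<xi>. m \<xi> * m' \<xi>) f"
proof -
  have "(%\<xi>. m' \<xi> * FT 1 f \<xi>) \<in> schwartz"
    using assms by (intro schwartz_mult FT_schwartz) auto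
  from FT_inversion[OF this, of "-1"]
  have "FT 1 (FT (- 1) (%\<xi>. m' \<xi> * FT 1 f \<xi>)) = (%\<xi>. m' \<xi> * FT 1 f \<xi>)" by (intro ext) simp
  then show ?thesis by (simp add: Mul_def mult.assoc)
qed

lemma Dv_Mul:
  assumes "pgrow m" "f \<in> schwartz"
  shows "Dv v (Mul m f) = Mul (%\<xi>. - \<i> * complex_of_real (\<xi> \<bullet> v) * m \<xi>) f"
  unfolding Mul_def using assms
  by (subst Dv_FT) (auto intro!: schwartz_mult FT_schwartz simp: mult_ac)

lemma Mul_Dv:
  assumes "v \<in> Basis" "f \<in> schwartz"
  shows "Mul m (Dv v f) = Mul (%\<xi>. - \<i> * complex_of_real (\<xi> \<bullet> v) * m \<xi>) f"
  using FT_Dv[OF assms(2,1), of 1] by (simp add: Mul_def mult_ac)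

lemma FT_sum:
  assumes "!!i. i \<in> I ==> f i \<in> schwartz"
  shows "FT \<sigma> (%x. \<Sum>i\<in>I. f i x) \<xi> = (\<Sum>i\<in>I. FT \<sigma> (f i) \<xi>)"
proof -
  have "(LBINT x. cis (\<sigma> * (x \<bullet> \<xi>)) * (\<Sum>i\<in>I. f i x)) = (\<Sum>i\<in>I. LBINT x. cis (\<sigma> * (x \<bullet> \<xi>)) * f i x)"
    by (simp add: sum_distrib_left cis_schwartz_integrable assms)
  then show ?thesis by (simp only: FT_def sum_distrib_left)
qed

lemma Mul_sum:
  assumes "!!i. i \<in> I ==> pgrow (m i)" "f \<in> schwartz"
  shows "Mul (%\<xi>. \<Sum>i\<in>I. m i \<xi>) f = (%x. \<Sum>i\<in>I. Mul (m i) f x)"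
  unfolding Mul_def sum_distrib_right using assms
  by (intro ext FT_sum) (auto intro!: schwartz_mult FT_schwartz)

lemma Mul_cmult: "Mul (%\<xi>. c * m \<xi>) f = (%x. c * Mul m f x)"
proof -
  have "(LBINT x. cis (- 1 * (x \<bullet> \<xi>)) * (c * m x * FT 1 f x)) =
      (LBINT x. c * (cis (- 1 * (x \<bullet> \<xi>)) * (m x * FT 1 f x)))" for \<xi>
    by (simp only: mult_ac)
  then show ?thesis unfolding Mul_def FT_def[of "- 1"] fun_eq_iff
    by (simp only: integral_mult_right_zero mult_ac) simp
qed

lemma FT_add:
  assumes "f \<in> schwartz" "g \<in> schwartz"
  shows "FT \<sigma> (%x. f x + g x) \<xi> = FT \<sigma> f \<xi> + FT \<sigma> g \<xi>"
  using assms by (simp add: FT_def distrib_left cis_schwartz_integrable)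

lemma FT_cmult: "FT \<sigma> (%x. c * f x) \<xi> = c * FT \<sigma> f \<xi>"
proof -
  have "(LBINT x. cis (\<sigma> * (x \<bullet> \<xi>)) * (c * f x)) = (LBINT x. c * (cis (\<sigma> * (x \<bullet> \<xi>)) * f x))"
    by (simp only: mult_ac)
  then show ?thesis by (simp add: FT_def)
qed

lemma Mul_add_fun:
  assumes "pgrow m" "f \<in> schwartz" "g \<in> schwartz"
  shows "Mul m (%x. f x + g x) = (%x. Mul m f x + Mul m g x)"
  using assms
  by (intro ext) (simp add: Mul_def FT_add[of f g] distrib_left FT_add[of "%\<xi>. m \<xi> * FT 1 f \<xi>" "%\<xi>. m \<xi> * FT 1 g \<xi>"]
      schwartz_mult FT_schwartz)

lemma Mul_cmult_fun: "Mul m (%x. c * f x) = (%x. c * Mul m f x)"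
  by (intro ext) (simp add: Mul_def FT_cmult mult.left_commute[of _ c])

lemma ker_schwartz: "m \<in> schwartz ==> ker m \<in> schwartz"
  unfolding ker_def[abs_def] by (intro schwartz_cmult FT_schwartz) auto

lemma Mul_conv:
  fixes m f :: "real ^ 'd => complex"
  assumes m: "m \<in> schwartz" and f: "f \<in> schwartz"
  shows "Mul m f x = (LBINT y. ker m (x - y) * f y)"
proof -
  let ?c = "fc TYPE('d)"
  have [measurable]: "f \<in> borel_measurable borel" "m \<in> borel_measurable borel"
    using schwartz_measurable f m by blast+
  have cc: "cis (1 * (y \<bullet> \<xi>)) * cis (- 1 * (\<xi> \<bullet> x)) = cis (- 1 * (\<xi> \<bullet> (x - y)))" for y \<xi>
    by (simp add: cis_mult inner_diff_right inner_commute)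
  have "cis (- 1 * (\<xi> \<bullet> x)) * (m \<xi> * FT 1 f \<xi>) =
      ?c * (LBINT y. cis (- 1 * (\<xi> \<bullet> (x - y))) * (m \<xi> * f y))" for \<xi>
  proof -
    have "(LBINT y. cis (- 1 * (\<xi> \<bullet> (x - y))) * (m \<xi> * f y)) =
      (LBINT y. (cis (- 1 * (\<xi> \<bullet> x)) * m \<xi>) * (cis (1 * (y \<bullet> \<xi>)) * f y))"
      by (intro integral_cong_refl) (simp only: cc[symmetric] mult_ac)
    also have "... = (cis (- 1 * (\<xi> \<bullet> x)) * m \<xi>) * (LBINT y. cis (1 * (y \<bullet> \<xi>)) * f y)"
      by (rule integral_mult_right_zero)
    finally show ?thesis by (simp only: FT_def mult_ac)
  qed
  then have "Mul m f x = ?c * (?c * (LBINT \<xi>. LBINT y. cis (- 1 * (\<xi> \<bullet> (x - y))) * (m \<xi> * f y)))"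
    unfolding Mul_def FT_def[of "- 1"] by (simp only: integral_mult_right_zero)
  also have "(LBINT \<xi>. LBINT y. cis (- 1 * (\<xi> \<bullet> (x - y))) * (m \<xi> * f y)) =
     (LBINT y. LBINT \<xi>. cis (- 1 * (\<xi> \<bullet> (x - y))) * (m \<xi> * f y))"
    by (rule fubini_bound(1)[where A="%\<xi>. norm (m \<xi>)" and B="%y. norm (f y)"])
       (use f m in \<open>auto simp: norm_mult intro!: schwartz_integrable\<close>)
  also have "... = (LBINT y. (LBINT \<xi>. cis (- 1 * (\<xi> \<bullet> (x - y))) * m \<xi>) * f y)"
    by (simp only: mult.assoc[symmetric] integral_mult_left_zero)
  also have "?c * (?c * ...) = (LBINT y. ker m (x - y) * f y)"
  proof -
    have "ker m (x - y) * f y = ?c * (?c * ((LBINT \<xi>. cis (- 1 * (\<xi> \<bullet> (x - y))) * m \<xi>) * f y))" for y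
      by (simp only: ker_def FT_def mult.assoc)
    then show ?thesis by (simp only: integral_mult_right_zero)
  qed
  finally show ?thesis .
qed

text \<open>The transform is symmetric under the bilinear pairing, so moving both transforms to the
  other factor turns \<open>FT (- 1)\<close> and \<open>FT 1\<close> around; restoring their order
  reflects the symbol.\<close>

lemma Mul_transpose:
  assumes m: "pgrow m" "pgrow (%\<xi>. m (- \<xi>))" and S: "h \<in> schwartz" "f \<in> schwartz"
  shows "(LBINT x. h x * Mul m f x) = (LBINT x. Mul (%\<xi>. m (- \<xi>)) h x * f x)"
proof -
  have mf: "(%\<xi>. m \<xi> * FT 1 f \<xi>) \<in> schwartz" "(%\<xi>. m (- \<xi>) * FT 1 h \<xi>) \<in> schwartz"
    "(%\<xi>. FT (- 1) h \<xi> * m \<xi>) \<in> schwartz"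
    using m S schwartz_mult[OF m(1) FT_schwartz[of "-1" h]]
    by (auto intro!: schwartz_mult FT_schwartz simp: mult.commute)
  have "(LBINT x. h x * Mul m f x) = (LBINT x. FT (- 1) h x * (m x * FT 1 f x))"
    unfolding Mul_def by (rule FT_symmetric[symmetric, OF S(1) mf(1)])
  then have A: "(LBINT x. h x * Mul m f x) = (LBINT x. FT 1 (%\<xi>. FT (- 1) h \<xi> * m \<xi>) x * f x)"
    using FT_symmetric[OF mf(3) S(2), of 1] by (simp add: mult.assoc)
  have "FT 1 (%\<xi>. FT (- 1) h \<xi> * m \<xi>) x = Mul (%\<xi>. m (- \<xi>)) h x" for x
  proof -
    have [measurable]: "(%\<xi>. FT (- 1) h \<xi> * m \<xi>) \<in> borel_measurable borel"
      using schwartz_measurable[OF mf(3)] .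
    have "(LBINT \<xi>. cis (\<xi> \<bullet> x) * (FT (- 1) h \<xi> * m \<xi>)) =
        (LBINT \<xi>. cis (- \<xi> \<bullet> x) * (FT (- 1) h (- \<xi>) * m (- \<xi>)))"
      by (rule lborel_integral_reflect[symmetric]) measurable
    also have "... = (LBINT \<xi>. cis (- 1 * (\<xi> \<bullet> x)) * (m (- \<xi>) * FT 1 h \<xi>))"
      by (intro integral_cong_refl) (simp add: FT_uminus[of 1 h, simplified] mult_ac)
    finally show ?thesis unfolding Mul_def FT_def[of 1 "%\<xi>. FT (- 1) h \<xi> * m \<xi>"]
        FT_def[of "- 1" "%\<xi>. m (- \<xi>) * FT 1 h \<xi>"] by simp
  qed
  then show ?thesis unfolding A by (simp only:)
qed

lemma FT_dilation:
  fixes m :: "real ^ 'd => complex"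
  assumes [measurable]: "m \<in> borel_measurable borel" and c: "c > 0"
  shows "FT \<sigma> (%\<xi>. m (c *\<^sub>R \<xi>)) x = FT \<sigma> m (x /\<^sub>R c) / complex_of_real (c ^ CARD('d))"
proof -
  have "(LBINT \<xi>. cis (\<sigma> * (\<xi> \<bullet> (x /\<^sub>R c))) * m \<xi>) =
    \<bar>c\<bar> ^ DIM(real ^ 'd) *\<^sub>R (LBINT \<xi>. cis (\<sigma> * ((c *\<^sub>R \<xi>) \<bullet> (x /\<^sub>R c))) * m (c *\<^sub>R \<xi>))"
    using c by (intro lborel_integral_scale) auto
  also have "... = complex_of_real (c ^ CARD('d)) * (LBINT \<xi>. cis (\<sigma> * (\<xi> \<bullet> x)) * m (c *\<^sub>R \<xi>))"
  proof -
    have "(c *\<^sub>R \<xi>) \<bullet> (x /\<^sub>R c) = \<xi> \<bullet> x" for \<xi> using c by simp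
    then show ?thesis using c by (simp only: scaleR_conv_of_real[where 'a=complex] abs_of_pos DIM_cart DIM_real mult_1_right)
  qed
  finally show ?thesis using c by (simp add: FT_def)
qed

text \<open>Dilating the symbol by c dilates the kernel by 1/c and divides it by c^d, which
  preserves its L_1 norm. All bounds uniform in the frequency level rest on this.\<close>

lemma ker_dilation_L1:
  fixes m :: "real ^ 'd => complex"
  assumes m: "m \<in> schwartz" and c: "c > 0"
  shows "(LBINT x. norm (ker (%\<xi>. m (c *\<^sub>R \<xi>)) x)) = (LBINT x. norm (ker m x))"
proof -
  have [measurable]: "m \<in> borel_measurable borel" "ker m \<in> borel_measurable borel"
    using m ker_schwartz schwartz_measurable by blast+
  have "(LBINT x. norm (ker (%\<xi>. m (c *\<^sub>R \<xi>)) x)) = (LBINT x. norm (ker m (inverse c *\<^sub>R x)) / c ^ CARD('d))"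
    using c by (simp add: ker_def FT_dilation norm_mult norm_divide norm_power)
  also have "... = inverse c ^ CARD('d) * (LBINT x. norm (ker m (inverse c *\<^sub>R x)))"
    by (simp add: field_simps)
  also have "... = (LBINT x. norm (ker m x))"
    using lborel_integral_scale[of "%x. norm (ker m x)" "inverse c"] c by simp
  finally show ?thesis .
qed

subsection \<open>Convergence of frequency cut-offs\<close>

text \<open>On the support of \<open>a k\<close> one has |x| >= 2^k, so one more power of the weight
  of \<open>g\<close> pays for the factor 2^-k. The family \<open>a\<close> is generalised because
  its derivatives keep both properties: uniform bounds and vanishing on the ball.\<close>

lemma cutoff_decay:
  fixes g :: "'a::euclidean_space => complex" and a :: "nat => 'a => complex"
  assumes "set vs \<subseteq> Basis" "g \<in> schwartz" "!!k. Cinf UNIV (a k)"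
    and "!!ws. set ws \<subseteq> Basis ==> \<exists>C. \<forall>k x. norm (iter_deriv ws (a k) x) <= C"
    and "!!k x. norm x < 2 ^ k ==> a k x = 0"
  shows "\<exists>C. \<forall>k x. jb x ^ N * norm (iter_deriv vs (%x. a k x * g x) x) <= C / 2 ^ k"
  using assms
proof (induction vs arbitrary: a g rule: rev_induct)
  case Nil
  obtain C where C: "!!k x. norm (a k x) <= C" using Nil.prems(4)[of "[]"] by auto
  then have "C >= 0" using norm_ge_zero order_trans by blast
  have "jb x ^ N * norm (a k x * g x) <= C * schwartz_norm (Suc N) g / 2 ^ k" for k x
  proof (cases "norm x < 2 ^ k")
    case True
    then show ?thesis using Nil.prems(5) \<open>C >= 0\<close> schwartz_norm_nonneg[OF Nil.prems(2)] by simp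
  next
    case False
    have "2 ^ k * (jb x ^ N * norm (a k x * g x)) <= jb x * (jb x ^ N * (C * norm (g x)))"
      using False C unfolding norm_mult by (intro mult_mono mult_right_mono mult_left_mono) auto
    also have "... = C * (jb x ^ Suc N * norm (g x))" by (simp add: mult_ac)
    also have "... <= C * schwartz_norm (Suc N) g"
      using \<open>C >= 0\<close> by (intro mult_left_mono schwartz_weight Nil.prems(2)) auto
    finally show ?thesis by (simp add: pos_le_divide_eq mult.commute)
  qed
  then show ?case by (intro exI[of _ "C * schwartz_norm (Suc N) g"]) simp
next
  case (snoc v vs)
  then have v: "v \<in> Basis" "set vs \<subseteq> Basis" by auto
  have g: "Cinf UNIV g" using snoc.prems by (simp add: schwartz_Cinf)
  obtain C where C: "!!k x. jb x ^ N * norm (iter_deriv vs (%x. a k x * Dv v g x) x) <= C / 2 ^ k"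
    using snoc.IH[OF v(2) schwartz_Dv[OF v(1) snoc.prems(2)] snoc.prems(3-5)] by blast
  have "\<exists>C. \<forall>k x. jb x ^ N * norm (iter_deriv vs (%x. Dv v (a k) x * g x) x) <= C / 2 ^ k"
  proof (rule snoc.IH[OF v(2) snoc.prems(2)])
    show "\<exists>C. \<forall>k x. norm (iter_deriv ws (Dv v (a k)) x) <= C" if "set ws \<subseteq> Basis" for ws
      using snoc.prems(4)[of "ws @ [v]"] that v by (simp add: iter_deriv_snoc)
    show "Dv v (a k) x = 0" if "norm x < 2 ^ k" for k x
      using frechet_derivative_cong_open[of "ball 0 (2 ^ k)" x "a k" "%_. 0"] that snoc.prems(5) by simp
  qed (intro Cinf_Dv snoc.prems)
  then obtain D where D: "!!k x. jb x ^ N * norm (iter_deriv vs (%x. Dv v (a k) x * g x) x) <= D / 2 ^ k"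
    by blast
  have "jb x ^ N * norm (iter_deriv (vs @ [v]) (%x. a k x * g x) x) <= (C + D) / 2 ^ k" for k x
  proof -
    have a: "Cinf UNIV (a k)" using snoc.prems by blast
    have "Dv v (%x. a k x * g x) = (%x. a k x * Dv v g x + Dv v (a k) x * g x)"
      using Dv_mult[OF Cinf_differentiable[OF a] Cinf_differentiable[OF g]] by auto
    then have "iter_deriv (vs @ [v]) (%x. a k x * g x) x =
        iter_deriv vs (%x. a k x * Dv v g x) x + iter_deriv vs (%x. Dv v (a k) x * g x) x"
      using a g by (simp add: iter_deriv_snoc iter_deriv_add Cinf_mult Cinf_Dv)
    then have "jb x ^ N * norm (iter_deriv (vs @ [v]) (%x. a k x * g x) x)
       <= jb x ^ N * (norm (iter_deriv vs (%x. a k x * Dv v g x) x) + norm (iter_deriv vs (%x. Dv v (a k) x * g x) x))"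
      by (auto intro!: mult_left_mono norm_triangle_ineq)
    then show ?thesis using C[of x k] D[of x k] by (simp add: distrib_left add_divide_distrib)
  qed
  then show ?case by blast
qed

text \<open>The removed part is \<open>FT (- 1)\<close> of (1 - dilated cut-off) times the transform
  of \<open>f\<close>. The factor 1 - cut-off vanishes for |\<xi>| < 2^k and has derivatives bounded
  uniformly in k, since each derivative of the dilated cut-off brings a factor (1/2)^k; then
  \<open>cutoff_decay\<close> applies.\<close>

lemma low_frequency_limit:
  fixes b :: "real ^ 'd => complex"
  assumes b: "b \<in> test_fun UNIV" "!!x. norm x <= 1 ==> b x = 1" and f: "f \<in> schwartz" and \<Phi>: "sb \<Phi>"
    and \<Phi>0: "!!f. f \<in> schwartz ==> 0 <= \<Phi> f"
  shows "(%k. \<Phi> (%x. f x - Mul (%\<xi>. b ((1 / 2) ^ k *\<^sub>R \<xi>)) f x)) \<longlonglongrightarrow> 0"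
proof -
  let ?b = "%k \<xi>. b ((1 / 2) ^ k *\<^sub>R \<xi>)"
  define a where "a k \<xi> = 1 - ?b k \<xi>" for k \<xi>
  have tb: "?b k \<in> test_fun UNIV" for k using b(1) by (intro test_fun_dilation) auto
  have bC: "Cinf UNIV b" using b(1) by (rule test_fun_Cinf)
  have aC: "Cinf UNIV (a k)" for k
    unfolding a_def[abs_def] using test_fun_Cinf[OF tb] by (intro Cinf_diff) auto
  have aB: "\<exists>C. \<forall>k x. norm (iter_deriv ws (a k) x) <= C" for ws
  proof -
    obtain C where C: "!!x. norm (iter_deriv ws b x) <= C" "C >= 0"
      using test_fun_bounded[OF test_fun_iter_deriv[OF b(1)]] by metis
    have "norm (iter_deriv ws (a k) x) <= 1 + C" for k x
    proof -
      have "iter_deriv ws (a k) = iter_deriv ws (%\<xi>. 1 + (- 1) * b ((1 / 2) ^ k *\<^sub>R \<xi> + 0))"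
        by (simp add: a_def[abs_def])
      also have "... = (%x. iter_deriv ws (%x. 1) x + (- 1) * (((1 / 2) ^ k) ^ length ws *\<^sub>R iter_deriv ws b ((1 / 2) ^ k *\<^sub>R x + 0)))"
        using Cinf_affine[OF bC, of "(1 / 2) ^ k" 0]
        by (subst iter_deriv_add; (subst iter_deriv_cmult)?; (subst iter_deriv_affine[OF bC])?)
           (auto intro!: Cinf_minus)
      finally have "norm (iter_deriv ws (a k) x) <= norm (iter_deriv ws (%x. 1::complex) x) +
          ((1 / 2) ^ k) ^ length ws * norm (iter_deriv ws b ((1 / 2) ^ k *\<^sub>R x))"
        by (auto intro!: order_trans[OF norm_triangle_ineq4])
      also have "... <= 1 + 1 * C"
        using norm_iter_deriv_const[of ws "1::complex" x] C
        by (intro add_mono mult_mono power_le_one) auto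
      finally show ?thesis by simp
    qed
    then show ?thesis by blast
  qed
  have a0: "a k x = 0" if "norm x < 2 ^ k" for k x
  proof -
    have "norm ((1 / 2) ^ k *\<^sub>R x) <= 1" using that by (simp add: power_one_over field_simps)
    then show ?thesis by (simp add: a_def b(2))
  qed
  define g where "g = FT 1 f"
  have g: "g \<in> schwartz" unfolding g_def using f by (intro FT_schwartz) auto
  have ap: "pgrow (a k)" for k
    unfolding pgrow_def using aC aB by (metis mult_cancel_left1 power_0 mult.right_neutral)
  have agS: "(%x. a k x * g x) \<in> schwartz" for k using ap g by (rule schwartz_mult)
  have eq: "(%x. f x - Mul (?b k) f x) = FT (- 1) (%x. a k x * g x)" for k
  proof -
    have S: "(%x. ?b k x * g x) \<in> schwartz" using g pgrow_test_fun[OF tb] by (intro schwartz_mult)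
    have "f x = FT (- 1) g x" for x unfolding g_def using FT_inversion[OF f, of 1] by simp
    also have "FT (- 1) g x = FT (- 1) (%x. a k x * g x + ?b k x * g x) x" for x
      by (simp add: a_def algebra_simps)
    also have "... x = FT (- 1) (%x. a k x * g x) x + Mul (?b k) f x" for x
      unfolding Mul_def g_def[symmetric] by (rule FT_add[OF agS S])
    finally show ?thesis by auto
  qed
  have "sb (%f. \<Phi> (FT (- 1) f))" using \<Phi> by (rule sb_compose[OF _ scont_FT]) simp
  then obtain C M where CM: "C >= 0" "!!f. f \<in> schwartz ==> \<Phi> (FT (- 1) f) <= C * schwartz_norm M f"
    unfolding sb_def by blast
  have "\<exists>K. \<forall>k x. jb x ^ M * norm (iter_deriv vs (%x. a k x * g x) x) <= K / 2 ^ k"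
    if "vs \<in> basis_lists M" for vs
    using that by (intro cutoff_decay g aC aB a0) (auto simp: basis_lists_def)
  then obtain K where K: "!!vs k x. vs \<in> basis_lists M ==>
      jb x ^ M * norm (iter_deriv vs (%x. a k x * g x) x) <= K vs / 2 ^ k" by metis
  have "schwartz_norm M (%x. a k x * g x) <= (\<Sum>vs\<in>basis_lists M. K vs) / 2 ^ k" for k
    unfolding schwartz_norm_def sum_divide_distrib using K by (intro sum_mono cSUP_least) auto
  then have le: "\<Phi> (%x. f x - Mul (?b k) f x) <= C * ((\<Sum>vs\<in>basis_lists M. K vs) / 2 ^ k)" for k
    unfolding eq using CM agS by (meson order_trans mult_left_mono)
  have ge: "0 <= \<Phi> (%x. f x - Mul (?b k) f x)" for k
    unfolding eq using \<Phi>0 FT_schwartz[OF _ agS] by simp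
  have "(%k. C * ((\<Sum>vs\<in>basis_lists M. K vs) * (1 / 2) ^ k)) \<longlonglongrightarrow> C * ((\<Sum>vs\<in>basis_lists M. K vs) * 0)"
    by (intro tendsto_intros LIMSEQ_realpow_zero) auto
  then have "(%k. C * ((\<Sum>vs\<in>basis_lists M. K vs) / 2 ^ k)) \<longlonglongrightarrow> 0"
    by (simp add: power_one_over)
  then show ?thesis
    by (rule tendsto_sandwich[OF _ _ tendsto_const, rotated 2])
       (intro always_eventually allI le ge)+
qed

section \<open>Duality of Lebesgue norms\<close>

definition lnorm :: "real => ('a::euclidean_space => complex) => real" where
  "lnorm r f = (LBINT x. norm (f x) powr r) powr (1 / r)"

definition conjugate_exps :: "real => real => bool" where
  "conjugate_exps p q \<longleftrightarrow> 1 < p \<and> 1 < q \<and> 1 / p + 1 / q = 1"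

lemma conjugate_exps_sym: "conjugate_exps p q \<longleftrightarrow> conjugate_exps q p"
  by (auto simp: conjugate_exps_def add.commute)

lemma conjugate_expsE: assumes "1 < p" obtains q where "conjugate_exps p q"
  by (rule that[of "p / (p - 1)"]) (use assms in \<open>auto simp: conjugate_exps_def field_simps\<close>)

lemma conjugate_exps_mult: "conjugate_exps p q ==> (p - 1) * q = p"
  by (auto simp: conjugate_exps_def field_simps)

abbreviation sob :: "real => nat => ('a::euclidean_space => complex) => real" where
  "sob r N f == \<Sum>vs\<in>basis_lists N. lnorm r (iter_deriv vs f)"

lemma lnorm_nonneg [simp]: "0 <= lnorm r f" by (simp add: lnorm_def)

lemma lnorm_powr: "r > 0 ==> lnorm r f powr r = (LBINT x. norm (f x) powr r)"
  by (simp add: lnorm_def powr_powr)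

lemma lnorm_cmult: "r > 0 ==> lnorm r (%x. c * f x) = norm c * lnorm r f"
  by (simp add: lnorm_def norm_mult powr_mult powr_powr)

lemma schwartz_Lp:
  assumes f: "f \<in> schwartz" and r: "1 <= r"
  shows "f \<in> Lp_fun r"
proof -
  have [measurable]: "f \<in> borel_measurable borel" using schwartz_measurable[OF f] .
  have "integrable lborel (%x. norm (f x) powr r)"
  proof (rule Bochner_Integration.integrable_bound)
    show "integrable lborel (%x. schwartz_norm 0 f powr (r - 1) * norm (f x))"
      using schwartz_integrable[OF f] by simp
    have "norm (f x) powr r <= schwartz_norm 0 f powr (r - 1) * norm (f x)" for x
    proof -
      have "norm (f x) powr r = norm (f x) powr (r - 1) * norm (f x)"
        by (cases "f x = 0") (simp_all add: powr_diff)
      also have "... <= schwartz_norm 0 f powr (r - 1) * norm (f x)"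
        using r schwartz_norm_ge0[OF f] by (intro mult_right_mono powr_mono2) auto
      finally show ?thesis .
    qed
    then show "AE x in lborel. norm (norm (f x) powr r) <= norm (schwartz_norm 0 f powr (r - 1) * norm (f x))"
      by (intro AE_I2) (simp add: order_trans[OF _ abs_ge_self])
  qed measurable
  then show ?thesis by (simp add: Lp_fun_def)
qed

lemma holder:
  assumes pq: "conjugate_exps p q" and f: "f \<in> Lp_fun p" and g: "g \<in> Lp_fun q"
  shows "integrable lborel (%x. f x * g x)" "(LBINT x. norm (f x * g x)) <= lnorm p f * lnorm q g"
proof -
  have p: "p > 1" "q > 1" "1 / p + 1 / q = 1" using pq by (auto simp: conjugate_exps_def)
  have [measurable]: "f \<in> borel_measurable lborel" "g \<in> borel_measurable lborel"
    and fi: "integrable lborel (%x. norm (f x) powr p)" and gi: "integrable lborel (%x. norm (g x) powr q)"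
    using f g by (auto simp: Lp_fun_def)
  have y: "norm (f x * g x) <= norm (f x) powr p / p + norm (g x) powr q / q" for x
    using Youngs_inequality[OF p, of "norm (f x)" "norm (g x)"] by (simp add: norm_mult)
  have i0: "integrable lborel (%x. norm (f x) powr p / p + norm (g x) powr q / q)"
    using fi gi by simp
  show i: "integrable lborel (%x. f x * g x)"
    by (rule Bochner_Integration.integrable_bound[OF i0])
       (auto intro!: AE_I2 order_trans[OF y])
  let ?A = "lnorm p f" and ?B = "lnorm q g"
  consider "?A = 0" | "?B = 0" | "?A > 0" "?B > 0" by (metis lnorm_nonneg order_le_less)
  then show "(LBINT x. norm (f x * g x)) <= ?A * ?B"
  proof cases
    case 1
    then have "(LBINT x. norm (f x) powr p) = 0" using p lnorm_powr[of p f] by simp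
    then have "AE x in lborel. norm (f x) powr p = 0"
      using integral_nonneg_eq_0_iff_AE[OF fi] by simp
    then have "AE x in lborel. norm (f x * g x) = 0" by (rule AE_mp) (auto intro!: AE_I2)
    then have "(LBINT x. norm (f x * g x)) = 0" by (rule integral_eq_zero_AE)
    then show ?thesis using 1 by simp
  next
    case 2
    then have "(LBINT x. norm (g x) powr q) = 0" using p lnorm_powr[of q g] by simp
    then have "AE x in lborel. norm (g x) powr q = 0"
      using integral_nonneg_eq_0_iff_AE[OF gi] by simp
    then have "AE x in lborel. norm (f x * g x) = 0" by (rule AE_mp) (auto intro!: AE_I2)
    then have "(LBINT x. norm (f x * g x)) = 0" by (rule integral_eq_zero_AE)
    then show ?thesis using 2 by simp
  next
    case 3
    have "norm (f x * g x) / (?A * ?B) <= norm (f x) powr p / (p * ?A powr p) + norm (g x) powr q / (q * ?B powr q)" for x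
      using Youngs_inequality[OF p, of "norm (f x) / ?A" "norm (g x) / ?B"] 3
      by (simp add: norm_mult powr_divide mult.commute)
    then have "(LBINT x. norm (f x * g x) / (?A * ?B)) <=
       (LBINT x. norm (f x) powr p / (p * ?A powr p) + norm (g x) powr q / (q * ?B powr q))"
      using i fi gi by (intro integral_mono) auto
    also have "... = ?A powr p / (p * ?A powr p) + ?B powr q / (q * ?B powr q)"
      using fi gi p by (simp add: lnorm_powr)
    also have "... = 1" using 3 p by simp
    finally show ?thesis using 3 by (simp add: divide_le_eq)
  qed
qed

lemma holder_schwartz:
  assumes "conjugate_exps p q" "f \<in> schwartz" "g \<in> schwartz"
  shows "norm (LBINT x. f x * g x) <= lnorm p f * lnorm q g"
proof -
  have "norm (LBINT x. f x * g x) <= (LBINT x. norm (f x * g x))" by (rule integral_norm_bound)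
  also have "... <= lnorm p f * lnorm q g"
    using assms by (intro holder(2) schwartz_Lp) (auto simp: conjugate_exps_def)
  finally show ?thesis .
qed

section \<open>Approximation by test functions and the converse of Hoelder's inequality\<close>

lemma cutoff_test_fun:
  assumes "is_cutoff b" shows "b \<in> test_fun UNIV"
  using assms
  by (intro test_funI[of _ "cball 0 2"]) (auto simp: is_cutoff_def smooth_on_open)

lemma Cinf_real_polynomial:
  fixes g :: "'a::euclidean_space => real"
  shows "real_polynomial_function g ==> Cinf UNIV g"
  by (induction rule: real_polynomial_function.induct)
     (auto intro: Cinf_bounded_linear Cinf_add Cinf_mult)

text \<open>Instead of mollifying, real and imaginary part are approximated by polynomials on a ball
  (Stone-Weierstrass) and multiplied by a cut-off that is 1 on radius R and 0 beyond 2R.\<close>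

lemma test_fun_approx:
  fixes f :: "'a::euclidean_space => complex"
  assumes b: "is_cutoff (b :: 'a => complex)" and f: "continuous_on UNIV f" and R: "R > 0"
    and f0: "!!x. norm x > R ==> f x = 0" and e: "e > 0"
  obtains g where "g \<in> test_fun UNIV" "!!x. norm (f x - g x) <= e" "!!x. norm x > 2 * R ==> g x = 0"
proof -
  let ?\<eta> = "%x. b ((1 / R) *\<^sub>R x)"
  have \<eta>t: "?\<eta> \<in> test_fun UNIV" using cutoff_test_fun[OF b] R by (intro test_fun_dilation) auto
  obtain C where C: "C >= 0" "!!x. norm (?\<eta> x) <= C" using test_fun_bounded[OF \<eta>t] by metis
  \<comment> \<open>Real and imaginary part contribute \<open>\<delta>\<close> each and the cut-off
    multiplies the error by at most \<open>C\<close>; the choice makes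
    \<open>C * (2 * \<delta>)\<close> at most \<open>e\<close>.\<close>
  define \<delta> where "\<delta> = e / (2 * (C + 1))"
  have \<delta>: "\<delta> > 0" using e C by (simp add: \<delta>_def)
  have "continuous_on (cball 0 (2 * R)) (%x. Re (f x))" "continuous_on (cball 0 (2 * R)) (%x. Im (f x))"
    using f by (auto intro!: continuous_intros intro: continuous_on_subset)
  then obtain P Q where P: "real_polynomial_function P" "!!x. x \<in> cball 0 (2 * R) ==> \<bar>Re (f x) - P x\<bar> < \<delta>"
    and Q: "real_polynomial_function Q" "!!x. x \<in> cball 0 (2 * R) ==> \<bar>Im (f x) - Q x\<bar> < \<delta>"
    using Stone_Weierstrass_real_polynomial_function[OF compact_cball _ \<delta>] by metis
  let ?h = "%x. complex_of_real (P x) + \<i> * complex_of_real (Q x)"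
  have h: "Cinf UNIV ?h"
    using P(1) Q(1) Cinf_real_polynomial by (intro Cinf_add Cinf_mult Cinf_of_real) auto
  have near: "norm (f x - ?h x) <= 2 * \<delta>" if "norm x <= 2 * R" for x
  proof -
    have "norm (f x - ?h x) <= \<bar>Re (f x - ?h x)\<bar> + \<bar>Im (f x - ?h x)\<bar>" by (rule cmod_le)
    then show ?thesis using P(2)[of x] Q(2)[of x] that by simp
  qed
  show ?thesis
  proof (rule that[of "%x. ?\<eta> x * ?h x"])
    show "(%x. ?\<eta> x * ?h x) \<in> test_fun UNIV" using \<eta>t h by (intro test_fun_mult) auto
    show \<eta>0: "?\<eta> x * ?h x = 0" if "norm x > 2 * R" for x
      using that b R by (simp add: is_cutoff_def field_simps)
    show "norm (f x - ?\<eta> x * ?h x) <= e" for x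
    proof (cases "norm x <= 2 * R")
      case True
      have "f x = ?\<eta> x * f x"
        using f0[of x] b R by (cases "norm x <= R") (auto simp: is_cutoff_def field_simps)
      then have "f x - ?\<eta> x * ?h x = ?\<eta> x * (f x - ?h x)" by (metis right_diff_distrib)
      then have "norm (f x - ?\<eta> x * ?h x) = norm (?\<eta> x) * norm (f x - ?h x)"
        by (simp only: norm_mult)
      also have "... <= C * (2 * \<delta>)" using near[OF True] C \<delta> by (intro mult_mono) auto
      also have "... <= e" using C e by (simp add: \<delta>_def field_simps)
      finally show ?thesis .
    next
      case False
      then have "f x = 0" "?\<eta> x * ?h x = 0" using f0[of x] \<eta>0[of x] R by auto
      then show ?thesis using e by (simp only: diff_zero norm_zero less_imp_le)
    qed
  qed
qed

lemma lnorm_tendsto: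
  fixes h :: "'a::euclidean_space => complex"
  assumes r: "r > 0" and [measurable]: "!!n. h' n \<in> borel_measurable borel" "h \<in> borel_measurable borel"
    and lim: "AE x in lborel. (%n. h' n x) \<longlonglongrightarrow> h x"
    and bd: "!!n x. norm (h' n x) <= C" and C: "C >= 0" and supp: "!!n x. norm x > R ==> h' n x = 0"
  shows "(%n. lnorm r (h' n)) \<longlonglongrightarrow> lnorm r h"
  unfolding lnorm_def
proof (rule tendsto_powr2)
  show "(%n. LBINT x. norm (h' n x) powr r) \<longlonglongrightarrow> (LBINT x. norm (h x) powr r)"
  proof (rule integral_dominated_convergence[where w="%x. indicator (cball 0 R) x *\<^sub>R C powr r"])
    show "AE x in lborel. (%n. norm (h' n x) powr r) \<longlonglongrightarrow> norm (h x) powr r"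
      using lim by eventually_elim (use r in \<open>auto intro!: tendsto_powr2 tendsto_norm tendsto_const\<close>)
    show "AE x in lborel. norm (norm (h' n x) powr r) <= indicator (cball 0 R) x *\<^sub>R C powr r" for n
      using bd supp r by (intro AE_I2) (auto simp: indicator_def intro!: powr_mono2)
    show "integrable lborel (%x::'a. indicator (cball 0 R) x *\<^sub>R C powr r)"
      by (intro integrable_scaleR_left integrable_real_indicator emeasure_lborel_cball_finite) auto
  qed measurable
qed (use r in \<open>auto intro!: always_eventually\<close>)

lemma integral_mult_tendsto:
  fixes h :: "'a::euclidean_space => complex"
  assumes [measurable]: "!!n. h' n \<in> borel_measurable borel" "h \<in> borel_measurable borel" "g \<in> borel_measurable borel"
    and loc: "integrable lborel (%x. indicator (cball 0 R) x *\<^sub>R g x)"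
    and lim: "AE x in lborel. (%n. h' n x) \<longlonglongrightarrow> h x"
    and bd: "!!n x. norm (h' n x) <= C" and C: "C >= 0" and supp: "!!n x. norm x > R ==> h' n x = 0"
  shows "(%n. LBINT x. g x * h' n x) \<longlonglongrightarrow> (LBINT x. g x * h x)"
proof (rule integral_dominated_convergence[where w="%x. norm (indicator (cball 0 R) x *\<^sub>R g x) * C"])
  show "AE x in lborel. (%n. g x * h' n x) \<longlonglongrightarrow> g x * h x"
    using lim by eventually_elim (rule tendsto_mult_left)
  show "AE x in lborel. norm (g x * h' n x) <= norm (indicator (cball 0 R) x *\<^sub>R g x) * C" for n
    using bd supp by (intro AE_I2) (auto simp: indicator_def norm_mult intro!: mult_left_mono)
  show "integrable lborel (%x. norm (indicator (cball 0 R) x *\<^sub>R g x) * C)"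
    by (intro integrable_mult_left integrable_norm loc)
qed measurable

text \<open>A measurable function is an almost everywhere limit of continuous ones, but these need
  not be uniformly bounded or supported in a common ball. Truncation of values and of support
  restores both without changing the limit.\<close>

lemma measurable_approx:
  fixes f :: "'a::euclidean_space => complex"
  assumes b: "is_cutoff (b :: 'a => complex)" and [measurable]: "f \<in> borel_measurable borel" and R: "R > 0"
    and f0: "!!x. norm x > R ==> f x = 0" and fb: "!!x. norm (f x) <= R"
  obtains h where "!!n::nat. h n \<in> test_fun UNIV" "!!n x. norm (h n x) <= R + 1"
    "!!n x. norm x > 2 * (R + 1) ==> h n x = 0" "AE x in lborel. (%n. h n x) \<longlonglongrightarrow> f x"
proof -
  have "f measurable_on UNIV" 
    by (intro lebesgue_measurable_imp_measurable_on measurable_completion) auto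
  then have "\<exists>N g. negligible N \<and> (\<forall>n. continuous_on UNIV (g n)) \<and>
      (\<forall>x. x \<notin> N --> (%n. g n x) \<longlonglongrightarrow> f x)"
    by (simp add: measurable_on_def)
  then obtain N g where N: "negligible N" and g: "!!n::nat. continuous_on UNIV (g n)"
    and lim: "!!x. x \<notin> N ==> (%n. g n x) \<longlonglongrightarrow> f x"
    by blast
  \<comment> \<open>\<open>cl\<close> is the radial retraction onto the disc of radius
    \<open>R\<close>, and \<open>\<eta>\<close> is a tent equal to 1 for |x| <= R and 0 for |x| >= R
    + 1; both leave \<open>f\<close> unchanged.\<close>
  define cl where "cl z = (R / max R (norm z)) *\<^sub>R z" for z :: complex
  define \<eta> where "\<eta> x = max 0 (min 1 (R + 1 - norm x))" for x :: 'a
  have clc: "continuous_on UNIV cl"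
    unfolding cl_def[abs_def] using R by (auto intro!: continuous_intros)
  have clb: "norm (cl z) <= R" for z using R by (auto simp: cl_def max_def field_simps)
  have cli: "cl z = z" if "norm z <= R" for z using that R by (simp add: cl_def max_def)
  let ?h = "%n x. \<eta> x *\<^sub>R cl (g n x)"
  have "\<bar>\<eta> x\<bar> <= 1" for x by (simp add: \<eta>_def)
  have hR: "norm (?h n x) <= R" for n x
    using mult_mono[OF \<open>\<bar>\<eta> x\<bar> <= 1\<close> clb[of "g n x"]] R by simp
  have "\<forall>n. \<exists>k. k \<in> test_fun UNIV \<and> (\<forall>x. norm (?h n x - k x) <= inverse (real (Suc n))) \<and> (\<forall>x. norm x > 2 * (R + 1) --> k x = 0)"
  proof
    fix n
    have "continuous_on UNIV (?h n)"
      unfolding \<eta>_def by (intro continuous_intros continuous_on_compose2[OF clc g]) auto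
    then show "\<exists>k. k \<in> test_fun UNIV \<and> (\<forall>x. norm (?h n x - k x) <= inverse (real (Suc n))) \<and> (\<forall>x. norm x > 2 * (R + 1) --> k x = 0)"
      by (rule test_fun_approx[OF b, of _ "R + 1" "inverse (real (Suc n))"]) (use R in \<open>auto simp: \<eta>_def\<close>)
  qed
  from choice[OF this] obtain k where k: "\<forall>n. k n \<in> test_fun UNIV \<and> (\<forall>x. norm (?h n x - k n x) <= inverse (real (Suc n))) \<and>
      (\<forall>x. norm x > 2 * (R + 1) --> k n x = 0)" by (rule exE)
  show ?thesis
  proof (rule that[of k])
    show "norm (k n x) <= R + 1" for n x
    proof -
      have "norm (k n x) <= norm (?h n x) + norm (?h n x - k n x)"
        using norm_triangle_ineq2[of "k n x" "?h n x"] by (simp add: norm_minus_commute)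
      moreover have "inverse (real (Suc n)) <= 1" by (simp add: inverse_le_1_iff)
      moreover have "norm (?h n x - k n x) <= inverse (real (Suc n))" using k by blast
      ultimately show ?thesis using hR[of x n] by linarith
    qed
    have lim': "(%n. k n x) \<longlonglongrightarrow> f x" if "x \<notin> N" for x
    proof -
      have "(%n. cl (g n x)) \<longlonglongrightarrow> cl (f x)"
        by (rule continuous_on_tendsto_compose[OF clc lim[OF that]]) auto
      then have "(%n. ?h n x) \<longlonglongrightarrow> \<eta> x *\<^sub>R f x" by (intro tendsto_scaleR tendsto_const) (simp add: cli fb)
      moreover have "\<eta> x *\<^sub>R f x = f x" using f0[of x] by (cases "norm x <= R") (auto simp: \<eta>_def)
      moreover have "(%n. ?h n x - k n x) \<longlonglongrightarrow> 0"
        by (rule Lim_null_comparison[OF always_eventually LIMSEQ_inverse_real_of_nat]) (use k in simp)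
      ultimately show ?thesis using tendsto_diff[of "%n. ?h n x" "f x" sequentially "%n. ?h n x - k n x" 0] by simp
    qed
    have "AE x in lebesgue. x \<notin> N" using N by (simp add: negligible_iff_null_sets AE_not_in)
    then have "AE x in lebesgue. (%n. k n x) \<longlonglongrightarrow> f x" by eventually_elim (rule lim')
    then show "AE x in lborel. (%n. k n x) \<longlonglongrightarrow> f x" by (simp add: AE_completion_iff)
  qed (use k in simp_all)
qed

text \<open>The hypothesis on test functions is first extended to bounded measurable functions of
  bounded support. It is then applied to the extremal function for Hoelder's inequality, truncated
  to the sets \<open>S n\<close> where |x| and |g| are bounded, and monotone convergence removes the
  truncation. Membership in L_p is part of the conclusion, not an assumption.\<close>

lemma converse_holder:
  fixes g :: "'a::euclidean_space => complex"
  assumes b: "is_cutoff (b :: 'a => complex)" and pq: "conjugate_exps p q" and gm[measurable]: "g \<in> borel_measurable borel"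
    and loc: "!!R. integrable lborel (%x. indicator (cball 0 R) x *\<^sub>R g x)" and M: "M >= 0"
    and bd: "!!f. f \<in> test_fun UNIV ==> norm (LBINT x. g x * f x) <= M * lnorm q f"
  shows "g \<in> Lp_fun p" "lnorm p g <= M"
proof -
  have p: "p > 1" "q > 1" "1 / p + 1 / q = 1" using pq by (auto simp: conjugate_exps_def)
  have bounded: "norm (LBINT x. g x * f x) <= M * lnorm q f"
    if fm[measurable]: "f \<in> borel_measurable borel" and R: "R > 0" and f0: "!!x. norm x > R ==> f x = 0"
      and fR: "!!x. norm (f x) <= R" for f R
  proof -
    obtain h where h: "!!n::nat. h n \<in> test_fun UNIV" "!!n x. norm (h n x) <= R + 1"
      "!!n x. norm x > 2 * (R + 1) ==> h n x = 0" "AE x in lborel. (%n. h n x) \<longlonglongrightarrow> f x"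
      by (rule measurable_approx[OF b fm R f0 fR], assumption, rule that)
    have [measurable]: "h n \<in> borel_measurable borel" for n using schwartz_measurable[OF test_fun_schwartz[OF h(1)]] .
    have "(%n. norm (LBINT x. g x * h n x)) \<longlonglongrightarrow> norm (LBINT x. g x * f x)"
      by (intro tendsto_norm integral_mult_tendsto[OF _ _ gm loc[of "2 * (R + 1)"] h(4) h(2)]) (use h R in auto)
    moreover have "(%n. M * lnorm q (h n)) \<longlonglongrightarrow> M * lnorm q f"
      by (intro tendsto_mult_left lnorm_tendsto[OF _ _ _ h(4) h(2)]) (use h R p in auto)
    ultimately show ?thesis by (rule LIMSEQ_le) (use bd[OF h(1)] in auto)
  qed
  define S where "S n = {x. norm x <= real (Suc n) \<and> norm (g x) <= real (Suc n)}" for n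
  have [measurable]: "S n \<in> sets borel" for n unfolding S_def by measurable
  define u where "u n x = indicator (S n) x * norm (g x) powr p" for n x
  have ui: "integrable lborel (u n)" for n
  proof (rule Bochner_Integration.integrable_bound)
    show "integrable lborel (%x::'a. indicator (cball 0 (real (Suc n))) x *\<^sub>R real (Suc n) powr p)"
      by (intro integrable_scaleR_left integrable_real_indicator emeasure_lborel_cball_finite) auto
    show "AE x in lborel. norm (u n x) <= norm (indicator (cball 0 (real (Suc n))) x *\<^sub>R real (Suc n) powr p)"
      using p by (intro AE_I2) (auto simp: u_def S_def indicator_def intro!: powr_mono2)
  qed (simp add: u_def[abs_def])
  have uM: "(LBINT x. u n x) <= M powr p" for n
  proof -
    let ?I = "LBINT x. u n x"
    \<comment> \<open>The extremal function: \<open>g x * f x\<close> equals |g|^p and |f|^q equals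
      |g|^p on \<open>S n\<close>, so the assumption reads I <= M I^(1/q) and yields I^(1/p) <=
      M.\<close>
    define f where "f x = indicator (S n) x * (cnj (sgn (g x)) * complex_of_real (norm (g x) powr (p - 1)))" for x
    have [measurable]: "cnj \<in> borel_measurable borel" "complex_of_real \<in> borel_measurable borel"
      by (intro borel_measurable_continuous_onI continuous_intros)+
    have [measurable]: "f \<in> borel_measurable borel" unfolding f_def sgn_div_norm by measurable
    have gf: "g x * f x = complex_of_real (u n x)" for x
    proof (cases "g x = 0")
      case False
      have "g x * cnj (sgn (g x)) = complex_of_real (norm (g x))"
      proof -
        have "g x * cnj (sgn (g x)) = (g x * cnj (g x)) / complex_of_real (norm (g x))"
          by (simp add: sgn_div_norm scaleR_conv_of_real divide_inverse)
        also have "... = complex_of_real ((norm (g x))\<^sup>2) / complex_of_real (norm (g x))"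
          by (simp only: complex_norm_square)
        finally show ?thesis using False by (simp add: power2_eq_square)
      qed
      moreover have "norm (g x) * norm (g x) powr (p - 1) = norm (g x) powr p"
        using False by (simp add: powr_diff)
      ultimately show ?thesis
        unfolding f_def u_def by (auto simp: indicator_def mult.assoc[symmetric] simp flip: of_real_mult)
    qed (simp add: f_def u_def)
    have fq: "norm (f x) powr q = u n x" for x
      using conjugate_exps_mult[OF pq]
      by (cases "g x = 0") (auto simp: f_def u_def indicator_def norm_mult norm_sgn powr_powr)
    have fb: "norm (f x) <= real (Suc n) powr (p - 1)" for x
      using p by (auto simp: f_def norm_mult norm_sgn indicator_def S_def intro!: powr_mono2)
    let ?R = "max (real (Suc n)) (real (Suc n) powr (p - 1))"
    have "norm (LBINT x. g x * f x) <= M * lnorm q f"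
      by (rule bounded[of f ?R]) (use fb in \<open>auto simp: f_def S_def indicator_def le_max_iff_disj\<close>)
    moreover have "(LBINT x. g x * f x) = complex_of_real ?I"
      unfolding gf by (rule integral_complex_of_real)
    moreover have I0: "?I >= 0" by (intro integral_nonneg_AE AE_I2) (auto simp: u_def)
    moreover have "lnorm q f = ?I powr (1 / q)" unfolding lnorm_def fq ..
    ultimately have le: "?I <= M * ?I powr (1 / q)" by simp
    show "?I <= M powr p"
    proof (cases "?I = 0")
      case False
      then have Ip: "?I > 0" using I0 by simp
      have "?I powr (1 / p) * ?I powr (1 / q) = ?I" using Ip p by (simp flip: powr_add)
      then have "?I powr (1 / p) * ?I powr (1 / q) <= M * ?I powr (1 / q)" using le by simp
      then have "?I powr (1 / p) <= M" using Ip by simp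
      then have "(?I powr (1 / p)) powr p <= M powr p" using p by (intro powr_mono2) auto
      then show ?thesis using Ip p by (simp add: powr_powr)
    qed (use M in simp)
  qed
  have mono: "AE x in lborel. incseq (%n. u n x)"
    by (intro AE_I2) (auto simp: incseq_def u_def S_def indicator_def)
  have lim: "AE x in lborel. (%n. u n x) \<longlonglongrightarrow> norm (g x) powr p"
  proof (intro AE_I2)
    fix x
    obtain k where k: "max (norm x) (norm (g x)) <= real k" using real_arch_simple by blast
    have "u n x = norm (g x) powr p" if "n >= k" for n
    proof -
      have "real k <= real (Suc n)" using that by simp
      then have "x \<in> S n" using k unfolding S_def by (auto intro: order_trans)
      then show ?thesis by (simp add: u_def)
    qed
    then show "(%n. u n x) \<longlonglongrightarrow> norm (g x) powr p"
      by (intro tendsto_eventually) (auto simp: eventually_sequentially)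
  qed
  have inc: "incseq (%n. LBINT x. u n x)"
    unfolding incseq_def using ui by (intro allI impI integral_mono) (auto simp: u_def S_def indicator_def)
  obtain L where L: "(%n. LBINT x. u n x) \<longlonglongrightarrow> L"
    using incseq_convergent[OF inc] uM by blast
  have LM: "L <= M powr p" by (rule LIMSEQ_le_const2[OF L]) (use uM in blast)
  have int: "integrable lborel (%x. norm (g x) powr p)"
    by (rule integrable_monotone_convergence[OF ui mono lim L]) measurable
  then show "g \<in> Lp_fun p" by (simp add: Lp_fun_def)
  have "(LBINT x. norm (g x) powr p) = L"
    by (rule integral_monotone_convergence[OF ui mono lim L]) measurable
  then have "lnorm p g <= (M powr p) powr (1 / p)"
    unfolding lnorm_def using LM p by (intro powr_mono2) (auto intro: LIMSEQ_le_const[OF L] exI)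
  then show "lnorm p g <= M" using p M by (simp add: powr_powr)
qed

section \<open>Regularisation of tempered distributions\<close>

lemma iter_deriv_diff:
  assumes f: "Cinf UNIV f" and g: "Cinf UNIV g"
  shows "iter_deriv vs (%x. f x - g x) = (%x. iter_deriv vs f x - iter_deriv vs g x)"
  using iter_deriv_add[OF f Cinf_minus[OF open_UNIV g], of vs]
    iter_deriv_linear_compose[OF bounded_linear_minus[OF bounded_linear_ident] g, of vs] by simp

lemma iter_deriv_translate:
  assumes "Cinf UNIV f"
  shows "iter_deriv vs (%x. f (x - y)) = (%x. iter_deriv vs f (x - y))"
  using iter_deriv_affine[OF assms, of vs 1 "- y"] by simp

lemma Cinf_translate: "Cinf UNIV f ==> Cinf UNIV (%x. f (x - y))"
  using Cinf_affine[of f 1 "- y"] by simp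

lemma schwartz_weight_deriv:
  assumes "f \<in> schwartz" "set vs \<subseteq> Basis"
  shows "jb x ^ N * norm (iter_deriv vs f x) <= schwartz_norm (N + length vs) f"
  using assms by (intro schwartz_norm_ge) auto

lemma schwartz_translate:
  assumes f: "f \<in> schwartz" shows "(%x. f (x - y)) \<in> schwartz"
  unfolding schwartz_iff
proof (intro conjI allI impI Cinf_translate schwartz_Cinf[OF f])
  fix vs :: "'a list" and N assume vs: "set vs \<subseteq> Basis"
  have "jb x ^ N * norm (iter_deriv vs f (x - y)) <= jb y ^ N * schwartz_norm (N + length vs) f" for x
  proof -
    have "jb x ^ N <= (jb (x - y) * jb y) ^ N"
      by (intro power_mono one_plus_norm_shift) auto
    then have "jb x ^ N * norm (iter_deriv vs f (x - y)) <=
        (jb (x - y) * jb y) ^ N * norm (iter_deriv vs f (x - y))"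
      by (rule mult_right_mono) auto
    also have "... = jb y ^ N * (jb (x - y) ^ N * norm (iter_deriv vs f (x - y)))"
      by (simp only: power_mult_distrib mult_ac)
    also have "... <= jb y ^ N * schwartz_norm (N + length vs) f"
      by (intro mult_left_mono schwartz_weight_deriv f vs) auto
    finally show ?thesis .
  qed
  then show "\<exists>B. \<forall>x. jb x ^ N * norm (iter_deriv vs (%x. f (x - y)) x) <= B"
    unfolding iter_deriv_translate[OF schwartz_Cinf[OF f]] by blast
qed

lemma schwartz_reflect:
  assumes f: "f \<in> schwartz" shows "(%x. f (- x)) \<in> schwartz"
proof -
  have C: "Cinf UNIV f" using f by (rule schwartz_Cinf)
  have "norm (iter_deriv vs (%x. f (- x)) x) = norm (iter_deriv vs f (- x))" for vs x
    using iter_deriv_affine[OF C, of vs "-1" 0] by (simp add: power_abs)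
  moreover have "Cinf UNIV (%x. f (- x))" using Cinf_affine[OF C, of "-1" 0] by simp
  moreover have "\<exists>B. \<forall>x. jb x ^ N * norm (iter_deriv vs f (- x)) <= B" if "set vs \<subseteq> Basis" for vs N
    using schwartz_weight_deriv[OF f that, of "- _" N] by (auto simp: norm_minus_cancel)
  ultimately show ?thesis unfolding schwartz_iff by simp
qed

lemma norm_Dv_le:
  fixes f :: "'a::euclidean_space => 'b::real_normed_vector"
  assumes "f differentiable (at x)"
  shows "norm (Dv v f x) <= norm v * (\<Sum>b\<in>Basis. norm (Dv b f x))"
proof -
  have "Dv v f x = (\<Sum>b\<in>Basis. (v \<bullet> b) *\<^sub>R Dv b f x)"
    by (rule linear_eq_sum_Basis[OF Dv_linear[OF assms]])
  also have "norm ... <= (\<Sum>b\<in>Basis. norm v * norm (Dv b f x))"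
    by (intro order_trans[OF norm_sum] sum_mono) (auto intro!: mult_right_mono Basis_le_norm)
  finally show ?thesis by (simp add: sum_distrib_left)
qed

text \<open>Mean value inequality along the segment joining the two shifted points, for each
  derivative of \<open>K\<close>. The weight at x is moved to the intermediate point x - w at the
  price of \<open>jb w\<close>, and \<open>jb w\<close> is at most \<open>jb y * jb z\<close>
  because w lies between y and z.\<close>

lemma translate_lipschitz:
  fixes K :: "'a::euclidean_space => complex"
  assumes K: "K \<in> schwartz"
  shows "\<exists>C\<ge>0. \<forall>y z. schwartz_norm N (%x. K (x - z) - K (x - y)) <= C * norm (z - y) * (jb y * jb z) ^ N"
proof -
  define A where "A vs = (\<Sum>b\<in>(Basis::'a set). schwartz_norm (N + Suc (length vs)) K)" for vs :: "'a list"
  have A0: "A vs >= 0" for vs unfolding A_def by (intro sum_nonneg schwartz_norm_nonneg K)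
  have pt: "jb x ^ N * norm (iter_deriv vs K (x - z) - iter_deriv vs K (x - y)) <=
      A vs * (norm (z - y) * (jb y * jb z) ^ N)" if vs: "set vs \<subseteq> Basis" for x y z vs
  proof -
    let ?L = "iter_deriv vs K" and ?P = "(jb y * jb z) ^ N"
    have L: "Cinf UNIV ?L" by (intro Cinf_iter_deriv schwartz_Cinf K)
    have "norm (?L (x - z) - ?L (x - y)) <= (A vs * ?P / jb x ^ N) * norm ((x - z) - (x - y))"
    proof (rule differentiable_bound[where S="closed_segment (x - y) (x - z)" and f'="%u v. Dv v ?L u"])
      fix u assume "u \<in> closed_segment (x - y) (x - z)"
      then obtain t where t: "0 <= t" "t <= 1" "u = (1 - t) *\<^sub>R (x - y) + t *\<^sub>R (x - z)"
        by (auto simp: closed_segment_def)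
      define w where "w = (1 - t) *\<^sub>R y + t *\<^sub>R z"
      have u: "u = x - w" using t by (simp add: w_def algebra_simps)
      have "norm w <= (1 - t) * norm y + t * norm z"
        unfolding w_def using t by (intro order_trans[OF norm_triangle_ineq]) auto
      also have "... <= norm y + norm z" using t by (intro add_mono) (auto simp: mult_left_le_one_le)
      finally have "1 + norm w <= jb y * jb z"
        using mult_nonneg_nonneg[OF norm_ge_zero norm_ge_zero, of y z] by (simp only: distrib_left distrib_right mult_1_left mult_1_right)
      then have "jb x <= jb u * (jb y * jb z)"
        unfolding u by (intro order_trans[OF one_plus_norm_shift[of x w]] mult_left_mono) auto
      then have P: "jb x ^ N <= jb u ^ N * ?P"
        unfolding power_mult_distrib[symmetric] by (intro power_mono) auto
      have db: "norm (Dv b ?L u) <= schwartz_norm (N + Suc (length vs)) K * ?P / jb x ^ N" if "b \<in> Basis" for b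
      proof -
        have "jb x ^ N * norm (Dv b ?L u) <= (jb u ^ N * ?P) * norm (Dv b ?L u)"
          using P by (rule mult_right_mono) simp
        also have "... = (jb u ^ N * norm (iter_deriv (b # vs) K u)) * ?P" by (simp add: mult_ac)
        also have "... <= schwartz_norm (N + Suc (length vs)) K * ?P"
          using schwartz_weight_deriv[OF K, of "b # vs" u N] vs that by (intro mult_right_mono) auto
        finally show ?thesis by (simp add: pos_le_divide_eq mult.commute)
      qed
      have "norm (Dv v ?L u) <= (A vs * ?P / jb x ^ N) * norm v" for v
      proof -
        have "norm (Dv v ?L u) <= norm v * (\<Sum>b\<in>Basis. norm (Dv b ?L u))"
          by (rule norm_Dv_le[OF Cinf_differentiable[OF L UNIV_I]])
        also have "... <= norm v * (\<Sum>b\<in>(Basis::'a set). schwartz_norm (N + Suc (length vs)) K * ?P / jb x ^ N)"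
          using db by (intro mult_left_mono sum_mono) auto
        also have "... = (A vs * ?P / jb x ^ N) * norm v" by (simp add: A_def)
        finally show ?thesis .
      qed
      then show "onorm (%v. Dv v ?L u) <= A vs * ?P / jb x ^ N"
        by (rule onorm_le)
      show "(?L has_derivative (%v. Dv v ?L u)) (at u within closed_segment (x - y) (x - z))"
        by (rule has_derivative_at_withinI[OF Cinf_has_derivative[OF L UNIV_I]])
    qed auto
    also have "norm ((x - z) - (x - y)) = norm (z - y)" by (simp add: norm_minus_commute)
    finally show ?thesis by (simp add: pos_le_divide_eq mult_ac)
  qed
  show ?thesis
  proof (intro exI[of _ "\<Sum>vs\<in>basis_lists N. A vs"] conjI allI)
    show "0 <= (\<Sum>vs\<in>basis_lists N. A vs)" using A0 by (rule sum_nonneg)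
    fix y z
    have C: "Cinf UNIV K" using K by (rule schwartz_Cinf)
    have "iter_deriv vs (%x. K (x - z) - K (x - y)) = (%x. iter_deriv vs K (x - z) - iter_deriv vs K (x - y))" for vs
      by (simp add: iter_deriv_diff[OF Cinf_translate[OF C] Cinf_translate[OF C]] iter_deriv_translate[OF C])
    then have "schwartz_norm N (%x. K (x - z) - K (x - y)) <=
      (\<Sum>vs\<in>basis_lists N. A vs * (norm (z - y) * (jb y * jb z) ^ N))"
      unfolding schwartz_norm_def using pt by (intro sum_mono cSUP_least) (auto simp: basis_lists_def)
    then show "schwartz_norm N (%x. K (x - z) - K (x - y)) <=
        (\<Sum>vs\<in>basis_lists N. A vs) * norm (z - y) * (jb y * jb z) ^ N"
      by (simp add: sum_distrib_right mult.assoc)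
  qed
qed

lemma tempered_add: "w \<in> tempered ==> f \<in> schwartz ==> g \<in> schwartz ==> w (%x. f x + g x) = w f + w g"
  by (auto simp: tempered_def linear_functional_on_def)

lemma tempered_cmult: "w \<in> tempered ==> f \<in> schwartz ==> w (%x. c * f x) = c * w f"
  by (auto simp: tempered_def linear_functional_on_def)

lemma tempered_zero: "w \<in> tempered ==> w (%x. 0) = 0"
  using tempered_cmult[of w "%x. 0" 0] test_fun_schwartz[OF test_fun_zero] by simp

lemma schwartz_sum: "(!!i. i \<in> I ==> f i \<in> schwartz) ==> (%x. \<Sum>i\<in>I. f i x) \<in> schwartz"
  by (induction I rule: infinite_finite_induct)
     (auto intro: schwartz_add test_fun_schwartz[OF test_fun_zero])

lemma tempered_sum:
  "w \<in> tempered ==> (!!i. i \<in> I ==> f i \<in> schwartz) ==> w (%x. \<Sum>i\<in>I. f i x) = (\<Sum>i\<in>I. w (f i))"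
proof (induction I rule: infinite_finite_induct)
  case (insert i I)
  have "w (%x. f i x + (\<Sum>i\<in>I. f i x)) = w (f i) + w (%x. \<Sum>i\<in>I. f i x)"
    by (intro tempered_add schwartz_sum) (use insert in auto)
  then show ?case using insert by simp
qed (auto simp: tempered_zero)

lemma tempered_diff:
  assumes "w \<in> tempered" "f \<in> schwartz" "g \<in> schwartz"
  shows "w (%x. f x - g x) = w f - w g"
proof -
  have "w (%x. f x - g x) = w (%x. f x + (- 1) * g x)" by simp
  also have "... = w f + w (%x. (- 1) * g x)" using assms by (intro tempered_add schwartz_cmult)
  also have "w (%x. (- 1) * g x) = (- 1) * w g" using assms by (intro tempered_cmult)
  finally show ?thesis by simp
qed

lemma tempered_sb: "w \<in> tempered ==> sb (%f. norm (w f))"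
proof -
  assume "w \<in> tempered"
  then obtain C N where "!!f. f \<in> schwartz ==> norm (w f) <= C * schwartz_norm N f"
    unfolding tempered_def by blast
  then show ?thesis by (rule sbI)
qed

lemma tempered_translate:
  assumes w: "w \<in> tempered" and K: "K \<in> schwartz"
  shows "\<exists>C\<ge>0. \<exists>N. \<forall>y z. norm (w (%x. K (x - z)) - w (%x. K (x - y))) <= C * norm (z - y) * (jb y * jb z) ^ N"
proof -
  obtain C N where C: "C >= 0" "!!f. f \<in> schwartz ==> norm (w f) <= C * schwartz_norm N f"
    using tempered_sb[OF w] unfolding sb_def by blast
  obtain D where D: "D >= 0" "!!y z. schwartz_norm N (%x. K (x - z) - K (x - y)) <= D * norm (z - y) * (jb y * jb z) ^ N"
    using translate_lipschitz[OF K] by blast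
  have "norm (w (%x. K (x - z)) - w (%x. K (x - y))) <= (C * D) * norm (z - y) * (jb y * jb z) ^ N" for y z
  proof -
    have "norm (w (%x. K (x - z)) - w (%x. K (x - y))) = norm (w (%x. K (x - z) - K (x - y)))"
      using w K by (subst tempered_diff) (auto intro: schwartz_translate)
    also have "... <= C * (D * norm (z - y) * (jb y * jb z) ^ N)"
      using K by (intro order_trans[OF C(2)] mult_left_mono D C schwartz_diff schwartz_translate)
    finally show ?thesis by (simp add: mult_ac)
  qed
  then show ?thesis using C D by (intro exI[of _ "C * D"]) auto
qed

text \<open>The function y -> w(K(. - y)) is the regularisation of \<open>w\<close> by the reflected
  kernel, and it will serve as a density. Continuity and polynomial growth both follow from the
  Lipschitz estimate, the latter by comparison with y = 0.\<close>

lemma tempered_translate_growth: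
  assumes w: "w \<in> tempered" and K: "K \<in> schwartz"
  shows "continuous_on UNIV (%y. w (%x. K (x - y)))"
    "\<exists>C N. \<forall>y. norm (w (%x. K (x - y))) <= C * jb y ^ N"
proof -
  let ?G = "%y. w (%x. K (x - y))"
  obtain C N where C: "C >= 0" "!!y z. norm (?G z - ?G y) <= C * norm (z - y) * (jb y * jb z) ^ N"
    using tempered_translate[OF assms] by blast
  have "(?G \<longlongrightarrow> ?G y) (at y)" for y
  proof -
    have "((%z. C * norm (z - y) * (jb y * jb z) ^ N) \<longlongrightarrow>
        C * norm (y - y) * (jb y * jb y) ^ N) (at y)"
      by (intro tendsto_intros)
    then have "((%z. C * norm (z - y) * (jb y * jb z) ^ N) \<longlongrightarrow> 0) (at y)" by simp
    then have "((%z. ?G z - ?G y) \<longlongrightarrow> 0) (at y)"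
      by (rule Lim_null_comparison[rotated]) (intro always_eventually allI C)
    then show ?thesis by (simp add: LIM_zero_iff)
  qed
  then show "continuous_on UNIV ?G" by (simp add: continuous_on_def)
  have "norm (?G y) <= (norm (?G 0) + C) * jb y ^ Suc N" for y
  proof -
    have "norm (?G y) <= norm (?G 0) + norm (?G y - ?G 0)" using norm_triangle_ineq2[of "?G y" "?G 0"] by linarith
    also have "norm (?G y - ?G 0) <= C * norm y * jb y ^ N" using C(2)[of y 0] by simp
    also have "... <= C * jb y * jb y ^ N" using C by (intro mult_right_mono mult_left_mono) auto
    also have "norm (?G 0) <= norm (?G 0) * jb y ^ Suc N"
      using one_le_power[of "1 + norm y" "Suc N"] mult_left_mono[of 1 "jb y ^ Suc N" "norm (?G 0)"] by simp
    finally show ?thesis by (simp add: algebra_simps)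
  qed
  then show "\<exists>C N. \<forall>y. norm (?G y) <= C * jb y ^ N" by blast
qed

definition conv :: "('a::euclidean_space => complex) => ('a => complex) => 'a => complex" where
  "conv K G x = (LBINT y. K (x - y) * G y)"

lemma conv_integrand:
  fixes G :: "'a::euclidean_space => complex"
  assumes K: "K \<in> schwartz" and [measurable]: "G \<in> borel_measurable borel"
    and G: "!!y. norm (G y) <= C * jb y ^ N"
  shows "integrable lborel (%y. K (x - y) * G y)"
proof (rule integrable_rapid(1))
  have [measurable]: "K \<in> borel_measurable borel" using schwartz_measurable[OF K] .
  show "(%y. K (x - y) * G y) \<in> borel_measurable lborel" by measurable
  have "C >= 0" using order_trans[OF norm_ge_zero G[of 0]] by simp
  let ?k = "DIM('a) + 2"
  fix y
  have "jb y ^ ?k * norm (K (x - y) * G y) <= jb y ^ ?k * (norm (K (x - y)) * (C * jb y ^ N))"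
    unfolding norm_mult by (intro mult_left_mono G) auto
  also have "... = C * (norm (K (x - y)) * jb y ^ (?k + N))" by (simp only: power_add mult_ac)
  also have "... <= C * (norm (K (x - y)) * (jb (x - y) * jb x) ^ (?k + N))"
    using one_plus_norm_shift[of y x] \<open>C >= 0\<close> by (intro mult_left_mono power_mono) (auto simp: norm_minus_commute)
  also have "... = C * jb x ^ (?k + N) * (jb (x - y) ^ (?k + N) * norm (K (x - y)))"
    by (simp only: power_mult_distrib mult_ac)
  also have "... <= C * jb x ^ (?k + N) * schwartz_norm (?k + N) K"
    using \<open>C >= 0\<close> by (intro mult_left_mono schwartz_weight K) auto
  finally show "jb y ^ ?k * norm (K (x - y) * G y) <= C * jb x ^ (?k + N) * schwartz_norm (?k + N) K" .
qed

lemma conv_has_derivative: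
  fixes G :: "'a::euclidean_space => complex"
  assumes K: "K \<in> schwartz" and [measurable]: "G \<in> borel_measurable borel"
    and G: "!!y. norm (G y) <= C * jb y ^ N"
  shows "(conv K G has_derivative (%v. conv (Dv v K) G x)) (at x)"
proof -
  let ?k = "DIM('a) + 2"
  have C0: "C >= 0" using order_trans[OF norm_ge_zero G[of 0]] by simp
  have [measurable]: "K \<in> borel_measurable borel" using schwartz_measurable[OF K] .
  have Kd: "K differentiable (at z)" for z using Cinf_differentiable[OF schwartz_Cinf[OF K]] by blast
  define S where "S = (\<Sum>b\<in>(Basis::'a set). schwartz_norm (?k + N) (Dv b K))"
  define h where "h y = C * (2 + norm x) ^ (?k + N) * S * (1 / jb y ^ ?k)" for y :: 'a
  have "((%x. LBINT y. K (x - y) * G y) has_derivative (%v. LBINT y. Dv v K (x - y) * G y)) (at x)"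
  proof (rule has_derivative_integral[where e=1 and h=h and F'="%x y v. Dv v K (x - y) * G y"])
    show "integrable lborel h" unfolding h_def by (rule integrable_mult_right[OF integrable_weight])
    show "integrable lborel (%y. K (x - y) * G y)" for x by (rule conv_integrand[OF K _ G]) measurable
    show "((%x. K (x - y) * G y) has_derivative (%v. Dv v K (x - y) * G y)) (at x)" for x y
    proof -
      have "((%x. K (x - y)) has_derivative (%v. Dv v K (x - y))) (at x)"
        by (rule has_derivative_compose[of "%x. x - y" "%v. v" x UNIV K])
           (auto intro!: derivative_eq_intros has_derivative_frechet[OF Kd])
      then show ?thesis by (rule has_derivative_mult_left)
    qed
    show "norm (Dv v K (x' - y) * G y) <= h y * norm v" if "x' \<in> ball x 1" for x' y v
    proof -
      have x': "norm x' <= 1 + norm x"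
        using that norm_triangle_ineq2[of x' x] by (simp add: dist_norm norm_minus_commute)
      have "1 + norm y <= jb (x' - y) * (1 + norm x')"
        using one_plus_norm_shift[of y x'] by (simp add: norm_minus_commute)
      also have "... <= jb (x' - y) * (2 + norm x)" using x' by (intro mult_left_mono) auto
      finally have P: "jb y ^ (?k + N) <= jb (x' - y) ^ (?k + N) * (2 + norm x) ^ (?k + N)"
        unfolding power_mult_distrib[symmetric] by (intro power_mono) auto
      have db: "jb y ^ (?k + N) * norm (Dv b K (x' - y)) <= (2 + norm x) ^ (?k + N) * schwartz_norm (?k + N) (Dv b K)"
        if "b \<in> Basis" for b
      proof -
        have "jb y ^ (?k + N) * norm (Dv b K (x' - y)) <=
          (jb (x' - y) ^ (?k + N) * (2 + norm x) ^ (?k + N)) * norm (Dv b K (x' - y))"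
          using P by (rule mult_right_mono) simp
        also have "... = (2 + norm x) ^ (?k + N) * (jb (x' - y) ^ (?k + N) * norm (Dv b K (x' - y)))"
          by (simp only: mult_ac)
        also have "... <= (2 + norm x) ^ (?k + N) * schwartz_norm (?k + N) (Dv b K)"
          by (intro mult_left_mono schwartz_weight schwartz_Dv K that) auto
        finally show ?thesis .
      qed
      have "jb y ^ ?k * norm (Dv v K (x' - y) * G y) <=
         jb y ^ ?k * ((norm v * (\<Sum>b\<in>Basis. norm (Dv b K (x' - y)))) * (C * jb y ^ N))"
        unfolding norm_mult by (intro mult_left_mono mult_mono G norm_Dv_le Kd) (auto intro!: sum_nonneg mult_nonneg_nonneg)
      also have "... = norm v * C * (\<Sum>b\<in>Basis. jb y ^ (?k + N) * norm (Dv b K (x' - y)))"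
        by (simp only: power_add mult_ac sum_distrib_left)
      also have "... <= norm v * C * (\<Sum>b\<in>(Basis::'a set). (2 + norm x) ^ (?k + N) * schwartz_norm (?k + N) (Dv b K))"
        using C0 by (intro mult_left_mono sum_mono db) auto
      also have "... = (C * (2 + norm x) ^ (?k + N) * S) * norm v"
        by (simp only: S_def sum_distrib_left mult_ac)
      finally have "norm (Dv v K (x' - y) * G y) <= (C * (2 + norm x) ^ (?k + N) * S) * norm v / jb y ^ ?k"
        by (simp add: pos_le_divide_eq mult.commute)
      then show ?thesis by (simp add: h_def)
    qed
    show "(%y. Dv v K (x - y) * G y) \<in> borel_measurable lborel" for v
      using Cinf_imp_continuous[OF Cinf_Dv[OF schwartz_Cinf[OF K]], of v, THEN borel_measurable_continuous_onI] by measurable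
  qed simp
  then show ?thesis by (simp add: conv_def[abs_def])
qed

text \<open>All derivatives fall on the kernel, which stays in the Schwartz space, so
  \<open>G\<close> only has to be measurable of polynomial growth.\<close>

lemma conv_Cinf:
  fixes G :: "'a::euclidean_space => complex"
  assumes K: "K \<in> schwartz" and Gm: "G \<in> borel_measurable borel"
    and G: "!!y. norm (G y) <= C * jb y ^ N"
  shows "Cinf UNIV (conv K G)"
  unfolding Cinf_def
proof
  fix k show "Ck_on k UNIV (conv K G)" using K
  proof (induction k arbitrary: K)
    case 0
    then show ?case using has_derivative_continuous[OF conv_has_derivative[OF 0 Gm G]]
      by (auto intro!: continuous_at_imp_continuous_on)
  next
    case (Suc k)
    note d = conv_has_derivative[OF Suc.prems Gm G]
    have Kd: "K differentiable (at z)" for z using Cinf_differentiable[OF schwartz_Cinf[OF Suc.prems]] by blast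
    have "Ck_on k UNIV (Dv v (conv K G))" for v
    proof -
      have "Dv v (conv K G) = (%x. \<Sum>b\<in>Basis. (v \<bullet> b) *\<^sub>R conv (Dv b K) G x)"
        by (intro ext) (subst Dv_eq[OF d], rule linear_eq_sum_Basis[OF has_derivative_linear[OF d]])
      moreover have "Ck_on k UNIV (%x. \<Sum>b\<in>Basis. (v \<bullet> b) *\<^sub>R conv (Dv b K) G x)"
        by (intro Ck_on_sum open_UNIV Ck_on_bilinear[OF bounded_bilinear_scaleR] Ck_on_const Suc.IH schwartz_Dv Suc.prems)
      ultimately show ?thesis by (simp only:)
    qed
    then show ?case using d by (auto simp: differentiable_def)
  qed
qed

lemma iter_deriv_conv:
  assumes K: "K \<in> schwartz" and G: "G \<in> borel_measurable borel" "!!y. norm (G y) <= C * jb y ^ N"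
    and vs: "set vs \<subseteq> Basis"
  shows "iter_deriv vs (conv K G) = conv (iter_deriv vs K) G"
  using vs
proof (induction vs)
  case (Cons v vs)
  then have "iter_deriv vs K \<in> schwartz" using scont_schwartz[OF scont_iter_deriv K] by simp
  from Dv_eq[OF conv_has_derivative[OF this G]] Cons show ?case by auto
qed simp

text \<open>A tempered distribution may be applied under the convolution integral: the integral is
  approximated by finite sums obtained from simple functions converging to the identity.\<close>

lemma tempered_conv:
  fixes K f :: "'a::euclidean_space => complex"
  assumes w: "w \<in> tempered" and K: "K \<in> schwartz" and f: "f \<in> schwartz" and cS: "conv K f \<in> schwartz"
  shows "w (conv K f) = (LBINT y. w (%x. K (x - y)) * f y)"
proof -
  define G where "G y = w (%x. K (x - y))" for y
  obtain C0 N0 where GC: "!!y. norm (G y) <= C0 * jb y ^ N0"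
    using tempered_translate_growth(2)[OF w K] unfolding G_def by blast
  have C0: "C0 >= 0" using order_trans[OF norm_ge_zero GC[of 0]] by simp
  have Gc: "continuous_on UNIV G" unfolding G_def[abs_def] by (rule tempered_translate_growth(1)[OF w K])
  have [measurable]: "G \<in> borel_measurable borel" using Gc by (rule borel_measurable_continuous_onI)
  have [measurable]: "f \<in> borel_measurable borel" using schwartz_measurable[OF f] .
  have [measurable]: "K \<in> borel_measurable borel" using schwartz_measurable[OF K] .
  \<comment> \<open>Simple functions converging to the identity map. Replacing y by
    \<open>s i y\<close> makes the convolution a finite sum of translates, and |s i y| <= 2 |y|
    supplies the majorants below.\<close>
  obtain s :: "nat => 'a => 'a" where s: "!!i. simple_function lborel (s i)"
      "!!y. (%i. s i y) \<longlonglongrightarrow> y" "!!i y. norm (s i y) <= 2 * norm y"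
    using borel_measurable_implies_sequence_metric[of "%x. x" lborel "0::'a"] by auto
  have sm[measurable]: "s i \<in> borel_measurable borel" for i
    using borel_measurable_simple_function[OF s(1)] by simp
  have fin: "finite (range (s i))" for i using s(1)[of i] by (simp add: simple_function_def)
  define Km where "Km i x = (LBINT y. K (x - s i y) * f y)" for i x
  have ind: "H (s i y) = (\<Sum>z\<in>range (s i). indicator (s i -` {z}) y * H z)" for H :: "'a => complex" and i y
  proof -
    have "(\<Sum>z\<in>range (s i) - {s i y}. indicator (s i -` {z}) y * H z) = 0"
      by (intro sum.neutral) (auto simp: indicator_def)
    then show ?thesis by (subst sum.remove[OF fin, of "s i y"]) auto
  qed
  have fi: "integrable lborel (%y. indicator (s i -` {z}) y * f y)" for i z
    by (rule Bochner_Integration.integrable_bound[OF schwartz_integrable[OF f]]) (auto simp: indicator_def)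
  have sumint: "(LBINT y. H (s i y) * f y) = (\<Sum>z\<in>range (s i). (LBINT y. indicator (s i -` {z}) y * f y) * H z)"
    for H :: "'a => complex" and i
  proof -
    have "H (s i y) * f y = (\<Sum>z\<in>range (s i). (indicator (s i -` {z}) y * f y) * H z)" for y
      unfolding ind[of H i y] sum_distrib_right by (simp only: mult_ac)
    then show ?thesis using fi by (simp add: Bochner_Integration.integral_sum)
  qed
  have Km: "Km i = (%x. \<Sum>z\<in>range (s i). (LBINT y. indicator (s i -` {z}) y * f y) * K (x - z))" for i
    unfolding Km_def using sumint[of "%z. K (_ - z)"] by auto
  have KmS: "Km i \<in> schwartz" for i
    unfolding Km by (intro schwartz_sum schwartz_cmult schwartz_translate K)
  have wKm: "w (Km i) = (LBINT y. G (s i y) * f y)" for i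
    unfolding Km sumint[of G]
    by (subst tempered_sum[OF w], intro schwartz_cmult schwartz_translate K)
       (simp only: G_def tempered_cmult[OF w schwartz_translate[OF K]])
  have fW: "integrable lborel (%y. jb y ^ n * norm (f y))" for n
  proof (rule integrable_rapid(1))
    show "jb y ^ (DIM('a) + 2) * norm (jb y ^ n * norm (f y)) <= schwartz_norm (DIM('a) + 2 + n) f" for y
      using schwartz_weight[OF f order_refl, of y "DIM('a) + 2 + n"] by (simp add: power_add mult.assoc)
  qed measurable
  have "(%i. LBINT y. G (s i y) * f y) \<longlonglongrightarrow> (LBINT y. G y * f y)"
  proof (rule integral_dominated_convergence[where w="%y. C0 * 2 ^ N0 * (jb y ^ N0 * norm (f y))"])
    show "integrable lborel (%y. C0 * 2 ^ N0 * (jb y ^ N0 * norm (f y)))"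
      by (rule integrable_mult_right[OF fW])
    show "AE y in lborel. (%i. G (s i y) * f y) \<longlonglongrightarrow> G y * f y"
      by (intro AE_I2 tendsto_mult_right continuous_on_tendsto_compose[OF Gc s(2)]) auto
    show "AE y in lborel. norm (G (s i y) * f y) <= C0 * 2 ^ N0 * (jb y ^ N0 * norm (f y))" for i
    proof (intro AE_I2)
      fix y
      have "jb (s i y) ^ N0 <= (2 * jb y) ^ N0" using s(3)[of i y] by (intro power_mono) auto
      then have "norm (G (s i y)) <= C0 * (2 * jb y) ^ N0"
        using C0 by (intro order_trans[OF GC] mult_left_mono) auto
      then have "norm (G (s i y)) * norm (f y) <= C0 * (2 * jb y) ^ N0 * norm (f y)"
        by (rule mult_right_mono) simp
      then show "norm (G (s i y) * f y) <= C0 * 2 ^ N0 * (jb y ^ N0 * norm (f y))"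
        by (simp only: norm_mult power_mult_distrib mult_ac)
    qed
  qed measurable
  then have lim1: "(%i. w (Km i)) \<longlonglongrightarrow> (LBINT y. G y * f y)" by (simp only: wKm)
  obtain C N where C: "C >= 0" "!!f. f \<in> schwartz ==> norm (w f) <= C * schwartz_norm N f"
    using tempered_sb[OF w] unfolding sb_def by blast
  obtain D where D: "D >= 0" "!!y z. schwartz_norm N (%x. K (x - z) - K (x - y)) <= D * norm (z - y) * (jb y * jb z) ^ N"
    using translate_lipschitz[OF K] by blast
  \<comment> \<open>Pointwise majorant of the error in the N-th Schwartz norm when the centre y is
    replaced by \<open>s i y\<close>. It tends to 0 for each y; the factors 3 and 2 ^ N in its
    integrable bound \<open>h\<close> come from |s i y| <= 2 |y|.\<close>
  define e where "e i y = D * norm (s i y - y) * (jb y * jb (s i y)) ^ N * norm (f y)" for i y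
  have [measurable]: "e i \<in> borel_measurable borel" for i unfolding e_def[abs_def] by measurable
  let ?M = "Suc (N + N)"
  define h where "h y = D * 3 * 2 ^ N * (jb y ^ ?M * norm (f y))" for y
  have eh: "e i y <= h y" for i y
  proof -
    have "norm (s i y - y) <= 3 * jb y"
      using norm_triangle_ineq4[of "s i y" y] s(3)[of i y] by simp
    moreover have "(jb y * jb (s i y)) ^ N <= (jb y * (2 * jb y)) ^ N"
      using s(3)[of i y] by (intro power_mono mult_left_mono) auto
    ultimately have "e i y <= D * (3 * jb y) * (jb y * (2 * jb y)) ^ N * norm (f y)"
      unfolding e_def using D by (intro mult_mono) auto
    also have "... = h y" by (simp only: h_def power_mult_distrib power_add power_Suc mult_ac)
    finally show ?thesis .
  qed
  have e0: "0 <= e i y" for i y using D by (simp add: e_def)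
  have hi: "integrable lborel h" unfolding h_def by (rule integrable_mult_right[OF fW])
  have ei: "integrable lborel (e i)" for i
    by (rule Bochner_Integration.integrable_bound[OF hi]) (use eh e0 in \<open>auto intro!: AE_I2 order_trans[OF eh]\<close>)
  have elim: "(%i. LBINT y. e i y) \<longlonglongrightarrow> (LINT y|(lborel :: 'a measure). 0::real)"
  proof (rule integral_dominated_convergence[where w=h])
    show "AE y in lborel. (%i. e i y) \<longlonglongrightarrow> 0"
    proof (intro AE_I2)
      fix y
      have "(%i. D * norm (s i y - y) * (jb y * jb (s i y)) ^ N * norm (f y)) \<longlonglongrightarrow>
         D * norm (y - y) * (jb y * jb y) ^ N * norm (f y)"
        by (intro tendsto_intros s(2))
      then show "(%i. e i y) \<longlonglongrightarrow> 0" by (simp add: e_def)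
    qed
    show "AE y in lborel. norm (e i y) <= h y" for i using e0 eh by (intro AE_I2) simp
  qed (use hi in auto)
  let ?c = "real (card (basis_lists N :: 'a list set))"
  have sn: "schwartz_norm N (%x. Km i x - conv K f x) <= ?c * (LBINT y. e i y)" for i
  proof (rule schwartz_norm_le)
    fix vs :: "'a list" and x assume "vs \<in> basis_lists N"
    then have vs: "set vs \<subseteq> Basis" "length vs <= N" by (auto simp: basis_lists_def)
    let ?L = "iter_deriv vs K"
    have KC: "Cinf UNIV K" using K by (rule schwartz_Cinf)
    have L: "?L \<in> schwartz" using scont_schwartz[OF scont_iter_deriv[OF vs(1)] K] .
    have [measurable]: "?L \<in> borel_measurable borel" using schwartz_measurable[OF L] .
    have d1: "iter_deriv vs (Km i) = (%x. LBINT y. ?L (x - s i y) * f y)"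
    proof -
      have "iter_deriv vs (Km i) = (%x. \<Sum>z\<in>range (s i). (LBINT y. indicator (s i -` {z}) y * f y) * ?L (x - z))"
        unfolding Km
        by (subst iter_deriv_sum, rule Cinf_mult[OF open_UNIV Cinf_const Cinf_translate[OF KC]])
           (simp only: iter_deriv_cmult[OF Cinf_translate[OF KC]] iter_deriv_translate[OF KC])
      then show ?thesis using sumint[of "%z. ?L (_ - z)"] by auto
    qed
    have d2: "iter_deriv vs (conv K f) = conv ?L f"
      by (rule iter_deriv_conv[OF K _ _ vs(1), where C="schwartz_norm 0 f" and N=0])
         (use schwartz_norm_ge0[OF f] in auto)
    have i1: "integrable lborel (%y. ?L (x - s i y) * f y)"
    proof (rule Bochner_Integration.integrable_bound)
      show "integrable lborel (%y. schwartz_norm 0 ?L * norm (f y))" using schwartz_integrable[OF f] by simp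
      show "AE y in lborel. norm (?L (x - s i y) * f y) <= norm (schwartz_norm 0 ?L * norm (f y))"
        unfolding norm_mult using schwartz_norm_ge0[OF L]
        by (intro AE_I2 mult_mono) (auto intro: order_trans[OF _ abs_ge_self])
    qed measurable
    have i2: "integrable lborel (%y. ?L (x - y) * f y)"
      by (rule conv_integrand[OF L, where C="schwartz_norm 0 f" and N=0]) (use schwartz_norm_ge0[OF f] in auto)
    note iter_deriv_diff[OF schwartz_Cinf[OF KmS] schwartz_Cinf[OF cS], of vs i]
    then have "iter_deriv vs (%x. Km i x - conv K f x) x = (LBINT y. ?L (x - s i y) * f y) - (LBINT y. ?L (x - y) * f y)"
      by (simp add: d1 d2 conv_def)
    also have "... = (LBINT y. (?L (x - s i y) - ?L (x - y)) * f y)"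
      using i1 i2 by (simp add: left_diff_distrib)
    finally have "jb x ^ N * norm (iter_deriv vs (%x. Km i x - conv K f x) x) <=
       jb x ^ N * (LBINT y. norm ((?L (x - s i y) - ?L (x - y)) * f y))"
      by (auto intro!: mult_left_mono)
    also have "... = (LBINT y. jb x ^ N * norm ((?L (x - s i y) - ?L (x - y)) * f y))" by simp
    also have "... <= (LBINT y. e i y)"
    proof (rule integral_mono)
      show "integrable lborel (%y. jb x ^ N * norm ((?L (x - s i y) - ?L (x - y)) * f y))"
        using i1 i2 by (simp only: left_diff_distrib) simp
      fix y
      have tS: "(%x. K (x - s i y) - K (x - y)) \<in> schwartz" by (intro schwartz_diff schwartz_translate K)
      have "iter_deriv vs (%x. K (x - s i y) - K (x - y)) x = ?L (x - s i y) - ?L (x - y)"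
        by (simp add: iter_deriv_diff[OF Cinf_translate[OF KC] Cinf_translate[OF KC]] iter_deriv_translate[OF KC])
      then have "jb x ^ N * norm (?L (x - s i y) - ?L (x - y)) <= schwartz_norm N (%x. K (x - s i y) - K (x - y))"
        using schwartz_norm_ge[OF tS vs order_refl, of x] by simp
      also have "... <= D * norm (s i y - y) * (jb y * jb (s i y)) ^ N" by (rule D)
      finally have "(jb x ^ N * norm (?L (x - s i y) - ?L (x - y))) * norm (f y) <= e i y"
        unfolding e_def by (rule mult_right_mono) simp
      then show "jb x ^ N * norm ((?L (x - s i y) - ?L (x - y)) * f y) <= e i y"
        by (simp add: norm_mult mult.assoc)
    qed (rule ei)
    finally show "jb x ^ N * norm (iter_deriv vs (%x. Km i x - conv K f x) x) <= (LBINT y. e i y)" .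
  qed
  have "(%i. w (Km i) - w (conv K f)) \<longlonglongrightarrow> 0"
  proof (rule Lim_null_comparison)
    show "(%i. C * (?c * (LBINT y. e i y))) \<longlonglongrightarrow> 0"
      using tendsto_mult_left[OF tendsto_mult_left[OF elim], of C ?c] by simp
    show "\<forall>\<^sub>F i in sequentially. norm (w (Km i) - w (conv K f)) <= C * (?c * (LBINT y. e i y))"
    proof (intro always_eventually allI)
      fix i
      have "norm (w (Km i) - w (conv K f)) = norm (w (%x. Km i x - conv K f x))"
        using tempered_diff[OF w KmS cS] by simp
      also have "... <= C * schwartz_norm N (%x. Km i x - conv K f x)" by (intro C schwartz_diff KmS cS)
      also have "... <= C * (?c * (LBINT y. e i y))" using C by (intro mult_left_mono sn)
      finally show "norm (w (Km i) - w (conv K f)) <= C * (?c * (LBINT y. e i y))" .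
    qed
  qed
  then have "(%i. w (Km i)) \<longlonglongrightarrow> w (conv K f)" by (simp add: LIM_zero_iff)
  with lim1 show ?thesis unfolding G_def using LIMSEQ_unique by blast
qed

section \<open>Littlewood--Paley estimates\<close>

lemma Lp_fun_indicator:
  assumes "r > 0" shows "(%x::'a::euclidean_space. complex_of_real (indicator (cball 0 R) x)) \<in> Lp_fun r"
proof -
  have "integrable lborel (%x::'a. indicator (cball 0 R) x :: real)"
    by (intro integrable_real_indicator emeasure_lborel_cball_finite) auto
  moreover have "norm (complex_of_real (indicator (cball 0 R) x)) powr r = indicator (cball 0 R) x" for x :: 'a
    using assms by (simp add: indicator_def)
  ultimately show ?thesis by (simp add: Lp_fun_def)
qed

lemma Lp_fun_loc_integrable:
  fixes g :: "'a::euclidean_space => complex"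
  assumes "conjugate_exps p q" "g \<in> Lp_fun p"
  shows "integrable lborel (%x. indicator (cball 0 R) x *\<^sub>R g x)"
  using holder(1)[OF assms Lp_fun_indicator] assms(1)
  by (simp add: conjugate_exps_def scaleR_conv_of_real mult.commute)

lemma continuous_loc_integrable:
  fixes g :: "'a::euclidean_space => complex"
  assumes g: "continuous_on UNIV g"
  shows "integrable lborel (%x. indicator (cball 0 R) x *\<^sub>R g x)"
  by (rule borel_integrable_compact[OF compact_cball continuous_on_subset[OF g]]) simp

lemma represents_norm_le:
  fixes g g' :: "'a::euclidean_space => complex"
  assumes b: "is_cutoff (b :: 'a => complex)" and pq: "conjugate_exps p q"
    and g: "g \<in> Lp_fun p" "represents g W" and M: "M >= 0" "!!f. f \<in> schwartz ==> norm (W f) <= M * lnorm q f"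
  shows "lnorm p g <= M"
proof (rule converse_holder(2)[OF b pq])
  show "g \<in> borel_measurable borel" using g by (simp add: Lp_fun_def)
  show "integrable lborel (%x. indicator (cball 0 R) x *\<^sub>R g x)" for R
    using Lp_fun_loc_integrable[OF pq g(1)] .
  show "norm (LBINT x. g x * f x) <= M * lnorm q f" if "f \<in> test_fun UNIV" for f
    using M(2)[OF test_fun_schwartz[OF that]] g(2) test_fun_schwartz[OF that] by (simp add: represents_def)
qed (rule M)

lemma represents_bound:
  assumes "conjugate_exps p q" "g \<in> Lp_fun p" "represents g W" "f \<in> schwartz"
  shows "norm (W f) <= lnorm p g * lnorm q f"
proof -
  have "norm (W f) = norm (LBINT x. g x * f x)" using assms by (simp add: represents_def)
  also have "... <= (LBINT x. norm (g x * f x))" by (rule integral_norm_bound)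
  also have "... <= lnorm p g * lnorm q f"
    using assms(1) by (intro holder(2)[OF assms(1,2)] schwartz_Lp[OF assms(4)]) (simp add: conjugate_exps_def)
  finally show ?thesis .
qed

text \<open>Resolves the definite description: by duality any two representing functions bound each
  other's norm, so the number is determined without comparing the functions themselves.\<close>

lemma Lp_norm_eq:
  fixes g :: "'a::euclidean_space => complex"
  assumes b: "is_cutoff (b :: 'a => complex)" and pq: "conjugate_exps p q" and g: "g \<in> Lp_fun p" "represents g W"
  shows "Lp_norm p W = lnorm p g"
  unfolding Lp_norm_def
proof (rule the_equality)
  show "\<exists>h\<in>Lp_fun p. represents h W \<and> lnorm p g = (LBINT x. norm (h x) powr p) powr (1 / p)"
    using g by (auto simp: lnorm_def)
  fix r assume "\<exists>g\<in>Lp_fun p. represents g W \<and> r = (LBINT x. norm (g x) powr p) powr (1 / p)"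
  then obtain h where h: "h \<in> Lp_fun p" "represents h W" "r = lnorm p h" by (auto simp: lnorm_def)
  have "lnorm p h <= lnorm p g"
    by (rule represents_norm_le[OF b pq h(1,2)]) (auto intro: represents_bound[OF pq g])
  moreover have "lnorm p g <= lnorm p h"
    by (rule represents_norm_le[OF b pq g]) (auto intro: represents_bound[OF pq h(1,2)])
  ultimately show "r = lnorm p g" using h by simp
qed

text \<open>\<open>Lp_norm\<close> is the least constant in the dual inequality. From here on norms
  of distributions are handled through these inequalities instead of representing functions.\<close>

lemma in_Lp_bound:
  fixes W :: "('a::euclidean_space => complex) => complex"
  assumes b: "is_cutoff (b :: 'a => complex)" and pq: "conjugate_exps p q" and W: "in_Lp p W"
  shows "0 <= Lp_norm p W" "!!f. f \<in> schwartz ==> norm (W f) <= Lp_norm p W * lnorm q f"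
    "!!M. M >= 0 ==> (!!f. f \<in> schwartz ==> norm (W f) <= M * lnorm q f) ==> Lp_norm p W <= M"
proof -
  obtain g where g: "g \<in> Lp_fun p" "represents g W" using W by (auto simp: in_Lp_def)
  note e = Lp_norm_eq[OF b pq g]
  show "0 <= Lp_norm p W" by (simp add: e)
  show "norm (W f) <= Lp_norm p W * lnorm q f" if "f \<in> schwartz" for f
    using represents_bound[OF pq g that] by (simp add: e)
  show "Lp_norm p W <= M" if "M >= 0" "!!f. f \<in> schwartz ==> norm (W f) <= M * lnorm q f" for M
    unfolding e by (rule represents_norm_le[OF b pq g that])
qed

lemma Mul_conv': "m \<in> schwartz ==> f \<in> schwartz ==> Mul m f = conv (ker m) f"
  by (auto simp: Mul_conv conv_def)

text \<open>The converse passage from inequality to function. A compactly supported multiplier makes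
  the functional integration against the continuous function \<open>G\<close>, so
  \<open>converse_holder\<close> is applicable; for a general tempered distribution there would be
  no function to start from.\<close>

lemma in_Lp_of_bound:
  fixes W :: "(real ^ 'd => complex) => complex"
  assumes b: "is_cutoff (b :: real ^ 'd => complex)" and pq: "conjugate_exps p q"
    and w: "w \<in> tempered" and m: "m \<in> test_fun UNIV" and W: "!!f. f \<in> schwartz ==> W f = w (Mul m f)"
    and M: "M >= 0" "!!f. f \<in> schwartz ==> norm (W f) <= M * lnorm q f"
  shows "in_Lp p W" "Lp_norm p W <= M"
proof -
  have mS: "m \<in> schwartz" using m by (rule test_fun_schwartz)
  define G where "G y = w (%x. ker m (x - y))" for y
  have Gc: "continuous_on UNIV G"
    unfolding G_def[abs_def] by (rule tempered_translate_growth(1)[OF w ker_schwartz[OF mS]])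
  have rep: "W f = (LBINT y. G y * f y)" if f: "f \<in> schwartz" for f
  proof -
    have "conv (ker m) f \<in> schwartz" using Mul_schwartz[OF pgrow_test_fun[OF m] f] Mul_conv'[OF mS f] by simp
    from tempered_conv[OF w ker_schwartz[OF mS] f this] show ?thesis
      using W[OF f] Mul_conv'[OF mS f] by (simp add: G_def)
  qed
  have "G \<in> Lp_fun p"
  proof (rule converse_holder(1)[OF b pq _ _ M(1)])
    show "G \<in> borel_measurable borel" using Gc by (rule borel_measurable_continuous_onI)
    show "integrable lborel (%x. indicator (cball 0 R) x *\<^sub>R G x)" for R
      by (rule continuous_loc_integrable[OF Gc])
    show "norm (LBINT x. G x * f x) <= M * lnorm q f" if "f \<in> test_fun UNIV" for f
      using M(2)[OF test_fun_schwartz[OF that]] rep[OF test_fun_schwartz[OF that]] by simp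
  qed
  then show "in_Lp p W" using rep by (auto simp: in_Lp_def represents_def)
  from in_Lp_bound(3)[OF b pq this M] show "Lp_norm p W <= M" .
qed

text \<open>The form in which duality is used for operators on Schwartz functions; the triangle
  inequality, Young's inequality and the transposed decay estimate are all derived from it.\<close>

lemma lnorm_le_dual:
  fixes g :: "'a::euclidean_space => complex"
  assumes b: "is_cutoff (b :: 'a => complex)" and pq: "conjugate_exps p q"
    and g: "g \<in> schwartz" and M: "M >= 0"
    and bd: "!!h. h \<in> schwartz ==> norm (LBINT x. g x * h x) <= M * lnorm q h"
  shows "lnorm p g <= M"
  by (rule converse_holder(2)[OF b pq schwartz_measurable[OF g] continuous_loc_integrable[OF schwartz_continuous[OF g]] M])
     (intro bd test_fun_schwartz)

lemma schwartz_mult_schwartz: "f \<in> schwartz ==> g \<in> schwartz ==> integrable lborel (%x. f x * g x)"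
  by (rule holder(1)[of 2 2]) (auto intro!: schwartz_Lp simp: conjugate_exps_def)

lemma lnorm_triangle:
  fixes f g :: "'a::euclidean_space => complex"
  assumes b: "is_cutoff (b :: 'a => complex)" and p: "1 < p" and f: "f \<in> schwartz" and g: "g \<in> schwartz"
  shows "lnorm p (%x. f x + g x) <= lnorm p f + lnorm p g"
proof -
  obtain q where pq: "conjugate_exps p q" using conjugate_expsE[OF p] .
  show ?thesis
  proof (rule lnorm_le_dual[OF b pq schwartz_add[OF f g]])
    fix h :: "'a => complex" assume h: "h \<in> schwartz"
    have "(LBINT x. (f x + g x) * h x) = (LBINT x. f x * h x) + (LBINT x. g x * h x)"
      using f g h by (simp add: distrib_right schwartz_mult_schwartz)
    also have "norm ... <= lnorm p f * lnorm q h + lnorm p g * lnorm q h"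
      by (intro order_trans[OF norm_triangle_ineq] add_mono holder_schwartz pq f g h)
    finally show "norm (LBINT x. (f x + g x) * h x) <= (lnorm p f + lnorm p g) * lnorm q h"
      by (simp add: distrib_right)
  qed simp
qed

lemma lnorm_zero [simp]: "lnorm r (%x. 0) = 0" by (simp add: lnorm_def)

lemma lnorm_sum:
  fixes f :: "'i => 'a::euclidean_space => complex"
  assumes b: "is_cutoff (b :: 'a => complex)" and p: "1 < p" and f: "!!i. i \<in> I ==> f i \<in> schwartz"
  shows "lnorm p (%x. \<Sum>i\<in>I. f i x) <= (\<Sum>i\<in>I. lnorm p (f i))"
  using f
proof (induction I rule: infinite_finite_induct)
  case (insert i I)
  have "lnorm p (%x. f i x + (\<Sum>i\<in>I. f i x)) <= lnorm p (f i) + lnorm p (%x. \<Sum>i\<in>I. f i x)"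
    using insert by (intro lnorm_triangle[OF b p] schwartz_sum) auto
  then show ?case using insert by fastforce
qed auto

lemma lnorm_translate:
  fixes f :: "'a::euclidean_space => complex"
  assumes [measurable]: "f \<in> borel_measurable borel" shows "lnorm r (%x. f (x - z)) = lnorm r f"
  using lborel_integral_shift[of "%x. norm (f x) powr r" "- z"] by (simp add: lnorm_def)

text \<open>Young's inequality, by duality\<close>

lemma lnorm_Mul:
  fixes m f :: "real ^ 'd => complex"
  assumes b: "is_cutoff (b :: real ^ 'd => complex)" and p: "1 < p" and m: "m \<in> test_fun UNIV" and f: "f \<in> schwartz"
  shows "lnorm p (Mul m f) <= (LBINT x. norm (ker m x)) * lnorm p f"
proof -
  obtain q where pq: "conjugate_exps p q" using conjugate_expsE[OF p] .
  have K: "ker m \<in> schwartz" by (intro ker_schwartz test_fun_schwartz[OF m])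
  have [measurable]: "f \<in> borel_measurable borel" "ker m \<in> borel_measurable borel"
    using f K schwartz_measurable by blast+
  show ?thesis
  proof (rule lnorm_le_dual[OF b pq])
    show "Mul m f \<in> schwartz" using Mul_schwartz[OF pgrow_test_fun[OF m] f] .
    show "0 <= (LBINT x. norm (ker m x)) * lnorm p f" by simp
    fix h :: "real ^ 'd => complex" assume h: "h \<in> schwartz"
    have [measurable]: "h \<in> borel_measurable borel" using h schwartz_measurable by blast
    have sub: "Mul m f x = (LBINT z. ker m z * f (x - z))" for x
    proof -
      have "(LBINT z. ker m z * f (x - z)) = (LBINT z. ker m (- z) * f (x - (- z)))"
        by (rule lborel_integral_reflect[symmetric]) measurable
      also have "... = (LBINT y. ker m (- (y + - x)) * f (x - (- (y + - x))))"
        by (rule lborel_integral_shift[symmetric]) measurable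
      finally show ?thesis using Mul_conv[OF test_fun_schwartz[OF m] f, of x] by simp
    qed
    have "(LBINT x. Mul m f x * h x) = (LBINT x. LBINT z. ker m z * f (x - z) * h x)"
      by (simp add: sub)
    also have "... = (LBINT z. LBINT x. ker m z * f (x - z) * h x)"
    proof (rule fubini_bound(1)[where A="%x. schwartz_norm 0 f * norm (h x)" and B="%z. norm (ker m z)"])
      show "norm (ker m z * f (x - z) * h x) <= schwartz_norm 0 f * norm (h x) * norm (ker m z)" for x z
        using mult_right_mono[OF schwartz_norm_ge0[OF f, of "x - z" 0], of "norm (h x) * norm (ker m z)"]
        by (simp add: norm_mult mult_ac)
    qed (use schwartz_integrable[OF h] schwartz_integrable[OF K] in auto)
    also have "... = (LBINT z. ker m z * (LBINT x. f (x - z) * h x))" by (simp add: mult.assoc)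
    also have "norm ... <= (LBINT z. norm (ker m z) * (lnorm p f * lnorm q h))"
    proof (rule order_trans[OF integral_norm_bound integral_mono'])
      show "integrable lborel (%z. norm (ker m z) * (lnorm p f * lnorm q h))" using schwartz_integrable[OF K] by simp
      show "norm (ker m z * (LBINT x. f (x - z) * h x)) <= norm (ker m z) * (lnorm p f * lnorm q h)" for z
        using holder_schwartz[OF pq schwartz_translate[OF f] h, of z]
        by (simp add: norm_mult lnorm_translate mult_left_mono)
    qed simp
    finally show "norm (LBINT x. Mul m f x * h x) <= (LBINT x. norm (ker m x)) * lnorm p f * lnorm q h"
      by (simp add: mult.assoc)
  qed
qed

abbreviation dil :: "(real ^ 'd => complex) => nat => real ^ 'd => complex" where
  "dil g k == (%\<xi>. g ((1 / 2) ^ k *\<^sub>R \<xi>))"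

lemma dil_test_fun: "g \<in> test_fun UNIV ==> dil g k \<in> test_fun UNIV"
  by (rule test_fun_dilation) auto

lemma lnorm_Mul_dil:
  fixes g f :: "real ^ 'd => complex"
  assumes b: "is_cutoff (b :: real ^ 'd => complex)" and p: "1 < p" and g: "g \<in> test_fun UNIV" and f: "f \<in> schwartz"
  shows "lnorm p (Mul (dil g k) f) <= (LBINT x. norm (ker g x)) * lnorm p f"
  using lnorm_Mul[OF b p dil_test_fun[OF g] f, of k] ker_dilation_L1[OF test_fun_schwartz[OF g], of "(1 / 2) ^ k"] by simp

text \<open>Differentiation multiplies the symbol by a coordinate, which equals 2^k times the
  coordinate of the rescaled variable. Hence the new symbol is again the k-th dilate of one fixed
  test function, and the resulting Bernstein inequality has a constant independent of k.\<close>

lemma iter_deriv_Mul_dil: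
  fixes g :: "real ^ 'd => complex"
  assumes "g \<in> test_fun UNIV"
  shows "\<exists>g'\<in>test_fun UNIV. \<forall>k. \<forall>f\<in>schwartz. iter_deriv vs (Mul (dil g k) f) = (%x. 2 ^ (k * length vs) * Mul (dil g' k) f x)"
proof (induction vs)
  case Nil
  then show ?case using assms by auto
next
  case (Cons v vs)
  then obtain g' where g': "g' \<in> test_fun UNIV" "!!k f. f \<in> schwartz ==> iter_deriv vs (Mul (dil g k) f) = (%x. 2 ^ (k * length vs) * Mul (dil g' k) f x)"
    by blast
  let ?h = "%\<xi>. g' \<xi> * (- \<i> * complex_of_real (\<xi> \<bullet> v))"
  have h: "?h \<in> test_fun UNIV"
    using g' by (intro test_fun_mult Cinf_mult Cinf_const Cinf_of_real Cinf_bounded_linear bounded_linear_inner_left) auto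
  have "iter_deriv (v # vs) (Mul (dil g k) f) = (%x. 2 ^ (k * length (v # vs)) * Mul (dil ?h k) f x)"
    if f: "f \<in> schwartz" for k f
  proof -
    have pg: "pgrow (dil g' k)" using pgrow_test_fun[OF dil_test_fun[OF g'(1)]] .
    have e: "- \<i> * complex_of_real (\<xi> \<bullet> v) * dil g' k \<xi> = 2 ^ k * dil ?h k \<xi>" for \<xi>
      by (simp add: power_one_over field_simps)
    have "Dv v (%x. 2 ^ (k * length vs) * Mul (dil g' k) f x) = (%x. 2 ^ (k * length vs) * Dv v (Mul (dil g' k) f) x)"
      using Dv_mult_left[OF Cinf_differentiable[OF schwartz_Cinf[OF Mul_schwartz[OF pg f]] UNIV_I]] by (intro ext) simp
    also have "Dv v (Mul (dil g' k) f) = (%x. 2 ^ k * Mul (dil ?h k) f x)"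
      unfolding Dv_Mul[OF pg f] e by (rule Mul_cmult)
    finally show ?thesis unfolding iter_deriv.simps g'(2)[OF f] by (simp add: power_add mult_ac)
  qed
  then show ?case by (intro bexI[OF _ h] allI ballI)
qed

lemma lnorm_iter_deriv_Mul_dil:
  fixes g :: "real ^ 'd => complex"
  assumes b: "is_cutoff (b :: real ^ 'd => complex)" and p: "1 < p" and g: "g \<in> test_fun UNIV"
  shows "\<exists>C\<ge>0. \<forall>k. \<forall>f\<in>schwartz. lnorm p (iter_deriv vs (Mul (dil g k) f)) <= C * 2 ^ (k * length vs) * lnorm p f"
proof -
  obtain g' where g': "g' \<in> test_fun UNIV" "!!k f. f \<in> schwartz ==> iter_deriv vs (Mul (dil g k) f) = (%x. 2 ^ (k * length vs) * Mul (dil g' k) f x)"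
    using iter_deriv_Mul_dil[OF g] by blast
  let ?C = "LBINT x. norm (ker g' x)"
  have "lnorm p (iter_deriv vs (Mul (dil g k) f)) <= ?C * 2 ^ (k * length vs) * lnorm p f" if f: "f \<in> schwartz" for k f
  proof -
    have "lnorm p (iter_deriv vs (Mul (dil g k) f)) = 2 ^ (k * length vs) * lnorm p (Mul (dil g' k) f)"
      using p by (simp add: g'(2)[OF f] lnorm_cmult norm_power)
    also have "... <= 2 ^ (k * length vs) * (?C * lnorm p f)"
      by (intro mult_left_mono lnorm_Mul_dil[OF b p g'(1) f]) simp
    finally show ?thesis by (simp add: mult_ac)
  qed
  then show ?thesis by (intro exI[of _ ?C]) simp
qed

definition vanishes_near_0 :: "('a::real_normed_vector => complex) => bool" where
  "vanishes_near_0 g \<longleftrightarrow> (\<exists>e>0. \<forall>x. norm x < e --> g x = 0)"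

text \<open>A multiplier vanishing near the origin factors through the gradient, \<open>g = \<Sum> g\<^sub>e \<eta>\<^sub>e\<close> with
  \<open>g\<^sub>e = g \<eta>\<^sub>e / |\<eta>|\<^sup>2\<close>; each such step gains a factor \<open>2\<^sup>-\<^sup>k\<close>.\<close>

lemma gradient_factor:
  fixes g :: "real ^ 'd => complex"
  assumes g: "g \<in> test_fun UNIV" "vanishes_near_0 g"
  obtains h where "!!e. h e \<in> test_fun UNIV" "!!e. vanishes_near_0 (h e)"
    "!!k f. f \<in> schwartz ==> Mul (dil g k) f = (%x. (1 / 2) ^ k * (\<Sum>e\<in>Basis. Mul (dil (h e) k) (Dv e f) x))"
proof -
  \<comment> \<open>By \<open>Mul_Dv\<close> a derivative contributes the factor - i times a
    coordinate, so the factor i here makes the sum over the basis reproduce \<open>g\<close>. The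
    singularity at 0 is harmless since \<open>g\<close> vanishes nearby.\<close>
  define h where "h e \<eta> = g \<eta> * (\<i> * complex_of_real (\<eta> \<bullet> e) * complex_of_real (inverse (\<eta> \<bullet> \<eta>)))" for e \<eta> :: "real ^ 'd"
  obtain \<epsilon> where \<epsilon>: "\<epsilon> > 0" "!!x. norm x < \<epsilon> ==> g x = 0" using g(2) unfolding vanishes_near_0_def by blast
  have h0: "h e x = 0" if "norm x < \<epsilon>" for e x using \<epsilon>(2)[OF that] by (simp add: h_def)
  have hC: "Cinf UNIV (h e)" for e
  proof (rule Cinf_local)
    fix x :: "real ^ 'd"
    show "\<exists>U. open U \<and> x \<in> U \<and> Cinf U (h e)"
    proof (cases "x = 0")
      case True
      have "Cinf (ball 0 \<epsilon>) (h e)"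
        using h0 Cinf_cong[of "ball 0 \<epsilon>" "h e" "%_. 0"] by simp
      then show ?thesis using True \<epsilon> by (intro exI[of _ "ball 0 \<epsilon>"]) simp
    next
      case False
      have "Cinf (- {0}) (h e)"
        unfolding h_def[abs_def] using test_fun_Cinf[OF g(1)]
        by (intro Cinf_mult Cinf_const Cinf_of_real Cinf_inverse Cinf_inner Cinf_id)
           (auto intro: Cinf_subset)
      then show ?thesis using False by (intro exI[of _ "- {0}"]) auto
    qed
  qed
  obtain K where K: "compact K" "!!x. x \<notin> K ==> g x = 0" using g(1) by (rule test_funE) blast
  show ?thesis
  proof (rule that[of h])
    show ht: "h e \<in> test_fun UNIV" for e
      by (rule test_funI[OF hC K(1)]) (auto simp: h_def K(2))
    show "vanishes_near_0 (h e)" for e unfolding vanishes_near_0_def using \<epsilon>(1) h0 by blast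
    fix k f assume f: "f \<in> (schwartz :: (real ^ 'd => complex) set)"
    let ?m = "%e \<xi>. - \<i> * complex_of_real (\<xi> \<bullet> e) * dil (h e) k \<xi>"
    have pm: "pgrow (?m e)" for e
    proof -
      have "(%\<xi>. dil (h e) k \<xi> * (- \<i> * complex_of_real (\<xi> \<bullet> e))) \<in> test_fun UNIV"
        by (intro test_fun_mult[OF dil_test_fun[OF ht]] open_UNIV Cinf_mult Cinf_const Cinf_of_real Cinf_bounded_linear bounded_linear_inner_left)
      then show ?thesis by (simp only: mult.commute[of _ "dil (h e) k _"] pgrow_test_fun)
    qed
    have e: "dil g k \<xi> = (1 / 2) ^ k * (\<Sum>e\<in>Basis. ?m e \<xi>)" for \<xi>
    proof (cases "\<xi> = 0")
      case True
      then show ?thesis using \<epsilon> by simp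
    next
      case False
      let ?\<eta> = "(1 / 2) ^ k *\<^sub>R \<xi>"
      have "(\<Sum>e\<in>Basis. ?m e \<xi>) = (\<Sum>e\<in>Basis. 2 ^ k * (g ?\<eta> * complex_of_real ((?\<eta> \<bullet> e) * (?\<eta> \<bullet> e) * inverse (?\<eta> \<bullet> ?\<eta>))))"
        by (intro sum.cong refl) (simp add: h_def power_one_over field_simps)
      also have "... = 2 ^ k * (g ?\<eta> * complex_of_real ((\<Sum>e\<in>Basis. (?\<eta> \<bullet> e) * (?\<eta> \<bullet> e)) * inverse (?\<eta> \<bullet> ?\<eta>)))"
        by (simp only: sum_distrib_left[symmetric] sum_distrib_right[symmetric] of_real_sum[symmetric])
      also have "(\<Sum>e\<in>Basis. (?\<eta> \<bullet> e) * (?\<eta> \<bullet> e)) = ?\<eta> \<bullet> ?\<eta>" by (rule euclidean_inner[symmetric])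
      also have "(?\<eta> \<bullet> ?\<eta>) * inverse (?\<eta> \<bullet> ?\<eta>) = 1"
        using False by (intro right_inverse) (simp only: inner_eq_zero_iff scaleR_eq_0_iff, simp)
      finally have "(\<Sum>e\<in>Basis. ?m e \<xi>) = 2 ^ k * g ?\<eta>" by (simp only: of_real_1 mult_1_right)
      then show ?thesis by (simp add: power_one_over)
    qed
    have "Mul (dil g k) f = Mul (%\<xi>. (1 / 2) ^ k * (\<Sum>e\<in>Basis. ?m e \<xi>)) f" by (simp only: e)
    also have "... = (%x. (1 / 2) ^ k * Mul (%\<xi>. \<Sum>e\<in>Basis. ?m e \<xi>) f x)" by (rule Mul_cmult)
    also have "Mul (%\<xi>. \<Sum>e\<in>Basis. ?m e \<xi>) f = (%x. \<Sum>e\<in>Basis. Mul (?m e) f x)" by (rule Mul_sum[OF pm f])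
    also have "... = (%x. \<Sum>e\<in>Basis. Mul (dil (h e) k) (Dv e f) x)"
      by (intro ext sum.cong refl) (simp only: Mul_Dv[OF _ f])
    finally show "Mul (dil g k) f = (%x. (1 / 2) ^ k * (\<Sum>e\<in>Basis. Mul (dil (h e) k) (Dv e f) x))" .
  qed
qed

lemma sobolev_sum_Dv:
  fixes W :: "('a::euclidean_space => complex) => real"
  assumes W: "!!f. f \<in> schwartz ==> 0 <= W f" and b: "b \<in> Basis" and f: "f \<in> schwartz"
  shows "(\<Sum>vs\<in>basis_lists N. W (iter_deriv vs (Dv b f))) <= (\<Sum>vs\<in>basis_lists (Suc N). W (iter_deriv vs f))"
proof -
  have "(\<Sum>vs\<in>basis_lists N. W (iter_deriv vs (Dv b f))) = (\<Sum>vs\<in>(%vs. vs @ [b]) ` basis_lists N. W (iter_deriv vs f))"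
    by (subst sum.reindex) (auto simp: inj_on_def iter_deriv_snoc)
  also have "... <= (\<Sum>vs\<in>basis_lists (Suc N). W (iter_deriv vs f))"
    by (intro sum_mono2 finite_basis_lists)
       (use b in \<open>auto simp: basis_lists_def intro!: W scont_schwartz[OF scont_iter_deriv f]\<close>)
  finally show ?thesis .
qed

text \<open>Counterpart of Bernstein's inequality for symbols vanishing near 0. The symbols created
  by \<open>gradient_factor\<close> vanish near 0 as well, so the step can be repeated N times with
  \<open>g\<close> generalised.\<close>

lemma lnorm_Mul_dil_gain:
  fixes g :: "real ^ 'd => complex"
  assumes b: "is_cutoff (b :: real ^ 'd => complex)" and p: "1 < p" and g: "g \<in> test_fun UNIV" "vanishes_near_0 g"
  shows "\<exists>C\<ge>0. \<forall>k. \<forall>f\<in>schwartz. lnorm p (Mul (dil g k) f) <=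
    C * (1 / 2) ^ (k * N) * sob p N f"
  using g
proof (induction N arbitrary: g)
  case 0
  have e: "basis_lists 0 = {[] :: (real ^ 'd) list}" by (auto simp: basis_lists_def)
  show ?case using lnorm_Mul_dil[OF b p 0(1)]
    by (intro exI[of _ "LBINT x. norm (ker g x)"]) (simp add: e)
next
  case (Suc N)
  obtain h where h: "!!e. h e \<in> test_fun UNIV" "!!e. vanishes_near_0 (h e)"
    "!!k f. f \<in> schwartz ==> Mul (dil g k) f = (%x. (1 / 2) ^ k * (\<Sum>e\<in>Basis. Mul (dil (h e) k) (Dv e f) x))"
    by (rule gradient_factor[OF Suc.prems], rule that)
  have "\<forall>e. \<exists>C\<ge>0. \<forall>k. \<forall>f\<in>schwartz. lnorm p (Mul (dil (h e) k) f) <=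
    C * (1 / 2) ^ (k * N) * sob p N f"
    using Suc.IH h(1,2) by blast
  from choice[OF this] obtain C where C': "\<forall>e. C e >= 0 \<and> (\<forall>k. \<forall>f\<in>schwartz. lnorm p (Mul (dil (h e) k) f) <=
    C e * (1 / 2) ^ (k * N) * sob p N f)" ..
  have C: "!!e. C e >= 0" "!!e k f. f \<in> schwartz ==> lnorm p (Mul (dil (h e) k) f) <=
    C e * (1 / 2) ^ (k * N) * sob p N f" using C' by auto
  have "lnorm p (Mul (dil g k) f) <= (\<Sum>e\<in>Basis. C e) * (1 / 2) ^ (k * Suc N) * sob p (Suc N) f"
    if f: "f \<in> schwartz" for k f
  proof -
    let ?S = "\<Sum>vs\<in>basis_lists (Suc N). lnorm p (iter_deriv vs f)"
    have "lnorm p (Mul (dil g k) f) = (1 / 2) ^ k * lnorm p (%x. \<Sum>e\<in>Basis. Mul (dil (h e) k) (Dv e f) x)"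
      using p by (simp add: h(3)[OF f] lnorm_cmult norm_power norm_divide)
    also have "... <= (1 / 2) ^ k * (\<Sum>e\<in>Basis. lnorm p (Mul (dil (h e) k) (Dv e f)))"
      by (intro mult_left_mono lnorm_sum[OF b p] Mul_schwartz pgrow_test_fun[OF dil_test_fun[OF h(1)]] schwartz_Dv f) auto
    also have "... <= (1 / 2) ^ k * (\<Sum>e\<in>Basis. C e * (1 / 2) ^ (k * N) * ?S)"
    proof (intro mult_left_mono sum_mono)
      fix e :: "real ^ 'd" assume e: "e \<in> Basis"
      have "lnorm p (Mul (dil (h e) k) (Dv e f)) <= C e * (1 / 2) ^ (k * N) * sob p N (Dv e f)"
        by (rule C(2)[OF schwartz_Dv[OF e f]])
      also have "... <= C e * (1 / 2) ^ (k * N) * ?S"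
        using C(1) by (intro mult_left_mono sobolev_sum_Dv[OF _ e f]) auto
      finally show "lnorm p (Mul (dil (h e) k) (Dv e f)) <= C e * (1 / 2) ^ (k * N) * ?S" .
    qed simp
    also have "... = (\<Sum>e\<in>Basis. C e) * (1 / 2) ^ (k * Suc N) * ?S"
      by (simp add: sum_distrib_right sum_distrib_left power_add mult_ac)
    finally show ?thesis .
  qed
  then show ?case using C(1) by (intro exI[of _ "\<Sum>e\<in>Basis. C e"]) (auto intro: sum_nonneg)
qed

text \<open>Dilates of one profile only from some index on: the member of index 0 contains the
  origin in its support, and finitely many exceptions can be absorbed into constants.\<close>

definition lp_family :: "(nat => real ^ 'd => complex) => bool" where
  "lp_family m \<longleftrightarrow> (\<forall>k. m k \<in> test_fun UNIV) \<and>
     (\<exists>K g. g \<in> test_fun UNIV \<and> vanishes_near_0 g \<and> (\<forall>k\<ge>K. m k = dil g k))"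

lemma lp_family_pgrow: "lp_family m ==> pgrow (m k)"
  by (auto simp: lp_family_def intro: pgrow_test_fun)

lemma lp_family_Mul_schwartz: "lp_family m ==> f \<in> schwartz ==> Mul (m k) f \<in> schwartz"
  by (intro Mul_schwartz lp_family_pgrow)

lemma lp_family_reflect:
  assumes "lp_family m" shows "lp_family (%k \<xi>. m k (- \<xi>))"
proof -
  have r: "(%\<xi>. g (- \<xi>)) \<in> test_fun UNIV" if "g \<in> test_fun UNIV" for g :: "real ^ 'a => complex"
    using test_fun_dilation[OF that, of "-1"] by simp
  obtain K g where g: "g \<in> test_fun UNIV" "vanishes_near_0 g" "!!k. k >= K ==> m k = dil g k"
    using assms unfolding lp_family_def by blast
  have "vanishes_near_0 (%\<xi>. g (- \<xi>))"
    using g(2) unfolding vanishes_near_0_def by (metis norm_minus_cancel)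
  then show ?thesis using assms g r unfolding lp_family_def
    by (intro conjI allI exI[of _ K] exI[of _ "%\<xi>. g (- \<xi>)"]) auto
qed

lemma lp_family_deriv:
  fixes m :: "nat => real ^ 'd => complex"
  assumes b: "is_cutoff (b :: real ^ 'd => complex)" and p: "1 < p" and m: "lp_family m"
  shows "\<exists>C\<ge>0. \<forall>k. \<forall>f\<in>schwartz. lnorm p (iter_deriv vs (Mul (m k) f)) <= C * 2 ^ (k * length vs) * lnorm p f"
proof -
  obtain K g where g: "g \<in> test_fun UNIV" "!!k. k >= K ==> m k = dil g k"
    using m unfolding lp_family_def by blast
  obtain C where C: "C >= 0" "!!k f. f \<in> schwartz ==> lnorm p (iter_deriv vs (Mul (dil g k) f)) <= C * 2 ^ (k * length vs) * lnorm p f"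
    using lnorm_iter_deriv_Mul_dil[OF b p g(1)] by blast
  have "\<exists>D\<ge>0. \<forall>f\<in>schwartz. lnorm p (iter_deriv vs (Mul (m k) f)) <= D * lnorm p f" for k
  proof -
    have "m k \<in> test_fun UNIV" using m by (simp add: lp_family_def)
    from lnorm_iter_deriv_Mul_dil[OF b p this, of vs] obtain D where
      D: "D >= 0" "!!j f. f \<in> schwartz ==> lnorm p (iter_deriv vs (Mul (dil (m k) j) f)) <= D * 2 ^ (j * length vs) * lnorm p f" by blast
    show ?thesis using D(1) D(2)[of _ 0] by (intro exI[of _ D]) simp
  qed
  then obtain D where D: "!!k. D k >= 0" "!!k f. f \<in> schwartz ==> lnorm p (iter_deriv vs (Mul (m k) f)) <= D k * lnorm p f"
    by metis
  let ?E = "C + (\<Sum>k<K. D k)"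
  have "lnorm p (iter_deriv vs (Mul (m k) f)) <= ?E * 2 ^ (k * length vs) * lnorm p f" if f: "f \<in> schwartz" for k f
  proof (cases "k >= K")
    case True
    have "lnorm p (iter_deriv vs (Mul (m k) f)) <= C * 2 ^ (k * length vs) * lnorm p f"
      using C(2)[OF f] g(2)[OF True] by simp
    also have "... <= ?E * 2 ^ (k * length vs) * lnorm p f"
      using D(1) by (intro mult_right_mono) (auto intro: sum_nonneg)
    finally show ?thesis .
  next
    case False
    have "D k <= (\<Sum>k<K. D k)" using False D(1) by (intro member_le_sum) auto
    then have "D k * 1 <= ?E * 2 ^ (k * length vs)" using C(1) D(1)[of k] by (intro mult_mono) auto
    then show ?thesis using D(2)[OF f, of k] mult_right_mono[of "D k" "?E * 2 ^ (k * length vs)" "lnorm p f"] by simp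
  qed
  moreover have "?E >= 0" using C D by (auto intro!: add_nonneg_nonneg sum_nonneg)
  ultimately show ?thesis by blast
qed

lemma lp_family_gain:
  fixes m :: "nat => real ^ 'd => complex"
  assumes b: "is_cutoff (b :: real ^ 'd => complex)" and p: "1 < p" and m: "lp_family m"
  shows "\<exists>C\<ge>0. \<forall>k. \<forall>f\<in>schwartz. lnorm p (Mul (m k) f) <=
    C * (1 / 2) ^ (k * N) * sob p N f"
proof -
  obtain K g where g: "g \<in> test_fun UNIV" "vanishes_near_0 g" "!!k. k >= K ==> m k = dil g k"
    using m unfolding lp_family_def by blast
  obtain C where C: "C >= 0" "!!k f. f \<in> schwartz ==> lnorm p (Mul (dil g k) f) <=
      C * (1 / 2) ^ (k * N) * sob p N f"
    using lnorm_Mul_dil_gain[OF b p g(1,2)] by blast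
  define D where "D k = (LBINT x. norm (ker (m k) x))" for k
  have D: "D k >= 0" "!!f. f \<in> schwartz ==> lnorm p (Mul (m k) f) <= D k * lnorm p f" for k
    unfolding D_def using m by (auto simp: lp_family_def intro: lnorm_Mul[OF b p])
  \<comment> \<open>For the exceptional k < K the factor \<open>2 ^ (K * N)\<close> outweighs
    (1/2)^(k N), so the claimed decay holds for them too.\<close>
  let ?E = "C + 2 ^ (K * N) * (\<Sum>k<K. D k)"
  have E0: "0 <= (\<Sum>k<K. D k)" using D by (auto intro: sum_nonneg)
  have "lnorm p (Mul (m k) f) <= ?E * (1 / 2) ^ (k * N) * sob p N f"
    if f: "f \<in> schwartz" for k f
  proof -
    let ?S = "\<Sum>vs\<in>basis_lists N. lnorm p (iter_deriv vs f)"
    have S0: "?S >= 0" by (intro sum_nonneg) simp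
    show ?thesis
    proof (cases "k >= K")
      case True
      have "lnorm p (Mul (m k) f) <= C * (1 / 2) ^ (k * N) * ?S" using C(2)[OF f] g(3)[OF True] by simp
      also have "... <= ?E * (1 / 2) ^ (k * N) * ?S" using E0 S0 by (intro mult_right_mono) auto
      finally show ?thesis .
    next
      case False
      have "D k <= (\<Sum>k<K. D k)" using False D(1) by (intro member_le_sum) auto
      moreover have "(2::real) ^ (k * N) <= 2 ^ (K * N)" using False by (intro power_increasing) auto
      then have "1 <= 2 ^ (K * N) * (1 / 2 :: real) ^ (k * N)" by (simp add: power_one_over)
      ultimately have "1 * D k <= (2 ^ (K * N) * (1 / 2) ^ (k * N)) * (\<Sum>k<K. D k)"
        using D(1) by (intro mult_mono) auto
      also have "... <= ?E * (1 / 2) ^ (k * N)" using C(1) by (simp add: algebra_simps)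
      finally have DE: "D k <= ?E * (1 / 2) ^ (k * N)" by simp
      have "lnorm p f <= ?S"
        using member_le_sum[of "[]" "basis_lists N" "%vs. lnorm p (iter_deriv vs f)"] by simp
      then have "D k * lnorm p f <= ?E * (1 / 2) ^ (k * N) * ?S"
        using DE D(1)[of k] by (intro mult_mono) auto
      then show ?thesis using D(2)[OF f, of k] by linarith
    qed
  qed
  moreover have "?E >= 0" using C E0 by auto
  ultimately show ?thesis by blast
qed

section \<open>Change of variables\<close>

text \<open>The library states the change-of-variables theorem for index types that are well-ordered;
  \<open>'d idx\<close> is a well-ordered copy of the finite type \<open>'d\<close>.\<close>

typedef (overloaded) ('d::finite) idx = "{..<CARD('d)}"
  by (rule exI[of _ 0]) simp

instantiation idx :: (finite) linorder
begin

definition "i <= j \<longleftrightarrow> Rep_idx i <= Rep_idx j" for i j :: "'a idx"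

definition "i < j \<longleftrightarrow> Rep_idx i < Rep_idx j" for i j :: "'a idx"

instance
  by intro_classes (auto simp: less_eq_idx_def less_idx_def Rep_idx_inject)

end

instance idx :: (finite) finite
proof
  have "(UNIV :: 'a idx set) = Abs_idx ` {..<CARD('a)}"
    using type_definition.Abs_image[OF type_definition_idx] by blast
  then show "finite (UNIV :: 'a idx set)" by (metis finite_imageI finite_lessThan)
qed

instance idx :: (finite) wellorder
proof
  fix P :: "'a idx => bool" and a :: "'a idx"
  assume step: "!!x. (!!y. y < x ==> P y) ==> P x"
  show "P a"
    by (induction a rule: measure_induct_rule[of Rep_idx]) (use step in \<open>auto simp: less_idx_def\<close>)
qed

lemma ex_idx_bij: "\<exists>\<sigma> :: 'd::finite idx => 'd. bij \<sigma>"
proof -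
  have "bij_betw Abs_idx {..<CARD('d)} (UNIV :: 'd idx set)"
    by (rule bij_betwI[where g=Rep_idx])
       (use Rep_idx in \<open>auto simp: Abs_idx_inverse Rep_idx_inverse\<close>)
  then have "CARD('d idx) = CARD('d)" using bij_betw_same_card by fastforce
  then show ?thesis using finite_same_card_bij[of "UNIV :: 'd idx set" "UNIV :: 'd set"] by simp
qed

definition ix :: "'d::finite idx => 'd" where "ix = (SOME \<sigma>. bij \<sigma>)"

lemma bij_ix: "bij (ix :: 'd::finite idx => 'd)"
  unfolding ix_def using someI_ex[OF ex_idx_bij] .

lemma inv_ix [simp]: "inv ix (ix i) = i" "ix (inv ix j) = j"
  by (rule inv_f_f[OF bij_is_inj[OF bij_ix]], rule surj_f_inv_f[OF bij_is_surj[OF bij_ix]])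

definition tw :: "real ^ 'd => real ^ 'd::finite idx" where "tw x = (\<chi> i. x $ ix i)"

definition tw' :: "real ^ 'd::finite idx => real ^ 'd" where "tw' y = (\<chi> j. y $ inv ix j)"

lemma tw_inverse [simp]: "tw' (tw x) = x" "tw (tw' y) = y"
  by (auto simp: tw_def tw'_def vec_eq_iff)

lemma linear_tw: "linear tw" "linear tw'"
  by (auto simp: linear_iff tw_def tw'_def vec_eq_iff)

lemma bounded_linear_tw: "bounded_linear tw" "bounded_linear tw'"
  using linear_tw by (auto simp: linear_linear)

text \<open>Conjugation by the bijection \<open>ix\<close> carries the permutations of one index
  type onto those of the other and preserves signs, so the two Leibniz sums agree term by
  term.\<close>

lemma det_reindex:
  fixes A :: "real ^ 'd::finite ^ 'd"
  shows "det (\<chi> i j. A $ ix i $ ix j) = det A"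
proof -
  let ?S = "{p :: 'd idx => 'd idx. p permutes UNIV}" and ?T = "{p :: 'd => 'd. p permutes UNIV}"
  let ?m = "map_permutation UNIV (ix :: 'd idx => 'd)"
  have inj: "inj (ix :: 'd idx => 'd)" using bij_ix bij_is_inj by blast
  have ap: "?m p (ix i) = ix (p i)" for p i by (rule map_permutation_apply[OF inj]) simp
  have m: "?m p permutes UNIV" if "p permutes UNIV" for p
    by (rule map_permutation_permutes[OF _ that]) (use bij_ix in simp)
  have bij: "bij_betw ?m ?S ?T"
  proof (rule bij_betwI[where g="%p i. inv ix (p (ix i))"])
    show "?m \<in> ?S \<rightarrow> ?T" using m by auto
    show "(%p i. inv ix (p (ix i))) \<in> ?T \<rightarrow> ?S"
    proof (intro funcsetI, clarsimp)
      fix p :: "'d => 'd" assume "p permutes UNIV"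
      then have "bij (inv ix \<circ> p \<circ> ix)" using bij_ix by (intro bij_comp bij_imp_bij_inv) (auto simp: permutes_bij)
      then show "(%i. inv ix (p (ix i))) permutes UNIV" by (intro bij_imp_permutes) (auto simp: comp_def)
    qed
    show "(%i. inv ix (?m p (ix i))) = p" if "p \<in> ?S" for p by (simp add: ap)
    show "?m (%i. inv ix (p (ix i))) = p" if "p \<in> ?T" for p
    proof
      fix j
      show "?m (%i. inv ix (p (ix i))) j = p j" using ap[of "%i. inv ix (p (ix i))" "inv ix j"] by simp
    qed
  qed
  have "det A = (\<Sum>p\<in>?T. of_int (sign p) * (\<Prod>j\<in>UNIV. A $ j $ p j))" by (simp add: det_def)
  also have "... = (\<Sum>p\<in>?S. of_int (sign (?m p)) * (\<Prod>j\<in>UNIV. A $ j $ ?m p j))"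
    by (rule sum.reindex_bij_betw[OF bij, symmetric])
  also have "... = (\<Sum>p\<in>?S. of_int (sign p) * (\<Prod>i\<in>UNIV. A $ ix i $ ix (p i)))"
  proof (intro sum.cong refl)
    fix p assume p: "p \<in> ?S"
    have "(\<Prod>j\<in>UNIV. A $ j $ ?m p j) = (\<Prod>i\<in>UNIV. A $ ix i $ ?m p (ix i))"
      by (rule prod.reindex_bij_betw[OF bij_ix, symmetric])
    then show "of_int (sign (?m p)) * (\<Prod>j\<in>UNIV. A $ j $ ?m p j) = of_int (sign p) * (\<Prod>i\<in>UNIV. A $ ix i $ ix (p i))"
      using sign_map_permutation[OF inj, of p] p by (simp add: ap)
  qed
  also have "... = det (\<chi> i j. A $ ix i $ ix j)" by (simp add: det_def)
  finally show ?thesis ..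
qed

text \<open>Lebesgue measure is determined by its values on boxes, and permuting coordinates only
  permutes the side lengths.\<close>

lemma distr_tw: "distr lborel borel (tw :: real ^ 'd => real ^ 'd::finite idx) = lborel"
proof (rule lborel_eqI[symmetric])
  fix l u :: "real ^ 'd idx" assume le: "!!b. b \<in> Basis ==> l \<bullet> b <= u \<bullet> b"
  have [measurable]: "tw \<in> borel_measurable borel"
    by (intro borel_measurable_continuous_onI linear_continuous_on bounded_linear_tw)
  have vim: "tw -` box l u = box (tw' l) (tw' u)"
  proof -
    have "x \<in> tw -` box l u \<longleftrightarrow> x \<in> box (tw' l) (tw' u)" for x :: "real ^ 'd"
      unfolding vimage_def mem_Collect_eq mem_box_cart tw_def tw'_def
      by simp (metis inv_ix)
    then show ?thesis by blast
  qed
  have e: "(\<Prod>b\<in>Basis. (v :: real ^ 'm) \<bullet> b) = (\<Prod>i\<in>UNIV. v $ i)" for v :: "real ^ 'm::finite"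
  proof -
    have "(Basis :: (real ^ 'm) set) = (%i. axis i 1) ` UNIV" by (auto simp: Basis_vec_def)
    then have "(\<Prod>b\<in>Basis. v \<bullet> b) = (\<Prod>b\<in>range (%i. axis i 1). v \<bullet> b)" by (simp only:)
    also have "... = (\<Prod>i\<in>UNIV. v \<bullet> axis i 1)"
      by (subst prod.reindex) (auto simp: inj_on_def axis_eq_axis)
    finally show ?thesis by (simp add: inner_axis)
  qed
  have le': "tw' l $ j <= tw' u $ j" for j
  proof -
    have "axis (inv ix j) (1::real) \<in> Basis" by (auto simp: Basis_vec_def)
    from le[OF this] show ?thesis by (simp add: tw'_def inner_axis)
  qed
  have "emeasure (distr lborel borel tw) (box l u) = emeasure lborel (box (tw' l) (tw' u))"
    by (subst emeasure_distr) (auto simp: vim)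
  also have "... = (\<Prod>b\<in>Basis. (tw' u - tw' l) \<bullet> b)"
    using le' by (intro emeasure_lborel_box) (auto simp: Basis_vec_def inner_axis)
  also have "(\<Prod>b\<in>Basis. (tw' u - tw' l) \<bullet> b) = (\<Prod>j\<in>UNIV. (u - l) $ inv ix j)"
    by (simp add: e tw'_def)
  also have "... = (\<Prod>i\<in>UNIV. (u - l) $ i)"
    by (rule prod.reindex_bij_betw[OF bij_imp_bij_inv[OF bij_ix]])
  finally show "emeasure (distr lborel borel tw) (box l u) = ennreal (\<Prod>b\<in>Basis. (u - l) \<bullet> b)"
    by (simp add: e)
qed simp

definition jac :: "(real ^ 'd::finite => real ^ 'd) => real ^ 'd => real" where
  "jac \<psi> x = \<bar>det (matrix (frechet_derivative \<psi> (at x)))\<bar>"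

text \<open>The inverse is carried along as an explicit map, so that passing to the transposed
  operator merely exchanges the two halves of the data.\<close>

definition diffeo :: "'a::euclidean_space set => ('a => 'a) => 'a set => ('a => 'a) => bool" where
  "diffeo U \<psi> V \<psi>' \<longleftrightarrow> open U \<and> open V \<and> Cinf U \<psi> \<and> Cinf V \<psi>' \<and> \<psi> ` U \<subseteq> V \<and> \<psi>' ` V \<subseteq> U \<and>
     (\<forall>x\<in>U. \<psi>' (\<psi> x) = x) \<and> (\<forall>y\<in>V. \<psi> (\<psi>' y) = y)"

lemma diffeo_sym: "diffeo U \<psi> V \<psi>' \<longleftrightarrow> diffeo V \<psi>' U \<psi>"
  by (auto simp: diffeo_def)

lemma integral_change_of_variables_idx:
  fixes g :: "real ^ 'm::{finite,wellorder} => real ^ 'm::_" and f :: "real ^ 'm::_ => real"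
  assumes S: "S \<in> sets lebesgue" and g: "!!x. x \<in> S ==> (g has_derivative g' x) (at x within S)" "inj_on g S"
    and f: "f absolutely_integrable_on g ` S"
  shows "(%x. \<bar>det (matrix (g' x))\<bar> * f (g x)) absolutely_integrable_on S"
    "integral (g ` S) f = integral S (%x. \<bar>det (matrix (g' x))\<bar> * f (g x))"
proof -
  let ?f = "%x. vec (f x) :: real ^ 1"
  have fv: "?f absolutely_integrable_on g ` S"
    using f by (simp add: absolutely_integrable_on_1_iff)
  have iff: "(%x. \<bar>det (matrix (g' x))\<bar> *\<^sub>R ?f (g x)) absolutely_integrable_on S \<and>
           integral S (%x. \<bar>det (matrix (g' x))\<bar> *\<^sub>R ?f (g x)) = integral (g ` S) ?f"
    using has_absolute_integral_change_of_variables[OF S g, of ?f "integral (g ` S) ?f"] fv by blast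
  then show "(%x. \<bar>det (matrix (g' x))\<bar> * f (g x)) absolutely_integrable_on S"
    by (simp add: absolutely_integrable_on_1_iff)
  have "integral (g ` S) f = integral (g ` S) ?f $ 1"
    using fv by (simp add: integral_on_1_eq)
  also have "... = integral S (%x. \<bar>det (matrix (g' x))\<bar> * f (g x))"
    using iff by (simp add: integral_on_1_eq)
  finally show "integral (g ` S) f = integral S (%x. \<bar>det (matrix (g' x))\<bar> * f (g x))" .
qed

lemma det_chain:
  fixes \<psi> \<psi>' :: "real ^ 'd::finite => real ^ 'd"
  assumes "diffeo U \<psi> V \<psi>'" "x \<in> U"
  shows "det (matrix (frechet_derivative \<psi>' (at (\<psi> x)))) * det (matrix (frechet_derivative \<psi> (at x))) = 1"
proof -
  have U: "open U" and C: "Cinf U \<psi>" "Cinf V \<psi>'" and V: "\<psi> x \<in> V" and i: "!!x. x \<in> U ==> \<psi>' (\<psi> x) = x"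
    using assms by (auto simp: diffeo_def)
  let ?D = "frechet_derivative \<psi> (at x)" and ?D' = "frechet_derivative \<psi>' (at (\<psi> x))"
  have d: "(\<psi> has_derivative ?D) (at x)" and d': "(\<psi>' has_derivative ?D') (at (\<psi> x))"
    using Cinf_differentiable[OF C(1) assms(2)] Cinf_differentiable[OF C(2) V] has_derivative_frechet by blast+
  have "((%x. \<psi>' (\<psi> x)) has_derivative (%v. ?D' (?D v))) (at x)"
    by (rule has_derivative_compose[OF d d'])
  then have "((%x. x) has_derivative (%v. ?D' (?D v))) (at x)"
    using has_derivative_cong_open[OF U assms(2), of "%x. \<psi>' (\<psi> x)" "%x. x"] i by blast
  then have "(%v. ?D' (?D v)) = (%v. v)" using has_derivative_unique[OF _ has_derivative_ident] by blast
  then have "?D' \<circ> ?D = id" by (auto simp: fun_eq_iff)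
  moreover have "matrix (?D' \<circ> ?D) = matrix ?D' ** matrix ?D"
    by (rule matrix_compose[OF has_derivative_linear[OF d] has_derivative_linear[OF d']])
  ultimately have "matrix ?D' ** matrix ?D = mat 1" by (simp add: matrix_id_mat_1)
  then show ?thesis by (metis det_I det_mul)
qed

text \<open>The determinant is a polynomial in the first derivatives, and the chain rule shows that
  it has no zeros, so its absolute value is smooth.\<close>

lemma Cinf_jac:
  fixes \<psi> :: "real ^ 'd::finite => real ^ 'd"
  assumes "diffeo U \<psi> V \<psi>'" shows "Cinf U (jac \<psi>)"
proof -
  have U: "open U" and C: "Cinf U \<psi>" using assms by (auto simp: diffeo_def)
  have "Cinf U (%x. Dv v \<psi> x $ i)" for v and i :: 'd
    using Cinf_linear_compose[OF bounded_linear_vec_nth U Cinf_Dv[OF C]] .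
  then have "Cinf U (%x. det (matrix (frechet_derivative \<psi> (at x))))"
    unfolding det_def matrix_def
    by (auto intro!: Cinf_sum[OF U] Cinf_mult[OF U] Cinf_prod[OF U])
  moreover have "det (matrix (frechet_derivative \<psi> (at x))) ~= 0" if "x \<in> U" for x
    using det_chain[OF assms that] by auto
  ultimately show ?thesis unfolding jac_def[abs_def] by (intro Cinf_abs U)
qed

lemma set_lebesgue_integral_support:
  fixes h :: "'a::euclidean_space => 'b::{banach, second_countable_topology}"
  assumes "!!x. x \<notin> K ==> h x = 0"
  shows "(LINT x:K|lborel. h x) = (LBINT x. h x)"
  unfolding set_lebesgue_integral_def
  by (intro integral_cong_refl) (use assms in \<open>auto simp: indicator_def\<close>)

lemma lborel_integral_tw:
  fixes h :: "real ^ 'd::finite => 'b::{banach, second_countable_topology}"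
  assumes [measurable]: "h \<in> borel_measurable borel"
  shows "(LBINT z. h (tw' z)) = (LBINT x. h x)"
proof -
  have [measurable]: "(tw :: real ^ 'd => _) \<in> borel_measurable borel" "(tw' :: _ => real ^ 'd) \<in> borel_measurable borel"
    by (intro borel_measurable_continuous_onI linear_continuous_on bounded_linear_tw)+
  have "(LBINT z. h (tw' z)) = (LINT z|distr lborel borel (tw :: real ^ 'd => _). h (tw' z))"
    by (simp only: distr_tw)
  also have "... = (LBINT x. h (tw' (tw x)))" by (intro integral_distr) auto
  finally show ?thesis by simp
qed

lemma change_of_variables_real:
  fixes \<psi> \<psi>' :: "real ^ 'd::finite => real ^ 'd" and h :: "real ^ 'd => real"
  assumes df: "diffeo U \<psi> V \<psi>'" and h: "continuous_on UNIV h"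
    and K: "compact K" "K \<subseteq> U" "!!x. x \<notin> K ==> h x = 0"
  shows "(LBINT x. h x) = (LBINT y. (if y \<in> V then jac \<psi>' y * h (\<psi>' y) else 0))"
proof -
  have V: "open V" and C: "Cinf U \<psi>" "Cinf V \<psi>'" and im: "\<psi> ` U \<subseteq> V" "\<psi>' ` V \<subseteq> U"
    and inv: "!!x. x \<in> U ==> \<psi>' (\<psi> x) = x" "!!y. y \<in> V ==> \<psi> (\<psi>' y) = y"
    using df by (auto simp: diffeo_def)
  define S where "S = \<psi> ` K"
  have S: "compact S" "S \<subseteq> V"
    unfolding S_def using K im continuous_on_subset[OF Cinf_imp_continuous[OF C(1)] K(2)]
    by (auto intro: compact_continuous_image)
  define g where "g z = tw (\<psi>' (tw' z))" for z :: "real ^ 'd idx"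
  define g' where "g' z v = tw (frechet_derivative \<psi>' (at (tw' z)) (tw' v))" for z v :: "real ^ 'd idx"
  have twc: "continuous_on X (tw :: real ^ 'd => _)" "continuous_on Y (tw' :: _ => real ^ 'd)" for X Y
    by (intro linear_continuous_on bounded_linear_tw)+
  have cS: "compact (tw ` S)" and cK: "compact (tw ` K)"
    using S K by (auto intro: compact_continuous_image twc)
  have tS: "tw' z \<in> V" if "z \<in> tw ` S" for z using that S by auto
  have gi: "g ` (tw ` S) = tw ` K"
    unfolding g_def S_def image_image using inv(1) K(2) by (intro image_cong) auto
  have dg: "(g has_derivative g' z) (at z within tw ` S)" if "z \<in> tw ` S" for z
    unfolding g_def[abs_def] g'_def
    by (rule has_derivative_at_withinI)
      (intro bounded_linear.has_derivative[OF bounded_linear_tw(1)]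
         has_derivative_compose[OF bounded_linear_imp_has_derivative[OF bounded_linear_tw(2)]]
         has_derivative_frechet Cinf_differentiable[OF C(2) tS[OF that]])
  have inj: "inj_on g (tw ` S)"
  proof (rule inj_onI)
    fix z z' assume z: "z \<in> tw ` S" "z' \<in> tw ` S" "g z = g z'"
    then have "\<psi>' (tw' z) = \<psi>' (tw' z')" unfolding g_def by (metis tw_inverse(1))
    then have "tw' z = tw' z'" using inv(2) tS z by metis
    then show "z = z'" by (metis tw_inverse(2))
  qed
  have dj: "\<bar>det (matrix (g' z))\<bar> = jac \<psi>' (tw' z)" for z
  proof -
    have ax: "tw' (axis j 1) = axis (ix j) (1::real)" for j :: "'d idx"
      by (auto simp: tw'_def axis_def vec_eq_iff)
    have "matrix (g' z) = (\<chi> i j. matrix (frechet_derivative \<psi>' (at (tw' z))) $ ix i $ ix j)"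
      by (simp add: matrix_def g'_def ax tw_def vec_eq_iff)
    then show ?thesis unfolding jac_def by (simp add: det_reindex)
  qed
  have hc: "continuous_on X (%z. h (tw' z))" for X
    using continuous_on_compose2[OF h twc(2)] by simp
  have ai: "(%z. h (tw' z)) absolutely_integrable_on g ` (tw ` S)"
    unfolding gi set_integrable_def
    using borel_integrable_compact[OF cK hc] by (subst integrable_completion) auto
  have jc: "continuous_on V (jac \<psi>')" using Cinf_jac df diffeo_sym Cinf_imp_continuous by blast
  have kc: "continuous_on V (%y. jac \<psi>' y * h (\<psi>' y))"
    by (intro continuous_intros jc continuous_on_compose2[OF h Cinf_imp_continuous[OF C(2)]]) auto
  let ?k = "%y. if y \<in> V then jac \<psi>' y * h (\<psi>' y) else 0"
  have k0: "?k y = 0" if "y \<notin> S" for y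
  proof -
    have "\<psi>' y \<notin> K" if "y \<in> V" using inv(2)[OF that] \<open>y \<notin> S\<close> unfolding S_def by force
    then show ?thesis using K(3) by auto
  qed
  have km: "?k \<in> borel_measurable borel"
    by (rule borel_measurable_continuous_on_if) (use V kc in auto)
  have "(LBINT x. h x) = (LBINT z. h (tw' z))"
    by (rule lborel_integral_tw[symmetric]) (rule borel_measurable_continuous_onI[OF h])
  also have "... = (LINT z:tw ` K|lborel. h (tw' z))"
  proof (rule set_lebesgue_integral_support[symmetric])
    fix z :: "real ^ 'd idx" assume "z \<notin> tw ` K"
    then have "tw' z \<notin> K" by (metis image_eqI tw_inverse(2))
    then show "h (tw' z) = 0" by (rule K(3))
  qed
  also have "... = integral (tw ` K) (%z. h (tw' z))"
    by (rule set_borel_integral_eq_integral(2))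
       (unfold set_integrable_def, rule borel_integrable_compact[OF cK hc])
  also have "... = integral (tw ` S) (%z. \<bar>det (matrix (g' z))\<bar> * h (tw' (g z)))"
    using integral_change_of_variables_idx(2)[OF _ dg inj ai] cS gi by (simp add: lmeasurable_compact fmeasurableD)
  also have "... = integral (tw ` S) (%z. ?k (tw' z))"
    using tS by (intro integral_cong) (simp add: dj g_def)
  also have "... = (LINT z:tw ` S|lborel. ?k (tw' z))"
  proof (rule set_borel_integral_eq_integral(2)[symmetric])
    have "continuous_on (tw ` S) (%z. jac \<psi>' (tw' z) * h (\<psi>' (tw' z)))"
      by (rule continuous_on_compose2[OF kc twc(2)]) (use tS in auto)
    then have "continuous_on (tw ` S) (%z. ?k (tw' z))"
      by (rule continuous_on_eq) (use tS in auto)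
    then show "set_integrable lborel (tw ` S) (%z. ?k (tw' z))"
      unfolding set_integrable_def by (rule borel_integrable_compact[OF cS])
  qed
  also have "... = (LBINT z. ?k (tw' z))"
  proof (rule set_lebesgue_integral_support)
    fix z :: "real ^ 'd idx" assume "z \<notin> tw ` S"
    then have "tw' z \<notin> S" by (metis image_eqI tw_inverse(2))
    then show "?k (tw' z) = 0" by (rule k0)
  qed
  also have "... = (LBINT y. ?k y)" by (rule lborel_integral_tw[OF km])
  finally show ?thesis .
qed

lemma compact_support_integrable:
  fixes h :: "'a::euclidean_space => 'b::{banach, second_countable_topology}"
  assumes "continuous_on UNIV h" "compact K" "!!x. x \<notin> K ==> h x = 0"
  shows "integrable lborel h"
proof -
  have "integrable lborel (%x. indicator K x *\<^sub>R h x)"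
    by (rule borel_integrable_compact[OF assms(2) continuous_on_subset[OF assms(1)]]) simp
  moreover have "(%x. indicator K x *\<^sub>R h x) = h" using assms(3) by (auto simp: indicator_def fun_eq_iff)
  ultimately show ?thesis by simp
qed

lemma pushforward_continuous:
  fixes h :: "'a::euclidean_space => 'b::real_normed_vector" and \<psi> \<psi>' :: "'a => 'a"
  assumes df: "diffeo U \<psi> V \<psi>'" and h: "continuous_on UNIV h"
    and K: "compact K" "K \<subseteq> U" "!!x. x \<notin> K ==> h x = 0" and c: "continuous_on V c"
  shows "continuous_on UNIV (%y. if y \<in> V then c y *\<^sub>R h (\<psi>' y) else 0)"
    "compact (\<psi> ` K)" "!!y. y \<notin> \<psi> ` K ==> (if y \<in> V then c y *\<^sub>R h (\<psi>' y) else 0) = 0"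
proof -
  have V: "open V" and C: "Cinf U \<psi>" "Cinf V \<psi>'" and inv: "!!y. y \<in> V ==> \<psi> (\<psi>' y) = y"
    and im: "\<psi> ` U \<subseteq> V"
    using df by (auto simp: diffeo_def)
  show S: "compact (\<psi> ` K)"
    using K continuous_on_subset[OF Cinf_imp_continuous[OF C(1)] K(2)] by (auto intro: compact_continuous_image)
  let ?k = "%y. if y \<in> V then c y *\<^sub>R h (\<psi>' y) else 0"
  show z: "?k y = 0" if "y \<notin> \<psi> ` K" for y
  proof -
    have "\<psi>' y \<notin> K" if "y \<in> V" using inv[OF that] \<open>y \<notin> \<psi> ` K\<close> by force
    then show ?thesis using K(3) by auto
  qed
  have "continuous_on V (%y. c y *\<^sub>R h (\<psi>' y))"
    by (intro continuous_intros c continuous_on_compose2[OF h Cinf_imp_continuous[OF C(2)]]) auto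
  then have 1: "continuous_on V ?k" by (rule continuous_on_eq) auto
  have 2: "continuous_on (- \<psi> ` K) ?k"
    by (rule continuous_on_eq[of _ "%_. 0"]) (use z in auto)
  have "open (- \<psi> ` K)" using S by (simp add: compact_imp_closed open_Compl)
  from continuous_on_open_Un[OF V this 1 2] show "continuous_on UNIV ?k"
    using K im by (auto simp: Un_absorb2 Compl_partition2 elim!: continuous_on_subset)
qed

lemma change_of_variables:
  fixes \<psi> \<psi>' :: "real ^ 'd::finite => real ^ 'd" and h :: "real ^ 'd => complex"
  assumes df: "diffeo U \<psi> V \<psi>'" and h: "continuous_on UNIV h"
    and K: "compact K" "K \<subseteq> U" "!!x. x \<notin> K ==> h x = 0"
  shows "(LBINT x. h x) = (LBINT y. (if y \<in> V then jac \<psi>' y *\<^sub>R h (\<psi>' y) else 0))"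
proof -
  let ?k = "%y. if y \<in> V then jac \<psi>' y *\<^sub>R h (\<psi>' y) else 0"
  have hi: "integrable lborel h" by (rule compact_support_integrable[OF h K(1,3)])
  have jc: "continuous_on V (jac \<psi>')" using Cinf_jac df diffeo_sym Cinf_imp_continuous by blast
  note p = pushforward_continuous[OF df h K jc]
  have ki: "integrable lborel ?k" by (rule compact_support_integrable[OF p])
  show ?thesis
  proof (rule complex_eqI)
    have "Re (LBINT x. h x) = (LBINT x. Re (h x))" using hi by simp
    also have "... = (LBINT y. (if y \<in> V then jac \<psi>' y * Re (h (\<psi>' y)) else 0))"
      using K by (intro change_of_variables_real[OF df _ K(1,2)] continuous_intros h) auto
    also have "... = (LBINT y. Re (?k y))" by (intro integral_cong_refl) auto
    also have "... = Re (LBINT y. ?k y)" using ki by simp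
    finally show "Re (LBINT x. h x) = Re (LBINT y. ?k y)" .
    have "Im (LBINT x. h x) = (LBINT x. Im (h x))" using hi by simp
    also have "... = (LBINT y. (if y \<in> V then jac \<psi>' y * Im (h (\<psi>' y)) else 0))"
      using K by (intro change_of_variables_real[OF df _ K(1,2)] continuous_intros h) auto
    also have "... = (LBINT y. Im (?k y))" by (intro integral_cong_refl) auto
    also have "... = Im (LBINT y. ?k y)" using ki by simp
    finally show "Im (LBINT x. h x) = Im (LBINT y. ?k y)" .
  qed
qed

lemma test_fun_push:
  assumes df: "diffeo U \<psi> V \<psi>'" and a: "a \<in> test_fun U" and g: "Cinf V g"
  shows "(%y. if y \<in> V then a (\<psi>' y) * g y else 0) \<in> test_fun V"
proof -
  have V: "open V" and C: "Cinf U \<psi>" "Cinf V \<psi>'" and inv: "!!y. y \<in> V ==> \<psi> (\<psi>' y) = y"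
    and im: "\<psi> ` U \<subseteq> V" using df by (auto simp: diffeo_def)
  from a obtain K where K: "compact K" "K \<subseteq> U" "!!x. x \<notin> K ==> a x = 0" "Cinf UNIV a"
    by (rule test_funE) blast
  have S: "compact (\<psi> ` K)"
    using K continuous_on_subset[OF Cinf_imp_continuous[OF C(1)] K(2)] by (auto intro: compact_continuous_image)
  let ?k = "%y. if y \<in> V then a (\<psi>' y) * g y else 0"
  have z: "?k y = 0" if "y \<notin> \<psi> ` K" for y
  proof -
    have "\<psi>' y \<notin> K" if "y \<in> V" using inv[OF that] \<open>y \<notin> \<psi> ` K\<close> by force
    then show ?thesis using K(3) by auto
  qed
  have 1: "Cinf V ?k"
  proof (subst Cinf_cong[OF V])
    show "Cinf V (%y. a (\<psi>' y) * g y)"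
      by (intro Cinf_mult V g Cinf_compose[OF V open_UNIV C(2) K(4)]) auto
  qed simp
  have o: "open (- \<psi> ` K)" using S by (simp add: compact_imp_closed open_Compl)
  have 2: "Cinf (- \<psi> ` K) ?k"
    by (subst Cinf_cong[OF o, where g="%_. 0"]) (use z in auto)
  have "Cinf UNIV ?k"
  proof (rule Cinf_local)
    fix y
    show "\<exists>U. open U \<and> y \<in> U \<and> Cinf U ?k"
    proof (cases "y \<in> V")
      case True then show ?thesis using V 1 by blast
    next
      case False
      then have "y \<in> - \<psi> ` K" using K(2) im by auto
      then show ?thesis using o 2 by blast
    qed
  qed
  then show ?thesis using S z K(2) im by (intro test_funI[of _ "\<psi> ` K"]) auto
qed

section \<open>Off-diagonal decay\<close>

definition pull :: "('a => complex) => ('a => 'b) => ('b => complex) => 'a => complex" where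
  "pull a \<psi> f x = a x * f (\<psi> x)"

text \<open>The coefficient of the transposed operator: the transpose of
  \<open>pull a \<psi>\<close> is \<open>pull (adj \<psi>' V a) \<psi>'\<close>, again an operator
  of the same form.\<close>

definition adj :: "(real ^ 'd::finite => real ^ 'd) => (real ^ 'd) set => (real ^ 'd => complex) => real ^ 'd => complex" where
  "adj \<psi>' V a y = (if y \<in> V then a (\<psi>' y) * complex_of_real (jac \<psi>' y) else 0)"

lemma diffeo_D:
  assumes "diffeo U \<psi> V \<psi>'"
  shows "open U" "open V" "Cinf U \<psi>" "Cinf V \<psi>'" "!!x. x \<in> U ==> \<psi> x \<in> V" "!!y. y \<in> V ==> \<psi>' y \<in> U"
    "!!x. x \<in> U ==> \<psi>' (\<psi> x) = x" "!!y. y \<in> V ==> \<psi> (\<psi>' y) = y"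
  using assms by (auto simp: diffeo_def)

lemma adj_test_fun:
  assumes "diffeo U \<psi> V \<psi>'" "a \<in> test_fun U" shows "adj \<psi>' V a \<in> test_fun V"
  unfolding adj_def[abs_def]
  using test_fun_push[OF assms Cinf_of_real[OF diffeo_D(2)[OF assms(1)] Cinf_jac]] assms(1) diffeo_sym by blast

lemma pull_test_fun:
  assumes "diffeo U \<psi> V \<psi>'" "a \<in> test_fun U" "Cinf UNIV f"
  shows "pull a \<psi> f \<in> test_fun U"
  unfolding pull_def[abs_def] using test_fun_pullback[OF assms(2) diffeo_D(1,3)[OF assms(1)] assms(3)] .

lemma pull_schwartz:
  assumes "diffeo U \<psi> V \<psi>'" "a \<in> test_fun U" "f \<in> schwartz"
  shows "pull a \<psi> f \<in> schwartz"
  using test_fun_schwartz[OF pull_test_fun[OF assms(1,2) schwartz_Cinf[OF assms(3)]]] .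

lemma scont_pull: "diffeo U \<psi> V \<psi>' ==> a \<in> test_fun U ==> scont (pull a \<psi>)"
  unfolding pull_def[abs_def] by (rule scont_pullback[OF diffeo_D(1,3)])

lemma pull_transpose:
  assumes df: "diffeo U \<psi> V \<psi>'" and a: "a \<in> test_fun U" and h: "Cinf UNIV h" and f: "Cinf UNIV f"
  shows "(LBINT x. h x * pull a \<psi> f x) = (LBINT y. pull (adj \<psi>' V a) \<psi>' h y * f y)"
proof -
  from a obtain K where K: "compact K" "K \<subseteq> U" "!!x. x \<notin> K ==> a x = 0" by (rule test_funE) blast
  have "continuous_on UNIV (%x. h x * pull a \<psi> f x)"
    by (intro continuous_intros Cinf_imp_continuous h test_fun_Cinf[OF pull_test_fun[OF df a f]])
  then have "(LBINT x. h x * pull a \<psi> f x) =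
      (LBINT y. (if y \<in> V then jac \<psi>' y *\<^sub>R (h (\<psi>' y) * pull a \<psi> f (\<psi>' y)) else 0))"
    by (rule change_of_variables[OF df _ K(1,2)]) (simp add: pull_def K(3))
  also have "... = (LBINT y. pull (adj \<psi>' V a) \<psi>' h y * f y)"
    using diffeo_D(8)[OF df]
    by (intro integral_cong_refl) (simp add: pull_def adj_def scaleR_conv_of_real)
  finally show ?thesis .
qed

text \<open>After the substitution |f|^r is multiplied by the Jacobian times |a \<circ> \<psi>'|^r,
  a continuous function of compact support and hence bounded by some \<open>B\<close>; the operator
  norm is at most B^(1/r).\<close>

lemma pull_lnorm:
  fixes \<psi> \<psi>' :: "real ^ 'd::finite => real ^ 'd"
  assumes df: "diffeo U \<psi> V \<psi>'" and a: "a \<in> test_fun U" and r: "r > 0"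
  shows "\<exists>C\<ge>0. \<forall>f\<in>schwartz. r >= 1 --> lnorm r (pull a \<psi> f) <= C * lnorm r f"
proof -
  from a obtain K where K: "compact K" "K \<subseteq> U" "!!x. x \<notin> K ==> a x = 0" by (rule test_funE) blast
  let ?k = "%y. if y \<in> V then jac \<psi>' y *\<^sub>R (norm (a (\<psi>' y)) powr r) else 0"
  have jc: "continuous_on V (jac \<psi>')" using Cinf_jac df diffeo_sym Cinf_imp_continuous by blast
  have ac: "continuous_on UNIV (%x. norm (a x) powr r)"
    using r by (intro continuous_on_powr' continuous_intros Cinf_imp_continuous test_fun_Cinf[OF a]) auto
  have a0: "norm (a x) powr r = 0" if "x \<notin> K" for x using K(3)[OF that] by simp
  note k = pushforward_continuous[OF df ac K(1,2) a0 jc]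
  have "bounded (?k ` (\<psi> ` K))"
    using compact_continuous_image[OF continuous_on_subset[OF k(1)] k(2)] compact_imp_bounded by blast
  then obtain B where B: "B > 0" "!!y. y \<in> \<psi> ` K ==> norm (?k y) <= B" unfolding bounded_pos by blast
  have kB: "?k y <= B" for y
    using B(2)[of y] B(1) k(3)[of y] by (cases "y \<in> \<psi> ` K") (auto simp: abs_le_iff)
  show ?thesis
  proof (intro exI[of _ "B powr (1 / r)"] conjI ballI impI)
    fix f :: "real ^ 'd => complex" assume f: "f \<in> schwartz" and r1: "r >= 1"
    have fi: "integrable lborel (%y. norm (f y) powr r)" using schwartz_Lp[OF f r1] by (simp add: Lp_fun_def)
    have "continuous_on UNIV (%x. norm (pull a \<psi> f x) powr r)"
      using r by (intro continuous_on_powr' continuous_intros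
          Cinf_imp_continuous test_fun_Cinf[OF pull_test_fun[OF df a schwartz_Cinf[OF f]]]) auto
    then have "(LBINT x. norm (pull a \<psi> f x) powr r) =
        (LBINT y. (if y \<in> V then jac \<psi>' y * (norm (pull a \<psi> f (\<psi>' y)) powr r) else 0))"
      by (rule change_of_variables_real[OF df _ K(1,2)]) (simp add: pull_def K(3))
    also have "... <= (LBINT y. B * norm (f y) powr r)"
    proof (rule integral_mono')
      show "integrable lborel (%y. B * norm (f y) powr r)" using fi by simp
      fix y
      show "0 <= B * norm (f y) powr r" using B by simp
      show "(if y \<in> V then jac \<psi>' y * (norm (pull a \<psi> f (\<psi>' y)) powr r) else 0) <= B * norm (f y) powr r"
      proof (cases "y \<in> V")
        case True
        have "jac \<psi>' y * (norm (pull a \<psi> f (\<psi>' y)) powr r) = ?k y * norm (f y) powr r"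
          using True diffeo_D(8)[OF df True] by (simp add: pull_def norm_mult powr_mult)
        also have "... <= B * norm (f y) powr r" by (intro mult_right_mono kB) simp
        finally show ?thesis using True by simp
      qed (use B in simp)
    qed
    finally have "(LBINT x. norm (pull a \<psi> f x) powr r) <= B * (LBINT y. norm (f y) powr r)" by simp
    then have "lnorm r (pull a \<psi> f) <= (B * (LBINT y. norm (f y) powr r)) powr (1 / r)"
      unfolding lnorm_def using r by (intro powr_mono2 integral_nonneg_AE) auto
    then show "lnorm r (pull a \<psi> f) <= B powr (1 / r) * lnorm r f"
      unfolding lnorm_def using B by (simp add: powr_mult)
  qed simp
qed

lemma pull_sobolev:
  fixes \<psi> \<psi>' :: "real ^ 'd::finite => real ^ 'd"
  assumes b: "is_cutoff (b :: real ^ 'd => complex)" and r: "1 < r"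
    and df: "diffeo U \<psi> V \<psi>'" and a: "a \<in> test_fun U" and vs: "set vs \<subseteq> Basis"
  shows "\<exists>C\<ge>0. \<forall>f\<in>schwartz. lnorm r (iter_deriv vs (pull a \<psi> f)) <= C * sob r (length vs) f"
  unfolding pull_def[abs_def]
proof (rule pullback_deriv_bound[where \<nu>="lnorm r" and W="lnorm r" and X=schwartz and V=U])
  show "\<exists>C\<ge>0. \<forall>f\<in>schwartz. lnorm r (%x. a x * f (\<psi> x)) <= C * lnorm r f" if "a \<in> test_fun U" for a
    using pull_lnorm[OF df that, of r] r unfolding pull_def[abs_def] by auto
  show "lnorm r (%x. f x + g x) <= lnorm r f + lnorm r g" if "f \<in> test_fun U" "g \<in> test_fun U" for f g :: "real ^ 'd => complex"
    using that by (intro lnorm_triangle[OF b r] test_fun_schwartz)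
qed (use diffeo_D[OF df] a vs in \<open>auto intro: schwartz_Cinf schwartz_Dv\<close>)

text \<open>The outer block gains 2^-(kN) at the cost of N derivatives, the pullback is bounded
  between Sobolev norms, and by Bernstein N derivatives of the inner block cost 2^(jN). The product
  is useful for j <= k.\<close>

lemma decay_half:
  fixes \<psi> \<psi>' :: "real ^ 'd::finite => real ^ 'd"
  assumes b: "is_cutoff (b :: real ^ 'd => complex)" and r: "1 < r"
    and df: "diffeo U \<psi> V \<psi>'" and a: "a \<in> test_fun U" and m: "lp_family m" and n: "lp_family n"
  shows "\<exists>C\<ge>0. \<forall>j k. \<forall>f\<in>schwartz. lnorm r (Mul (m k) (pull a \<psi> (Mul (n j) f))) <= C * (1 / 2) ^ (k * N) * 2 ^ (j * N) * lnorm r f"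
proof -
  obtain C where C: "C >= 0" "!!k f. f \<in> schwartz ==> lnorm r (Mul (m k) f) <=
    C * (1 / 2) ^ (k * N) * sob r N f"
    using lp_family_gain[OF b r m] by blast
  have "\<forall>vs\<in>basis_lists N. \<exists>D\<ge>0. \<forall>f\<in>schwartz. lnorm r (iter_deriv vs (pull a \<psi> f)) <= D * sob r (length vs) f"
    using pull_sobolev[OF b r df a] by (auto simp: basis_lists_def)
  from bchoice[OF this] obtain D where D': "\<forall>vs\<in>basis_lists N. D vs >= 0 \<and> (\<forall>f\<in>schwartz.
      lnorm r (iter_deriv vs (pull a \<psi> f)) <= D vs * sob r (length vs) f)" ..
  have "\<forall>ws. \<exists>E\<ge>0. \<forall>j. \<forall>f\<in>schwartz. lnorm r (iter_deriv ws (Mul (n j) f)) <= E * 2 ^ (j * length ws) * lnorm r f"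
    using lp_family_deriv[OF b r n] by blast
  from choice[OF this] obtain E where E': "\<forall>ws. E ws >= 0 \<and> (\<forall>j. \<forall>f\<in>schwartz.
      lnorm r (iter_deriv ws (Mul (n j) f)) <= E ws * 2 ^ (j * length ws) * lnorm r f)" ..
  let ?K = "\<Sum>vs\<in>basis_lists N. D vs * (\<Sum>ws\<in>basis_lists (length vs). E ws)"
  have K0: "?K >= 0" using D' E' by (intro sum_nonneg mult_nonneg_nonneg) auto
  have "lnorm r (Mul (m k) (pull a \<psi> (Mul (n j) f))) <= (C * ?K) * (1 / 2) ^ (k * N) * 2 ^ (j * N) * lnorm r f"
    if f: "f \<in> schwartz" for j k f
  proof -
    let ?g = "Mul (n j) f"
    have g: "?g \<in> schwartz" using lp_family_Mul_schwartz[OF n f] .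
    have "sob r N (pull a \<psi> ?g) <=
      (\<Sum>vs\<in>basis_lists N. D vs * (\<Sum>ws\<in>basis_lists (length vs). E ws * (2 ^ (j * N) * lnorm r f)))"
    proof (rule sum_mono)
      fix vs :: "(real ^ 'd) list" assume vs: "vs \<in> basis_lists N"
      have "lnorm r (iter_deriv vs (pull a \<psi> ?g)) <= D vs * sob r (length vs) ?g"
        using D' vs g by blast
      also have "... <= D vs * (\<Sum>ws\<in>basis_lists (length vs). E ws * (2 ^ (j * N) * lnorm r f))"
      proof (intro mult_left_mono sum_mono)
        fix ws :: "(real ^ 'd) list" assume ws: "ws \<in> basis_lists (length vs)"
        then have "length ws <= N" using vs by (auto simp: basis_lists_def)
        then have "(2::real) ^ (j * length ws) <= 2 ^ (j * N)" by (intro power_increasing) auto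
        then have "E ws * 2 ^ (j * length ws) * lnorm r f <= E ws * (2 ^ (j * N) * lnorm r f)"
          using E' by (simp add: mult.assoc mult_left_mono mult_right_mono)
        then show "lnorm r (iter_deriv ws ?g) <= E ws * (2 ^ (j * N) * lnorm r f)"
          using E' f by (meson order_trans)
      qed (use D' vs in auto)
      finally show "lnorm r (iter_deriv vs (pull a \<psi> ?g)) <= D vs * (\<Sum>ws\<in>basis_lists (length vs). E ws * (2 ^ (j * N) * lnorm r f))" .
    qed
    also have "... = ?K * (2 ^ (j * N) * lnorm r f)" by (simp add: sum_distrib_right mult.assoc)
    finally have "C * (1 / 2) ^ (k * N) * sob r N (pull a \<psi> ?g) <=
        C * (1 / 2) ^ (k * N) * (?K * (2 ^ (j * N) * lnorm r f))"
      using C(1) by (intro mult_left_mono) auto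
    with C(2)[OF pull_schwartz[OF df a g], of k] show ?thesis by (simp add: mult_ac)
  qed
  moreover have "C * ?K >= 0" using C K0 by simp
  ultimately show ?thesis by blast
qed

text \<open>The distance |j - k|: with truncated subtraction one of the two summands is 0.\<close>

definition gap :: "nat => nat => nat" where "gap j k = (j - k) + (k - j)"

lemma gap_commute: "gap j k = gap k j" by (simp add: gap_def)

text \<open>The case of a larger input frequency follows by transposition.\<close>

lemma off_diagonal_decay:
  fixes \<psi> \<psi>' :: "real ^ 'd::finite => real ^ 'd"
  assumes b: "is_cutoff (b :: real ^ 'd => complex)" and r: "1 < r"
    and df: "diffeo U \<psi> V \<psi>'" and a: "a \<in> test_fun U" and m: "lp_family m" and n: "lp_family n"
  shows "\<exists>C\<ge>0. \<forall>j k. \<forall>f\<in>schwartz. lnorm r (Mul (m k) (pull a \<psi> (Mul (n j) f))) <= C * (1 / 2) ^ (N * gap j k) * lnorm r f"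
proof -
  obtain r' where rr: "conjugate_exps r r'" using conjugate_expsE[OF r] .
  then have r': "1 < r'" by (simp add: conjugate_exps_def)
  let ?m = "%k \<xi>. m k (- \<xi>)" and ?n = "%k \<xi>. n k (- \<xi>)" and ?a = "adj \<psi>' V a"
  have m': "lp_family ?m" and n': "lp_family ?n" using m n by (auto intro: lp_family_reflect)
  have df': "diffeo V \<psi>' U \<psi>" using df diffeo_sym by blast
  have a': "?a \<in> test_fun V" by (rule adj_test_fun[OF df a])
  obtain C1 where C1: "C1 >= 0" "!!j k f. f \<in> schwartz ==> lnorm r (Mul (m k) (pull a \<psi> (Mul (n j) f))) <= C1 * (1 / 2) ^ (k * N) * 2 ^ (j * N) * lnorm r f"
    using decay_half[OF b r df a m n] by blast
  obtain C2 where C2: "C2 >= 0" "!!j k f. f \<in> schwartz ==> lnorm r' (Mul (?n j) (pull ?a \<psi>' (Mul (?m k) f))) <= C2 * (1 / 2) ^ (j * N) * 2 ^ (k * N) * lnorm r' f"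
    using decay_half[OF b r' df' a' n' m', of N] by blast
  \<comment> \<open>Pairing with \<open>h\<close> and moving all three factors across gives the
    transposed operator with the roles of j and k exchanged; \<open>decay_half\<close> for the
    conjugate exponent then yields decay for k < j.\<close>
  have dual: "lnorm r (Mul (m k) (pull a \<psi> (Mul (n j) f))) <= C2 * (1 / 2) ^ (j * N) * 2 ^ (k * N) * lnorm r f"
    if f: "f \<in> schwartz" for j k f
  proof -
    let ?g = "pull a \<psi> (Mul (n j) f)"
    have nf: "Mul (n j) f \<in> schwartz" by (rule lp_family_Mul_schwartz[OF n f])
    have g: "?g \<in> schwartz" by (rule pull_schwartz[OF df a nf])
    show ?thesis
    proof (rule lnorm_le_dual[OF b rr lp_family_Mul_schwartz[OF m g]])
      fix h :: "real ^ 'd => complex" assume h: "h \<in> schwartz"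
      have mh: "Mul (?m k) h \<in> schwartz" by (rule lp_family_Mul_schwartz[OF m' h])
      have ph: "pull ?a \<psi>' (Mul (?m k) h) \<in> schwartz" by (rule pull_schwartz[OF df' a' mh])
      have "(LBINT x. Mul (m k) ?g x * h x) = (LBINT x. h x * Mul (m k) ?g x)" by (simp add: mult.commute)
      also have "... = (LBINT x. Mul (?m k) h x * ?g x)"
        by (rule Mul_transpose[OF lp_family_pgrow[OF m] lp_family_pgrow[OF m'] h g])
      also have "... = (LBINT x. pull ?a \<psi>' (Mul (?m k) h) x * Mul (n j) f x)"
        by (rule pull_transpose[OF df a schwartz_Cinf[OF mh] schwartz_Cinf[OF nf]])
      also have "... = (LBINT x. Mul (?n j) (pull ?a \<psi>' (Mul (?m k) h)) x * f x)"
        by (rule Mul_transpose[OF lp_family_pgrow[OF n] lp_family_pgrow[OF n'] ph f])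
      finally have e: "(LBINT x. Mul (m k) ?g x * h x) = (LBINT x. Mul (?n j) (pull ?a \<psi>' (Mul (?m k) h)) x * f x)" .
      have nS: "Mul (?n j) (pull ?a \<psi>' (Mul (?m k) h)) \<in> schwartz" by (rule lp_family_Mul_schwartz[OF n' ph])
      have "norm (LBINT x. Mul (m k) ?g x * h x) <= lnorm r' (Mul (?n j) (pull ?a \<psi>' (Mul (?m k) h))) * lnorm r f"
        unfolding e by (rule holder_schwartz[OF conjugate_exps_sym[THEN iffD1, OF rr] nS f])
      also have "... <= (C2 * (1 / 2) ^ (j * N) * 2 ^ (k * N) * lnorm r' h) * lnorm r f"
        by (rule mult_right_mono[OF C2(2)[OF h] lnorm_nonneg])
      finally show "norm (LBINT x. Mul (m k) ?g x * h x) <= (C2 * (1 / 2) ^ (j * N) * 2 ^ (k * N) * lnorm r f) * lnorm r' h"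
        by (simp add: mult_ac)
    qed (use C2 in simp)
  qed
  have pw: "(1 / 2 :: real) ^ (k * N) * 2 ^ (j * N) = (1 / 2) ^ (N * gap j k)" if "j <= k" for j k
  proof -
    have "gap j k + j = k" using that by (simp add: gap_def)
    then have "k * N = N * gap j k + j * N" by (metis distrib_right mult.commute)
    then show ?thesis by (simp add: power_add power_one_over)
  qed
  have "lnorm r (Mul (m k) (pull a \<psi> (Mul (n j) f))) <= (C1 + C2) * (1 / 2) ^ (N * gap j k) * lnorm r f"
    if f: "f \<in> schwartz" for j k f
  proof (cases "j <= k")
    case True
    have "lnorm r (Mul (m k) (pull a \<psi> (Mul (n j) f))) <= C1 * (1 / 2) ^ (N * gap j k) * lnorm r f"
      using C1(2)[OF f, of k j] pw[OF True] by (simp add: mult.assoc)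
    also have "... <= (C1 + C2) * (1 / 2) ^ (N * gap j k) * lnorm r f" using C2(1) by (intro mult_right_mono) auto
    finally show ?thesis .
  next
    case False
    then have "lnorm r (Mul (m k) (pull a \<psi> (Mul (n j) f))) <= C2 * (1 / 2) ^ (N * gap j k) * lnorm r f"
      using dual[OF f, of k j] pw[of k j] by (simp add: mult.assoc gap_commute[of j k])
    also have "... <= (C1 + C2) * (1 / 2) ^ (N * gap j k) * lnorm r f" using C1(1) by (intro mult_right_mono) auto
    finally show ?thesis .
  qed
  moreover have "C1 + C2 >= 0" using C1 C2 by simp
  ultimately show ?thesis by blast
qed

subsection \<open>Weighted sequences\<close>

lemma sum_half_powers_inj:
  assumes "finite S" "inj_on h S" shows "(\<Sum>k\<in>S. (1 / 2 :: real) ^ h k) <= 2"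
proof -
  have "(\<Sum>k\<in>S. (1 / 2 :: real) ^ h k) = (\<Sum>i\<in>h ` S. (1 / 2) ^ i)" using assms by (simp add: sum.reindex)
  also have "... <= (\<Sum>i. (1 / 2) ^ i)" using assms by (intro sum_le_suminf) auto
  finally show ?thesis by (simp add: suminf_geometric)
qed

text \<open>On either side of j the gaps are distinct, so each side is bounded by the geometric
  series with sum 2.\<close>

lemma sum_half_gap:
  assumes "finite F" shows "(\<Sum>k\<in>F. (1 / 2 :: real) ^ gap j k) <= 4"
proof -
  have "(\<Sum>k\<in>F. (1 / 2 :: real) ^ gap j k) = (\<Sum>k\<in>{k\<in>F. k < j}. (1 / 2) ^ gap j k) + (\<Sum>k\<in>{k\<in>F. j <= k}. (1 / 2) ^ gap j k)"
    using assms by (subst sum.union_disjoint[symmetric]) (auto intro!: sum.cong)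
  also have "... <= 2 + 2"
    using assms by (intro add_mono sum_half_powers_inj) (auto simp: inj_on_def gap_def)
  finally show ?thesis by simp
qed

lemma summable_half_gap: "summable (%k. (1 / 2 :: real) ^ gap j k)" "(\<Sum>k. (1 / 2 :: real) ^ gap j k) <= 4"
proof -
  show s: "summable (%k. (1 / 2 :: real) ^ gap j k)"
    by (rule summableI_nonneg_bounded[of _ 4]) (auto intro: sum_half_gap)
  show "(\<Sum>k. (1 / 2 :: real) ^ gap j k) <= 4"
    by (rule suminf_le_const[OF s]) (auto intro: sum_half_gap)
qed

text \<open>Of the L + 2 powers of decay, L cancel the growth of the weights. A further one is
  summed over k, giving the factor 4. The last one stays with x_k = \<rho>_k a_k and bounds each
  term by S_j^(1/p), where S_j sums 2^-gap x_k^p; summation of S_j over j gives the other 4. Hence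
  the constant 4^p * 4.\<close>

lemma weighted_schur:
  fixes \<rho> a :: "nat => real"
  assumes p: "1 <= p" and \<rho>: "!!k. \<rho> k > 0" "!!j k. \<rho> j <= 2 ^ (L * gap j k) * \<rho> k"
    and a: "!!k. a k >= 0" "summable (%k. (\<rho> k * a k) powr p)"
  defines "c j == (\<Sum>k. (1 / 2) ^ ((L + 2) * gap j k) * a k)"
  shows "summable (%k. (1 / 2) ^ ((L + 2) * gap j k) * a k)" "summable (%j. (\<rho> j * c j) powr p)"
    "(\<Sum>j. (\<rho> j * c j) powr p) <= 4 powr p * 4 * (\<Sum>k. (\<rho> k * a k) powr p)"
proof -
  define x where "x k = \<rho> k * a k" for k
  define X where "X k = x k powr p" for k
  have x0: "x k >= 0" for k using \<rho>(1)[of k] a(1)[of k] by (simp add: x_def)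
  have X: "summable X" "X k >= 0" for k using a(2) by (simp_all add: X_def[abs_def] x_def X_def)
  have h1: "(1 / 2 :: real) ^ n <= 1" for n by (simp add: power_le_one)
  define S where "S j = (\<Sum>k. (1 / 2) ^ gap j k * X k)" for j
  have sS: "summable (%k. (1 / 2) ^ gap j k * X k)" for j
    by (rule summable_comparison_test'[OF X(1), of 0]) (use X(2) h1 in \<open>auto simp: abs_mult mult_left_le_one_le\<close>)
  have S0: "S j >= 0" for j unfolding S_def using X(2) by (intro suminf_nonneg sS) auto
  \<comment> \<open>A single term is bounded by the whole sum \<open>S j\<close>; since p >= 1,
    raising a number of [0,1] to the power p only decreases it.\<close>
  have xS: "(1 / 2) ^ gap j k * x k <= S j powr (1 / p)" for j k
  proof -
    have "((1 / 2) ^ gap j k * x k) powr p = ((1 / 2) ^ gap j k) powr p * X k"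
      using x0 by (simp add: powr_mult X_def)
    also have "((1 / 2 :: real) ^ gap j k) powr p <= ((1 / 2) ^ gap j k) powr 1"
      using p h1 by (intro powr_mono') auto
    then have "((1 / 2) ^ gap j k) powr p * X k <= (1 / 2) ^ gap j k * X k"
      using X(2) by (intro mult_right_mono) auto
    also have "... <= S j" unfolding S_def
      using sum_le_suminf[OF sS, of "{k}" j] X(2) by simp
    finally have "(((1 / 2) ^ gap j k * x k) powr p) powr (1 / p) <= S j powr (1 / p)"
      using p by (intro powr_mono2) auto
    then show ?thesis using p x0[of k] by (simp add: powr_powr)
  qed
  have main: "\<rho> j * ((1 / 2) ^ ((L + 2) * gap j k) * a k) <= (1 / 2) ^ gap j k * S j powr (1 / p)" for j k
  proof -
    have "\<rho> j * ((1 / 2) ^ ((L + 2) * gap j k) * a k) <= (2 ^ (L * gap j k) * \<rho> k) * ((1 / 2) ^ ((L + 2) * gap j k) * a k)"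
      using \<rho>(2)[of j k] a(1)[of k] by (intro mult_right_mono) auto
    also have "... = (2 ^ (L * gap j k) * (1 / 2) ^ (L * gap j k)) * ((1 / 2) ^ gap j k * ((1 / 2) ^ gap j k * x k))"
    proof -
      have "(L + 2) * gap j k = L * gap j k + (gap j k + gap j k)" by (simp add: algebra_simps)
      then show ?thesis by (simp only: x_def power_add mult_ac)
    qed
    also have "(2::real) ^ (L * gap j k) * (1 / 2) ^ (L * gap j k) = 1" by (simp flip: power_mult_distrib)
    also have "1 * ((1 / 2) ^ gap j k * ((1 / 2) ^ gap j k * x k)) <= (1 / 2) ^ gap j k * S j powr (1 / p)"
      using xS by (simp add: mult_left_mono)
    finally show ?thesis .
  qed
  have sm: "summable (%k. (1 / 2) ^ ((L + 2) * gap j k) * a k)" for j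
  proof (rule summable_comparison_test'[of _ 0])
    show "summable (%k. (1 / 2) ^ gap j k * (S j powr (1 / p) / \<rho> j))"
      using summable_half_gap(1) by (rule summable_mult2)
    show "norm ((1 / 2) ^ ((L + 2) * gap j k) * a k) <= (1 / 2) ^ gap j k * (S j powr (1 / p) / \<rho> j)" for k
      using main[of j k] \<rho>(1)[of j] a(1)[of k] by (simp add: abs_mult pos_le_divide_eq mult_ac)
  qed
  then show "summable (%k. (1 / 2) ^ ((L + 2) * gap j k) * a k)" .
  have c0: "c j >= 0" for j unfolding c_def using a(1) by (intro suminf_nonneg sm) auto
  have cS: "\<rho> j * c j <= 4 * S j powr (1 / p)" for j
  proof -
    have "\<rho> j * c j = (\<Sum>k. \<rho> j * ((1 / 2) ^ ((L + 2) * gap j k) * a k))"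
      unfolding c_def by (rule suminf_mult[OF sm, symmetric])
    also have "... <= (\<Sum>k. (1 / 2) ^ gap j k * S j powr (1 / p))"
      by (intro suminf_le main summable_mult sm summable_mult2 summable_half_gap)
    also have "... = (\<Sum>k. (1 / 2) ^ gap j k) * S j powr (1 / p)"
      by (rule suminf_mult2[OF summable_half_gap(1), symmetric])
    also have "... <= 4 * S j powr (1 / p)" by (intro mult_right_mono summable_half_gap) simp
    finally show ?thesis .
  qed
  have cp: "(\<rho> j * c j) powr p <= 4 powr p * S j" for j
  proof -
    have "(\<rho> j * c j) powr p <= (4 * S j powr (1 / p)) powr p"
      using cS c0[of j] \<rho>(1)[of j] p by (intro powr_mono2) auto
    also have "... = 4 powr p * S j" using p S0[of j] by (simp add: powr_mult powr_powr)
    finally show ?thesis .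
  qed
  have fin: "(\<Sum>j\<in>J. S j) <= 4 * suminf X" if "finite J" for J
  proof -
    have "(\<Sum>j\<in>J. S j) = (\<Sum>k. \<Sum>j\<in>J. (1 / 2) ^ gap j k * X k)"
      unfolding S_def by (rule suminf_sum[OF sS, symmetric])
    also have "... <= (\<Sum>k. 4 * X k)"
    proof (rule suminf_le)
      show "(\<Sum>j\<in>J. (1 / 2) ^ gap j k * X k) <= 4 * X k" for k
        using sum_half_gap[OF that, of k] X(2)[of k] by (simp add: gap_commute[of _ k] sum_distrib_right[symmetric] mult_right_mono)
    qed (intro summable_sum sS summable_mult X)+
    also have "... = 4 * suminf X" by (rule suminf_mult[OF X(1)])
    finally show ?thesis .
  qed
  have fin': "(\<Sum>j\<in>J. (\<rho> j * c j) powr p) <= 4 powr p * 4 * suminf X" if "finite J" for J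
  proof -
    have "(\<Sum>j\<in>J. (\<rho> j * c j) powr p) <= (\<Sum>j\<in>J. 4 powr p * S j)" by (intro sum_mono cp)
    also have "... = 4 powr p * (\<Sum>j\<in>J. S j)" by (simp add: sum_distrib_left)
    also have "... <= 4 powr p * (4 * suminf X)" using fin[OF that] by (intro mult_left_mono) auto
    finally show ?thesis by simp
  qed
  show s: "summable (%j. (\<rho> j * c j) powr p)"
    by (rule summableI_nonneg_bounded[of _ "4 powr p * 4 * suminf X"]) (auto intro: fin')
  have "(\<Sum>j. (\<rho> j * c j) powr p) <= 4 powr p * 4 * suminf X"
    by (rule suminf_le_const[OF s]) (auto intro: fin')
  then show "(\<Sum>j. (\<rho> j * c j) powr p) <= 4 powr p * 4 * (\<Sum>k. (\<rho> k * a k) powr p)"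
    by (simp add: X_def[abs_def] x_def)
qed

text \<open>If one of the arguments is 0 the claim reduces to t^p <= t on [0,1]; otherwise it is
  convexity on the positive half-line.\<close>

lemma powr_convex_nonneg:
  fixes u v t p :: real
  assumes "1 <= p" "0 <= t" "t <= 1" "0 <= u" "0 <= v"
  shows "((1 - t) * u + t * v) powr p <= (1 - t) * u powr p + t * v powr p"
proof -
  have tp: "s powr p <= s" if "0 <= s" "s <= 1" for s :: real
    using powr_mono'[of 1 p s] that assms(1) by simp
  consider "u = 0" | "v = 0" | "u > 0" "v > 0" using assms by linarith
  then show ?thesis
  proof cases
    case 1
    then show ?thesis using tp[of t] assms by (simp add: powr_mult mult_right_mono)
  next
    case 2
    then show ?thesis using tp[of "1 - t"] assms by (simp add: powr_mult mult_right_mono)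
  next
    case 3
    then show ?thesis using convex_onD[OF powr_convex[OF assms(1)], of t u v] assms by simp
  qed
qed

text \<open>Convexity of the power function, applied to (x/A) and (y/B) with weights A/(A+B) and
  B/(A+B), where \<open>A\<close> and \<open>B\<close> are strictly positive upper bounds of the two
  norms. The norms themselves may vanish, so they are enlarged by a small positive number which then
  tends to 0.\<close>

lemma minkowski_suminf:
  fixes x y :: "nat => real"
  assumes p: "1 <= p" and x: "!!k. x k >= 0" "summable (%k. x k powr p)" and y: "!!k. y k >= 0" "summable (%k. y k powr p)"
  shows "summable (%k. (x k + y k) powr p)"
    "(\<Sum>k. (x k + y k) powr p) powr (1 / p) <= (\<Sum>k. x k powr p) powr (1 / p) + (\<Sum>k. y k powr p) powr (1 / p)"
proof -
  have main: "summable (%k. (x k + y k) powr p) \<and> (\<Sum>k. (x k + y k) powr p) powr (1 / p) <= A + B"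
    if A: "A > 0" "(\<Sum>k. x k powr p) <= A powr p" and B: "B > 0" "(\<Sum>k. y k powr p) <= B powr p" for A B
  proof -
    have AB: "A + B > 0" using A B by simp
    have cv: "((x k + y k) / (A + B)) powr p <= A / (A + B) * (x k powr p / A powr p) + B / (A + B) * (y k powr p / B powr p)" for k
    proof -
      have t: "1 - B / (A + B) = A / (A + B)" using AB by (simp add: field_simps)
      have "(x k + y k) / (A + B) = (1 - B / (A + B)) * (x k / A) + (B / (A + B)) * (y k / B)"
        unfolding t using A B by (simp add: add_divide_distrib)
      also have "... powr p <= (1 - B / (A + B)) * (x k / A) powr p + (B / (A + B)) * (y k / B) powr p"
        using A B AB x(1)[of k] y(1)[of k] by (intro powr_convex_nonneg p) auto
      finally show ?thesis unfolding t using A B x(1)[of k] y(1)[of k] by (simp add: powr_divide)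
    qed
    have cv': "(x k + y k) powr p <= (A + B) powr p * (A / (A + B) * (x k powr p / A powr p) + B / (A + B) * (y k powr p / B powr p))" for k
      using cv[of k] x(1)[of k] y(1)[of k] AB by (simp add: powr_divide divide_le_eq mult.commute)
    have s1: "summable (%k. (A + B) powr p * (A / (A + B) * (x k powr p / A powr p) + B / (A + B) * (y k powr p / B powr p)))"
      by (intro summable_mult summable_add summable_divide x y)
    have s: "summable (%k. (x k + y k) powr p)"
      by (rule summable_comparison_test'[OF s1, of 0]) (use cv' in auto)
    have "(\<Sum>k. (x k + y k) powr p) <= (\<Sum>k. (A + B) powr p * (A / (A + B) * (x k powr p / A powr p) + B / (A + B) * (y k powr p / B powr p)))"
      by (intro suminf_le cv' s s1)
    also have "... = (A + B) powr p * (A / (A + B) * ((\<Sum>k. x k powr p) / A powr p) + B / (A + B) * ((\<Sum>k. y k powr p) / B powr p))"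
      using x(2) y(2) by (simp add: suminf_mult suminf_divide summable_mult summable_divide summable_add suminf_add[symmetric])
    also have "... <= (A + B) powr p * (A / (A + B) * 1 + B / (A + B) * 1)"
      using A B by (intro mult_left_mono add_mono) auto
    also have "... = (A + B) powr p" using AB by (simp add: add_divide_distrib[symmetric])
    finally have "(\<Sum>k. (x k + y k) powr p) powr (1 / p) <= ((A + B) powr p) powr (1 / p)"
      using p by (intro powr_mono2 suminf_nonneg s) auto
    then show ?thesis using s p AB by (simp add: powr_powr)
  qed
  let ?A = "(\<Sum>k. x k powr p) powr (1 / p)" and ?B = "(\<Sum>k. y k powr p) powr (1 / p)"
  have e: "(\<Sum>k. x k powr p) <= (?A + e) powr p" "(\<Sum>k. y k powr p) <= (?B + e) powr p" if "e > 0" for e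
  proof -
    have "(\<Sum>k. x k powr p) = ?A powr p" "(\<Sum>k. y k powr p) = ?B powr p"
      using p suminf_nonneg[OF x(2)] suminf_nonneg[OF y(2)] by (auto simp: powr_powr)
    moreover have "?A powr p <= (?A + e) powr p" "?B powr p <= (?B + e) powr p"
      using p that by (auto intro!: powr_mono2)
    ultimately show "(\<Sum>k. x k powr p) <= (?A + e) powr p" "(\<Sum>k. y k powr p) <= (?B + e) powr p" by simp_all
  qed
  have pos: "?A + e > 0" "?B + e > 0" if "e > 0" for e using that by (auto intro: add_nonneg_pos)
  show "summable (%k. (x k + y k) powr p)" using main[OF pos(1) e(1) pos(2) e(2)] by (metis zero_less_one)
  show "(\<Sum>k. (x k + y k) powr p) powr (1 / p) <= ?A + ?B"
  proof (rule field_le_epsilon)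
    fix \<epsilon> :: real assume "\<epsilon> > 0"
    then have h: "\<epsilon> / 2 > 0" by simp
    from main[OF pos(1)[OF h] e(1)[OF h] pos(2)[OF h] e(2)[OF h]]
    show "(\<Sum>k. (x k + y k) powr p) powr (1 / p) <= ?A + ?B + \<epsilon>" by simp
  qed
qed

section \<open>The spaces \<open>B\<^sub>p\<close> on \<open>\<real>\<^sup>d\<close>\<close>

definition wt :: "real => (real => real) => nat => real" where
  "wt s \<phi> k = 2 powr (s * real k) * \<phi> (2 ^ k)"

text \<open>The estimate on the first derivative bounds the derivative of ln \<phi> by c / t, so ln
  \<phi> changes by at most c over the interval from 2^k to 2^(k+1): the length 2^k cancels 1/t.
  Iterating over the levels between j and k gives the exponential bound in both directions.\<close>

lemma Upsilon_growth:
  assumes "\<phi> \<in> Upsilon"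
  shows "!!k. wt s \<phi> k > 0" "\<exists>L. \<forall>j k. wt s \<phi> j <= 2 ^ (L * gap j k) * wt s \<phi> k"
proof -
  from assms have pos: "!!t. t >= 1 ==> \<phi> t > 0" by (simp add: Upsilon_def)
  from assms obtain D where D0: "!!t. t >= 1 ==> D 0 t = \<phi> t"
    and D: "!!k t. t >= 1 ==> (D k has_real_derivative D (Suc k) t) (at t within {1..})"
    and D1: "\<forall>k\<ge>1. \<exists>c>0. \<forall>t\<ge>1. t ^ k * \<bar>D k t\<bar> <= c * \<phi> t"
    by (simp add: Upsilon_def) blast
  from D1[rule_format, of "Suc 0"] obtain c where c: "c > 0" "!!t. t >= 1 ==> t * \<bar>D (Suc 0) t\<bar> <= c * \<phi> t" by auto
  show wpos: "wt s \<phi> k > 0" for k using pos[of "2 ^ k"] by (simp add: wt_def)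
  have step: "\<bar>ln (\<phi> (2 ^ Suc k)) - ln (\<phi> (2 ^ k))\<bar> <= c" for k
  proof -
    let ?S = "{2 ^ k .. 2 ^ Suc k :: real}"
    have k1: "(1::real) <= 2 ^ k" by simp
    have "norm (ln (D 0 (2 ^ Suc k)) - ln (D 0 (2 ^ k))) <= c / 2 ^ k * norm (2 ^ Suc k - 2 ^ k :: real)"
    proof (rule field_differentiable_bound[of ?S "%t. ln (D 0 t)" "%t. D (Suc 0) t / D 0 t"])
      fix t assume t: "t \<in> ?S"
      then have t1: "t >= 1" "t >= 2 ^ k" using k1 by (auto intro: order_trans[OF k1])
      have p: "D 0 t > 0" using D0 pos t1 by simp
      have "(D 0 has_real_derivative D (Suc 0) t) (at t within ?S)"
        using DERIV_subset[OF D[OF t1(1)]] order_trans[OF k1] by (auto intro: DERIV_subset)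
      then show "((%t. ln (D 0 t)) has_real_derivative D (Suc 0) t / D 0 t) (at t within ?S)"
        using p by (auto intro!: derivative_eq_intros simp: field_simps)
      have "\<bar>D (Suc 0) t\<bar> * 2 ^ k <= t * \<bar>D (Suc 0) t\<bar>" using t1 by (subst mult.commute) (rule mult_right_mono, auto)
      also have "... <= c * D 0 t" using c(2)[OF t1(1)] D0[OF t1(1)] by simp
      finally show "norm (D (Suc 0) t / D 0 t) <= c / 2 ^ k" using p by (simp add: field_simps)
    qed auto
    then show ?thesis using D0 k1 by (simp add: D0)
  qed
  \<comment> \<open>Per level ln 2^(sk) changes by |s| ln 2 and ln \<phi> by at most c; dividing by
    ln 2 and rounding up gives an integer rate.\<close>
  define L where "L = nat \<lceil>\<bar>s\<bar> + c / ln 2\<rceil>"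
  have L: "\<bar>s\<bar> * ln 2 + c <= real L * ln 2"
  proof -
    have "\<bar>s\<bar> + c / ln 2 <= real L" using real_nat_ceiling_ge unfolding L_def .
    then have "(\<bar>s\<bar> + c / ln 2) * ln 2 <= real L * ln 2" by (intro mult_right_mono) auto
    then show ?thesis by (simp add: algebra_simps)
  qed
  have ln_wt: "ln (wt s \<phi> k) = s * real k * ln 2 + ln (\<phi> (2 ^ k))" for k
    using pos[of "2 ^ k"] by (simp add: wt_def ln_mult ln_powr)
  have lstep: "\<bar>ln (wt s \<phi> (Suc k)) - ln (wt s \<phi> k)\<bar> <= real L * ln 2" for k
  proof -
    have "ln (wt s \<phi> (Suc k)) - ln (wt s \<phi> k) = s * ln 2 + (ln (\<phi> (2 ^ Suc k)) - ln (\<phi> (2 ^ k)))"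
      unfolding ln_wt by (simp add: algebra_simps)
    moreover have "\<bar>s * ln 2\<bar> = \<bar>s\<bar> * ln 2" by (simp add: abs_mult)
    ultimately show ?thesis using step[of k] L by linarith
  qed
  have le: "wt s \<phi> j <= 2 ^ L * wt s \<phi> k" if "\<bar>ln (wt s \<phi> j) - ln (wt s \<phi> k)\<bar> <= real L * ln 2" for j k
  proof -
    have "ln (wt s \<phi> j) <= ln (2 ^ L * wt s \<phi> k)" using that wpos[of k] by (simp add: ln_mult ln_realpow)
    then show ?thesis using wpos by simp
  qed
  have up: "wt s \<phi> (k + n) <= 2 ^ (L * n) * wt s \<phi> k" for k n
  proof (induction n)
    case (Suc n)
    have "wt s \<phi> (k + Suc n) <= 2 ^ L * wt s \<phi> (k + n)" using le[OF lstep[of "k + n"]] by simp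
    also have "... <= 2 ^ L * (2 ^ (L * n) * wt s \<phi> k)" using Suc by simp
    finally show ?case by (simp add: power_add mult.assoc)
  qed simp
  have dn: "wt s \<phi> k <= 2 ^ (L * n) * wt s \<phi> (k + n)" for k n
  proof (induction n)
    case (Suc n)
    have "wt s \<phi> (k + n) <= 2 ^ L * wt s \<phi> (k + Suc n)" using le[of "k + n" "k + Suc n"] lstep[of "k + n"] by (simp add: abs_minus_commute)
    then have "2 ^ (L * n) * wt s \<phi> (k + n) <= 2 ^ (L * n) * (2 ^ L * wt s \<phi> (k + Suc n))"
      by (rule mult_left_mono) simp
    with Suc have "wt s \<phi> k <= 2 ^ (L * n) * (2 ^ L * wt s \<phi> (k + Suc n))" by (rule order_trans)
    then show ?case by (simp add: power_add mult_ac)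
  qed simp
  have "wt s \<phi> j <= 2 ^ (L * gap j k) * wt s \<phi> k" for j k
    using up[of k "j - k"] dn[of j "k - j"] by (cases "j <= k") (simp_all add: gap_def)
  then show "\<exists>L. \<forall>j k. wt s \<phi> j <= 2 ^ (L * gap j k) * wt s \<phi> k" by blast
qed

lemma dyadic_0: "dyadic b 0 = b" by (simp add: dyadic_def[abs_def])

lemma dyadic_dil:
  assumes "k >= 1" shows "dyadic b k = dil (%\<eta>. b \<eta> - b (2 *\<^sub>R \<eta>)) k"
proof -
  have "(2::real) powr (- real k) = (1 / 2) ^ k" by (simp add: powr_minus powr_realpow power_one_over inverse_eq_divide)
  moreover have "(2::real) powr (1 - real k) = 2 * (1 / 2) ^ k" by (simp add: powr_diff powr_realpow power_one_over)
  ultimately show ?thesis using assms by (simp add: dyadic_def[abs_def] fun_eq_iff)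
qed

text \<open>Equal to \<open>1\<close> on the support of \<open>dyadic b k\<close>\<close>

definition fat :: "(real ^ 'd::finite => complex) => nat => real ^ 'd => complex" where
  "fat b k = (if k = 0 then dil b 1 else dil (%\<eta>. b ((1 / 2) *\<^sub>R \<eta>) - b (4 *\<^sub>R \<eta>)) k)"

lemma scale_test_fun:
  fixes b :: "real ^ 'd::finite => complex"
  shows "b \<in> test_fun UNIV ==> c ~= 0 ==> (%\<eta>. b (c *\<^sub>R \<eta>)) \<in> test_fun UNIV"
  using test_fun_dilation by blast

lemma test_fun_diff: "f \<in> test_fun V ==> g \<in> test_fun V ==> (%x. f x - g x) \<in> test_fun V"
  using test_fun_add[of f V "%x. (-1) * g x"] test_fun_cmult[of g V "-1"] by simp

lemma lp_family_dil:
  fixes m :: "nat => real ^ 'd::finite => complex"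
  assumes "m 0 \<in> test_fun UNIV" "g \<in> test_fun UNIV" "e > 0" "!!x. norm x < e ==> g x = 0" "!!k. k >= 1 ==> m k = dil g k"
  shows "lp_family m"
  unfolding lp_family_def
proof (intro conjI allI)
  show "m k \<in> test_fun UNIV" for k using assms dil_test_fun[of g k] by (cases "k = 0") auto
  have "vanishes_near_0 g" using assms unfolding vanishes_near_0_def by blast
  then show "\<exists>K g. g \<in> test_fun UNIV \<and> vanishes_near_0 g \<and> (\<forall>k\<ge>K. m k = dil g k)"
    using assms(2,5) by blast
qed

text \<open>Both profiles are differences of two dilates of \<open>b\<close> that equal 1 near the
  origin and cancel there: for |x| < 1/2 in \<open>dyadic\<close>, for |x| < 1/4 in
  \<open>fat\<close>.\<close>

lemma lp_dyadic:
  fixes b :: "real ^ 'd::finite => complex"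
  assumes "is_cutoff b" shows "lp_family (dyadic b)" "lp_family (fat b)"
proof -
  note bt = cutoff_test_fun[OF assms]
  have 1: "norm y <= 1 ==> b y = 1" for y using assms by (simp add: is_cutoff_def)
  show "lp_family (dyadic b)"
    by (rule lp_family_dil[where e="1/2", OF _ _ _ _ dyadic_dil])
       (use bt in \<open>auto simp: dyadic_0 1 intro!: test_fun_diff scale_test_fun\<close>)
  show "lp_family (fat b)"
    by (rule lp_family_dil[where e="1/4" and g="%\<eta>. b ((1 / 2) *\<^sub>R \<eta>) - b (4 *\<^sub>R \<eta>)"])
       (use bt dil_test_fun[OF bt, of 1] in \<open>auto simp: fat_def 1 intro!: test_fun_diff scale_test_fun\<close>)
qed

text \<open>For k >= 1 the rescaled variable satisfies 1/2 < |\<eta>| < 2 where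
  \<open>dyadic b k\<close> does not vanish; there b(\<eta>/2) = 1 and b(4 \<eta>) = 0. For k = 0
  only the upper bound matters.\<close>

lemma fat_dyadic:
  assumes b: "is_cutoff b" shows "dyadic b k \<xi> * fat b k \<xi> = dyadic b k \<xi>"
proof (cases "dyadic b k \<xi> = 0")
  case nz: False
  have 1: "norm y <= 1 ==> b y = 1" and 0: "norm y >= 2 ==> b y = 0" for y using b by (auto simp: is_cutoff_def)
  show ?thesis
  proof (cases "k = 0")
    case True
    then have "norm \<xi> < 2" using nz 0 by (force simp: dyadic_0)
    then show ?thesis using True by (simp add: fat_def 1)
  next
    case False
    then have k: "k >= 1" by simp
    let ?\<eta> = "(1 / 2) ^ k *\<^sub>R \<xi>"
    from nz have nz: "b ?\<eta> ~= b (2 *\<^sub>R ?\<eta>)" by (simp add: dyadic_dil[OF k])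
    have "norm ?\<eta> < 2"
    proof (rule ccontr)
      assume "\<not> norm ?\<eta> < 2"
      then have "norm ?\<eta> >= 2" "norm (2 *\<^sub>R ?\<eta>) >= 2" by auto
      with nz 0 show False by metis
    qed
    moreover have "norm ?\<eta> > 1 / 2"
    proof (rule ccontr)
      assume "\<not> norm ?\<eta> > 1 / 2"
      then have "norm ?\<eta> <= 1" "norm (2 *\<^sub>R ?\<eta>) <= 1" by auto
      with nz 1 show False by metis
    qed
    ultimately have "norm ((1 / 2) *\<^sub>R ?\<eta>) <= 1" "norm (4 *\<^sub>R ?\<eta>) >= 2" by (auto simp: mult.commute)
    then have "b ((1 / 2) *\<^sub>R ?\<eta>) = 1" "b (4 *\<^sub>R ?\<eta>) = 0" using 0 1 by blast+
    then show ?thesis using False by (simp only: fat_def if_False) simp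
  qed
qed simp

lemma sum_dyadic: "(\<Sum>k\<le>K. dyadic b k \<xi>) = dil b K \<xi>"
proof (induction K)
  case (Suc K)
  have "dyadic b (Suc K) \<xi> = dil b (Suc K) \<xi> - dil b K \<xi>" by (subst dyadic_dil) simp_all
  with Suc show ?case by simp
qed (simp add: dyadic_0)

text \<open>\<open>dyadic b k\<close> vanishes for |\<xi>| >= 2^(k+1), while \<open>dil b K\<close>
  equals 1 for |\<xi>| <= 2^K; since k + 1 <= K the first support lies where the second function is
  1.\<close>

lemma dil_dyadic:
  assumes b: "is_cutoff b" and k: "k < K" shows "dil b K \<xi> * dyadic b k \<xi> = dyadic b k \<xi>"
proof (cases "norm \<xi> <= 2 ^ K")
  case True
  then have "norm ((1 / 2) ^ K *\<^sub>R \<xi>) <= 1" by (simp add: power_one_over divide_le_eq)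
  then show ?thesis using b by (simp add: is_cutoff_def)
next
  case False
  have "(2::real) ^ Suc k <= 2 ^ K" using k by (intro power_increasing) auto
  then have *: "norm \<xi> >= 2 * 2 ^ k" using False by simp
  have 0: "norm y >= 2 ==> b y = 0" for y using b by (auto simp: is_cutoff_def)
  have n: "norm ((1 / 2) ^ k *\<^sub>R \<xi>) >= 2" using * by (simp add: power_one_over le_divide_eq)
  then have "norm (2 *\<^sub>R ((1 / 2) ^ k *\<^sub>R \<xi>)) >= 2" by auto
  with n have "b ((1 / 2) ^ k *\<^sub>R \<xi>) = 0" "b (2 *\<^sub>R ((1 / 2) ^ k *\<^sub>R \<xi>)) = 0" using 0 by blast+
  then have "dyadic b k \<xi> = 0" by (cases "k = 0") (simp_all add: dyadic_0 dyadic_dil)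
  then show ?thesis by simp
qed

lemma piece_eq:
  assumes b: "is_cutoff b" and f: "f \<in> schwartz" shows "piece b k w f = w (Mul (dyadic b k) f)"
proof -
  have F: "FT 1 f \<in> schwartz" using f by (intro FT_schwartz) auto
  then have "(%\<xi>. dyadic b k \<xi> * FT 1 f \<xi>) \<in> schwartz"
    using scont_schwartz[OF scont_mult[OF lp_family_pgrow[OF lp_dyadic(1)[OF b]]]] by blast
  then show ?thesis using f F
    by (simp add: piece_def inv_fourier_def mult_tempered_def fourier_def inv_fourier_fun_eq fourier_fun_eq Mul_def)
qed

text \<open>The partial sums telescope to the low-pass operator \<open>Mul (dil b K)\<close>, and
  \<open>low_frequency_limit\<close> is applied to the seminorm f -> |w(f)|.\<close>

lemma dyadic_sums:
  assumes b: "is_cutoff b" and w: "w \<in> tempered" and f: "f \<in> schwartz"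
  shows "(%k. w (Mul (dyadic b k) f)) sums w f"
  unfolding sums_def_le
proof -
  note lp = lp_dyadic(1)[OF b]
  have "w (Mul (dil b K) f) = (\<Sum>k\<le>K. w (Mul (dyadic b k) f))" for K
  proof -
    have "Mul (dil b K) f = (%x. \<Sum>k\<le>K. Mul (dyadic b k) f x)"
      unfolding sum_dyadic[symmetric] using lp f by (intro Mul_sum lp_family_pgrow)
    then show ?thesis using tempered_sum[OF w, of "{..K}" "%k. Mul (dyadic b k) f"] lp_family_Mul_schwartz[OF lp f] by simp
  qed
  moreover have "(%K. norm (w (%x. f x - Mul (dil b K) f x))) \<longlonglongrightarrow> 0"
    using b by (intro low_frequency_limit cutoff_test_fun f tempered_sb w) (auto simp: is_cutoff_def)
  moreover have "w (%x. f x - Mul (dil b K) f x) = w f - w (Mul (dil b K) f)" for K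
    using f by (intro tempered_diff w Mul_schwartz pgrow_test_fun[OF dil_test_fun] cutoff_test_fun b)
  ultimately have "(%K. norm (w f - (\<Sum>k\<le>K. w (Mul (dyadic b k) f)))) \<longlonglongrightarrow> 0" by simp
  then have "(%K. w f - (\<Sum>k\<le>K. w (Mul (dyadic b k) f))) \<longlonglongrightarrow> 0" by (rule tendsto_norm_zero_cancel)
  from tendsto_diff[OF tendsto_const[of "w f"] this]
  show "(%n. \<Sum>i\<le>n. w (Mul (dyadic b i) f)) \<longlonglongrightarrow> w f" by simp
qed

lemma temperedI:
  assumes "!!f g. f \<in> schwartz ==> g \<in> schwartz ==> w (%x. f x + g x) = w f + w g"
    and "!!c f. f \<in> schwartz ==> w (%x. c * f x) = c * w f" and "sb (%f. norm (w f))" and "!!f. f \<notin> schwartz ==> w f = 0"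
  shows "w \<in> tempered"
  using assms unfolding tempered_def linear_functional_on_def sb_def by blast

lemma tempered_compose:
  assumes w: "w \<in> tempered" and A: "scont A"
    "!!f g. f \<in> schwartz ==> g \<in> schwartz ==> A (%x. f x + g x) = (%x. A f x + A g x)"
    "!!c f. f \<in> schwartz ==> A (%x. c * f x) = (%x. c * A f x)"
  shows "(%f. if f \<in> schwartz then w (A f) else 0) \<in> tempered"
proof (rule temperedI)
  show "sb (%f. norm (if f \<in> schwartz then w (A f) else 0))"
    by (rule sb_le[OF sb_compose[OF tempered_sb[OF w] A(1)]]) simp
qed (use w in \<open>simp_all add: A schwartz_add schwartz_cmult tempered_add tempered_cmult scont_schwartz[OF A(1)]\<close>)

lemma sb_lnorm: 
  assumes r: "1 <= r" shows "sb (lnorm r :: ('a::euclidean_space => complex) => real)"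
proof (rule sbI)
  fix f :: "'a => complex" assume f: "f \<in> schwartz"
  let ?M = "DIM('a) + 2" let ?s = "schwartz_norm ?M f"
  have s0: "?s >= 0" using schwartz_norm_nonneg[OF f] .
  have [measurable]: "f \<in> borel_measurable borel" using schwartz_measurable[OF f] .
  have "(LBINT x. norm (norm (f x) powr r)) <= ?s powr r * wint TYPE('a)"
  proof (rule integrable_rapid(2))
    fix x :: 'a
    let ?c = "jb x ^ ?M"
    have p: "?c >= 1" by (rule one_le_power) simp
    have "?c * norm (norm (f x) powr r) <= ?c powr r * norm (f x) powr r"
      using powr_mono[OF r, of ?c] p by (simp add: mult_right_mono)
    also have "... = (?c * norm (f x)) powr r" using p by (simp add: powr_mult)
    also have "... <= ?s powr r"
      using schwartz_norm_ge[OF f, of "[]" ?M ?M x] r by (intro powr_mono2) auto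
    finally show "?c * norm (norm (f x) powr r) <= ?s powr r" .
  qed measurable
  then have "lnorm r f <= (?s powr r * wint TYPE('a)) powr (1 / r)"
    unfolding lnorm_def using r by (intro powr_mono2) auto
  also have "... = wint TYPE('a) powr (1 / r) * ?s"
    using r s0 by (simp add: powr_mult powr_powr)
  finally show "lnorm r f <= wint TYPE('a) powr (1 / r) * ?s" .
qed

text \<open>The smoothness s and the function \<phi> enter the analysis only through positive
  weights with at most exponential variation; \<open>L\<close> is the rate on which the orders of
  decay below are based.\<close>

locale lp_setting =
  fixes b :: "real ^ 'd::finite => complex" and s p q :: real and \<phi> :: "real => real" and L :: nat
  assumes b: "is_cutoff b" and pq: "conjugate_exps p q"
    and wt_pos: "!!k. wt s \<phi> k > 0" and wt_growth: "!!j k. wt s \<phi> j <= 2 ^ (L * gap j k) * wt s \<phi> k"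
begin

abbreviation "BR == besov_Rd b s \<phi> p"
abbreviation "bnorm == besov_Rd_norm b s \<phi> p"
abbreviation "pn w k == Lp_norm p (piece b k w)"
abbreviation "W k == wt s \<phi> k"
abbreviation "D k == Mul (dyadic b k)"

lemma p1: "1 < p" "1 < q" "0 < p" "0 < q" using pq by (auto simp: conjugate_exps_def)

lemma bnorm_nonneg [simp]: "bnorm w >= 0" by (simp add: besov_Rd_norm_def)

lemma besov_term_eq: "besov_term b s \<phi> p w k = (W k * pn w k) powr p"
  by (simp add: besov_term_def wt_def)

text \<open>Membership and norm from dual inequalities alone: any admissible constants
  \<open>A k\<close> serve, whether or not they are optimal. Together with \<open>besov_RdD\<close>
  this removes representing functions from all later arguments.\<close>

lemma besov_RdI:
  assumes w: "w \<in> tempered" and A: "!!k. A k >= 0"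
    and bd: "!!k f. f \<in> schwartz ==> norm (w (D k f)) <= A k * lnorm q f"
    and s: "summable (%k. (W k * A k) powr p)"
  shows "w \<in> BR" "bnorm w <= (\<Sum>k. (W k * A k) powr p) powr (1 / p)"
proof -
  have L: "in_Lp p (piece b k w)" "pn w k <= A k" for k
    using lp_dyadic(1)[OF b] bd
    by (auto intro!: in_Lp_of_bound[OF b pq w, of "dyadic b k"] A simp: lp_family_def piece_eq[OF b])
  have pn0: "pn w k >= 0" for k using in_Lp_bound(1)[OF b pq L(1)] .
  have le: "(W k * pn w k) powr p <= (W k * A k) powr p" for k
    using L(2) pn0[of k] wt_pos[of k] p1 by (intro powr_mono2 mult_left_mono) auto
  have s': "summable (%k. (W k * pn w k) powr p)"
    by (rule summable_comparison_test'[OF s, of 0]) (use le in auto)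
  then show "w \<in> BR" using w L by (simp add: besov_Rd_def besov_term_eq[abs_def])
  show "bnorm w <= (\<Sum>k. (W k * A k) powr p) powr (1 / p)"
    unfolding besov_Rd_norm_def besov_term_eq using p1
    by (intro powr_mono2 suminf_le le s s' suminf_nonneg) auto
qed

lemma besov_RdD:
  assumes "w \<in> BR"
  shows "w \<in> tempered" "pn w k >= 0" "f \<in> schwartz ==> norm (w (D k f)) <= pn w k * lnorm q f"
    "M >= 0 ==> (!!f. f \<in> schwartz ==> norm (w (D k f)) <= M * lnorm q f) ==> pn w k <= M"
    "summable (%k. (W k * pn w k) powr p)" "bnorm w powr p = (\<Sum>k. (W k * pn w k) powr p)"
    "bnorm w = (\<Sum>k. (W k * pn w k) powr p) powr (1 / p)"
    "W k * pn w k <= bnorm w"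
proof -
  have i: "in_Lp p (piece b k w)" for k using assms by (auto simp: besov_Rd_def)
  show "w \<in> tempered" using assms by (simp add: besov_Rd_def)
  show n0: "pn w k >= 0" for k using in_Lp_bound(1)[OF b pq i] .
  show "f \<in> schwartz ==> norm (w (D k f)) <= pn w k * lnorm q f"
    using in_Lp_bound(2)[OF b pq i, of f k] piece_eq[OF b, of f k w] by simp
  show "M >= 0 ==> (!!f. f \<in> schwartz ==> norm (w (D k f)) <= M * lnorm q f) ==> pn w k <= M"
    using in_Lp_bound(3)[OF b pq i, of M k] piece_eq[OF b, of _ k w] by simp
  show s: "summable (%k. (W k * pn w k) powr p)"
    using assms by (simp add: besov_Rd_def besov_term_eq[abs_def])
  show e: "bnorm w = (\<Sum>k. (W k * pn w k) powr p) powr (1 / p)"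
    by (simp add: besov_Rd_norm_def besov_term_eq)
  show e': "bnorm w powr p = (\<Sum>k. (W k * pn w k) powr p)"
    unfolding e using p1 suminf_nonneg[OF s] by (simp add: powr_powr)
  have "(W k * pn w k) powr p <= bnorm w powr p"
    unfolding e' using sum_le_suminf[OF s, of "{k}"] by simp
  then have "((W k * pn w k) powr p) powr (1 / p) <= (bnorm w powr p) powr (1 / p)"
    by (rule powr_mono2[rotated 2]) (use p1 in auto)
  then show "W k * pn w k <= bnorm w"
    using p1 n0[of k] wt_pos[of k] bnorm_nonneg[of w] by (simp add: powr_powr)
qed

text \<open>Since \<open>fat b k\<close> is 1 on the support of \<open>dyadic b k\<close>, it may be
  inserted in front of \<open>f\<close>. This puts a frequency-localised version of \<open>f\<close>
  on the right-hand side, and it is there that decay in k is available.\<close>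

lemma tail_bound:
  assumes w: "w \<in> BR" and f: "f \<in> schwartz"
  shows "norm (w (D k f)) <= pn w k * lnorm q (Mul (fat b k) f)"
proof -
  note lp = lp_dyadic[OF b]
  have "D k (Mul (fat b k) f) = D k f"
    using Mul_Mul[OF lp_family_pgrow[OF lp(2)] f] by (simp add: fat_dyadic[OF b])
  then show ?thesis using besov_RdD(3)[OF w lp_family_Mul_schwartz[OF lp(2) f, of k], of k] by simp
qed

lemma norm_sums_le:
  assumes w: "w \<in> BR" and f: "f \<in> schwartz" and s: "summable B" and B: "!!k. pn w k * lnorm q (Mul (fat b k) f) <= B k"
  shows "norm (w f) <= suminf B"
proof -
  have le: "norm (w (D k f)) <= B k" for k using tail_bound[OF w f, of k] B[of k] by linarith
  note su = dyadic_sums[OF b besov_RdD(1)[OF w] f]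
  have "norm (\<Sum>k. w (D k f)) <= suminf B"
    by (rule norm_suminf_le[OF le s])
  then show ?thesis using sums_unique[OF su] by simp
qed

text \<open>A bounded sequence of coefficients with off-diagonal decay acts on the weighted \<open>\<ell>\<^sub>p\<close> by Schur's test.\<close>

lemma besov_pull:
  assumes df: "diffeo U \<psi> V \<psi>'" and a: "a \<in> test_fun U"
  shows "\<exists>C\<ge>0. \<forall>w\<in>BR. (%f. if f \<in> schwartz then w (pull a \<psi> f) else 0) \<in> BR \<and>
    bnorm (%f. if f \<in> schwartz then w (pull a \<psi> f) else 0) <= C * bnorm w"
proof -
  note lp = lp_dyadic[OF b]
  \<comment> \<open>Here j is the level at which the transformed distribution is tested and k the
    level of \<open>w\<close> in its dyadic decomposition; the decay estimate is used on L_q, the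
    side of the test functions.\<close>
  obtain C where C: "C >= 0" "!!j k f. f \<in> schwartz ==>
     lnorm q (Mul (fat b k) (pull a \<psi> (D j f))) <= C * (1 / 2) ^ ((L + 2) * gap j k) * lnorm q f"
    using off_diagonal_decay[OF b p1(2) df a lp(2,1), of "L + 2"] by blast
  show ?thesis
  \<comment> \<open>The p-th root of Schur's constant 4^p * 4, times the constant of the decay
    estimate.\<close>
  proof (intro exI[of _ "C * (4 * 4 powr (1 / p))"] conjI ballI)
    show "0 <= C * (4 * 4 powr (1 / p))" using C by simp
    fix w assume w: "w \<in> BR"
    let ?w = "%f. if f \<in> schwartz then w (pull a \<psi> f) else 0"
    define c where "c j = (\<Sum>k. (1 / 2) ^ ((L + 2) * gap j k) * pn w k)" for j
    note sch = weighted_schur[OF less_imp_le[OF p1(1)] wt_pos wt_growth besov_RdD(2)[OF w] besov_RdD(5)[OF w], folded c_def]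
    have c0: "c j >= 0" for j unfolding c_def using besov_RdD(2)[OF w] by (intro suminf_nonneg sch) auto
    have wT: "?w \<in> tempered"
      by (rule tempered_compose[OF besov_RdD(1)[OF w] scont_pull[OF df a]]) (auto simp: pull_def fun_eq_iff algebra_simps)
    have bd: "norm (?w (D j f)) <= C * c j * lnorm q f" if f: "f \<in> schwartz" for j f
    proof -
      let ?g = "D j f"
      have g: "?g \<in> schwartz" by (rule lp_family_Mul_schwartz[OF lp(1) f])
      have "norm (w (pull a \<psi> ?g)) <= (\<Sum>k. C * lnorm q f * ((1 / 2) ^ ((L + 2) * gap j k) * pn w k))"
      proof (rule norm_sums_le[OF w pull_schwartz[OF df a g]])
        show "summable (%k. C * lnorm q f * ((1 / 2) ^ ((L + 2) * gap j k) * pn w k))"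
          by (intro summable_mult sch)
        show "pn w k * lnorm q (Mul (fat b k) (pull a \<psi> ?g)) <= C * lnorm q f * ((1 / 2) ^ ((L + 2) * gap j k) * pn w k)" for k
          using mult_left_mono[OF C(2)[OF f, of k j] besov_RdD(2)[OF w, of k]] by (simp add: mult_ac)
      qed
      also have "... = C * lnorm q f * c j" unfolding c_def by (intro suminf_mult sch)
      finally show ?thesis using g by (simp add: mult_ac)
    qed
    have e: "(W k * (C * c k)) powr p = C powr p * (W k * c k) powr p" for k
      using C c0[of k] wt_pos[of k] by (simp add: powr_mult[symmetric] mult_ac)
    have s: "summable (%k. (W k * (C * c k)) powr p)" unfolding e by (intro summable_mult sch)
    note res = besov_RdI[OF wT _ bd s]
    show "?w \<in> BR" by (rule res) (use C c0 in auto)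
    have "(\<Sum>k. (W k * (C * c k)) powr p) = C powr p * (\<Sum>k. (W k * c k) powr p)"
      unfolding e by (intro suminf_mult sch)
    also have "... <= C powr p * (4 powr p * 4 * bnorm w powr p)"
      unfolding besov_RdD(6)[OF w] by (intro mult_left_mono sch) simp
    finally have "(\<Sum>k. (W k * (C * c k)) powr p) powr (1 / p) <= (C powr p * (4 powr p * 4 * bnorm w powr p)) powr (1 / p)"
      using p1 by (intro powr_mono2 suminf_nonneg s) auto
    also have "... = C * (4 * 4 powr (1 / p)) * bnorm w"
      using C p1 by (simp add: powr_mult powr_powr)
    finally show "bnorm ?w <= C * (4 * 4 powr (1 / p)) * bnorm w"
      using res(2) C c0 by (meson order_trans mult_nonneg_nonneg)
  qed
qed

end

lemma tempered_off: "w \<in> tempered ==> f \<notin> schwartz ==> w f = 0"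
  by (simp add: tempered_def)

definition tfun :: "('a::euclidean_space => complex) => ('a => complex) => complex" where
  "tfun g f = (if f \<in> schwartz then LBINT x. g x * f x else 0)"

lemma tfun_tempered:
  assumes g: "g \<in> schwartz"
  shows "tfun g \<in> tempered"
proof (rule temperedI)
  obtain q where q: "conjugate_exps 2 q" by (rule conjugate_expsE[of 2]) auto
  show "sb (%f. norm (tfun g f))"
  proof (rule sb_const_mult[OF sb_lnorm])
    show "norm (tfun g f) <= lnorm 2 g * lnorm q f" if "f \<in> schwartz" for f
      using that holder_schwartz[OF q g that] by (simp add: tfun_def)
  qed (use q in \<open>auto simp: conjugate_exps_def\<close>)
qed (use g in \<open>simp_all add: tfun_def schwartz_add schwartz_cmult distrib_left schwartz_mult_schwartz mult.left_commute[of "g _"]\<close>)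

context lp_setting
begin

text \<open>Relative to \<open>W 0\<close> the weight grows at most like 2^(Lk), so decay of order L
  + 1 leaves a factor 2^-k; the geometric series with sum 2 accounts for 2^(1/p).\<close>

lemma geometric_besov:
  assumes w: "w \<in> tempered" and S: "S >= 0"
    and bd: "!!k f. f \<in> schwartz ==> norm (w (D k f)) <= (1 / 2) ^ (k * (L + 1)) * S * lnorm q f"
  shows "w \<in> BR" "bnorm w <= W 0 * 2 powr (1 / p) * S"
proof -
  let ?A = "%k. (1 / 2) ^ (k * (L + 1)) * S"
  have le: "(W k * ?A k) powr p <= (W 0 * S) powr p * (1 / 2) ^ k" for k
  proof -
    have e: "(2::real) ^ (L * k) * (1 / 2) ^ (L * k) = 1" by (simp flip: power_mult_distrib)
    have "W k * ?A k <= (2 ^ (L * k) * W 0) * ?A k"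
      using wt_growth[of k 0] S by (intro mult_right_mono) (auto simp: gap_def)
    also have "... = (2 ^ (L * k) * (1 / 2) ^ (L * k)) * (W 0 * S * (1 / 2) ^ k)" by (simp add: power_add mult_ac)
    finally have "W k * ?A k <= W 0 * S * (1 / 2) ^ k" by (simp only: e mult_1)
    then have "(W k * ?A k) powr p <= (W 0 * S * (1 / 2) ^ k) powr p"
      using p1 S wt_pos[of k] by (intro powr_mono2) auto
    also have "... = (W 0 * S) powr p * ((1 / 2) ^ k) powr p" using S wt_pos[of 0] by (simp add: powr_mult)
    also have "((1 / 2 :: real) ^ k) powr p <= ((1 / 2) ^ k) powr 1"
      using p1 by (intro powr_mono') (auto simp: power_le_one)
    then have "(W 0 * S) powr p * ((1 / 2) ^ k) powr p <= (W 0 * S) powr p * (1 / 2) ^ k"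
      by (intro mult_left_mono) auto
    finally show ?thesis .
  qed
  have g: "summable (%k. (W 0 * S) powr p * (1 / 2) ^ k)" by (intro summable_mult summable_geometric) simp
  have s: "summable (%k. (W k * ?A k) powr p)" by (rule summable_comparison_test'[OF g, of 0]) (use le in auto)
  have A0: "?A k >= 0" for k using S by simp
  note res = besov_RdI[OF w A0 bd s]
  show "w \<in> BR" by (rule res(1))
  have "(\<Sum>k. (W k * ?A k) powr p) <= (\<Sum>k. (W 0 * S) powr p * (1 / 2) ^ k)" by (intro suminf_le le s g)
  also have "... = (W 0 * S) powr p * 2" by (subst suminf_mult) (simp_all add: suminf_geometric)
  finally have "(\<Sum>k. (W k * ?A k) powr p) powr (1 / p) <= ((W 0 * S) powr p * 2) powr (1 / p)"
    using p1 by (intro powr_mono2 suminf_nonneg s) auto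
  also have "... = W 0 * 2 powr (1 / p) * S" using p1 S wt_pos[of 0] by (simp add: powr_mult powr_powr)
  finally show "bnorm w <= W 0 * 2 powr (1 / p) * S" using res(2) by linarith
qed

text \<open>The dyadic block is moved by transposition from the test function to \<open>g\<close>,
  where the reflected family gains L + 1 orders. The bound involves finitely many derivatives of
  \<open>g\<close> in L_p, and this finiteness is what the separability proof exploits.\<close>

lemma schwartz_besov:
  shows "\<exists>C\<ge>0. \<exists>N. \<forall>g\<in>schwartz. tfun g \<in> BR \<and> bnorm (tfun g) <= C * sob p N g"
proof -
  let ?m = "%k \<xi>. dyadic b k (- \<xi>)"
  note lp = lp_dyadic(1)[OF b]
  have lp': "lp_family ?m" by (rule lp_family_reflect[OF lp])
  obtain C where C: "C >= 0" "!!k f. f \<in> schwartz ==>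
      lnorm p (Mul (?m k) f) <= C * (1 / 2) ^ (k * (L + 1)) * sob p (L + 1) f"
    using lp_family_gain[OF b p1(1) lp', of "L + 1"] by blast
  show ?thesis
  proof (intro exI[of _ "W 0 * 2 powr (1 / p) * C"] exI[of _ "L + 1"] conjI ballI)
    show "0 <= W 0 * 2 powr (1 / p) * C" using C wt_pos[of 0] by simp
    fix g :: "real ^ 'd => complex" assume g: "g \<in> schwartz"
    let ?S = "\<Sum>vs\<in>basis_lists (L + 1). lnorm p (iter_deriv vs g)"
    have bd: "norm (tfun g (D k f)) <= (1 / 2) ^ (k * (L + 1)) * (C * ?S) * lnorm q f" if f: "f \<in> schwartz" for k f
    proof -
      have "tfun g (D k f) = (LBINT x. Mul (?m k) g x * f x)"
        using lp_family_Mul_schwartz[OF lp f] Mul_transpose[OF lp_family_pgrow[OF lp] lp_family_pgrow[OF lp'] g f] by (simp add: tfun_def)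
      also have "norm ... <= lnorm p (Mul (?m k) g) * lnorm q f"
        by (intro holder_schwartz[OF pq] lp_family_Mul_schwartz[OF lp'] g f)
      also have "... <= (C * (1 / 2) ^ (k * (L + 1)) * ?S) * lnorm q f"
        by (intro mult_right_mono C g) simp
      finally show ?thesis by (simp only: mult_ac)
    qed
    have S: "C * ?S >= 0" using C by (intro mult_nonneg_nonneg sum_nonneg) auto
    note res = geometric_besov[OF tfun_tempered[OF g] S bd]
    show "tfun g \<in> BR" by (rule res)
    show "bnorm (tfun g) <= W 0 * 2 powr (1 / p) * C * ?S" using res(2) by (simp only: mult.assoc)
  qed
qed

text \<open>Continuous embedding into the tempered distributions: each block is at most 2^(Lk) times
  the norm (over \<open>W 0\<close>), and the test function supplies decay 2^-(k(L+1)) through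
  \<open>fat\<close>.\<close>

lemma besov_le_seminorm:
  shows "\<exists>\<Phi>. sb \<Phi> \<and> (\<forall>w\<in>BR. \<forall>f\<in>schwartz. norm (w f) <= bnorm w * \<Phi> f) \<and> (\<forall>f\<in>schwartz. 0 <= \<Phi> f)"
proof -
  note lp = lp_dyadic(2)[OF b]
  obtain C where C: "C >= 0" "!!k f. f \<in> schwartz ==>
      lnorm q (Mul (fat b k) f) <= C * (1 / 2) ^ (k * (L + 1)) * sob q (L + 1) f"
    using lp_family_gain[OF b p1(2) lp, of "L + 1"] by blast
  let ?S = "%f. \<Sum>vs\<in>basis_lists (L + 1). lnorm q (iter_deriv vs f)"
  have S0: "?S f >= 0" for f :: "real ^ 'd => complex" by (intro sum_nonneg) simp
  have "sb ?S"
    using p1 by (intro sb_sum sb_compose[OF sb_lnorm scont_iter_deriv]) (auto simp: basis_lists_def)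
  then have "sb (%f. 2 * C / W 0 * ?S f)" using C wt_pos[of 0] by (intro sb_cmult) auto
  moreover have "norm (w f) <= bnorm w * (2 * C / W 0 * ?S f)" if w: "w \<in> BR" and f: "f \<in> schwartz" for w f
  proof -
    let ?B = "%k. (bnorm w * C * ?S f / W 0) * (1 / 2) ^ k"
    have s: "summable ?B" by (intro summable_mult summable_geometric) simp
    have "norm (w f) <= suminf ?B"
    proof (rule norm_sums_le[OF w f s])
      fix k
      have e: "(2::real) ^ (L * k) * (1 / 2) ^ (L * k) = 1" by (simp flip: power_mult_distrib)
      have "W 0 * pn w k <= (2 ^ (L * k) * W k) * pn w k"
        using wt_growth[of 0 k] besov_RdD(2)[OF w] by (intro mult_right_mono) (auto simp: gap_def)
      also have "... <= 2 ^ (L * k) * bnorm w"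
        using besov_RdD(8)[OF w, of k] by (simp only: mult.assoc) (intro mult_left_mono, auto)
      finally have "pn w k <= 2 ^ (L * k) * bnorm w / W 0" using wt_pos[of 0] by (simp add: field_simps)
      then have "pn w k * lnorm q (Mul (fat b k) f) <= (2 ^ (L * k) * bnorm w / W 0) * (C * (1 / 2) ^ (k * (L + 1)) * ?S f)"
        using C(2)[OF f, of k] wt_pos[of 0] by (intro mult_mono) auto
      also have "... = (2 ^ (L * k) * (1 / 2) ^ (L * k)) * ?B k" by (simp add: power_add mult_ac)
      finally show "pn w k * lnorm q (Mul (fat b k) f) <= ?B k" by (simp only: e mult_1)
    qed
    also have "... = (bnorm w * C * ?S f / W 0) * 2" by (subst suminf_mult) (simp_all add: suminf_geometric)
    finally show ?thesis by (simp add: mult_ac)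
  qed
  moreover have "0 <= 2 * C / W 0 * ?S f" for f :: "real ^ 'd => complex" using C wt_pos[of 0] S0[of f] by simp
  ultimately show ?thesis by blast
qed

lemma bnorm_eq_0:
  assumes "w \<in> BR" "bnorm w = 0" shows "w = (%f. 0)"
proof
  fix f
  obtain \<Phi> where "\<forall>w\<in>BR. \<forall>f\<in>schwartz. norm (w f) <= bnorm w * \<Phi> f" using besov_le_seminorm by blast
  then have "f \<in> schwartz ==> w f = 0" using assms by force
  moreover have "f \<notin> schwartz ==> w f = 0" using besov_RdD(1)[OF assms(1)] by (simp add: tempered_def)
  ultimately show "w f = 0" by blast
qed

lemma besov_Rd_add:
  assumes v: "v \<in> BR" and w: "w \<in> BR"
  shows "(%f. v f + w f) \<in> BR" "bnorm (%f. v f + w f) <= bnorm v + bnorm w"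
proof -
  have t: "(%f. v f + w f) \<in> tempered"
  proof (rule temperedI)
    show "sb (%f. norm (v f + w f))"
      by (rule sb_le[OF sb_add[OF tempered_sb[OF besov_RdD(1)[OF v]] tempered_sb[OF besov_RdD(1)[OF w]]]]) (rule norm_triangle_ineq)
  qed (use v w besov_RdD(1) in \<open>auto simp: tempered_add tempered_cmult distrib_left tempered_off\<close>)
  have e: "W k * (pn v k + pn w k) = W k * pn v k + W k * pn w k" for k by (simp add: distrib_left)
  have n0: "W k * pn v k >= 0" "W k * pn w k >= 0" for k
    using wt_pos[of k] besov_RdD(2)[OF v, of k] besov_RdD(2)[OF w, of k] by auto
  note mk = minkowski_suminf[OF less_imp_le[OF p1(1)] n0(1) besov_RdD(5)[OF v] n0(2) besov_RdD(5)[OF w], folded e]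
  have bd: "norm (v (D k f) + w (D k f)) <= (pn v k + pn w k) * lnorm q f" if "f \<in> schwartz" for k f
    using besov_RdD(3)[OF v that, of k] besov_RdD(3)[OF w that, of k] norm_triangle_ineq[of "v (D k f)" "w (D k f)"]
    by (simp add: distrib_right)
  note res = besov_RdI[OF t add_nonneg_nonneg[OF besov_RdD(2)[OF v] besov_RdD(2)[OF w]] bd mk(1)]
  show "(%f. v f + w f) \<in> BR" by (rule res(1))
  show "bnorm (%f. v f + w f) <= bnorm v + bnorm w"
    unfolding besov_RdD(7)[OF v] besov_RdD(7)[OF w] by (rule order_trans[OF res(2) mk(2)])
qed

lemma besov_Rd_scale:
  assumes w: "w \<in> BR"
  shows "(%f. c * w f) \<in> BR" "bnorm (%f. c * w f) = norm c * bnorm w"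
proof -
  have main: "(%f. c * w f) \<in> BR \<and> bnorm (%f. c * w f) <= norm c * bnorm w" if w: "w \<in> BR" for c w
  proof -
    note wt = besov_RdD(1)[OF w]
    have t: "(%f. c * w f) \<in> tempered"
    proof (rule temperedI)
      show "sb (%f. norm (c * w f))"
        by (rule sb_const_mult[OF tempered_sb[OF wt], of _ "norm c"]) (auto simp: norm_mult)
    qed (use wt in \<open>auto simp: tempered_add tempered_cmult distrib_left tempered_off\<close>)
    have bd: "norm (c * w (D k f)) <= (norm c * pn w k) * lnorm q f" if "f \<in> schwartz" for k f
      using besov_RdD(3)[OF w that, of k] by (simp add: norm_mult mult.assoc mult_left_mono)
    have e: "(W k * (norm c * pn w k)) powr p = norm c powr p * (W k * pn w k) powr p" for k
      using wt_pos[of k] besov_RdD(2)[OF w, of k] by (simp add: powr_mult[symmetric] mult_ac)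
    have s: "summable (%k. (W k * (norm c * pn w k)) powr p)" unfolding e by (intro summable_mult besov_RdD(5) w)
    note res = besov_RdI[OF t mult_nonneg_nonneg[OF norm_ge_zero besov_RdD(2)[OF w]] bd s]
    have "(\<Sum>k. (W k * (norm c * pn w k)) powr p) = norm c powr p * bnorm w powr p"
      unfolding e besov_RdD(6)[OF w] by (intro suminf_mult besov_RdD(5) w)
    then have "(\<Sum>k. (W k * (norm c * pn w k)) powr p) powr (1 / p) = norm c * bnorm w"
      using p1 by (simp add: powr_mult powr_powr)
    then show ?thesis using res by simp
  qed
  show i: "(%f. c * w f) \<in> BR" using main[OF w] by blast
  \<comment> \<open>The inequality of \<open>main\<close> for the inverse scalar, applied to the
    scaled distribution, gives the reverse bound.\<close>
  have "norm c * bnorm w <= bnorm (%f. c * w f)"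
  proof (cases "c = 0")
    case False
    then have "(%f. inverse c * (c * w f)) = w" by (simp add: fun_eq_iff mult.assoc[symmetric])
    then have "bnorm w <= norm (inverse c) * bnorm (%f. c * w f)" using main[OF i, of "inverse c"] by simp
    then have "norm c * bnorm w <= norm c * (norm (inverse c) * bnorm (%f. c * w f))" by (intro mult_left_mono) auto
    also have "... = norm (c * inverse c) * bnorm (%f. c * w f)" by (simp only: norm_mult mult.assoc)
    finally show ?thesis using False by simp
  qed simp
  with main[OF w, of c] show "bnorm (%f. c * w f) = norm c * bnorm w" by (simp add: order_antisym)
qed

lemma besov_Rd_diff:
  assumes v: "v \<in> BR" and w: "w \<in> BR" shows "(%f. v f - w f) \<in> BR"
  using besov_Rd_add(1)[OF v besov_Rd_scale(1)[OF w, of "-1"]] by simp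

lemma besov_Rd_zero: "(%f. 0) \<in> BR" "bnorm (%f. 0) = 0"
proof -
  have t: "(%f. 0) \<in> (tempered :: ((real ^ 'd => complex) => complex) set)" by (rule temperedI) auto
  note res = besov_RdI[OF t, of "%_. 0"]
  show "(%f. 0) \<in> BR" by (rule res) auto
  have "bnorm (%f. 0) <= (\<Sum>k. (W k * 0) powr p) powr (1 / p)" by (rule res) auto
  then show "bnorm (%f. 0) = 0" using bnorm_nonneg[of "%f. 0"] by simp
qed

lemma besov_Rd_sum:
  assumes "finite I" "!!i. i \<in> I ==> w i \<in> BR"
  shows "(%f. \<Sum>i\<in>I. w i f) \<in> BR \<and> bnorm (%f. \<Sum>i\<in>I. w i f) <= (\<Sum>i\<in>I. bnorm (w i))"
  using assms
proof (induction I rule: finite_induct)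
  case (insert i I)
  then have IH: "(%f. \<Sum>i\<in>I. w i f) \<in> BR" "bnorm (%f. \<Sum>i\<in>I. w i f) <= (\<Sum>i\<in>I. bnorm (w i))" and i: "w i \<in> BR" by auto
  from besov_Rd_add[OF i IH(1)] IH(2) insert show ?case by simp
qed (simp add: besov_Rd_zero)

text \<open>Fatou property: the norm is lower semicontinuous under pointwise convergence on Schwartz
  functions. Temperedness of the limit is not obtained from Banach-Steinhaus but from the common
  bound by one seminorm.\<close>

lemma besov_Rd_limit:
  assumes w: "!!n. w n \<in> BR" "!!n. bnorm (w n) <= R" and lim: "!!f. f \<in> schwartz ==> (%n. w n f) \<longlonglongrightarrow> v f"
    and v0: "!!f. f \<notin> schwartz ==> v f = 0"
  shows "v \<in> BR" "bnorm v <= R"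
proof -
  have R0: "R >= 0" using w(2)[of 0] bnorm_nonneg[of "w 0"] by linarith
  obtain \<Phi> where \<Phi>: "sb \<Phi>" "!!w f. w \<in> BR ==> f \<in> schwartz ==> norm (w f) <= bnorm w * \<Phi> f"
    "!!f. f \<in> schwartz ==> 0 <= \<Phi> f" using besov_le_seminorm by blast
  have vt: "v \<in> tempered"
  proof (rule temperedI)
    show "v (%x. f x + g x) = v f + v g" if f: "f \<in> schwartz" "g \<in> schwartz" for f g
    proof (rule LIMSEQ_unique[OF lim[OF schwartz_add[OF f]]])
      show "(%n. w n (%x. f x + g x)) \<longlonglongrightarrow> v f + v g"
        unfolding tempered_add[OF besov_RdD(1)[OF w(1)] f] by (intro tendsto_add lim f)
    qed
    show "v (%x. c * f x) = c * v f" if f: "f \<in> schwartz" for c f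
    proof (rule LIMSEQ_unique[OF lim[OF schwartz_cmult[OF f]]])
      show "(%n. w n (%x. c * f x)) \<longlonglongrightarrow> c * v f"
        unfolding tempered_cmult[OF besov_RdD(1)[OF w(1)] f] by (intro tendsto_mult tendsto_const lim f)
    qed
    show "sb (%f. norm (v f))"
    proof (rule sb_const_mult[OF \<Phi>(1) _ R0])
      fix f :: "real ^ 'd => complex" assume f: "f \<in> schwartz"
      have "norm (w n f) <= R * \<Phi> f" for n
        using \<Phi>(2)[OF w(1) f, of n] mult_right_mono[OF w(2) \<Phi>(3)[OF f], of n] by linarith
      then show "norm (v f) <= R * \<Phi> f"
        using lim[OF f] by (intro LIMSEQ_le_const2[OF tendsto_norm]) auto
    qed
  qed (rule v0)
  note lp = lp_dyadic(1)[OF b]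
  have pnR: "pn (w n) k <= R / W k" for n k
    using besov_RdD(8)[OF w(1), of k n] w(2)[of n] wt_pos[of k] by (simp add: field_simps)
  have bdR: "norm (v (D k f)) <= (R / W k) * lnorm q f" if f: "f \<in> schwartz" for k f
  proof -
    have "norm (w n (D k f)) <= (R / W k) * lnorm q f" for n
      using besov_RdD(3)[OF w(1) f, of n k] mult_right_mono[OF pnR lnorm_nonneg, of k n q f] by linarith
    then show ?thesis
      by (intro LIMSEQ_le_const2[OF tendsto_norm[OF lim[OF lp_family_Mul_schwartz[OF lp f]]]] exI allI impI)
  qed
  have iL: "in_Lp p (piece b k v)" for k
    using lp bdR R0 less_imp_le[OF wt_pos[of k]]
    by (intro in_Lp_of_bound(1)[OF b pq vt, of "dyadic b k" _ "R / W k"]) (auto simp: lp_family_def piece_eq[OF b])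
  note iLb = in_Lp_bound[OF b pq iL]
  \<comment> \<open>\<open>pn v k\<close> is a least constant, so slightly less than it is violated
    by some \<open>f\<close>; for large n the same \<open>f\<close> violates it for
    \<open>w n\<close>.\<close>
  have ev: "\<forall>\<^sub>F n in sequentially. pn v k - \<delta> <= pn (w n) k" if \<delta>: "\<delta> > 0" for k \<delta>
  proof (cases "pn v k - \<delta> >= 0")
    case True
    have "\<exists>f\<in>schwartz. norm (v (D k f)) > (pn v k - \<delta>) * lnorm q f"
    proof (rule ccontr)
      assume "\<not> ?thesis"
      then have "pn v k <= pn v k - \<delta>" by (intro iLb(3) True) (auto simp: piece_eq[OF b] not_less)
      then show False using \<delta> by simp
    qed
    then obtain f where f: "f \<in> schwartz" "(pn v k - \<delta>) * lnorm q f < norm (v (D k f))" by blast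
    have "(%n. norm (w n (D k f))) \<longlonglongrightarrow> norm (v (D k f))"
      by (intro tendsto_norm lim lp_family_Mul_schwartz[OF lp] f)
    from order_tendstoD(1)[OF this f(2)] show ?thesis
    proof (rule eventually_mono)
      fix n assume "(pn v k - \<delta>) * lnorm q f < norm (w n (D k f))"
      with besov_RdD(3)[OF w(1) f(1), of n k] have "(pn v k - \<delta>) * lnorm q f < pn (w n) k * lnorm q f" by linarith
      then have "pn v k - \<delta> < pn (w n) k" by (rule mult_right_less_imp_less) simp
      then show "pn v k - \<delta> <= pn (w n) k" by simp
    qed
  next
    case False
    have "pn v k - \<delta> <= pn (w n) k" for n using False besov_RdD(2)[OF w(1), of k n] by linarith
    then show ?thesis by simp
  qed
  \<comment> \<open>For finitely many k one index n is good for all of them. The lower bounds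
    \<open>pn v k - \<delta>\<close> may be negative and are cut off at 0 before powers are taken;
    then \<delta> tends to 0 from the right.\<close>
  have fin: "(\<Sum>k<K. (W k * pn v k) powr p) <= R powr p" for K
  proof (rule tendsto_upperbound)
    have "((%\<delta>. (W k * max 0 (pn v k - \<delta>)) powr p) \<longlongrightarrow> (W k * max 0 (pn v k - 0)) powr p) (at_right 0)" for k
      using p1 wt_pos[of k]
      by (intro tendsto_powr' tendsto_mult tendsto_const tendsto_max tendsto_diff tendsto_ident_at) auto
    then have "((%\<delta>. \<Sum>k<K. (W k * max 0 (pn v k - \<delta>)) powr p) \<longlongrightarrow> (\<Sum>k<K. (W k * max 0 (pn v k - 0)) powr p)) (at_right 0)"
      by (rule tendsto_sum)
    then show "((%\<delta>. \<Sum>k<K. (W k * max 0 (pn v k - \<delta>)) powr p) \<longlongrightarrow> (\<Sum>k<K. (W k * pn v k) powr p)) (at_right 0)"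
      using iLb(1) by (simp add: max_absorb2)
    have "(\<Sum>k<K. (W k * max 0 (pn v k - \<delta>)) powr p) <= R powr p" if \<delta>: "\<delta> > 0" for \<delta>
    proof -
      have "\<forall>\<^sub>F n in sequentially. \<forall>k\<in>{..<K}. pn v k - \<delta> <= pn (w n) k"
        by (subst eventually_ball_finite_distrib) (auto intro: ev[OF \<delta>])
      then obtain n where n: "!!k. k < K ==> pn v k - \<delta> <= pn (w n) k"
        unfolding eventually_sequentially by auto
      have "(\<Sum>k<K. (W k * max 0 (pn v k - \<delta>)) powr p) <= (\<Sum>k<K. (W k * pn (w n) k) powr p)"
        using n besov_RdD(2)[OF w(1)] less_imp_le[OF wt_pos] p1
        by (intro sum_mono powr_mono2 mult_left_mono mult_nonneg_nonneg) auto
      also have "... <= (\<Sum>k. (W k * pn (w n) k) powr p)" by (intro sum_le_suminf besov_RdD(5) w) auto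
      also have "... <= R powr p"
        unfolding besov_RdD(6)[OF w(1), symmetric] using w(2) p1 by (intro powr_mono2) auto
      finally show ?thesis .
    qed
    then show "\<forall>\<^sub>F \<delta> in at_right 0. (\<Sum>k<K. (W k * max 0 (pn v k - \<delta>)) powr p) <= R powr p"
      by (simp add: eventually_at_filter)
  qed simp
  have s: "summable (%k. (W k * pn v k) powr p)"
    by (rule bounded_imp_summable[of _ "R powr p"]) (use fin[of "Suc _"] in \<open>auto simp: lessThan_Suc_atMost\<close>)
  have bd: "norm (v (D k f)) <= pn v k * lnorm q f" if f: "f \<in> schwartz" for k f
    using iLb(2)[OF f, of k] by (simp add: piece_eq[OF b f])
  note res = besov_RdI[OF vt iLb(1) bd s]
  show "v \<in> BR" by (rule res(1))
  have "(\<Sum>k. (W k * pn v k) powr p) <= R powr p" by (rule suminf_le_const[OF s fin])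
  then have "(\<Sum>k. (W k * pn v k) powr p) powr (1 / p) <= (R powr p) powr (1 / p)"
    using p1 by (intro powr_mono2 suminf_nonneg s) auto
  with res(2) show "bnorm v <= R" using p1 R0 by (simp add: powr_powr)
qed

text \<open>Levels k < K are unchanged by the low-pass operator, and on the others its norm is
  bounded uniformly in K, so the error is at most 1 + c times a tail of the convergent series
  defining the norm. Finiteness of p enters here: tails tend to 0.\<close>

lemma low_pass_besov:
  assumes w: "w \<in> BR"
  defines "v K == (%f. if f \<in> schwartz then w (Mul (dil b K) f) else 0)"
  shows "!!K. v K \<in> tempered" "!!K. (%f. v K f - w f) \<in> BR" "(%K. bnorm (%f. v K f - w f)) \<longlonglongrightarrow> 0"
proof -
  note wt = besov_RdD(1)[OF w] note bt = cutoff_test_fun[OF b] note lp = lp_dyadic(1)[OF b]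
  have pg: "pgrow (dil b K)" for K by (rule pgrow_test_fun[OF dil_test_fun[OF bt]])
  show vt: "v K \<in> tempered" for K
    unfolding v_def by (rule tempered_compose[OF wt scont_Mul[OF pg]]) (auto simp: Mul_add_fun[OF pg] Mul_cmult_fun)
  have dt: "(%f. v K f - w f) \<in> tempered" for K
  proof (rule temperedI)
    show "sb (%f. norm (v K f - w f))"
      by (rule sb_le[OF sb_add[OF tempered_sb[OF vt] tempered_sb[OF wt]]]) (auto intro: norm_triangle_ineq4)
  qed (use vt[of K] wt in \<open>auto simp: tempered_add tempered_cmult right_diff_distrib tempered_off\<close>)
  define c where "c = (LBINT x. norm (ker b x))"
  have c: "c >= 0" by (simp add: c_def)
  let ?A = "%K k. if k < K then 0 else (1 + c) * pn w k"
  have A0: "?A K k >= 0" for K k using besov_RdD(2)[OF w] c by simp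
  have bd: "norm (v K (D k f) - w (D k f)) <= ?A K k * lnorm q f" if f: "f \<in> schwartz" for K k f
  proof -
    have vK: "v K (D k f) = w (Mul (%\<xi>. dil b K \<xi> * dyadic b k \<xi>) f)"
      using lp_family_Mul_schwartz[OF lp f] Mul_Mul[OF lp_family_pgrow[OF lp] f] by (simp add: v_def)
    show ?thesis
    proof (cases "k < K")
      case True
      then show ?thesis by (simp add: vK dil_dyadic[OF b])
    next
      case False
      \<comment> \<open>The two multipliers commute; applying the low-pass first leaves
        \<open>D k\<close> adjacent to \<open>w\<close>, where the norm of the block can be
        used.\<close>
      have "(%\<xi>. dil b K \<xi> * dyadic b k \<xi>) = (%\<xi>. dyadic b k \<xi> * dil b K \<xi>)" by (simp add: mult.commute)
      then have "v K (D k f) = w (D k (Mul (dil b K) f))"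
        unfolding vK by (simp only: Mul_Mul[OF pg f])
      also have "norm ... <= pn w k * lnorm q (Mul (dil b K) f)" by (intro besov_RdD(3) w Mul_schwartz pg f)
      also have "... <= pn w k * (c * lnorm q f)"
        unfolding c_def by (intro mult_left_mono lnorm_Mul_dil[OF b] p1 bt f besov_RdD(2) w)
      finally have "norm (v K (D k f)) <= pn w k * (c * lnorm q f)" .
      with besov_RdD(3)[OF w f, of k] norm_triangle_ineq4[of "v K (D k f)" "w (D k f)"] False
      show ?thesis by (simp add: algebra_simps)
    qed
  qed
  let ?x = "%k. (W k * pn w k) powr p"
  have e: "(W k * ?A K k) powr p = (1 + c) powr p * (?x k - (if k \<in> {..<K} then ?x k else 0))" for K k
    using wt_pos[of k] besov_RdD(2)[OF w, of k] c by (simp add: powr_mult[symmetric] mult_ac)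
  have su: "(%k. (W k * ?A K k) powr p) sums ((1 + c) powr p * (suminf ?x - sum ?x {..<K}))" for K
    unfolding e by (intro sums_mult sums_diff sums_If_finite_set summable_sums besov_RdD(5) w) simp
  note res = besov_RdI[OF dt A0 bd sums_summable[OF su]]
  show "(%f. v K f - w f) \<in> BR" for K by (rule res(1))
  have "(%K. ((1 + c) powr p * (suminf ?x - sum ?x {..<K})) powr (1 / p)) \<longlonglongrightarrow> ((1 + c) powr p * (suminf ?x - suminf ?x)) powr (1 / p)"
    using p1 summable_LIMSEQ[OF besov_RdD(5)[OF w]] sum_le_suminf[OF besov_RdD(5)[OF w]]
    by (intro tendsto_powr' tendsto_mult tendsto_diff tendsto_const) (auto intro!: always_eventually)
  then have lim: "(%K. ((1 + c) powr p * (suminf ?x - sum ?x {..<K})) powr (1 / p)) \<longlonglongrightarrow> 0" by simp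
  show "(%K. bnorm (%f. v K f - w f)) \<longlonglongrightarrow> 0"
  proof (rule tendsto_sandwich[OF _ _ tendsto_const lim])
    show "\<forall>\<^sub>F K in sequentially. bnorm (%f. v K f - w f) <= ((1 + c) powr p * (suminf ?x - sum ?x {..<K})) powr (1 / p)"
      using res(2) by (intro always_eventually allI) (simp only: sums_unique[OF su])
  qed simp
qed

end

section \<open>Charts\<close>

text \<open>The bump is 1 minus the product of the factors 1 - b_x over a finite cover by balls: at
  a point of \<open>K\<close> one factor vanishes, and away from all doubled balls every factor is
  1.\<close>

lemma smooth_bump:
  fixes K U :: "'a::euclidean_space set"
  assumes b: "is_cutoff (b :: 'a => complex)" and K: "compact K" and U: "open U" "K \<subseteq> U"
  obtains \<theta> where "\<theta> \<in> test_fun U" "!!x. x \<in> K ==> \<theta> x = 1"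
proof -
  have "\<forall>x\<in>K. \<exists>r>0. cball x (2 * r) \<subseteq> U"
  proof
    fix x assume "x \<in> K"
    then obtain e where "e > 0" "cball x e \<subseteq> U" using U open_contains_cball by blast
    then show "\<exists>r>0. cball x (2 * r) \<subseteq> U" by (intro exI[of _ "e / 2"]) auto
  qed
  from bchoice[OF this] obtain r where r: "\<forall>x\<in>K. r x > 0 \<and> cball x (2 * r x) \<subseteq> U" ..
  have "K \<subseteq> (\<Union>x\<in>K. ball x (r x))" using r by force
  then obtain X where X: "X \<subseteq> K" "finite X" "K \<subseteq> (\<Union>x\<in>X. ball x (r x))"
    using compactE_image[OF K, of K "%x. ball x (r x)"] by blast
  have 1: "norm y <= 1 ==> b y = 1" and 0: "norm y >= 2 ==> b y = 0" for y using b by (auto simp: is_cutoff_def)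
  let ?b = "%x y. b ((1 / r x) *\<^sub>R (y - x))"
  let ?\<theta> = "%y. 1 - (\<Prod>x\<in>X. 1 - ?b x y)"
  have bC: "Cinf UNIV b" using b by (simp add: is_cutoff_def smooth_on_open)
  have bi: "Cinf UNIV (?b x)" for x
    by (rule Cinf_compose[OF open_UNIV open_UNIV _ bC])
       (auto intro!: Cinf_linear_compose[OF bounded_linear_scaleR_right] Cinf_diff)
  have "?\<theta> \<in> test_fun U"
  proof (rule test_funI[of _ "\<Union>x\<in>X. cball x (2 * r x)"])
    show "Cinf UNIV ?\<theta>" by (intro Cinf_diff Cinf_prod Cinf_const open_UNIV bi)
    show "compact (\<Union>x\<in>X. cball x (2 * r x))" using X by (intro compact_UN) auto
    show "(\<Union>x\<in>X. cball x (2 * r x)) \<subseteq> U" using X r by blast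
    fix y assume y: "y \<notin> (\<Union>x\<in>X. cball x (2 * r x))"
    have "?b x y = 0" if "x \<in> X" for x
    proof (rule 0)
      have rx: "r x > 0" using r X that by auto
      have "norm (y - x) > 2 * r x" using y that by (auto simp: dist_norm norm_minus_commute)
      then have "2 <= norm (y - x) / r x" using rx by (simp add: le_divide_eq)
      then show "2 <= norm ((1 / r x) *\<^sub>R (y - x))" using rx by simp
    qed
    then show "?\<theta> y = 0" by simp
  qed
  moreover have "?\<theta> y = 1" if y: "y \<in> K" for y
  proof -
    obtain x where x: "x \<in> X" "dist x y < r x" using X y by auto
    have "?b x y = 1" using x by (intro 1) (auto simp: dist_norm norm_minus_commute divide_le_eq)
    then show ?thesis using x X prod_zero[OF X(2), of "%x. 1 - ?b x y"] by auto
  qed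
  ultimately show ?thesis by (rule that)
qed

lemma param_D:
  assumes "param \<Gamma> V \<pi>"
  shows "open V" "openin (top_of_set \<Gamma>) (\<pi> ` V)" "inj_on \<pi> V" "Cinf V \<pi>" "!!x. x \<in> V ==> \<pi> x \<in> \<Gamma>"
    "!!x. x \<in> V ==> inv_into V \<pi> (\<pi> x) = x" "continuous_on V \<pi>"
  using assms openin_imp_subset[OF conjunct1[OF conjunct2[OF assms[unfolded param_def]]]] Cinf_imp_continuous[of V \<pi>]
  by (auto simp: param_def smooth_diffeo_def bij_betw_def smooth_on_open)

text \<open>The local smooth extension of the inverse chart, restricted further to an ambient open
  set meeting \<Gamma> only inside the chart image. On it the extension can be composed with other
  maps into \<Gamma>.\<close>

lemma param_inv_extension:
  assumes pm: "param \<Gamma> V \<pi>" and z: "z \<in> \<pi> ` V"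
  obtains U F where "open U" "z \<in> U" "Cinf U F" "U \<inter> \<Gamma> \<subseteq> \<pi> ` V" "!!z'. z' \<in> U \<inter> \<Gamma> ==> F z' = inv_into V \<pi> z'"
proof -
  have "smooth_on (\<pi> ` V) (inv_into V \<pi>)" using pm by (simp add: param_def smooth_diffeo_def)
  then obtain U F where U: "open U" "z \<in> U" "Cinf U F" "\<forall>y\<in>U \<inter> \<pi> ` V. F y = inv_into V \<pi> y"
    unfolding smooth_on_iff using z by blast
  obtain O' where O': "open O'" "\<pi> ` V = \<Gamma> \<inter> O'" using param_D(2)[OF pm] by (auto simp: openin_open)
  show ?thesis
  proof (rule that[of "U \<inter> O'" F])
    show "z \<in> U \<inter> O'" using U O' z by blast
    show "U \<inter> O' \<inter> \<Gamma> \<subseteq> \<pi> ` V" using O' by blast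
    show "Cinf (U \<inter> O') F" using U(3) by (rule Cinf_subset) blast
    show "F z' = inv_into V \<pi> z'" if "z' \<in> U \<inter> O' \<inter> \<Gamma>" for z' using U(4) O'(2) that by blast
  qed (use U O' in auto)
qed

lemma param_inv_continuous:
  assumes pm: "param \<Gamma> V \<pi>" shows "continuous_on (\<pi> ` V) (inv_into V \<pi>)"
  unfolding continuous_on_eq_continuous_within
proof
  fix z assume z: "z \<in> \<pi> ` V"
  obtain U F where U: "open U" "z \<in> U" "Cinf U F" "!!z'. z' \<in> U \<inter> \<Gamma> ==> F z' = inv_into V \<pi> z'"
    using param_inv_extension[OF pm z] by metis
  obtain e where e: "e > 0" "ball z e \<subseteq> U" using U open_contains_ball by blast
  have "continuous (at z within \<pi> ` V) F"
    using Cinf_imp_continuous[OF U(3)] U(1,2) by (meson continuous_on_eq_continuous_at continuous_at_imp_continuous_at_within)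
  then show "continuous (at z within \<pi> ` V) (inv_into V \<pi>)"
  proof (rule continuous_transform_within[OF _ e(1) z])
    fix z' assume "z' \<in> \<pi> ` V" "dist z' z < e"
    then show "F z' = inv_into V \<pi> z'" using e(2) param_D(5)[OF pm] by (intro U(4)) (auto simp: dist_commute)
  qed
qed

lemma param_compact_preimage:
  assumes pm: "param \<Gamma> V \<pi>" and S: "compact S" "S \<subseteq> \<pi> ` V"
  shows "compact (inv_into V \<pi> ` S)" "inv_into V \<pi> ` S \<subseteq> V"
proof -
  show "compact (inv_into V \<pi> ` S)"
    using compact_continuous_image[OF continuous_on_subset[OF param_inv_continuous[OF pm] S(2)] S(1)] .
  show "inv_into V \<pi> ` S \<subseteq> V" using S(2) by (auto intro: inv_into_into)
qed

lemma smooth_on_param: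
  fixes g :: "real ^ 'n::finite => 'b::real_normed_vector"
  assumes pm: "param \<Gamma> V \<pi>" and g: "smooth_on \<Gamma> g"
  shows "Cinf V (%x. g (\<pi> x))"
proof (rule Cinf_local)
  fix x assume x: "x \<in> V"
  then have "\<pi> x \<in> \<Gamma>" using param_D(5)[OF pm] by blast
  then obtain U G where U: "open U" "\<pi> x \<in> U" "Cinf U G" "\<forall>y\<in>U \<inter> \<Gamma>. G y = g y"
    using g unfolding smooth_on_iff by blast
  let ?W = "V \<inter> \<pi> -` U"
  have W: "open ?W" by (rule continuous_open_preimage[OF param_D(7,1)[OF pm] U(1)])
  have "Cinf ?W (%x. G (\<pi> x))"
    by (rule Cinf_compose[OF W U(1) Cinf_subset[OF param_D(4)[OF pm]] U(3)]) auto
  also have "?this \<longleftrightarrow> Cinf ?W (%x. g (\<pi> x))"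
    using U(4) param_D(5)[OF pm] by (intro Cinf_cong[OF W]) auto
  finally show "\<exists>U. open U \<and> x \<in> U \<and> Cinf U (%x. g (\<pi> x))" using W x U(2) by (intro exI[of _ ?W]) auto
qed

lemma transition_param: "\<pi>1 x \<in> \<pi>2 ` V2 ==> transition V2 \<pi>2 \<pi>1 x \<in> V2 \<and> \<pi>2 (transition V2 \<pi>2 \<pi>1 x) = \<pi>1 x"
  by (simp add: transition_def inv_into_into f_inv_into_f)

text \<open>Locally a transition map is a smooth chart followed by an ambient smooth extension of
  the other inverse chart, hence smooth in the ordinary sense; by symmetry one half of each claim
  suffices.\<close>

lemma transition_diffeo:
  fixes \<pi>1 \<pi>2 :: "real ^ 'd::finite => real ^ 'n::finite"
  assumes p1: "param \<Gamma> V1 \<pi>1" and p2: "param \<Gamma> V2 \<pi>2"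
  shows "diffeo {x \<in> V1. \<pi>1 x \<in> \<pi>2 ` V2} (transition V2 \<pi>2 \<pi>1) {y \<in> V2. \<pi>2 y \<in> \<pi>1 ` V1} (transition V1 \<pi>1 \<pi>2)"
proof -
  have op: "open {x \<in> V1. \<pi>1 x \<in> \<pi>2 ` V2}" if p1: "param \<Gamma> V1 \<pi>1" and p2: "param \<Gamma> V2 \<pi>2"
    for V1 V2 and \<pi>1 \<pi>2 :: "real ^ 'd => real ^ 'n"
  proof -
    obtain O' where O': "open O'" "\<pi>2 ` V2 = \<Gamma> \<inter> O'" using param_D(2)[OF p2] by (auto simp: openin_open)
    have "{x \<in> V1. \<pi>1 x \<in> \<pi>2 ` V2} = V1 \<inter> \<pi>1 -` O'" unfolding O'(2) using param_D(5)[OF p1] by auto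
    then show ?thesis using continuous_open_preimage[OF param_D(7,1)[OF p1] O'(1)] by simp
  qed
  have sm: "Cinf {x \<in> V1. \<pi>1 x \<in> \<pi>2 ` V2} (transition V2 \<pi>2 \<pi>1)" if p1: "param \<Gamma> V1 \<pi>1" and p2: "param \<Gamma> V2 \<pi>2"
    for V1 V2 and \<pi>1 \<pi>2 :: "real ^ 'd => real ^ 'n"
  proof (rule Cinf_local)
    fix x assume "x \<in> {x \<in> V1. \<pi>1 x \<in> \<pi>2 ` V2}"
    then have x: "x \<in> V1" "\<pi>1 x \<in> \<pi>2 ` V2" by auto
    obtain U F where U: "open U" "\<pi>1 x \<in> U" "Cinf U F" "!!z. z \<in> U \<inter> \<Gamma> ==> F z = inv_into V2 \<pi>2 z"
      using param_inv_extension[OF p2 x(2)] by metis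
    let ?W = "V1 \<inter> \<pi>1 -` U"
    have W: "open ?W" by (rule continuous_open_preimage[OF param_D(7,1)[OF p1] U(1)])
    have "Cinf ?W (%x. F (\<pi>1 x))"
      by (rule Cinf_compose[OF W U(1) Cinf_subset[OF param_D(4)[OF p1]] U(3)]) auto
    also have "?this \<longleftrightarrow> Cinf ?W (transition V2 \<pi>2 \<pi>1)"
      using U(4) param_D(5)[OF p1] by (intro Cinf_cong[OF W]) (auto simp: transition_def)
    finally show "\<exists>U. open U \<and> x \<in> U \<and> Cinf U (transition V2 \<pi>2 \<pi>1)" using W x U(2) by (intro exI[of _ ?W]) auto
  qed
  have inv: "transition V1 \<pi>1 \<pi>2 (transition V2 \<pi>2 \<pi>1 x) = x" if "param \<Gamma> V1 \<pi>1" "x \<in> V1" "\<pi>1 x \<in> \<pi>2 ` V2"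
    for V1 V2 x and \<pi>1 \<pi>2 :: "real ^ 'd => real ^ 'n"
    using transition_param[of \<pi>1 x \<pi>2 V2] that param_D(6)[OF that(1,2)] by (simp add: transition_def)
  show ?thesis
    unfolding diffeo_def
  proof (intro conjI op sm p1 p2 ballI subsetI)
    fix x assume "x \<in> transition V2 \<pi>2 \<pi>1 ` {x \<in> V1. \<pi>1 x \<in> \<pi>2 ` V2}"
    then obtain y where y: "y \<in> V1" "\<pi>1 y \<in> \<pi>2 ` V2" "x = transition V2 \<pi>2 \<pi>1 y" by blast
    show "x \<in> {y \<in> V2. \<pi>2 y \<in> \<pi>1 ` V1}" unfolding y(3) using transition_param[of \<pi>1 y \<pi>2 V2] y(1,2) by simp
  next
    fix x assume "x \<in> transition V1 \<pi>1 \<pi>2 ` {y \<in> V2. \<pi>2 y \<in> \<pi>1 ` V1}"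
    then obtain y where y: "y \<in> V2" "\<pi>2 y \<in> \<pi>1 ` V1" "x = transition V1 \<pi>1 \<pi>2 y" by blast
    show "x \<in> {x \<in> V1. \<pi>1 x \<in> \<pi>2 ` V2}" unfolding y(3) using transition_param[of \<pi>2 y \<pi>1 V1] y(1,2) by simp
  qed (auto simp: inv[OF p1] inv[OF p2])
qed

lemma chart_mult_test_fun:
  fixes g :: "real ^ 'n::finite => complex"
  assumes pm: "param \<Gamma> V \<pi>" and h: "h \<in> test_fun V" and g: "smooth_on \<Gamma> g"
  shows "(%y. h y * g (\<pi> y)) \<in> test_fun V"
  by (rule test_fun_mult[OF h param_D(1)[OF pm] smooth_on_param[OF pm g]])

text \<open>The support is contained in the part of the support of the product in \<open>V\<close>
  that is mapped into \<open>S\<close>. This is compact although the overlap itself is merely open,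
  and it stays away from the boundary of the overlap.\<close>

lemma chart_mult_test_fun_overlap:
  fixes g :: "real ^ 'n::finite => complex"
  assumes pm: "param \<Gamma> V \<pi>" and h: "h \<in> test_fun V" and g: "smooth_on \<Gamma> g"
    and S: "compact S" "S \<subseteq> T" "!!z. z \<in> \<Gamma> ==> z \<notin> S ==> g z = 0"
  shows "(%y. h y * g (\<pi> y)) \<in> test_fun {y \<in> V. \<pi> y \<in> T}"
proof -
  from chart_mult_test_fun[OF pm h g] obtain K where K: "compact K" "K \<subseteq> V" "!!y. y \<notin> K ==> h y * g (\<pi> y) = 0"
    and C: "Cinf UNIV (%y. h y * g (\<pi> y))" by (rule test_funE) blast
  show ?thesis
  proof (rule test_funI[OF C, of "K \<inter> \<pi> -` S"])
    have "closed (K \<inter> \<pi> -` S)"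
      using K S by (intro continuous_closed_preimage continuous_on_subset[OF param_D(7)[OF pm]] compact_imp_closed)
    then show "compact (K \<inter> \<pi> -` S)" using compact_Int_closed[OF K(1), of "K \<inter> \<pi> -` S"] by (simp add: Int_assoc[symmetric])
    show "K \<inter> \<pi> -` S \<subseteq> {y \<in> V. \<pi> y \<in> T}" using K S by auto
    show "h y * g (\<pi> y) = 0" if "y \<notin> K \<inter> \<pi> -` S" for y
      using that K(2) K(3)[of y] S(3)[of "\<pi> y"] param_D(5)[OF pm, of y] by (cases "y \<in> K") auto
  qed
qed

lemma chart_test_fun:
  fixes g :: "real ^ 'n::finite => complex"
  assumes pm: "param \<Gamma> V \<pi>" and g: "smooth_on \<Gamma> g"
    and S: "compact S" "S \<subseteq> \<pi> ` V" "!!z. z \<in> \<Gamma> ==> z \<notin> S ==> g z = 0"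
  shows "(%y. if y \<in> V then g (\<pi> y) else 0) \<in> test_fun V"
proof (rule test_funI)
  let ?K = "inv_into V \<pi> ` S" let ?f = "%y. if y \<in> V then g (\<pi> y) else 0"
  note K = param_compact_preimage[OF pm S(1,2)]
  show "compact ?K" "?K \<subseteq> V" by fact+
  show z: "?f y = 0" if "y \<notin> ?K" for y
  proof (cases "y \<in> V")
    case True
    then have "\<pi> y \<notin> S" using that param_D(6)[OF pm True] by (metis imageI)
    then show ?thesis using S(3)[OF param_D(5)[OF pm True]] by simp
  qed simp
  have CV: "Cinf V ?f" using smooth_on_param[OF pm g] by (subst Cinf_cong[OF param_D(1)[OF pm]]) auto
  have CK: "Cinf (- ?K) ?f"
    using z by (subst Cinf_cong[of _ _ "%y. 0"]) (auto simp: open_Compl compact_imp_closed K)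
  show "Cinf UNIV ?f"
  proof (rule Cinf_local)
    fix x
    show "\<exists>U. open U \<and> x \<in> U \<and> Cinf U ?f"
    proof (cases "x \<in> V")
      case True
      then show ?thesis using CV param_D(1)[OF pm] by (intro exI[of _ V]) simp
    next
      case False
      then have "x \<in> - ?K" using K(2) by blast
      then show ?thesis using CK open_Compl[OF compact_imp_closed[OF K(1)]] by (intro exI[of _ "- ?K"] conjI)
    qed
  qed
qed

definition lift :: "(real ^ 'd) set => (real ^ 'd => real ^ 'n) => (real ^ 'd => complex) => real ^ 'n => complex" where
  "lift V \<pi> f z = (if z \<in> \<pi> ` V then f (inv_into V \<pi> z) else 0)"

lemma lift_param: "param \<Gamma> V \<pi> ==> x \<in> V ==> lift V \<pi> f (\<pi> x) = f x"
  by (simp add: lift_def param_D(6))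

lemma lift_support:
  assumes pm: "param \<Gamma> V \<pi>" and f: "f \<in> test_fun V"
  obtains S where "compact S" "S \<subseteq> \<pi> ` V" "!!z. z \<notin> S ==> lift V \<pi> f z = 0"
proof -
  from f obtain K where K: "compact K" "K \<subseteq> V" "!!y. y \<notin> K ==> f y = 0" by (rule test_funE) blast
  show ?thesis
  proof (rule that[of "\<pi> ` K"])
    show "compact (\<pi> ` K)" using K by (intro compact_continuous_image continuous_on_subset[OF param_D(7)[OF pm]])
    show "lift V \<pi> f z = 0" if "z \<notin> \<pi> ` K" for z
    proof (cases "z \<in> \<pi> ` V")
      case True
      then obtain y where y: "y \<in> V" "z = \<pi> y" by blast
      then have "y \<notin> K" using that by blast
      then show ?thesis using K(3) param_D(6)[OF pm y(1)] y by (simp add: lift_def)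
    qed (simp add: lift_def)
  qed (use K in auto)
qed

text \<open>Inside the chart image the lift is \<open>f\<close> composed with an ambient extension
  of the inverse chart; outside, a neighbourhood avoids the compact image of the support, where the
  lift is 0.\<close>

lemma lift_smooth:
  assumes pm: "param \<Gamma> V \<pi>" and f: "f \<in> test_fun V"
  shows "smooth_on \<Gamma> (lift V \<pi> f)"
  unfolding smooth_on_iff
proof
  fix z assume z: "z \<in> \<Gamma>"
  show "\<exists>U F. open U \<and> z \<in> U \<and> Cinf U F \<and> (\<forall>y\<in>U \<inter> \<Gamma>. F y = lift V \<pi> f y)"
  proof (cases "z \<in> \<pi> ` V")
    case True
    obtain U F where U: "open U" "z \<in> U" "Cinf U F" "U \<inter> \<Gamma> \<subseteq> \<pi> ` V" "!!z'. z' \<in> U \<inter> \<Gamma> ==> F z' = inv_into V \<pi> z'"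
      using param_inv_extension[OF pm True] by metis
    have "Cinf U (%y. f (F y))"
      by (rule Cinf_compose[OF U(1) open_UNIV U(3) test_fun_Cinf[OF f]]) simp
    then show ?thesis using U by (intro exI[of _ U] exI[of _ "%y. f (F y)"]) (auto simp: lift_def)
  next
    case False
    obtain S where S: "compact S" "S \<subseteq> \<pi> ` V" "!!z. z \<notin> S ==> lift V \<pi> f z = 0" by (rule lift_support[OF pm f], rule that)
    then show ?thesis using False
      by (intro exI[of _ "- S"] exI[of _ "%y. 0"]) (auto simp: open_Compl compact_imp_closed)
  qed
qed

lemma smooth_on_sum:
  assumes "!!i. i \<in> I ==> smooth_on S (f i)" "finite I"
  shows "smooth_on S (%x. \<Sum>i\<in>I. f i x)"
  unfolding smooth_on_iff
proof
  fix x assume x: "x \<in> S"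
  have "\<forall>i\<in>I. \<exists>UF. open (fst UF) \<and> x \<in> fst UF \<and> Cinf (fst UF) (snd UF) \<and> (\<forall>y\<in>fst UF \<inter> S. snd UF y = f i y)"
    using assms(1) x unfolding smooth_on_iff by (metis fst_conv snd_conv)
  from bchoice[OF this] obtain G where G: "\<forall>i\<in>I. open (fst (G i)) \<and> x \<in> fst (G i) \<and> Cinf (fst (G i)) (snd (G i)) \<and>
      (\<forall>y\<in>fst (G i) \<inter> S. snd (G i) y = f i y)" ..
  let ?U = "\<Inter>i\<in>I. fst (G i)"
  have U: "open ?U" using G assms(2) by (intro open_INT) auto
  have "Cinf ?U (%y. \<Sum>i\<in>I. snd (G i) y)"
    using G by (intro Cinf_sum U) (blast intro: Cinf_subset)
  moreover have "\<forall>y\<in>?U \<inter> S. (\<Sum>i\<in>I. snd (G i) y) = (\<Sum>i\<in>I. f i y)"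
    using G by (intro ballI sum.cong) auto
  ultimately show "\<exists>U F. open U \<and> x \<in> U \<and> Cinf U F \<and> (\<forall>y\<in>U \<inter> S. F y = (\<Sum>i\<in>I. f i y))"
    using U G by (intro exI[of _ ?U] exI[of _ "%y. \<Sum>i\<in>I. snd (G i) y"]) auto
qed

section \<open>Distributions on the manifold and their local parts\<close>

lemma distributions_D:
  assumes "u \<in> distributions V"
  shows "!!f g. f \<in> test_fun V ==> g \<in> test_fun V ==> u (%x. f x + g x) = u f + u g"
    "!!c f. f \<in> test_fun V ==> u (%x. c * f x) = c * u f" "!!f. f \<notin> test_fun V ==> u f = 0"
  using assms by (auto simp: distributions_def linear_functional_on_def)

lemma distributions_sum:
  assumes u: "u \<in> distributions V" and f: "!!i. i \<in> I ==> f i \<in> test_fun V"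
  shows "u (%x. \<Sum>i\<in>I. f i x) = (\<Sum>i\<in>I. u (f i))"
  using f
proof (induction I rule: infinite_finite_induct)
  case (insert i I)
  then show ?case using distributions_D(1)[OF u, of "f i" "%x. \<Sum>i\<in>I. f i x"] by (simp add: test_fun_sum)
qed (use distributions_D(2)[OF u test_fun_zero, of 0] in simp_all)

lemma mdistributions_D:
  assumes "v \<in> mdistributions \<Gamma>"
  shows "param \<Gamma> V \<pi> ==> v V \<pi> \<in> distributions V" "\<not> param \<Gamma> V \<pi> ==> v V \<pi> = (%_. 0)"
  using assms by (simp_all add: mdistributions_def)

text \<open>The transformed test function in the compatibility condition of
  \<open>mdistributions\<close>; test functions carry the Jacobian because they transform like
  densities.\<close>

definition tpush :: "(real ^ 'd) set => (real ^ 'd => real ^ 'n) => (real ^ 'd) set => (real ^ 'd => real ^ 'n) =>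
    (real ^ 'd => complex) => real ^ 'd::finite => complex" where
  "tpush V1 \<pi>1 V2 \<pi>2 f x = (if x \<in> V1 \<and> \<pi>1 x \<in> \<pi>2 ` V2
    then f (transition V2 \<pi>2 \<pi>1 x) * complex_of_real (jac (transition V2 \<pi>2 \<pi>1) x) else 0)"

lemma mdistributions_compat:
  assumes "v \<in> mdistributions \<Gamma>" "param \<Gamma> V1 \<pi>1" "param \<Gamma> V2 \<pi>2" "f \<in> test_fun {y \<in> V2. \<pi>2 y \<in> \<pi>1 ` V1}"
  shows "v V2 \<pi>2 f = v V1 \<pi>1 (tpush V1 \<pi>1 V2 \<pi>2 f)"
  unfolding tpush_def[abs_def] jac_def
  using assms(1)[unfolded mdistributions_def mem_Collect_eq, THEN conjunct2, THEN conjunct2, rule_format, OF conjI[OF assms(2,3)] assms(4)] .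

text \<open>\<open>\<theta> j\<close> equals 1 wherever the j-th cut-off is nonzero in its chart.
  Multiplying by it does not change a local part, but gives the transported operators compactly
  supported coefficients of their own.\<close>

locale charts =
  fixes \<Gamma> :: "(real ^ 'n) set" and A :: "('n::finite, 'd::finite) local_data" and \<theta> :: "nat => real ^ 'd => complex"
  assumes \<Gamma>: "compact \<Gamma>" and A: "is_local_data \<Gamma> A"
    and \<theta>: "!!j. j \<in> {1..num A} ==> \<theta> j \<in> test_fun (dom A j)"
      "!!j y. j \<in> {1..num A} ==> y \<in> dom A j ==> cut A j (par A j y) ~= 0 ==> \<theta> j y = 1"
begin

abbreviation "J == {1..num A}"

lemma data:
  assumes "j \<in> J" shows "param \<Gamma> (dom A j) (par A j)" "smooth_on \<Gamma> (cut A j)"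
  using assms A unfolding is_local_data_def by blast+

lemma cut_sum: "z \<in> \<Gamma> ==> (\<Sum>j\<in>J. cut A j z) = 1"
  using A[unfolded is_local_data_def, THEN conjunct2, THEN conjunct2] by (rule bspec)

lemma cut_support:
  assumes "j \<in> J" obtains S where "compact S" "S \<subseteq> par A j ` dom A j" "!!z. z \<in> \<Gamma> ==> z \<notin> S ==> cut A j z = 0"
proof (rule that[of "closure {x \<in> \<Gamma>. cut A j x ~= 0}"])
  have "bounded {x \<in> \<Gamma>. cut A j x ~= 0}" by (rule bounded_subset[OF compact_imp_bounded[OF \<Gamma>]]) auto
  then show "compact (closure {x \<in> \<Gamma>. cut A j x ~= 0})" by simp
  show "closure {x \<in> \<Gamma>. cut A j x ~= 0} \<subseteq> par A j ` dom A j" using A assms unfolding is_local_data_def by blast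
  show "cut A j z = 0" if "z \<in> \<Gamma>" "z \<notin> closure {x \<in> \<Gamma>. cut A j x ~= 0}" for z
    using that closure_subset[of "{x \<in> \<Gamma>. cut A j x ~= 0}"] by blast
qed

definition "ct j y = (if y \<in> dom A j then cut A j (par A j y) else 0)"

lemma ct_test_fun: "j \<in> J ==> ct j \<in> test_fun (dom A j)"
  unfolding ct_def[abs_def] by (rule cut_support, assumption) (rule chart_test_fun[OF data])

abbreviation "lpart v j == local_part (dom A j) (par A j) (cut A j) v"

lemma lpart_eq: "lpart v j f = (if f \<in> schwartz then v (dom A j) (par A j) (%y. ct j y * f y) else 0)"
  by (auto simp: local_part_def ct_def intro!: arg_cong[of _ _ "v _ _"])

definition "tr V \<pi> j = transition V \<pi> (par A j)"
definition "ov V \<pi> j = {x \<in> dom A j. par A j x \<in> \<pi> ` V}"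
text \<open>The coefficient of the operator carrying functions from the j-th chart to the chart
  \<open>\<pi>\<close>; \<open>cf\<close> is the coefficient of its transpose, which acts on test
  functions.\<close>

definition "mc V \<pi> h j y = h y * lift (dom A j) (par A j) (\<theta> j) (\<pi> y)" for V :: "(real ^ 'd) set" and \<pi> :: "real ^ 'd => real ^ 'n"
definition "cf V \<pi> h j = adj (tr V \<pi> j) (ov V \<pi> j) (mc V \<pi> h j)"

lemma tr_diffeo:
  assumes "param \<Gamma> V \<pi>" "j \<in> J"
  shows "diffeo {y \<in> V. \<pi> y \<in> par A j ` dom A j} (transition (dom A j) (par A j) \<pi>) (ov V \<pi> j) (tr V \<pi> j)"
  unfolding ov_def tr_def by (rule transition_diffeo[OF assms(1) data(1)[OF assms(2)]])

lemma mc_test_fun: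
  assumes pm: "param \<Gamma> V \<pi>" and j: "j \<in> J" and h: "h \<in> test_fun V"
  shows "mc V \<pi> h j \<in> test_fun {y \<in> V. \<pi> y \<in> par A j ` dom A j}"
proof -
  obtain S where S: "compact S" "S \<subseteq> par A j ` dom A j" "!!z. z \<notin> S ==> lift (dom A j) (par A j) (\<theta> j) z = 0"
    by (rule lift_support[OF data(1)[OF j] \<theta>(1)[OF j]], rule that)
  show ?thesis unfolding mc_def[abs_def]
    by (rule chart_mult_test_fun_overlap[OF pm h lift_smooth[OF data(1)[OF j] \<theta>(1)[OF j]] S])
qed

lemma cf_test_fun:
  assumes "param \<Gamma> V \<pi>" "j \<in> J" "h \<in> test_fun V"
  shows "cf V \<pi> h j \<in> test_fun (ov V \<pi> j)"
  unfolding cf_def by (rule adj_test_fun[OF tr_diffeo mc_test_fun]) (use assms in auto)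

abbreviation "T V \<pi> h j == pull (cf V \<pi> h j) (tr V \<pi> j)"

lemma T_schwartz:
  assumes "param \<Gamma> V \<pi>" "j \<in> J" "h \<in> test_fun V" "f \<in> schwartz"
  shows "T V \<pi> h j f \<in> schwartz" "T V \<pi> h j f \<in> test_fun (dom A j)"
proof -
  note d = diffeo_sym[THEN iffD1, OF tr_diffeo[OF assms(1,2)]] and c = cf_test_fun[OF assms(1-3)]
  show "T V \<pi> h j f \<in> schwartz" by (rule pull_schwartz[OF d c assms(4)])
  show "T V \<pi> h j f \<in> test_fun (dom A j)"
    by (rule test_fun_mono[OF pull_test_fun[OF d c schwartz_Cinf[OF assms(4)]]]) (auto simp: ov_def)
qed

text \<open>A distribution is determined by its local parts, through a formula that does not involve it.\<close>

lemma glue: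
  assumes pm: "param \<Gamma> V \<pi>" and h: "h \<in> test_fun V" and v: "v \<in> mdistributions \<Gamma>" and f: "f \<in> schwartz"
  shows "v V \<pi> (%y. h y * f y) = (\<Sum>j\<in>J. lpart v j (T V \<pi> h j f))"
proof -
  have vd: "v V \<pi> \<in> distributions V" by (rule mdistributions_D(1)[OF v pm])
  have hf: "(%y. h y * f y) \<in> test_fun V"
    by (rule test_fun_mult[OF h param_D(1)[OF pm] Cinf_subset[OF schwartz_Cinf[OF f]]]) simp
  \<comment> \<open>Partition of unity: the j-th summand is supported in the overlap with the j-th
    chart, where the compatibility condition can be applied.\<close>
  let ?f = "%j y. h y * f y * cut A j (\<pi> y)"
  have tf: "?f j \<in> test_fun V" if "j \<in> J" for j
    by (rule chart_mult_test_fun[OF pm hf data(2)[OF that]])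
  have "(%y. h y * f y) = (%y. \<Sum>j\<in>J. ?f j y)"
  proof
    fix y
    show "h y * f y = (\<Sum>j\<in>J. ?f j y)"
    proof (cases "y \<in> V")
      case True
      then have "(\<Sum>j\<in>J. cut A j (\<pi> y)) = 1" by (intro cut_sum param_D(5)[OF pm])
      then show ?thesis by (simp add: sum_distrib_left[symmetric])
    next
      case False
      then show ?thesis using test_fun_support[OF h] by simp
    qed
  qed
  then have "v V \<pi> (%y. h y * f y) = (\<Sum>j\<in>J. v V \<pi> (?f j))" using distributions_sum[OF vd, of J ?f] tf by simp
  also have "... = (\<Sum>j\<in>J. lpart v j (T V \<pi> h j f))"
  proof (rule sum.cong[OF refl])
    fix j assume j: "j \<in> J"
    note pj = data(1)[OF j]
    obtain S where S: "compact S" "S \<subseteq> par A j ` dom A j" "!!z. z \<in> \<Gamma> ==> z \<notin> S ==> cut A j z = 0"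
      using cut_support[OF j] by blast
    have "?f j \<in> test_fun {y \<in> V. \<pi> y \<in> par A j ` dom A j}"
      by (rule chart_mult_test_fun_overlap[OF pm hf data(2)[OF j] S])
    then have "v V \<pi> (?f j) = v (dom A j) (par A j) (tpush (dom A j) (par A j) V \<pi> (?f j))"
      by (rule mdistributions_compat[OF v pj pm])
    also have "tpush (dom A j) (par A j) V \<pi> (?f j) = (%x. ct j x * T V \<pi> h j f x)"
    proof
      fix x
      show "tpush (dom A j) (par A j) V \<pi> (?f j) x = ct j x * T V \<pi> h j f x"
      proof (cases "x \<in> dom A j \<and> par A j x \<in> \<pi> ` V")
        case True
        then have p: "\<pi> (transition V \<pi> (par A j) x) = par A j x" using transition_param by blast
        \<comment> \<open>The operator contains the additional factor \<open>\<theta> j\<close>; it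
          is 1 unless the cut-off vanishes, in which case both sides are 0.\<close>
        show ?thesis using True \<theta>(2)[OF j, of x]
          by (cases "cut A j (par A j x) = 0")
             (simp_all add: p tpush_def ct_def pull_def cf_def adj_def ov_def mc_def tr_def lift_param[OF pj] mult_ac)
      qed (auto simp: tpush_def pull_def cf_def adj_def ov_def)
    qed
    finally show "v V \<pi> (?f j) = lpart v j (T V \<pi> h j f)"
      using T_schwartz[OF pm j h f] by (simp add: lpart_eq)
  qed
  finally show ?thesis .
qed

end

lemma charts_exist:
  fixes \<Gamma> :: "(real ^ 'n::finite) set" and A :: "('n, 'd::finite) local_data"
  assumes \<Gamma>: "compact \<Gamma>" and A: "is_local_data \<Gamma> A" and b: "is_cutoff (b :: real ^ 'd => complex)"
  shows "\<exists>\<theta>. charts \<Gamma> A \<theta>"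
proof -
  have "\<forall>j\<in>{1..num A}. \<exists>\<theta>. \<theta> \<in> test_fun (dom A j) \<and> (\<forall>y\<in>dom A j. cut A j (par A j y) ~= 0 --> \<theta> y = 1)"
  proof
    fix j assume j: "j \<in> {1..num A}"
    let ?S = "closure {x \<in> \<Gamma>. cut A j x ~= 0}"
    have pm: "param \<Gamma> (dom A j) (par A j)" and S2: "?S \<subseteq> par A j ` dom A j" using A j unfolding is_local_data_def by blast+
    have "bounded {x \<in> \<Gamma>. cut A j x ~= 0}" by (rule bounded_subset[OF compact_imp_bounded[OF \<Gamma>]]) auto
    then have S1: "compact ?S" by simp
    note K = param_compact_preimage[OF pm S1 S2]
    obtain \<theta> where th: "\<theta> \<in> test_fun (dom A j)" "!!x. x \<in> inv_into (dom A j) (par A j) ` ?S ==> \<theta> x = 1"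
      by (rule smooth_bump[OF b K(1) param_D(1)[OF pm] K(2)], rule that)
    have "\<theta> y = 1" if y: "y \<in> dom A j" "cut A j (par A j y) ~= 0" for y
    proof (rule th(2))
      have "par A j y \<in> ?S" by (rule subsetD[OF closure_subset]) (use y param_D(5)[OF pm] in simp)
      then show "y \<in> inv_into (dom A j) (par A j) ` ?S" by (rule image_eqI[rotated]) (simp only: param_D(6)[OF pm y(1)])
    qed
    with th(1) show "\<exists>\<theta>. \<theta> \<in> test_fun (dom A j) \<and> (\<forall>y\<in>dom A j. cut A j (par A j y) ~= 0 --> \<theta> y = 1)"
      by (intro exI[of _ \<theta>] conjI ballI impI)
  qed
  from bchoice[OF this] obtain \<theta> where "\<forall>j\<in>{1..num A}. \<theta> j \<in> test_fun (dom A j) \<and> (\<forall>y\<in>dom A j. cut A j (par A j y) ~= 0 --> \<theta> j y = 1)" ..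
  then have "charts \<Gamma> A \<theta>" by (intro charts.intro \<Gamma> A) simp_all
  then show ?thesis by (intro exI[of _ \<theta>])
qed

section \<open>The spaces \<open>B\<^sub>p\<close> on \<open>\<Gamma>\<close>\<close>

text \<open>On functions supported in a fixed compact set the unweighted seminorms of the definition
  are equivalent to Schwartz seminorms, so continuity can be expressed by \<open>sb\<close> and
  combined with continuous operators.\<close>

lemma distributions_iff:
  fixes V :: "'a::euclidean_space set"
  shows "u \<in> distributions V \<longleftrightarrow> linear_functional_on (test_fun V) u \<and>
    (\<forall>K. compact K \<and> K \<subseteq> V --> (\<exists>\<Phi>. sb \<Phi> \<and> (\<forall>f\<in>test_fun K. norm (u f) <= \<Phi> f))) \<and> (\<forall>f. f \<notin> test_fun V --> u f = 0)"
proof -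
  have "(\<exists>C N. \<forall>f\<in>test_fun K. norm (u f) <= C * (\<Sum>vs\<in>basis_lists N. SUP x. norm (iter_deriv vs f x))) \<longleftrightarrow>
      (\<exists>\<Phi>. sb \<Phi> \<and> (\<forall>f\<in>test_fun K. norm (u f) <= \<Phi> f))" (is "?l \<longleftrightarrow> ?r") if K: "compact K" for K
  proof
    assume ?l
    then obtain C N where C: "!!f. f \<in> test_fun K ==> norm (u f) <= C * (\<Sum>vs\<in>basis_lists N. SUP x. norm (iter_deriv vs f x))" by blast
    have "norm (u f) <= \<bar>C\<bar> * schwartz_norm N f" if f: "f \<in> test_fun K" for f
    proof -
      have fS: "f \<in> schwartz" by (rule test_fun_schwartz[OF f])
      have bd: "bdd_above (range (%x. jb x ^ M * norm (iter_deriv vs f x)))" if "vs \<in> basis_lists N" for vs M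
        using fS that by (simp add: schwartz_def basis_lists_def)
      have le: "(SUP x. norm (iter_deriv vs f x)) <= (SUP x. jb x ^ N * norm (iter_deriv vs f x))" if vs: "vs \<in> basis_lists N" for vs
      proof (rule cSUP_mono)
        fix x :: 'a
        have "1 * norm (iter_deriv vs f x) <= jb x ^ N * norm (iter_deriv vs f x)"
          by (intro mult_right_mono one_le_power) auto
        then show "\<exists>m\<in>UNIV. norm (iter_deriv vs f x) <= jb m ^ N * norm (iter_deriv vs f m)" by auto
      qed (use bd[OF vs] in auto)
      have ge: "0 <= (SUP x. norm (iter_deriv vs f x))" if vs: "vs \<in> basis_lists N" for vs
        using bd[OF vs, of 0] by (intro cSUP_upper2[of _ _ 0]) auto
      have "norm (u f) <= C * (\<Sum>vs\<in>basis_lists N. SUP x. norm (iter_deriv vs f x))" by (rule C[OF f])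
      also have "... <= \<bar>C\<bar> * (\<Sum>vs\<in>basis_lists N. SUP x. norm (iter_deriv vs f x))"
        using ge by (intro mult_right_mono sum_nonneg) auto
      also have "... <= \<bar>C\<bar> * schwartz_norm N f"
        unfolding schwartz_norm_def using le by (intro mult_left_mono sum_mono) auto
      finally show ?thesis .
    qed
    then show ?r by (intro exI[of _ "%f. \<bar>C\<bar> * schwartz_norm N f"] conjI sb_cmult sb_norm ballI) auto
  next
    assume ?r
    then obtain \<Phi> C0 M where \<Phi>: "!!f. f \<in> test_fun K ==> norm (u f) <= \<Phi> f"
      and C0: "C0 >= 0" "!!f. f \<in> schwartz ==> \<Phi> f <= C0 * schwartz_norm M f" unfolding sb_def by blast
    obtain C where C: "!!f. f \<in> test_fun K ==> schwartz_norm M f <= C * (\<Sum>vs\<in>basis_lists M. SUP x. norm (iter_deriv vs f x))"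
      by (rule schwartz_norm_test_fun[OF K, of M], rule that)
    have "norm (u f) <= (C0 * C) * (\<Sum>vs\<in>basis_lists M. SUP x. norm (iter_deriv vs f x))" if f: "f \<in> test_fun K" for f
      using \<Phi>[OF f] C0(2)[OF test_fun_schwartz[OF f]] mult_left_mono[OF C[OF f] C0(1)] by (simp add: mult.assoc)
    then show ?l by blast
  qed
  then show ?thesis unfolding distributions_def by auto
qed

lemma distributions_sb:
  assumes "u \<in> distributions V" "compact K" "K \<subseteq> V"
  shows "\<exists>\<Phi>. sb \<Phi> \<and> (\<forall>f\<in>test_fun K. norm (u f) <= \<Phi> f)"
  using assms(1)[unfolded distributions_iff] assms(2,3) by simp

lemma module_mscale: "module (mscale :: complex => ('n::finite, 'd::finite) mdistr => ('n, 'd) mdistr)"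
  by unfold_locales (auto simp: mscale_def fun_eq_iff algebra_simps)

lemma mdistributionsI:
  assumes "!!V \<pi>. param \<Gamma> V \<pi> ==> linear_functional_on (test_fun V) (v V \<pi>)"
    and "!!V \<pi> K. param \<Gamma> V \<pi> ==> compact K ==> K \<subseteq> V ==> \<exists>\<Phi>. sb \<Phi> \<and> (\<forall>f\<in>test_fun K. norm (v V \<pi> f) <= \<Phi> f)"
    and "!!V \<pi> f. param \<Gamma> V \<pi> ==> f \<notin> test_fun V ==> v V \<pi> f = 0"
    and "!!V \<pi>. \<not> param \<Gamma> V \<pi> ==> v V \<pi> = (%_. 0)"
    and "!!V1 \<pi>1 V2 \<pi>2 f. param \<Gamma> V1 \<pi>1 ==> param \<Gamma> V2 \<pi>2 ==> f \<in> test_fun {y \<in> V2. \<pi>2 y \<in> \<pi>1 ` V1} ==>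
      v V2 \<pi>2 f = v V1 \<pi>1 (tpush V1 \<pi>1 V2 \<pi>2 f)"
  shows "v \<in> mdistributions \<Gamma>"
  using assms(5) unfolding tpush_def[abs_def] jac_def mdistributions_def distributions_iff mem_Collect_eq
  by (intro conjI allI impI ballI; (elim conjE)?) (rule assms(1-4); assumption | assumption | blast)+

lemma mdistributions_lincomb:
  fixes u v :: "('n::finite, 'd::finite) mdistr"
  assumes u: "u \<in> mdistributions \<Gamma>" and v: "v \<in> mdistributions \<Gamma>"
  shows "mscale c u + v \<in> mdistributions \<Gamma>"
proof (rule mdistributionsI)
  fix V :: "(real ^ 'd) set" and \<pi> assume pm: "param \<Gamma> V \<pi>"
  note D = mdistributions_D(1)[OF u pm] mdistributions_D(1)[OF v pm]
  show "linear_functional_on (test_fun V) ((mscale c u + v) V \<pi>)"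
    using D by (simp add: distributions_def linear_functional_on_def mscale_def algebra_simps)
  show "\<exists>\<Phi>. sb \<Phi> \<and> (\<forall>f\<in>test_fun K. norm ((mscale c u + v) V \<pi> f) <= \<Phi> f)" if K: "compact K" "K \<subseteq> V" for K
  proof -
    obtain \<Phi> where \<Phi>: "sb \<Phi>" "\<forall>f\<in>test_fun K. norm (u V \<pi> f) <= \<Phi> f" using distributions_sb[OF D(1) K] by blast
    obtain \<Psi> where \<Psi>: "sb \<Psi>" "\<forall>f\<in>test_fun K. norm (v V \<pi> f) <= \<Psi> f" using distributions_sb[OF D(2) K] by blast
    have "norm ((mscale c u + v) V \<pi> f) <= norm c * \<Phi> f + \<Psi> f" if "f \<in> test_fun K" for f
      using \<Phi>(2) \<Psi>(2) that by (auto simp: mscale_def norm_mult intro!: norm_triangle_mono mult_left_mono)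
    then show ?thesis by (intro exI[of _ "%f. norm c * \<Phi> f + \<Psi> f"] conjI sb_add sb_cmult \<Phi>(1) \<Psi>(1)) auto
  qed
  show "(mscale c u + v) V \<pi> f = 0" if "f \<notin> test_fun V" for f
    using distributions_D(3)[OF D(1) that] distributions_D(3)[OF D(2) that] by (simp add: mscale_def)
next
  fix V :: "(real ^ 'd) set" and \<pi> assume "\<not> param \<Gamma> V \<pi>"
  then show "(mscale c u + v) V \<pi> = (%_. 0)"
    using mdistributions_D(2)[OF u] mdistributions_D(2)[OF v] by (simp add: fun_eq_iff mscale_def)
next
  fix V1 V2 :: "(real ^ 'd) set" and \<pi>1 \<pi>2 f assume a: "param \<Gamma> V1 \<pi>1" "param \<Gamma> V2 \<pi>2" "f \<in> test_fun {y \<in> V2. \<pi>2 y \<in> \<pi>1 ` V1}"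
  show "(mscale c u + v) V2 \<pi>2 f = (mscale c u + v) V1 \<pi>1 (tpush V1 \<pi>1 V2 \<pi>2 f)"
    by (simp only: plus_fun_apply mscale_def mdistributions_compat[OF u a] mdistributions_compat[OF v a])
qed

lemma mdistributions_zero: "0 \<in> mdistributions \<Gamma>"
  by (rule mdistributionsI) (auto simp: linear_functional_on_def fun_eq_iff intro!: exI[of _ "%f. 0"])

lemma Lp_norm_uminus: "Lp_norm p (%f. - w f) = Lp_norm p w"
proof -
  have *: "(\<exists>g\<in>Lp_fun p. represents g (%f. - w f) \<and> r = (LBINT x. norm (g x) powr p) powr (1 / p)) ==>
     (\<exists>g\<in>Lp_fun p. represents g w \<and> r = (LBINT x. norm (g x) powr p) powr (1 / p))" for w and r
  proof (elim bexE conjE)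
    fix g assume "g \<in> Lp_fun p" "represents g (%f. - w f)" "r = (LBINT x. norm (g x) powr p) powr (1 / p)"
    then show "\<exists>g\<in>Lp_fun p. represents g w \<and> r = (LBINT x. norm (g x) powr p) powr (1 / p)"
      by (intro bexI[of _ "%x. - g x"]) (auto simp: Lp_fun_def represents_def minus_equation_iff[of "w _"])
  qed
  show ?thesis unfolding Lp_norm_def
    by (intro arg_cong[of _ _ The] ext iffI) (rule *[of w], assumption, rule *[of "%f. - w f"], simp)
qed

lemma besov_Rd_norm_uminus: "besov_Rd_norm b s \<phi> p (%f. - w f) = besov_Rd_norm b s \<phi> p w"
proof -
  have "piece b k (%f. - w f) = (%f. - piece b k w f)" for k
    by (auto simp: fun_eq_iff piece_def inv_fourier_def mult_tempered_def fourier_def)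
  then show ?thesis by (simp add: besov_Rd_norm_def besov_term_def Lp_norm_uminus)
qed

locale besov_charts = lp_setting b s p q \<phi> L + charts \<Gamma> A \<theta>
  for b :: "real ^ 'd::finite => complex" and s p q \<phi> L and \<Gamma> :: "(real ^ 'n::finite) set"
    and A :: "('n, 'd) local_data" and \<theta>
begin

abbreviation "B == besov b \<Gamma> A s \<phi> p"
abbreviation "N == besov_norm b A s \<phi> p"

lemma B_D: 
  assumes "v \<in> B"
  shows "v \<in> mdistributions \<Gamma>" "!!j. j \<in> J ==> lpart v j \<in> BR" "!!j. j \<in> J ==> bnorm (lpart v j) <= N v"
proof -
  show "v \<in> mdistributions \<Gamma>" "!!j. j \<in> J ==> lpart v j \<in> BR" using assms by (simp_all add: besov_def)
  show "bnorm (lpart v j) <= N v" if "j \<in> J" for j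
    unfolding besov_norm_def by (rule member_le_sum) (use that in auto)
qed

lemma B_I: "v \<in> mdistributions \<Gamma> ==> (!!j. j \<in> J ==> lpart v j \<in> BR) ==> v \<in> B"
  by (simp add: besov_def)

lemma N_nonneg: "N v >= 0" unfolding besov_norm_def by (intro sum_nonneg bnorm_nonneg)

lemma lpart_add: "lpart (u + v) j = (%f. lpart u j f + lpart v j f)"
  and lpart_scale: "lpart (mscale c v) j = (%f. c * lpart v j f)"
  and lpart_diff: "lpart (u - v) j = (%f. lpart u j f - lpart v j f)"
  and lpart_zero: "lpart 0 j = (%f. 0)"
  by (auto simp: local_part_def mscale_def)

text \<open>With \<open>h\<close> equal to 1 on \<open>K\<close> the product \<open>h f\<close> is
  \<open>f\<close>. One \<open>h\<close> works for all distributions and all \<open>f\<close>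
  supported in \<open>K\<close>, which makes limits and bounds uniform.\<close>

lemma glue_on_compact:
  assumes pm: "param \<Gamma> V \<pi>" and K: "compact K" "K \<subseteq> V"
  obtains h where "h \<in> test_fun V" "!!v f. v \<in> mdistributions \<Gamma> ==> f \<in> test_fun K ==> v V \<pi> f = (\<Sum>j\<in>J. lpart v j (T V \<pi> h j f))"
proof -
  obtain h where h: "h \<in> test_fun V" "!!x. x \<in> K ==> h x = 1" by (rule smooth_bump[OF b K(1) param_D(1)[OF pm] K(2)], rule that)
  have "v V \<pi> f = (\<Sum>j\<in>J. lpart v j (T V \<pi> h j f))" if v: "v \<in> mdistributions \<Gamma>" and f: "f \<in> test_fun K" for v f
  proof -
    have "(%y. h y * f y) = f"
    proof
      show "h y * f y = f y" for y using h(2)[of y] test_fun_support[OF f, of y] by (cases "y \<in> K") auto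
    qed
    then show ?thesis using glue[OF pm h(1) v test_fun_schwartz[OF f]] by simp
  qed
  with h(1) show ?thesis by (rule that)
qed

lemma test_fun_compact_support:
  assumes "f \<in> test_fun V" obtains K where "compact K" "K \<subseteq> V" "f \<in> test_fun K"
proof -
  from assms obtain K where "compact K" "K \<subseteq> V" "!!x. x \<notin> K ==> f x = 0" "Cinf UNIV f" by (rule test_funE) blast
  then show ?thesis by (intro that[of K] test_funI[of f K K]) auto
qed

lemma B_zero: "0 \<in> B"
  by (rule B_I[OF mdistributions_zero]) (simp only: lpart_zero besov_Rd_zero)

lemma mdistributions_add: "u \<in> mdistributions \<Gamma> ==> v \<in> mdistributions \<Gamma> ==> u + v \<in> mdistributions \<Gamma>"
  using mdistributions_lincomb[of u \<Gamma> v 1] by (simp add: mscale_def)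

lemma mdistributions_scale: "v \<in> mdistributions \<Gamma> ==> mscale c v \<in> mdistributions \<Gamma>"
  using mdistributions_lincomb[OF _ mdistributions_zero, of v \<Gamma> c] by simp

lemma B_add: "u \<in> B ==> v \<in> B ==> u + v \<in> B"
  by (rule B_I[OF mdistributions_add[OF B_D(1) B_D(1)]]; (simp only: lpart_add)?) (rule besov_Rd_add(1)[OF B_D(2) B_D(2)])

lemma B_scale: "v \<in> B ==> mscale c v \<in> B"
  by (rule B_I[OF mdistributions_scale[OF B_D(1)]]; (simp only: lpart_scale)?) (rule besov_Rd_scale(1)[OF B_D(2)])

lemma B_diff: "u \<in> B ==> v \<in> B ==> u - v \<in> B"
proof -
  have "u - v = u + mscale (-1) v" by (simp add: fun_eq_iff mscale_def)
  then show "u \<in> B ==> v \<in> B ==> u - v \<in> B" by (simp only: B_add B_scale)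
qed

lemma N_zero_imp:
  assumes v: "v \<in> B" and N: "N v = 0" shows "v = 0"
proof -
  note vm = B_D(1)[OF v]
  have l0: "lpart v j = (%f. 0)" if "j \<in> J" for j
    using B_D(3)[OF v that] N bnorm_nonneg[of "lpart v j"] by (intro bnorm_eq_0 B_D[OF v] that) simp
  have "v V \<pi> f = 0" for V \<pi> f
  proof (cases "param \<Gamma> V \<pi>")
    case pm: True
    show ?thesis
    proof (cases "f \<in> test_fun V")
      case True
      then obtain K where K: "compact K" "K \<subseteq> V" "f \<in> test_fun K" by (rule test_fun_compact_support)
      from K(1,2) obtain h where "v V \<pi> f = (\<Sum>j\<in>J. lpart v j (T V \<pi> h j f))"
        by (rule glue_on_compact[OF pm]) (rule that, use vm K(3) in blast)
      then show ?thesis using l0 by simp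
    qed (use distributions_D(3)[OF mdistributions_D(1)[OF vm pm]] in blast)
  qed (simp add: mdistributions_D(2)[OF vm])
  then show ?thesis by (simp add: fun_eq_iff)
qed

lemma N_triangle: "u \<in> B ==> v \<in> B ==> N (u + v) <= N u + N v"
  unfolding besov_norm_def lpart_add sum.distrib[symmetric] by (intro sum_mono besov_Rd_add B_D)

lemma N_scale: "v \<in> B ==> N (mscale c v) = norm c * N v"
  unfolding besov_norm_def lpart_scale sum_distrib_left by (intro sum.cong refl besov_Rd_scale B_D)

lemma N_0: "N 0 = 0"
  by (simp add: besov_norm_def lpart_zero besov_Rd_zero)

lemma normed_space: "is_normed_space B N"
  unfolding is_normed_space_def module.subspace_def[OF module_mscale]
  using B_zero B_add B_scale N_nonneg N_zero_imp N_0 N_scale N_triangle by auto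

lemma N_commute: "N (u - v) = N (v - u)"
proof -
  have "lpart (u - v) j = (%f. - lpart (v - u) j f)" for j by (simp add: lpart_diff)
  then show ?thesis by (simp add: besov_norm_def besov_Rd_norm_uminus)
qed

lemma metric_space: "Metric_space B (norm_dist N)"
proof
  show "norm_dist N x y = norm_dist N y x" for x y by (simp add: norm_dist_def N_commute)
  show "0 <= norm_dist N x y" for x y by (simp add: norm_dist_def N_nonneg)
  show "norm_dist N x y = 0 \<longleftrightarrow> x = y" if "x \<in> B" "y \<in> B" for x y
    using N_zero_imp[OF B_diff[OF that]] N_0 by (auto simp: norm_dist_def)
  show "norm_dist N x z <= norm_dist N x y + norm_dist N y z" if "x \<in> B" "y \<in> B" "z \<in> B" for x y z
    using N_triangle[OF B_diff[OF that(1,2)] B_diff[OF that(2,3)]] by (simp add: norm_dist_def)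
qed

definition "Tsum V \<pi> h w f = (if f \<in> schwartz then \<Sum>j\<in>J. w j (T V \<pi> h j f) else 0)"

lemma T_bound:
  assumes pm: "param \<Gamma> V \<pi>" and h: "h \<in> test_fun V"
  shows "\<exists>C\<ge>0. \<forall>w. (\<forall>j\<in>J. w j \<in> BR) --> Tsum V \<pi> h w \<in> BR \<and> bnorm (Tsum V \<pi> h w) <= C * (\<Sum>j\<in>J. bnorm (w j))"
proof -
  have "\<forall>j\<in>J. \<exists>C\<ge>0. \<forall>w\<in>BR. (%f. if f \<in> schwartz then w (T V \<pi> h j f) else 0) \<in> BR \<and>
      bnorm (%f. if f \<in> schwartz then w (T V \<pi> h j f) else 0) <= C * bnorm w"
    by (intro ballI besov_pull[OF diffeo_sym[THEN iffD1, OF tr_diffeo] cf_test_fun] pm h)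
  from bchoice[OF this] obtain C where C: "\<forall>j\<in>J. C j >= 0 \<and> (\<forall>w\<in>BR. (%f. if f \<in> schwartz then w (T V \<pi> h j f) else 0) \<in> BR \<and>
      bnorm (%f. if f \<in> schwartz then w (T V \<pi> h j f) else 0) <= C j * bnorm w)" ..
  show ?thesis
  proof (intro exI[of _ "sum C J"] conjI allI impI)
    show "0 <= sum C J" using C by (intro sum_nonneg) auto
    fix w assume w: "\<forall>j\<in>J. w j \<in> BR"
    let ?t = "%j f. if f \<in> schwartz then w j (T V \<pi> h j f) else 0"
    have e: "Tsum V \<pi> h w = (%f. \<Sum>j\<in>J. ?t j f)" by (auto simp: Tsum_def)
    have S: "(%f. \<Sum>j\<in>J. ?t j f) \<in> BR \<and>
      bnorm (%f. \<Sum>j\<in>J. ?t j f) <= (\<Sum>j\<in>J. bnorm (?t j))"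
      using C w by (intro besov_Rd_sum) auto
    then show "(Tsum V \<pi> h w) \<in> BR" unfolding e by blast
    have "(\<Sum>j\<in>J. bnorm (?t j)) <= (\<Sum>j\<in>J. sum C J * bnorm (w j))"
    proof (rule sum_mono)
      fix j assume j: "j \<in> J"
      have "C j <= sum C J" using C j by (intro member_le_sum) auto
      then have "C j * bnorm (w j) <= sum C J * bnorm (w j)" by (rule mult_right_mono) simp
      moreover have "bnorm (?t j) <= C j * bnorm (w j)" using C w j by blast
      ultimately show "bnorm (?t j) <= sum C J * bnorm (w j)" by linarith
    qed
    then show "bnorm (Tsum V \<pi> h w) <= sum C J * (\<Sum>j\<in>J. bnorm (w j))"
      unfolding e using S by (simp only: sum_distrib_left) linarith
  qed
qed

text \<open>A local part for the other data evaluates the distribution at the cut-off of that data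
  times \<open>f\<close>; this is the left-hand side of \<open>glue\<close> with that cut-off in the
  role of \<open>h\<close>.\<close>

lemma other_chart:
  assumes A': "charts \<Gamma> A' \<theta>'" and i: "i \<in> {1..num A'}"
  shows "\<exists>C\<ge>0. \<forall>v\<in>B. local_part (dom A' i) (par A' i) (cut A' i) v \<in> BR \<and>
    bnorm (local_part (dom A' i) (par A' i) (cut A' i) v) <= C * N v"
proof -
  note pm = charts.data(1)[OF A' i] and h = charts.ct_test_fun[OF A' i]
  let ?T = "Tsum (dom A' i) (par A' i) (charts.ct A' i)"
  obtain C where C: "C >= 0" "!!w. (\<forall>j\<in>J. w j \<in> BR) ==>
    ?T w \<in> BR \<and> bnorm (?T w) <= C * (\<Sum>j\<in>J. bnorm (w j))"
    using T_bound[OF pm h] by blast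
  show ?thesis
  proof (intro exI[of _ C] conjI ballI)
    fix v assume v: "v \<in> B"
    have e: "local_part (dom A' i) (par A' i) (cut A' i) v = ?T (lpart v)"
      using charts.lpart_eq[OF A', of i v] glue[OF pm h B_D(1)[OF v]] by (simp add: fun_eq_iff Tsum_def)
    show "local_part (dom A' i) (par A' i) (cut A' i) v \<in> BR"
      "bnorm (local_part (dom A' i) (par A' i) (cut A' i) v) <= C * N v"
      unfolding e besov_norm_def using C(2)[of "lpart v"] B_D(2)[OF v] by blast+
  qed (rule C)
qed

lemma other_data:
  assumes A': "charts \<Gamma> A' \<theta>'"
  shows "B \<subseteq> besov b \<Gamma> A' s \<phi> p" "\<exists>C\<ge>0. \<forall>v\<in>B. besov_norm b A' s \<phi> p v <= C * N v"
proof -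
  show "B \<subseteq> besov b \<Gamma> A' s \<phi> p" using other_chart[OF A'] B_D(1) unfolding besov_def[of b \<Gamma> A'] by blast
  from other_chart[OF A'] have "\<forall>i\<in>{1..num A'}. \<exists>C\<ge>0. \<forall>v\<in>B. bnorm (local_part (dom A' i) (par A' i) (cut A' i) v) <= C * N v" by blast
  from bchoice[OF this] obtain C where C: "\<forall>i\<in>{1..num A'}. C i >= 0 \<and> (\<forall>v\<in>B. bnorm (local_part (dom A' i) (par A' i) (cut A' i) v) <= C i * N v)" ..
  have "besov_norm b A' s \<phi> p v <= sum C {1..num A'} * N v" if "v \<in> B" for v
    unfolding besov_norm_def[of b A'] sum_distrib_right using C that by (intro sum_mono) auto
  moreover have "sum C {1..num A'} >= 0" using C by (intro sum_nonneg) auto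
  ultimately show "\<exists>C\<ge>0. \<forall>v\<in>B. besov_norm b A' s \<phi> p v <= C * N v" by blast
qed

text \<open>Only the local parts in the fixed charts are assumed to converge. By \<open>glue\<close>
  convergence holds in every parametrization, and on each compact set the limit is bounded by the
  seminorm formed from the \<open>w j\<close>; linearity and compatibility pass to the
  limit.\<close>

lemma mdistributions_limit:
  assumes v: "!!n::nat. v n \<in> mdistributions \<Gamma>" and w: "!!j. j \<in> J ==> w j \<in> tempered"
    and lim: "!!j f. j \<in> J ==> f \<in> schwartz ==> (%n. lpart (v n) j f) \<longlonglongrightarrow> w j f"
  shows "\<exists>u\<in>mdistributions \<Gamma>. \<forall>j\<in>J. lpart u j = w j"
proof -
  have rep: "\<exists>\<Phi>. sb \<Phi> \<and> (\<forall>f\<in>test_fun K. norm (z f) <= \<Phi> f \<and> (%n. v n V \<pi> f) \<longlonglongrightarrow> z f)"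
    if pm: "param \<Gamma> V \<pi>" and K: "compact K" "K \<subseteq> V" and z: "!!f. z f = lim (%n. v n V \<pi> f)" for V \<pi> K z
  proof -
    obtain h where h: "h \<in> test_fun V" "!!v f. v \<in> mdistributions \<Gamma> ==> f \<in> test_fun K ==> v V \<pi> f = (\<Sum>j\<in>J. lpart v j (T V \<pi> h j f))"
      by (rule glue_on_compact[OF pm K], rule that)
    have L: "(%n. v n V \<pi> f) \<longlonglongrightarrow> (\<Sum>j\<in>J. w j (T V \<pi> h j f))" if f: "f \<in> test_fun K" for f
      unfolding h(2)[OF v f] by (intro tendsto_sum lim T_schwartz pm h test_fun_schwartz[OF f])
    have zf: "z f = (\<Sum>j\<in>J. w j (T V \<pi> h j f))" if f: "f \<in> test_fun K" for f
      unfolding z by (rule limI[OF L[OF f]])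
    show ?thesis
    proof (intro exI conjI ballI)
      show "sb (%f. \<Sum>j\<in>J. norm (w j (T V \<pi> h j f)))"
        by (intro sb_sum sb_compose[OF tempered_sb[OF w] scont_pull[OF diffeo_sym[THEN iffD1, OF tr_diffeo] cf_test_fun]] pm h)
      fix f assume f: "f \<in> test_fun K"
      show "norm (z f) <= (\<Sum>j\<in>J. norm (w j (T V \<pi> h j f)))" unfolding zf[OF f] by (rule norm_sum)
      show "(%n. v n V \<pi> f) \<longlonglongrightarrow> z f" using L[OF f] zf[OF f] by simp
    qed
  qed
  define u where "u V \<pi> f = lim (%n. v n V \<pi> f)" for V \<pi> f
  have conv: "(%n. v n V \<pi> f) \<longlonglongrightarrow> u V \<pi> f" if pm: "param \<Gamma> V \<pi>" and f: "f \<in> test_fun V" for V \<pi> f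
  proof -
    from f obtain K where "compact K" "K \<subseteq> V" "f \<in> test_fun K" by (rule test_fun_compact_support)
    then show ?thesis using rep[OF pm, of K "u V \<pi>"] by (auto simp: u_def)
  qed
  have um: "u \<in> mdistributions \<Gamma>"
  proof (rule mdistributionsI)
    fix V :: "(real ^ 'd) set" and \<pi> assume pm: "param \<Gamma> V \<pi>"
    note D = mdistributions_D(1)[OF v pm]
    show "linear_functional_on (test_fun V) (u V \<pi>)"
      unfolding linear_functional_on_def
    proof (intro conjI ballI allI)
      show "u V \<pi> (%x. f x + g x) = u V \<pi> f + u V \<pi> g" if f: "f \<in> test_fun V" "g \<in> test_fun V" for f g
        using conv[OF pm test_fun_add[OF f]] tendsto_add[OF conv[OF pm f(1)] conv[OF pm f(2)]]
        unfolding distributions_D(1)[OF D f] by (rule LIMSEQ_unique)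
      show "u V \<pi> (%x. c * f x) = c * u V \<pi> f" if f: "f \<in> test_fun V" for c f
        using conv[OF pm test_fun_cmult[OF f]] tendsto_mult_left[OF conv[OF pm f]]
        unfolding distributions_D(2)[OF D f] by (rule LIMSEQ_unique)
    qed
    show "\<exists>\<Phi>. sb \<Phi> \<and> (\<forall>f\<in>test_fun K. norm (u V \<pi> f) <= \<Phi> f)" if K: "compact K" "K \<subseteq> V" for K
      using rep[OF pm K, of "u V \<pi>"] by (auto simp: u_def)
    show "u V \<pi> f = 0" if "f \<notin> test_fun V" for f
      unfolding u_def using distributions_D(3)[OF D that] by simp
  next
    fix V :: "(real ^ 'd) set" and \<pi> assume "\<not> param \<Gamma> V \<pi>"
    then show "u V \<pi> = (%_. 0)" unfolding u_def using mdistributions_D(2)[OF v] by simp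
  next
    fix V1 V2 :: "(real ^ 'd) set" and \<pi>1 \<pi>2 f assume a: "param \<Gamma> V1 \<pi>1" "param \<Gamma> V2 \<pi>2" "f \<in> test_fun {y \<in> V2. \<pi>2 y \<in> \<pi>1 ` V1}"
    show "u V2 \<pi>2 f = u V1 \<pi>1 (tpush V1 \<pi>1 V2 \<pi>2 f)"
      by (simp only: u_def mdistributions_compat[OF v a])
  qed
  have "lpart u j f = w j f" if j: "j \<in> J" for j f
  proof (cases "f \<in> schwartz")
    case True
    then have "lpart u j f = lim (%n. lpart (v n) j f)" by (simp add: lpart_eq u_def)
    then show ?thesis using limI[OF lim[OF j True]] by simp
  qed (use tempered_off[OF w[OF j]] in \<open>simp add: lpart_eq\<close>)
  then show ?thesis using um by (intro bexI[of _ u]) auto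
qed

lemma complete: "Metric_space.mcomplete B (norm_dist N)"
  unfolding Metric_space.mcomplete_def[OF metric_space]
proof (intro allI impI)
  fix v assume "Metric_space.MCauchy B (norm_dist N) v"
  then have v: "!!n. v n \<in> B" and Cau: "!!e. e > 0 ==> \<exists>M. \<forall>n m. M <= n --> M <= m --> N (v n - v m) < e"
    unfolding Metric_space.MCauchy_def[OF metric_space] norm_dist_def by blast+
  obtain \<Phi> where \<Phi>: "!!w f. w \<in> BR ==> f \<in> schwartz ==> norm (w f) <= bnorm w * \<Phi> f" "!!f. f \<in> schwartz ==> 0 <= \<Phi> f"
    using besov_le_seminorm by blast
  define w where "w j f = lim (%n. lpart (v n) j f)" for j f
  have lim: "(%n. lpart (v n) j f) \<longlonglongrightarrow> w j f" if j: "j \<in> J" and f: "f \<in> schwartz" for j f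
  proof -
    have "Cauchy (%n. lpart (v n) j f)"
    proof (rule CauchyI)
      fix e :: real assume e: "e > 0"
      have p: "\<Phi> f + 1 > 0" using \<Phi>(2)[OF f] by simp
      then have "e / (\<Phi> f + 1) > 0" using e by simp
      from Cau[OF this] obtain M where M: "\<forall>n m. M <= n --> M <= m --> N (v n - v m) < e / (\<Phi> f + 1)" ..
      have "norm (lpart (v m) j f - lpart (v n) j f) < e" if mn: "m >= M" "n >= M" for m n
      proof -
        have i: "v m - v n \<in> B" by (intro B_diff v)
        have "norm (lpart (v m - v n) j f) <= N (v m - v n) * \<Phi> f"
          using \<Phi>(1)[OF B_D(2)[OF i j] f] mult_right_mono[OF B_D(3)[OF i j] \<Phi>(2)[OF f]] by linarith
        also have "... <= N (v m - v n) * (\<Phi> f + 1)" by (intro mult_left_mono N_nonneg) simp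
        also have "... < e" using M mn p by (simp add: less_divide_eq)
        finally show ?thesis by (simp add: lpart_diff)
      qed
      then show "\<exists>M. \<forall>m\<ge>M. \<forall>n\<ge>M. norm (lpart (v m) j f - lpart (v n) j f) < e" by blast
    qed
    then show ?thesis unfolding w_def using Cauchy_convergent convergent_LIMSEQ_iff by blast
  qed
  have w0: "w j f = 0" if "f \<notin> schwartz" for j f using that by (simp add: w_def local_part_def)
  \<comment> \<open>Fatou property for the differences with the n-th member: the Cauchy bound
    survives the limit in the second index, now with a non-strict inequality.\<close>
  have near: "(%f. w j f - lpart (v n) j f) \<in> BR" "bnorm (%f. w j f - lpart (v n) j f) <= e"
    if M: "\<forall>n m. M <= n --> M <= m --> N (v n - v m) < e" and n: "n >= M" and j: "j \<in> J" for M n e j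
  proof -
    let ?u = "%m f. lpart (v (m + M)) j f - lpart (v n) j f"
    have u: "?u m \<in> BR" for m by (intro besov_Rd_diff B_D v j)
    have ub: "bnorm (?u m) <= e" for m
    proof -
      have i: "v (m + M) - v n \<in> B" by (intro B_diff v)
      have "N (v (m + M) - v n) < e" using M n by simp
      with B_D(3)[OF i j] show ?thesis by (simp add: lpart_diff)
    qed
    have ul: "(%m. ?u m f) \<longlonglongrightarrow> w j f - lpart (v n) j f" if "f \<in> schwartz" for f
      by (intro tendsto_diff tendsto_const LIMSEQ_ignore_initial_segment[OF lim[OF j that]])
    have z: "w j f - lpart (v n) j f = 0" if "f \<notin> schwartz" for f using that by (simp add: w0 local_part_def)
    show "(%f. w j f - lpart (v n) j f) \<in> BR" "bnorm (%f. w j f - lpart (v n) j f) <= e"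
      by (rule besov_Rd_limit[OF u ub ul z]; assumption)+
  qed
  have wB: "w j \<in> BR" if j: "j \<in> J" for j
  proof -
    from Cau[of 1] obtain M where M: "\<forall>n m. M <= n --> M <= m --> N (v n - v m) < 1" by auto
    show ?thesis using besov_Rd_add(1)[OF near(1)[OF M order_refl j] B_D(2)[OF v j, of M]] by simp
  qed
  obtain u where um: "u \<in> mdistributions \<Gamma>" and ul: "\<forall>j\<in>J. lpart u j = w j"
    using mdistributions_limit[OF B_D(1)[OF v] besov_RdD(1)[OF wB] lim] by blast
  have uB: "u \<in> B" using um ul wB by (intro B_I) auto
  have "limitin (Metric_space.mtopology B (norm_dist N)) v u sequentially"
    unfolding Metric_space.limit_metric_sequentially[OF metric_space]
  proof (intro conjI allI impI)
    fix e :: real assume e: "e > 0"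
    \<comment> \<open>The norm is a sum over \<open>num A\<close> charts; the additional 1 keeps the
      total strictly below \<open>e\<close> and the denominator positive.\<close>
    let ?e = "e / (real (num A) + 1)"
    have "?e > 0" using e by (intro divide_pos_pos) auto
    from Cau[OF this] obtain M where M: "\<forall>n m. M <= n --> M <= m --> N (v n - v m) < ?e" ..
    have "norm_dist N (v n) u < e" if n: "n >= M" for n
    proof -
      have "norm_dist N (v n) u = N (u - v n)" by (simp add: norm_dist_def N_commute)
      also have "... = (\<Sum>j\<in>J. bnorm (%f. w j f - lpart (v n) j f))"
        unfolding besov_norm_def lpart_diff using ul by (intro sum.cong) auto
      also have "... <= (\<Sum>j\<in>J. ?e)" by (intro sum_mono near(2)[OF M n])
      also have "... < e" using e by (simp add: field_simps)
      finally show ?thesis .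
    qed
    then show "\<exists>M. \<forall>n\<ge>M. v n \<in> B \<and> norm_dist N (v n) u < e" using v by blast
  qed (rule uB)
  then show "\<exists>u. limitin (Metric_space.mtopology B (norm_dist N)) v u sequentially" by (intro exI[of _ u])
qed

end

section \<open>Smooth functions on \<open>\<Gamma>\<close>\<close>

lemma mdistr_of_fun_eq:
  assumes "param \<Gamma> V \<pi>" "f \<in> test_fun V"
  shows "mdistr_of_fun \<Gamma> g V \<pi> f = (LBINT y. g (\<pi> y) * f y)"
proof -
  have "indicator V y *\<^sub>R (g (\<pi> y) * f y) = g (\<pi> y) * f y" for y
    using test_fun_support[OF assms(2), of y] by (cases "y \<in> V") auto
  then show ?thesis using assms by (simp add: mdistr_of_fun_def set_lebesgue_integral_def)
qed

lemma chart_mult_schwartz: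
  fixes g :: "real ^ 'n::finite => complex"
  assumes "param \<Gamma> V \<pi>" "smooth_on \<Gamma> g" "f \<in> test_fun V"
  shows "(%y. g (\<pi> y) * f y) \<in> schwartz"
  using test_fun_schwartz[OF chart_mult_test_fun[OF assms(1,3,2)]] by (simp add: mult.commute)

lemma mdistr_of_fun_mdistributions:
  fixes g :: "real ^ 'n::finite => complex"
  assumes g: "smooth_on \<Gamma> g"
  shows "(mdistr_of_fun \<Gamma> g :: ('n, 'd::finite) mdistr) \<in> mdistributions \<Gamma>"
proof (rule mdistributionsI)
  fix V :: "(real ^ 'd) set" and \<pi> assume pm: "param \<Gamma> V \<pi>"
  note i = schwartz_integrable[OF chart_mult_schwartz[OF pm g]]
  show "linear_functional_on (test_fun V) (mdistr_of_fun \<Gamma> g V \<pi>)"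
    unfolding linear_functional_on_def
    using i by (auto simp: mdistr_of_fun_eq[OF pm] test_fun_add test_fun_cmult distrib_left mult.left_commute[of "g _"])
  show "\<exists>\<Phi>. sb \<Phi> \<and> (\<forall>f\<in>test_fun K. norm (mdistr_of_fun \<Gamma> g V \<pi> f) <= \<Phi> f)" if K: "compact K" "K \<subseteq> V" for K
  proof -
    have "compact ((%y. g (\<pi> y)) ` K)"
      using Cinf_imp_continuous[OF smooth_on_param[OF pm g]] K by (intro compact_continuous_image) (auto intro: continuous_on_subset)
    then have "bounded ((%y. g (\<pi> y)) ` K)" by (rule compact_imp_bounded)
    then obtain M where M: "M > 0" "!!y. y \<in> K ==> norm (g (\<pi> y)) <= M" unfolding bounded_pos by auto
    have "norm (mdistr_of_fun \<Gamma> g V \<pi> f) <= (M * wint TYPE(real^'d)) * schwartz_norm (DIM(real^'d) + 2) f" if f: "f \<in> test_fun K" for f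
    proof -
      have fV: "f \<in> test_fun V" by (rule test_fun_mono[OF f K(2)])
      have "norm (mdistr_of_fun \<Gamma> g V \<pi> f) <= (LBINT y. norm (g (\<pi> y) * f y))"
        unfolding mdistr_of_fun_eq[OF pm fV] by (rule integral_norm_bound)
      also have "... <= (LBINT y. M * norm (f y))"
      proof (rule integral_mono)
        show "norm (g (\<pi> y) * f y) <= M * norm (f y)" for y
          using M(2)[of y] test_fun_support[OF f, of y] by (cases "y \<in> K") (auto simp: norm_mult mult_right_mono)
      qed (use i[OF fV] schwartz_integrable[OF test_fun_schwartz[OF f]] in auto)
      also have "... <= M * (schwartz_norm (DIM(real^'d) + 2) f * wint TYPE(real^'d))"
        using schwartz_L1[OF test_fun_schwartz[OF f]] M by (simp only: integral_mult_right_zero) (intro mult_left_mono, auto)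
      finally show ?thesis by (simp only: mult_ac)
    qed
    moreover have "sb (%f. (M * wint TYPE(real^'d)) * schwartz_norm (DIM(real^'d) + 2) (f :: real ^ 'd => complex))"
      using M(1) by (intro sb_cmult sb_norm mult_nonneg_nonneg wint_nonneg) simp
    ultimately show ?thesis
      by (intro exI[of _ "%f. (M * wint TYPE(real^'d)) * schwartz_norm (DIM(real^'d) + 2) f"] conjI ballI)
  qed
  show "mdistr_of_fun \<Gamma> g V \<pi> f = 0" if "f \<notin> test_fun V" for f using that by (simp add: mdistr_of_fun_def)
next
  fix V :: "(real ^ 'd) set" and \<pi> assume "\<not> param \<Gamma> V \<pi>"
  then show "mdistr_of_fun \<Gamma> g V \<pi> = (%_. 0)" by (simp add: mdistr_of_fun_def fun_eq_iff)
next
  fix V1 V2 :: "(real ^ 'd) set" and \<pi>1 \<pi>2 f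
  assume p1: "param \<Gamma> V1 \<pi>1" and p2: "param \<Gamma> V2 \<pi>2" and f: "f \<in> test_fun {y \<in> V2. \<pi>2 y \<in> \<pi>1 ` V1}"
  let ?O = "{x \<in> V1. \<pi>1 x \<in> \<pi>2 ` V2}" and ?O' = "{y \<in> V2. \<pi>2 y \<in> \<pi>1 ` V1}" let ?\<psi> = "transition V2 \<pi>2 \<pi>1"
  note df = transition_diffeo[OF p2 p1]
  have f2: "f \<in> test_fun V2" by (rule test_fun_mono[OF f]) auto
  let ?F = "tpush V1 \<pi>1 V2 \<pi>2 f"
  have Fe: "?F = (%x. if x \<in> ?O then f (?\<psi> x) * complex_of_real (jac ?\<psi> x) else 0)"
    by (simp add: tpush_def fun_eq_iff)
  have "?F \<in> test_fun ?O" unfolding Fe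
    by (intro test_fun_push[OF df f] Cinf_of_real Cinf_jac[OF diffeo_sym[THEN iffD1, OF df]] diffeo_D(2)[OF df])
  then have F1: "?F \<in> test_fun V1" by (rule test_fun_mono) auto
  let ?h = "%y. g (\<pi>2 y) * f y"
  from f obtain K where K: "compact K" "K \<subseteq> ?O'" "!!x. x \<notin> K ==> f x = 0" by (rule test_funE) blast
  have "(LBINT y. ?h y) = (LBINT x. (if x \<in> ?O then jac ?\<psi> x *\<^sub>R ?h (?\<psi> x) else 0))"
    by (rule change_of_variables[OF df Cinf_imp_continuous[OF schwartz_Cinf[OF chart_mult_schwartz[OF p2 g f2]]] K(1,2)])
       (simp add: K(3))
  also have "... = (LBINT x. g (\<pi>1 x) * ?F x)"
  proof (intro integral_cong_refl)
    fix x
    show "(if x \<in> ?O then jac ?\<psi> x *\<^sub>R ?h (?\<psi> x) else 0) = g (\<pi>1 x) * ?F x"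
      using transition_param[of \<pi>1 x \<pi>2 V2] by (auto simp: tpush_def scaleR_conv_of_real)
  qed
  finally show "mdistr_of_fun \<Gamma> g V2 \<pi>2 f = mdistr_of_fun \<Gamma> g V1 \<pi>1 ?F"
    unfolding mdistr_of_fun_eq[OF p2 f2] mdistr_of_fun_eq[OF p1 F1] .
qed

section \<open>Smooth densities of low-pass regularisations\<close>

lemma ker_Mul:
  fixes m m' :: "real ^ 'd::finite => complex"
  assumes m: "m \<in> schwartz" and mm: "!!\<xi>. m' \<xi> * m \<xi> = m \<xi>"
  shows "Mul m' (ker m) = ker m"
proof -
  have k: "ker m = (%z. fc TYPE('d) * FT (- 1) m z)" by (simp add: ker_def[abs_def])
  have "FT 1 (ker m) = (%\<xi>. fc TYPE('d) * m \<xi>)"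
    unfolding k using FT_inversion[OF m, of "-1"] by (simp add: FT_cmult fun_eq_iff)
  then have e: "(%\<xi>. m' \<xi> * FT 1 (ker m) \<xi>) = (%\<xi>. fc TYPE('d) * m \<xi>)"
    using mm by (simp add: fun_eq_iff mult.left_commute[of "m' _"])
  show ?thesis
  proof
    show "Mul m' (ker m) z = ker m z" for z unfolding Mul_def e by (simp only: FT_cmult k)
  qed
qed

text \<open>\<open>tempered_conv\<close> gives a density that is only known to be continuous. The
  next larger cut-off equals 1 on the support of the given one, so the kernel reproduces itself
  under convolution with the larger kernel; therefore the density is itself a convolution with a
  Schwartz kernel and hence smooth.\<close>

lemma low_pass_smooth:
  fixes b :: "real ^ 'd::finite => complex"
  assumes b: "is_cutoff b" and w: "w \<in> tempered"
  shows "\<exists>G. Cinf UNIV G \<and> (\<forall>f\<in>schwartz. w (Mul (dil b K) f) = (LBINT x. G x * f x))"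
proof -
  let ?m = "dil b K" and ?m' = "dil b (Suc K)"
  note bt = cutoff_test_fun[OF b]
  have S: "?m \<in> schwartz" "?m' \<in> schwartz" by (intro test_fun_schwartz[OF dil_test_fun[OF bt]])+
  note k = ker_schwartz[OF S(1)] ker_schwartz[OF S(2)]
  have mm: "?m' \<xi> * ?m \<xi> = ?m \<xi>" for \<xi>
  proof (cases "norm ((1 / 2) ^ K *\<^sub>R \<xi>) >= 2")
    case True
    then have "?m \<xi> = 0" using b unfolding is_cutoff_def by blast
    then show ?thesis by simp
  next
    case False
    then have "norm ((1 / 2) ^ Suc K *\<^sub>R \<xi>) <= 1" by simp
    then have "?m' \<xi> = 1" using b unfolding is_cutoff_def by blast
    then show ?thesis by simp
  qed
  have kk: "conv (ker ?m') (ker ?m) = ker ?m"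
    using ker_Mul[OF S(1) mm] Mul_conv'[OF S(2) k(1)] by simp
  have sh: "conv (ker ?m') (%z. ker ?m (z - y)) = (%x. ker ?m (x - y))" for y
  proof
    fix x
    have "conv (ker ?m') (%z. ker ?m (z - y)) x = (LBINT z. ker ?m' (x - (z + y)) * ker ?m (z + y - y))"
      unfolding conv_def
      by (rule lborel_integral_shift[symmetric])
         (use schwartz_measurable[OF k(1)] schwartz_measurable[OF k(2)] in measurable)
    also have "... = conv (ker ?m') (ker ?m) (x - y)" by (simp add: conv_def algebra_simps)
    finally show "conv (ker ?m') (%z. ker ?m (z - y)) x = ker ?m (x - y)" by (simp only: kk)
  qed
  define G' where "G' z = w (%x. ker ?m' (x - z))" for z
  let ?R = "%u. ker ?m (- u)"
  have G: "w (%x. ker ?m (x - y)) = conv ?R G' y" for y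
  proof -
    have "w (conv (ker ?m') (%z. ker ?m (z - y))) = (LBINT z. w (%x. ker ?m' (x - z)) * ker ?m (z - y))"
      by (rule tempered_conv[OF w k(2) schwartz_translate[OF k(1)]]) (simp only: sh schwartz_translate[OF k(1)])
    then show ?thesis unfolding sh by (simp add: conv_def G'_def mult.commute)
  qed
  note gr = tempered_translate_growth[OF w k(2), folded G'_def]
  obtain C M where CM: "!!y. norm (G' y) <= C * jb y ^ M" using gr(2) by blast
  have "Cinf UNIV (conv ?R G')"
    by (rule conv_Cinf[OF schwartz_reflect[OF k(1)] borel_measurable_continuous_onI[OF gr(1)] CM])
  moreover have "w (Mul ?m f) = (LBINT x. conv ?R G' x * f x)" if f: "f \<in> schwartz" for f
    unfolding Mul_conv'[OF S(1) f] G[symmetric]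
    using Mul_schwartz[OF pgrow_test_fun[OF dil_test_fun[OF bt]] f, of K]
    by (intro tempered_conv[OF w k(1) f]) (simp add: Mul_conv'[OF S(1) f])
  ultimately show ?thesis by blast
qed

text \<open>Given e and \<epsilon>, compactness yields a finite pattern of conditions "U is mapped
  into W", with basic open sets U and W and W of small diameter, that is satisfied by e. Any other
  element satisfying the pattern is uniformly \<epsilon>-close, so one witness per pattern suffices.
  As witnesses are taken from \<open>E\<close>, the countable set consists of members of the family
  itself.\<close>

lemma uniform_separable:
  fixes F :: "'i => 'e => 'a::second_countable_topology => 'b::{metric_space, second_countable_topology}"
  assumes I: "finite I" and X: "!!i. i \<in> I ==> compact (X i)" and F: "!!i e. i \<in> I ==> e \<in> E ==> continuous_on (X i) (F i e)"
  obtains D where "countable D" "D \<subseteq> E"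
    "!!e \<epsilon>. e \<in> E ==> \<epsilon> > 0 ==> \<exists>d\<in>D. \<forall>i\<in>I. \<forall>x\<in>X i. dist (F i e x) (F i d x) < \<epsilon>"
proof -
  obtain BB :: "'a set set" where BB: "countable BB" "topological_basis BB" using ex_countable_basis by blast
  obtain CC :: "'b set set" where CC: "countable CC" "topological_basis CC" using ex_countable_basis by blast
  \<comment> \<open>A pattern is a finite set of triples over countable bases and the finite index
    set, so there are only countably many patterns.\<close>
  define good where "good P e \<longleftrightarrow> (\<forall>(i, U, W)\<in>P. F i e ` (U \<inter> X i) \<subseteq> W)" for P e
  have goodD: "F i e x \<in> W" if "good P e" "(i, U, W) \<in> P" "x \<in> U" "x \<in> X i" for P e i U W x
    using bspec[OF that(1)[unfolded good_def] that(2)] that(3,4) by auto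
  let ?P = "{P. finite P \<and> P \<subseteq> I \<times> BB \<times> CC}"
  let ?c = "%P. SOME e. e \<in> E \<and> good P e"
  let ?D = "?c ` {P \<in> ?P. \<exists>e. e \<in> E \<and> good P e}"
  have c: "?c P \<in> E \<and> good P (?c P)" if "\<exists>e. e \<in> E \<and> good P e" for P using someI_ex[OF that] .
  show ?thesis
  proof (rule that[of ?D])
    have "countable (I \<times> BB \<times> CC)" by (intro countable_SIGMA countable_finite[OF I] BB CC)
    then have "countable ?P" by (rule countable_Collect_finite_subset)
    then show "countable ?D" by (intro countable_image) (auto intro: countable_subset[rotated])
    show "?D \<subseteq> E" using c by blast
    fix e \<epsilon> assume e: "e \<in> E" and \<epsilon>: "\<epsilon> > (0::real)"
    have "\<forall>i\<in>I. \<exists>P. finite P \<and> P \<subseteq> I \<times> BB \<times> CC \<and> good P e \<and>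
      (\<forall>x\<in>X i. \<exists>U W. (i, U, W) \<in> P \<and> x \<in> U \<and> (\<forall>u\<in>W. \<forall>v\<in>W. dist u v < \<epsilon>))"
    proof
      fix i assume i: "i \<in> I"
      have "\<forall>x\<in>X i. \<exists>UW. fst UW \<in> BB \<and> snd UW \<in> CC \<and> x \<in> fst UW \<and> F i e ` (fst UW \<inter> X i) \<subseteq> snd UW \<and>
          (\<forall>u\<in>snd UW. \<forall>v\<in>snd UW. dist u v < \<epsilon>)"
      proof
        fix x assume x: "x \<in> X i"
        have "F i e x \<in> ball (F i e x) (\<epsilon> / 2)" using \<epsilon> by simp
        then obtain W where W: "W \<in> CC" "F i e x \<in> W" "W \<subseteq> ball (F i e x) (\<epsilon> / 2)"
          using topological_basisE[OF CC(2) open_ball] by metis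
        have "open W" using W(1) CC(2) topological_basis_open by blast
        then obtain O' where O': "open O'" "O' \<inter> X i = F i e -` W \<inter> X i"
          using F[OF i e] unfolding continuous_on_open_invariant by blast
        have "x \<in> O'" using O'(2) W(2) x by blast
        then obtain U where U: "U \<in> BB" "x \<in> U" "U \<subseteq> O'" using topological_basisE[OF BB(2) O'(1)] by metis
        have "dist u v < \<epsilon>" if "u \<in> W" "v \<in> W" for u v
        proof -
          have "dist (F i e x) u < \<epsilon> / 2" "dist (F i e x) v < \<epsilon> / 2" using W(3) that by auto
          then show ?thesis using dist_triangle3[of u v "F i e x"] by linarith
        qed
        then show "\<exists>UW. fst UW \<in> BB \<and> snd UW \<in> CC \<and> x \<in> fst UW \<and> F i e ` (fst UW \<inter> X i) \<subseteq> snd UW \<and>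
          (\<forall>u\<in>snd UW. \<forall>v\<in>snd UW. dist u v < \<epsilon>)"
          using U W(1) O'(2) by (intro exI[of _ "(U, W)"]) auto
      qed
      from bchoice[OF this] obtain UW where UW: "\<forall>x\<in>X i. fst (UW x) \<in> BB \<and> snd (UW x) \<in> CC \<and> x \<in> fst (UW x) \<and>
          F i e ` (fst (UW x) \<inter> X i) \<subseteq> snd (UW x) \<and> (\<forall>u\<in>snd (UW x). \<forall>v\<in>snd (UW x). dist u v < \<epsilon>)" ..
      have "open (fst (UW x))" if "x \<in> X i" for x using UW that BB(2) topological_basis_open by blast
      moreover have "X i \<subseteq> (\<Union>x\<in>X i. fst (UW x))" using UW by blast
      ultimately obtain X' where X': "X' \<subseteq> X i" "finite X'" "X i \<subseteq> (\<Union>x\<in>X'. fst (UW x))"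
        using compactE_image[OF X[OF i], of "X i" "%x. fst (UW x)"] by blast
      show "\<exists>P. finite P \<and> P \<subseteq> I \<times> BB \<times> CC \<and> good P e \<and>
      (\<forall>x\<in>X i. \<exists>U W. (i, U, W) \<in> P \<and> x \<in> U \<and> (\<forall>u\<in>W. \<forall>v\<in>W. dist u v < \<epsilon>))"
      proof (intro exI[of _ "(%x. (i, fst (UW x), snd (UW x))) ` X'"] conjI ballI)
        fix x assume "x \<in> X i"
        then obtain y where y: "y \<in> X'" "x \<in> fst (UW y)" using X'(3) by blast
        then show "\<exists>U W. (i, U, W) \<in> (%x. (i, fst (UW x), snd (UW x))) ` X' \<and> x \<in> U \<and> (\<forall>u\<in>W. \<forall>v\<in>W. dist u v < \<epsilon>)"
          using UW X'(1) by (intro exI[of _ "fst (UW y)"] exI[of _ "snd (UW y)"]) blast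
      next
        show "(%x. (i, fst (UW x), snd (UW x))) ` X' \<subseteq> I \<times> BB \<times> CC"
        proof (rule image_subsetI)
          show "(i, fst (UW x), snd (UW x)) \<in> I \<times> BB \<times> CC" if "x \<in> X'" for x
            using UW[rule_format, OF subsetD[OF X'(1) that]] i by (simp add: mem_Times_iff)
        qed
        have "F i e ` (fst (UW x) \<inter> X i) \<subseteq> snd (UW x)" if "x \<in> X'" for x
          using UW[rule_format, OF subsetD[OF X'(1) that]] by simp
        then show "good ((%x. (i, fst (UW x), snd (UW x))) ` X') e" by (simp add: good_def case_prod_beta)
      qed (use X'(2) in simp)
    qed
    from bchoice[OF this] obtain P where P: "\<forall>i\<in>I. finite (P i) \<and> P i \<subseteq> I \<times> BB \<times> CC \<and> good (P i) e \<and>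
      (\<forall>x\<in>X i. \<exists>U W. (i, U, W) \<in> P i \<and> x \<in> U \<and> (\<forall>u\<in>W. \<forall>v\<in>W. dist u v < \<epsilon>))" ..
    let ?Q = "\<Union>i\<in>I. P i"
    have Q: "?Q \<in> ?P" "good ?Q e" using P I by (auto simp: good_def)
    then have Q': "\<exists>e. e \<in> E \<and> good ?Q e" using e by blast
    show "\<exists>d\<in>?D. \<forall>i\<in>I. \<forall>x\<in>X i. dist (F i e x) (F i d x) < \<epsilon>"
    proof (intro bexI[of _ "?c ?Q"] ballI)
      fix i x assume ix: "i \<in> I" "x \<in> X i"
      then obtain U W where U: "(i, U, W) \<in> P i" "x \<in> U" "\<forall>u\<in>W. \<forall>v\<in>W. dist u v < \<epsilon>" using P by blast
      then have "(i, U, W) \<in> ?Q" using ix by blast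
      then have "F i e x \<in> W" "F i (?c ?Q) x \<in> W"
        using goodD[OF Q(2) _ U(2) ix(2)] goodD[OF conjunct2[OF c[OF Q']] _ U(2) ix(2)] by simp_all
      then show "dist (F i e x) (F i (?c ?Q) x) < \<epsilon>" using U(3) by simp
    next
      show "?c ?Q \<in> ?D" using Q(1) Q' by blast
    qed
  qed
qed

context besov_charts
begin

definition "gp g j y = ct j y * g (par A j y)" for g :: "real ^ 'n => complex"

lemma gp_test_fun: "smooth_on \<Gamma> g ==> j \<in> J ==> gp g j \<in> test_fun (dom A j)"
  unfolding gp_def[abs_def] by (rule chart_mult_test_fun[OF data(1) ct_test_fun])

lemma lpart_mdistr:
  assumes g: "smooth_on \<Gamma> g" and j: "j \<in> J"
  shows "lpart (mdistr_of_fun \<Gamma> g) j = tfun (gp g j)"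
proof
  fix f :: "real ^ 'd => complex"
  have "(%y. ct j y * f y) \<in> test_fun (dom A j)" if "f \<in> schwartz"
    using Cinf_subset[OF schwartz_Cinf[OF that]] by (intro test_fun_mult[OF ct_test_fun[OF j] param_D(1)[OF data(1)[OF j]]]) auto
  then show "lpart (mdistr_of_fun \<Gamma> g) j f = tfun (gp g j) f"
    by (auto simp: tfun_def lpart_eq mdistr_of_fun_eq[OF data(1)[OF j]] gp_def intro!: Bochner_Integration.integral_cong)
qed

lemma mdistr_B: "smooth_on \<Gamma> g ==> mdistr_of_fun \<Gamma> g \<in> B"
proof (rule B_I[OF mdistr_of_fun_mdistributions])
  fix j assume g: "smooth_on \<Gamma> g" and j: "j \<in> J"
  show "lpart (mdistr_of_fun \<Gamma> g) j \<in> BR"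
    unfolding lpart_mdistr[OF g j] using schwartz_besov test_fun_schwartz[OF gp_test_fun[OF g j]] by blast
qed

lemma C_infinity_B: "C_infinity \<Gamma> \<subseteq> B"
  using mdistr_B by (auto simp: C_infinity_def)

lemma lift_test_fun:
  assumes "j \<in> J" "Cinf UNIV G" shows "(%x. \<theta> j x * G x) \<in> test_fun (dom A j)"
  by (rule test_fun_mult[OF \<theta>(1)[OF assms(1)] param_D(1)[OF data(1)[OF assms(1)]] Cinf_subset[OF assms(2)]]) simp

lemma lift_mult_smooth:
  "j \<in> J ==> Cinf UNIV G ==> smooth_on \<Gamma> (lift (dom A j) (par A j) (%x. \<theta> j x * G x))"
  by (rule lift_smooth[OF data(1) lift_test_fun])

lemma lift_sum_smooth:
  assumes "!!j. j \<in> J ==> Cinf UNIV (G j)"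
  shows "smooth_on \<Gamma> (%z. \<Sum>j\<in>J. lift (dom A j) (par A j) (%x. \<theta> j x * G j x) z)"
  by (rule smooth_on_sum[OF lift_mult_smooth]) (use assms in auto)

text \<open>The \<open>w j\<close> are any functionals with smooth densities; they need not be the
  local parts of one distribution. Change of variables moves the lifted pieces to the j-th chart,
  where the operators of the gluing formula appear.\<close>

lemma lpart_lift:
  assumes G: "!!j. j \<in> J ==> Cinf UNIV (G j)" and w: "!!j f. j \<in> J ==> f \<in> schwartz ==> w j f = (LBINT x. G j x * f x)"
    and i: "i \<in> J" and f: "f \<in> schwartz"
  defines "g == %z. \<Sum>j\<in>J. lift (dom A j) (par A j) (%x. \<theta> j x * G j x) z"
  shows "lpart (mdistr_of_fun \<Gamma> g) i f = (\<Sum>j\<in>J. w j (T (dom A i) (par A i) (ct i) j f))"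
proof -
  have sm: "smooth_on \<Gamma> (lift (dom A j) (par A j) (%x. \<theta> j x * G j x))" if "j \<in> J" for j
    by (rule lift_mult_smooth[OF that G[OF that]])
  have g: "smooth_on \<Gamma> g" unfolding g_def by (rule lift_sum_smooth[OF G])
  let ?l = "%j y. ct i y * lift (dom A j) (par A j) (%x. \<theta> j x * G j x) (par A i y) * f y"
  have "lpart (mdistr_of_fun \<Gamma> g) i f = (LBINT y. gp g i y * f y)" using f by (simp add: lpart_mdistr[OF g i] tfun_def)
  also have "... = (LBINT y. (\<Sum>j\<in>J. ?l j y))"
    by (simp add: gp_def g_def sum_distrib_left sum_distrib_right)
  also have "... = (\<Sum>j\<in>J. (LBINT y. ?l j y))"
  proof (rule Bochner_Integration.integral_sum)
    fix j assume j: "j \<in> J"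
    show "integrable lborel (?l j)"
      using schwartz_mult_schwartz[OF test_fun_schwartz[OF chart_mult_test_fun[OF data(1)[OF i] ct_test_fun[OF i] sm[OF j]]] f] .
  qed
  also have "... = (\<Sum>j\<in>J. w j (T (dom A i) (par A i) (ct i) j f))"
  proof (rule sum.cong[OF refl])
    fix j assume j: "j \<in> J"
    let ?mc = "mc (dom A i) (par A i) (ct i) j" and ?t = "transition (dom A j) (par A j) (par A i)"
    have "(LBINT y. ?l j y) = (LBINT y. f y * pull ?mc ?t (G j) y)"
      by (intro integral_cong_refl) (simp add: mc_def pull_def lift_def transition_def)
    also have "... = (LBINT y. T (dom A i) (par A i) (ct i) j f y * G j y)"
      unfolding cf_def
      by (rule pull_transpose[OF tr_diffeo[OF data(1)[OF i] j] mc_test_fun[OF data(1)[OF i] j ct_test_fun[OF i]] schwartz_Cinf[OF f] G[OF j]])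
    also have "... = w j (T (dom A i) (par A i) (ct i) j f)"
      by (subst w[OF j T_schwartz(1)[OF data(1)[OF i] j ct_test_fun[OF i] f]]) (simp add: mult.commute)
    finally show "(LBINT y. ?l j y) = w j (T (dom A i) (par A i) (ct i) j f)" .
  qed
  finally show "lpart (mdistr_of_fun \<Gamma> g) i f = (\<Sum>j\<in>J. w j (T (dom A i) (par A i) (ct i) j f))" .
qed

lemma dense:
  assumes v: "v \<in> B" and e: "e > 0"
  shows "\<exists>g. smooth_on \<Gamma> g \<and> N (v - mdistr_of_fun \<Gamma> g) < e"
proof -
  have "\<forall>i\<in>J. \<exists>C\<ge>0. \<forall>w. (\<forall>j\<in>J. w j \<in> BR) -->
    bnorm (Tsum (dom A i) (par A i) (ct i) w) <= C * (\<Sum>j\<in>J. bnorm (w j))"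
    using T_bound[OF data(1) ct_test_fun] by blast
  from bchoice[OF this] obtain C where C: "\<forall>i\<in>J. C i >= 0 \<and> (\<forall>w. (\<forall>j\<in>J. w j \<in> BR) -->
    bnorm (Tsum (dom A i) (par A i) (ct i) w) <= C i * (\<Sum>j\<in>J. bnorm (w j)))" ..
  let ?w = "%K j f. if f \<in> schwartz then lpart v j (Mul (dil b K) f) else 0"
  note lp = low_pass_besov[OF B_D(2)[OF v]]
  have "(%K. \<Sum>i\<in>J. C i * (\<Sum>j\<in>J. bnorm (%f. ?w K j f - lpart v j f))) \<longlonglongrightarrow> (\<Sum>i\<in>J. C i * (\<Sum>j\<in>J. 0))"
    by (intro tendsto_sum tendsto_mult tendsto_const lp(3))
  then have "(%K. \<Sum>i\<in>J. C i * (\<Sum>j\<in>J. bnorm (%f. ?w K j f - lpart v j f))) \<longlonglongrightarrow> 0" by simp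
  from order_tendstoD(2)[OF this e] obtain K where K: "(\<Sum>i\<in>J. C i * (\<Sum>j\<in>J. bnorm (%f. ?w K j f - lpart v j f))) < e"
    unfolding eventually_sequentially by blast
  have "\<forall>j\<in>J. \<exists>G. Cinf UNIV G \<and> (\<forall>f\<in>schwartz. lpart v j (Mul (dil b K) f) = (LBINT x. G x * f x))"
    by (intro ballI low_pass_smooth b besov_RdD(1) B_D(2)[OF v])
  from bchoice[OF this] obtain G where G: "\<forall>j\<in>J. Cinf UNIV (G j) \<and> (\<forall>f\<in>schwartz. lpart v j (Mul (dil b K) f) = (LBINT x. G j x * f x))" ..
  let ?g = "%z. \<Sum>j\<in>J. lift (dom A j) (par A j) (%x. \<theta> j x * G j x) z"
  have GC: "Cinf UNIV (G j)" and Gw: "f \<in> schwartz ==> ?w K j f = (LBINT x. G j x * f x)" if "j \<in> J" for j f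
    using G that by auto
  have sm: "smooth_on \<Gamma> ?g" by (rule lift_sum_smooth[OF GC])
  have "N (v - mdistr_of_fun \<Gamma> ?g) = N (mdistr_of_fun \<Gamma> ?g - v)" by (rule N_commute)
  also have "... <= (\<Sum>i\<in>J. C i * (\<Sum>j\<in>J. bnorm (%f. ?w K j f - lpart v j f)))"
    unfolding besov_norm_def
  proof (rule sum_mono)
    fix i assume i: "i \<in> J"
    \<comment> \<open>For \<open>v\<close> by \<open>glue\<close> and for the approximating function
      by \<open>lpart_lift\<close>, the i-th local part arises through the same operators, so the
      error of the regularisation in each chart is simply transported.\<close>
    have "lpart (mdistr_of_fun \<Gamma> ?g - v) i = Tsum (dom A i) (par A i) (ct i) (%j f. ?w K j f - lpart v j f)"
    proof
      fix f :: "real ^ 'd => complex"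
      show "lpart (mdistr_of_fun \<Gamma> ?g - v) i f = Tsum (dom A i) (par A i) (ct i) (%j f. ?w K j f - lpart v j f) f"
      proof (cases "f \<in> schwartz")
        case True
        have "lpart v i f = (\<Sum>j\<in>J. lpart v j (T (dom A i) (par A i) (ct i) j f))"
          using glue[OF data(1)[OF i] ct_test_fun[OF i] B_D(1)[OF v] True] True by (simp only: lpart_eq if_True)
        moreover have "lpart (mdistr_of_fun \<Gamma> ?g) i f = (\<Sum>j\<in>J. ?w K j (T (dom A i) (par A i) (ct i) j f))"
          by (rule lpart_lift[of G "?w K", OF GC Gw i True])
        ultimately show ?thesis using True by (simp only: Tsum_def lpart_diff if_True sum_subtractf)
      qed (simp add: Tsum_def local_part_def)
    qed
    then show "bnorm (lpart (mdistr_of_fun \<Gamma> ?g - v) i) <= C i * (\<Sum>j\<in>J. bnorm (%f. ?w K j f - lpart v j f))"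
      using C[rule_format, OF i, THEN conjunct2, rule_format, of "%j f. ?w K j f - lpart v j f"] lp(2) by simp
  qed
  finally show ?thesis using K sm by (intro exI[of _ ?g]) simp
qed

lemma lnorm_test_fun_le:
  assumes K: "compact K"
  shows "\<exists>C\<ge>0. \<forall>f\<in>test_fun K. \<forall>\<delta>\<ge>0. (\<forall>x\<in>K. norm (f x) <= \<delta>) --> lnorm p (f :: real ^ 'd => complex) <= C * \<delta>"
proof (intro exI[of _ "measure lborel K powr (1 / p)"] conjI ballI allI impI)
  fix f :: "real ^ 'd => complex" and \<delta> :: real
  assume f: "f \<in> test_fun K" and \<delta>: "\<delta> >= 0" and bd: "\<forall>x\<in>K. norm (f x) <= \<delta>"
  have Km: "K \<in> sets lborel" "emeasure lborel K < \<infinity>"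
    using borel_compact[OF K] emeasure_bounded_finite[OF compact_imp_bounded[OF K]] by auto
  have ki: "integrable lborel (%x. indicator K x * \<delta> powr p)"
    using Km by (intro integrable_mult_left integrable_real_indicator) auto
  have "(LBINT x. norm (f x) powr p) <= (LBINT x. indicator K x * \<delta> powr p)"
  proof (rule integral_mono')
    show "norm (f x) powr p <= indicator K x * \<delta> powr p" for x
      using bd test_fun_support[OF f, of x] p1 by (cases "x \<in> K") (auto intro: powr_mono2)
  qed (use ki in auto)
  also have "... = measure lborel K * \<delta> powr p" using Km by simp
  finally have "lnorm p f <= (measure lborel K * \<delta> powr p) powr (1 / p)"
    unfolding lnorm_def using p1 by (intro powr_mono2 integral_nonneg_AE) auto
  also have "... = measure lborel K powr (1 / p) * \<delta>" using p1 \<delta> by (simp add: powr_mult powr_powr)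
  finally show "lnorm p f <= measure lborel K powr (1 / p) * \<delta>" .
qed simp

text \<open>\<open>schwartz_besov\<close> bounds the norm of a difference by L_p norms of
  derivatives up to a fixed order \<open>M\<close>. In each chart these live on a fixed compact set
  carrying the cut-off, where uniform closeness controls the L_p norm.\<close>

lemma countable_dense:
  obtains D :: "(real ^ 'n => complex) set" where "countable D" "!!g. g \<in> D ==> smooth_on \<Gamma> g"
    "!!g e. smooth_on \<Gamma> g ==> e > 0 ==> \<exists>g'\<in>D. N (mdistr_of_fun \<Gamma> g - mdistr_of_fun \<Gamma> g') < e"
proof -
  obtain C M where C: "C >= 0" "!!g. g \<in> schwartz ==>
    bnorm (tfun g) <= C * sob p M g"
    using schwartz_besov by blast
  have "\<forall>j\<in>J. \<exists>K. compact K \<and> K \<subseteq> dom A j \<and> ct j \<in> test_fun K"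
  proof
    fix j assume "j \<in> J"
    from ct_test_fun[OF this] obtain K where "compact K" "K \<subseteq> dom A j" "ct j \<in> test_fun K" by (rule test_fun_compact_support)
    then show "\<exists>K. compact K \<and> K \<subseteq> dom A j \<and> ct j \<in> test_fun K" by blast
  qed
  from bchoice[OF this] obtain K where K: "\<forall>j\<in>J. compact (K j) \<and> K j \<subseteq> dom A j \<and> ct j \<in> test_fun (K j)" ..
  have gK: "gp g j \<in> test_fun (K j)" if g: "smooth_on \<Gamma> g" and j: "j \<in> J" for g j
  proof (rule test_funI[OF test_fun_Cinf[OF gp_test_fun[OF g j]]])
    show "gp g j x = 0" if "x \<notin> K j" for x using K j test_fun_support[of "ct j" "K j" x] that by (simp add: gp_def)
  qed (use K j in auto)
  have "\<forall>j\<in>J. \<exists>V\<ge>0. \<forall>f\<in>test_fun (K j). \<forall>\<delta>\<ge>0. (\<forall>x\<in>K j. norm (f x) <= \<delta>) --> lnorm p (f :: real ^ 'd => complex) <= V * \<delta>"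
    using K by (intro ballI lnorm_test_fun_le) blast
  from bchoice[OF this] obtain V where V: "\<forall>j\<in>J. V j >= 0 \<and> (\<forall>f\<in>test_fun (K j). \<forall>\<delta>\<ge>0. (\<forall>x\<in>K j. norm (f x) <= \<delta>) --> lnorm p (f :: real ^ 'd => complex) <= V j * \<delta>)" ..
  let ?I = "J \<times> (basis_lists M :: (real ^ 'd) list set)"
  let ?F = "%(j, vs) g. iter_deriv vs (gp g j)"
  let ?E = "{g :: real ^ 'n => complex. smooth_on \<Gamma> g}"
  let ?c = "\<Sum>j\<in>J. C * (\<Sum>vs\<in>(basis_lists M :: (real ^ 'd) list set). V j)"
  have c0: "?c >= 0" using C V by (intro sum_nonneg mult_nonneg_nonneg) auto
  obtain D where D: "countable D" "D \<subseteq> ?E"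
    "!!e \<epsilon>. e \<in> ?E ==> \<epsilon> > 0 ==> \<exists>d\<in>D. \<forall>i\<in>?I. \<forall>x\<in>K (fst i). dist (?F i e x) (?F i d x) < \<epsilon>"
  proof (rule uniform_separable[of ?I "%i. K (fst i)" ?E ?F])
    show "compact (K (fst i))" if "i \<in> ?I" for i using K that by auto
    show "continuous_on (K (fst i)) (?F i e)" if "i \<in> ?I" "e \<in> ?E" for i e
    proof -
      obtain j vs where i: "i = (j, vs)" "j \<in> J" using \<open>i \<in> ?I\<close> by auto
      have "Cinf UNIV (iter_deriv vs (gp e j))" using that i by (intro Cinf_iter_deriv test_fun_Cinf[OF gp_test_fun]) auto
      then show ?thesis unfolding i by (simp add: continuous_on_subset[OF Cinf_imp_continuous])
    qed
  qed (auto intro: that)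
  show ?thesis
  proof (rule that[of D])
    fix g :: "real ^ 'n => complex" and e :: real assume g: "smooth_on \<Gamma> g" and e: "e > 0"
    \<comment> \<open>\<open>?c\<close> collects the embedding constant, the number of derivatives
      and the L_p norms of the indicator functions of the compact sets; adding 1 keeps the quotient
      meaningful when \<open>?c\<close> is 0.\<close>
    let ?\<delta> = "e / (?c + 1)"
    have \<delta>: "?\<delta> > 0" using c0 e by (intro divide_pos_pos) auto
    from D(3)[OF _ \<delta>, of g] g obtain g' where g': "g' \<in> D"
      "\<forall>i\<in>?I. \<forall>x\<in>K (fst i). dist (?F i g x) (?F i g' x) < ?\<delta>" by blast
    have sg': "smooth_on \<Gamma> g'" using g' D(2) by blast
    have "N (mdistr_of_fun \<Gamma> g - mdistr_of_fun \<Gamma> g') <= (\<Sum>j\<in>J. C * (\<Sum>vs\<in>(basis_lists M :: (real ^ 'd) list set). V j * ?\<delta>))"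
      unfolding besov_norm_def
    proof (rule sum_mono)
      fix j assume j: "j \<in> J"
      let ?h = "%x. gp g j x - gp g' j x"
      have hK: "?h \<in> test_fun (K j)" by (intro test_fun_diff gK g sg' j)
      have hS: "?h \<in> schwartz" by (rule test_fun_schwartz[OF hK])
      have S: "gp g j \<in> schwartz" "gp g' j \<in> schwartz" by (intro test_fun_schwartz[OF gK] g sg' j)+
      have "lpart (mdistr_of_fun \<Gamma> g - mdistr_of_fun \<Gamma> g') j = tfun ?h"
        by (auto simp: tfun_def fun_eq_iff lpart_diff lpart_mdistr[OF g j] lpart_mdistr[OF sg' j] left_diff_distrib schwartz_mult_schwartz S)
      then have "bnorm (lpart (mdistr_of_fun \<Gamma> g - mdistr_of_fun \<Gamma> g') j) <= C * sob p M ?h"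
        using C(2)[OF hS] by simp
      also have "... <= C * (\<Sum>vs\<in>(basis_lists M :: (real ^ 'd) list set). V j * ?\<delta>)"
      proof (intro mult_left_mono C sum_mono)
        fix vs :: "(real ^ 'd) list" assume vs: "vs \<in> basis_lists M"
        have "norm (iter_deriv vs ?h x) <= ?\<delta>" if "x \<in> K j" for x
        proof -
          have "dist (iter_deriv vs (gp g j) x) (iter_deriv vs (gp g' j) x) < ?\<delta>"
            using g'(2)[rule_format, of "(j, vs)" x] j vs that by simp
          then show ?thesis
            using iter_deriv_diff[OF schwartz_Cinf[OF S(1)] schwartz_Cinf[OF S(2)], of vs] by (simp add: dist_norm)
        qed
        then show "lnorm p (iter_deriv vs ?h) <= V j * ?\<delta>"
          using V j test_fun_iter_deriv[OF hK, of vs] less_imp_le[OF \<delta>] by blast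
      qed
      finally show "bnorm (lpart (mdistr_of_fun \<Gamma> g - mdistr_of_fun \<Gamma> g') j) <= C * (\<Sum>vs\<in>(basis_lists M :: (real ^ 'd) list set). V j * ?\<delta>)" .
    qed
    also have "... = ?c * ?\<delta>" by (simp only: sum_distrib_right mult.assoc)
    also have "... < e" using c0 e by (simp add: field_simps)
    finally show "\<exists>g'\<in>D. N (mdistr_of_fun \<Gamma> g - mdistr_of_fun \<Gamma> g') < e" using g'(1) by blast
  qed (use D in auto)
qed

lemma closure_C_infinity: "Metric_space.mtopology B (norm_dist N) closure_of C_infinity \<Gamma> = B"
proof -
  interpret M: Metric_space B "norm_dist N" by (rule metric_space)
  have "\<exists>y\<in>C_infinity \<Gamma>. y \<in> M.mball v e" if v: "v \<in> B" and e: "e > 0" for v e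
  proof -
    obtain g where g: "smooth_on \<Gamma> g" "N (v - mdistr_of_fun \<Gamma> g) < e" using dense[OF v e] by blast
    then show ?thesis
      using v mdistr_B[OF g(1)] by (intro bexI[of _ "mdistr_of_fun \<Gamma> g"]) (auto simp: C_infinity_def norm_dist_def)
  qed
  then show ?thesis unfolding M.metric_closure_of by blast
qed

lemma separable: "separable_space (Metric_space.mtopology B (norm_dist N))"
proof -
  interpret M: Metric_space B "norm_dist N" by (rule metric_space)
  obtain D where D: "countable D" "!!g. g \<in> D ==> smooth_on \<Gamma> g"
    "!!g e. smooth_on \<Gamma> g ==> e > 0 ==> \<exists>g'\<in>D. N (mdistr_of_fun \<Gamma> g - mdistr_of_fun \<Gamma> g') < e"
    by (rule countable_dense, rule that)
  have "\<exists>y\<in>mdistr_of_fun \<Gamma> ` D. y \<in> M.mball v e" if v: "v \<in> B" and e: "e > 0" for v e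
  proof -
    have e2: "e / 2 > 0" using e by simp
    obtain g where g: "smooth_on \<Gamma> g" "N (v - mdistr_of_fun \<Gamma> g) < e / 2" using dense[OF v e2] by blast
    obtain g' where g': "g' \<in> D" "N (mdistr_of_fun \<Gamma> g - mdistr_of_fun \<Gamma> g') < e / 2" using D(3)[OF g(1) e2] by blast
    have "norm_dist N v (mdistr_of_fun \<Gamma> g') < e"
      using M.triangle[OF v mdistr_B[OF g(1)] mdistr_B[OF D(2)[OF g'(1)]]] g(2) g'(2) by (simp add: norm_dist_def)
    then show ?thesis using v mdistr_B[OF D(2)[OF g'(1)]] g'(1) by (intro bexI[of _ "mdistr_of_fun \<Gamma> g'"]) auto
  qed
  then have "M.mtopology closure_of (mdistr_of_fun \<Gamma> ` D) = B" unfolding M.metric_closure_of by blast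
  then show ?thesis
    unfolding separable_space_def using D(1,2) mdistr_B by (intro exI[of _ "mdistr_of_fun \<Gamma> ` D"]) auto
qed

end

theorem theorem2p5:
  fixes \<Omega> \<Gamma> :: "(real ^ 'n) set"
    and \<beta>0 :: "real ^ 'd \<Rightarrow> complex"
    and s p :: real
    and \<phi> :: "real \<Rightarrow> real"
  assumes dim: "CARD('n) = CARD('d) + 1"
    and \<Omega>: "open \<Omega>" "connected \<Omega>" "bounded \<Omega>" "\<Omega> \<noteq> {}" "smooth_boundary \<Omega>"
    and \<Gamma>: "\<Gamma> = frontier \<Omega>"
    and \<beta>0: "is_cutoff \<beta>0"
    and \<phi>: "\<phi> \<in> Upsilon"
    and p: "1 < p"
  shows
    "(\<forall>A :: ('n, 'd) local_data. is_local_data \<Gamma> A \<longrightarrow>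
        (let B = besov \<beta>0 \<Gamma> A s \<phi> p;
             N = besov_norm \<beta>0 A s \<phi> p;
             d = norm_dist N
         in is_normed_space B N \<and>
            Metric_space.mcomplete B d \<and>
            separable_space (Metric_space.mtopology B d) \<and>
            C_infinity \<Gamma> \<subseteq> B \<and>
            Metric_space.mtopology B d closure_of C_infinity \<Gamma> = B)) \<and>
     (\<forall>A A' :: ('n, 'd) local_data. is_local_data \<Gamma> A \<and> is_local_data \<Gamma> A' \<longrightarrow>
        besov \<beta>0 \<Gamma> A s \<phi> p = besov \<beta>0 \<Gamma> A' s \<phi> p \<and>
        equivalent_norms (besov \<beta>0 \<Gamma> A s \<phi> p)
          (besov_norm \<beta>0 A s \<phi> p) (besov_norm \<beta>0 A' s \<phi> p))"
proof -
  obtain q where q: "conjugate_exps p q" by (rule conjugate_expsE[OF p])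
  obtain L where L: "\<forall>j k. wt s \<phi> j <= 2 ^ (L * gap j k) * wt s \<phi> k" using Upsilon_growth(2)[OF \<phi>] by blast
  have lp: "lp_setting \<beta>0 s p q \<phi> L"
    using L by (intro lp_setting.intro \<beta>0 q Upsilon_growth(1)[OF \<phi>]) blast
  have cG: "compact \<Gamma>" unfolding \<Gamma> by (rule compact_frontier_bounded[OF \<Omega>(3)])
  have main: "\<exists>\<theta>. charts \<Gamma> A \<theta> \<and> besov_charts \<beta>0 s p q \<phi> L \<Gamma> A \<theta>" if A: "is_local_data \<Gamma> A" for A :: "('n, 'd) local_data"
  proof -
    obtain \<theta> where "charts \<Gamma> A \<theta>" using charts_exist[OF cG A \<beta>0] by blast
    then show ?thesis using besov_charts.intro[OF lp] by (intro exI[of _ \<theta>] conjI)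
  qed
  show ?thesis
  proof (intro conjI allI impI)
    fix A :: "('n, 'd) local_data" assume "is_local_data \<Gamma> A"
    then obtain \<theta> where A: "besov_charts \<beta>0 s p q \<phi> L \<Gamma> A \<theta>" using main by blast
    show "let B = besov \<beta>0 \<Gamma> A s \<phi> p; N = besov_norm \<beta>0 A s \<phi> p; d = norm_dist N
         in is_normed_space B N \<and> Metric_space.mcomplete B d \<and> separable_space (Metric_space.mtopology B d) \<and>
            C_infinity \<Gamma> \<subseteq> B \<and> Metric_space.mtopology B d closure_of C_infinity \<Gamma> = B"
      unfolding Let_def
      by (intro conjI besov_charts.normed_space[OF A] besov_charts.complete[OF A] besov_charts.separable[OF A]
          besov_charts.C_infinity_B[OF A] besov_charts.closure_C_infinity[OF A])
  next
    fix A A' :: "('n, 'd) local_data" assume "is_local_data \<Gamma> A \<and> is_local_data \<Gamma> A'"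
    then obtain \<theta> \<theta>' where A: "charts \<Gamma> A \<theta>" "besov_charts \<beta>0 s p q \<phi> L \<Gamma> A \<theta>"
      and A': "charts \<Gamma> A' \<theta>'" "besov_charts \<beta>0 s p q \<phi> L \<Gamma> A' \<theta>'" using main by blast
    note o = besov_charts.other_data[OF A(2) A'(1)] and o' = besov_charts.other_data[OF A'(2) A(1)]
    show eq: "besov \<beta>0 \<Gamma> A s \<phi> p = besov \<beta>0 \<Gamma> A' s \<phi> p" using o(1) o'(1) by blast
    obtain C where C: "C >= 0" "!!v. v \<in> besov \<beta>0 \<Gamma> A s \<phi> p ==> besov_norm \<beta>0 A' s \<phi> p v <= C * besov_norm \<beta>0 A s \<phi> p v" using o(2) by blast
    obtain C' where C': "C' >= 0" "!!v. v \<in> besov \<beta>0 \<Gamma> A s \<phi> p ==> besov_norm \<beta>0 A s \<phi> p v <= C' * besov_norm \<beta>0 A' s \<phi> p v" using o'(2) unfolding eq by blast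
    note n0 = besov_charts.N_nonneg[OF A(2)] besov_charts.N_nonneg[OF A'(2)]
    \<comment> \<open>The constants from \<open>other_data\<close> are only nonnegative; enlarging
      them by 1 provides the strictly positive constants of an equivalence of norms.\<close>
    have le: "1 / (C' + 1) * besov_norm \<beta>0 A s \<phi> p v <= besov_norm \<beta>0 A' s \<phi> p v \<and>
        besov_norm \<beta>0 A' s \<phi> p v <= (C + 1) * besov_norm \<beta>0 A s \<phi> p v" if v: "v \<in> besov \<beta>0 \<Gamma> A s \<phi> p" for v
      using C'(2)[OF v] C'(1) n0(2)[of v] C(2)[OF v] n0(1)[of v] by (simp add: divide_le_eq algebra_simps)
    have pos: "1 / (C' + 1) > 0" "C + 1 > 0" using C C' by auto
    show "equivalent_norms (besov \<beta>0 \<Gamma> A s \<phi> p) (besov_norm \<beta>0 A s \<phi> p) (besov_norm \<beta>0 A' s \<phi> p)"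
      unfolding equivalent_norms_def using le pos by blast
  qed
qed

end
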